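(* (a) Let $k\ge 3$ be a fixed integer and let $p=p(n)\in(0,1)$ satisfy $\frac{1}{p(1-p)}=o(n^{1/2})$ as $n\to\infty$. Then $u_k(n,p)=O\big(\max\{D(n,p),\,p(1-p)\}\,n^{k-2}\big)$, i.e. there is a constant $C>0$ such that for all sufficiently large $n$ there exists a graph $G$ on $n$ vertices with $u_k(G,p)\le C\max\{D(n,p),p(1-p)\}n^{k-2}$. (b) Let $k\ge 4$ be a fixed integer and let $p=p(n)\in(0,1)$. Then $u_k(n,p)=\Omega\big(\max\{D(n,p),\,p(1-p)\}\,n^{k-2}\big)$, i.e. there is a constant $c>0$ such that for all sufficiently large $n$ every graph $G$ on $n$ vertices satisfies $u_k(G,p)\ge c\max\{D(n,p),p(1-p)\}n^{k-2}$.
   Context: For graphs $F,G$, $N(F,G)$ denotes the number of induced subgraphs of $G$ isomorphic to $F$. $\mathcal{G}(n,p)$ is the Erdős–Rényi random graph on $n$ vertices with edge probability $p$; for a $k$-vertex graph $F$ with $k\le n$, $\mathbb{E}[N(F,\mathcal{G}(n,p))]=\frac{n(n-1)\cdots(n-k+1)}{|\mathrm{Aut}(F)|}p^{e(F)}(1-p)^{\binom k2-e(F)}$. For a graph $G$ on $n$ vertices, $u_k(G,p):=\max\{N(F,G)-\mathbb{E}[N(F,\mathcal{G}(n,p))] : F \text{ a graph with } v(F)=k\}$, and $u_k(n,p):=\min\{u_k(G,p): v(G)=n\}$. $D(n,p)$ denotes the distance from $p\binom n2$ to the nearest integer. Asymptotic notation is as $n\to\infty$ with $k$ fixed; constants depend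 only on $k$. *)

theory Defs
  imports
    "HOL-Probability.Probability"
    "HOL-Probability.Product_PMF"
    "HOL-Library.Ramsey"
    "HOL-Library.Landau_Symbols"
begin

section \<open>Finite simple graphs\<close>

type_synonym 'a graph = "'a set \<times> 'a set set"

abbreviation verts :: "'a graph \<Rightarrow> 'a set" where "verts G \<equiv> fst G"

abbreviation edges :: "'a graph \<Rightarrow> 'a set set" where "edges G \<equiv> snd G"

definition simple_graph :: "'a graph \<Rightarrow> bool" where
  "simple_graph G \<longleftrightarrow> finite (verts G) \<and> edges G \<subseteq> [verts G]\<^bsup>2\<^esup>"

definition graph_iso :: "'a graph \<Rightarrow> 'b graph \<Rightarrow> bool" where
  "graph_iso F G \<longleftrightarrow> (\<exists>f. bij_betw f (verts F) (verts G) \<and> edges G = (image f) ` edges F)"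

definition induced_subgraph :: "'a graph \<Rightarrow> 'a set \<Rightarrow> 'a graph" where
  "induced_subgraph G S = (S, {e \<in> edges G. e \<subseteq> S})"

definition num_induced :: "'b graph \<Rightarrow> 'a graph \<Rightarrow> nat" where
  "num_induced F G = card {S. S \<subseteq> verts G \<and> graph_iso (induced_subgraph G S) F}"


section \<open>The random graph\<close>

definition erdos_renyi :: "nat \<Rightarrow> real \<Rightarrow> nat graph pmf" where
  "erdos_renyi n p =
     map_pmf (\<lambda>b. ({..<n}, {e \<in> [{..<n}]\<^bsup>2\<^esup>. b e}))
       (Pi_pmf ([{..<n}]\<^bsup>2\<^esup>) False (\<lambda>_. bernoulli_pmf p))"

definition expected_num_induced :: "'b graph \<Rightarrow> nat \<Rightarrow> real \<Rightarrow> real" where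
  "expected_num_induced F n p =
     measure_pmf.expectation (erdos_renyi n p) (\<lambda>G. real (num_induced F G))"


section \<open>The quantities \<open>u\<^sub>k\<close> and \<open>D\<close>\<close>

text \<open>
  Graphs with vertices in the natural numbers represent all isomorphism types of finite graphs.
  There are infinitely many of them on \<open>k\<close> vertices, but the maximum and the minimum below range
  over finite nonempty sets of values; see the lemmas that follow.
\<close>

definition deviations :: "nat \<Rightarrow> 'a graph \<Rightarrow> real \<Rightarrow> real set" where
  "deviations k G p =
     {real (num_induced F G) - expected_num_induced F (card (verts G)) p
       | F :: nat graph. simple_graph F \<and> card (verts F) = k}"

definition u_graph :: "nat \<Rightarrow> 'a graph \<Rightarrow> real \<Rightarrow> real" where
  "u_graph k G p = Max (deviations k G p)"

definition u_min :: "nat \<Rightarrow> nat \<Rightarrow> real \<Rightarrow> real" where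
  "u_min k n p =
     Min {u_graph k G p | G :: nat graph. simple_graph G \<and> card (verts G) = n}"

definition int_dist :: "nat \<Rightarrow> real \<Rightarrow> real" where
  "int_dist n p =
     \<bar>p * real (n choose 2) - of_int (round (p * real (n choose 2)))\<bar>"


section \<open>The extrema are attained\<close>

lemma graph_iso_trans:
  assumes "graph_iso F G" "graph_iso G H" shows "graph_iso F H"
proof -
  obtain f g where fg: "bij_betw f (verts F) (verts G)" "edges G = (image f) ` edges F"
      "bij_betw g (verts G) (verts H)" "edges H = (image g) ` edges G"
    using assms by (auto simp: graph_iso_def)
  have "bij_betw (g \<circ> f) (verts F) (verts H)"
    by (rule bij_betw_trans[OF fg(1,3)])
  moreover have "edges H = (image (g \<circ> f)) ` edges F"
    by (simp only: fg(2,4) image_image comp_def)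
  ultimately show ?thesis by (auto simp: graph_iso_def)
qed

lemma graph_iso_sym:
  assumes "simple_graph F" "graph_iso F G" shows "graph_iso G F"
proof -
  obtain f where f: "bij_betw f (verts F) (verts G)" "edges G = (image f) ` edges F"
    using assms by (auto simp: graph_iso_def)
  let ?g = "inv_into (verts F) f"
  have "?g ` f ` e = e" if "e \<in> edges F" for e
  proof -
    have "e \<subseteq> verts F" using assms(1) that by (auto simp: simple_graph_def nsets_def)
    then show ?thesis using f(1) by (meson bij_betw_def inv_into_image_cancel)
  qed
  then have "(image ?g) ` edges G = edges F"
    by (simp add: f(2) image_image)
  moreover have "bij_betw ?g (verts G) (verts F)" using f(1) by (rule bij_betw_inv_into)
  ultimately show ?thesis unfolding graph_iso_def by metis
qed

lemma num_induced_cong_iso: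
  assumes "simple_graph F" "graph_iso F F'"
  shows "num_induced F (G :: 'c graph) = num_induced F' G"
proof -
  have "graph_iso H F \<longleftrightarrow> graph_iso H F'" for H :: "'c graph"
    using assms graph_iso_trans[of H F F'] graph_iso_trans[of H F' F] graph_iso_sym[of F F'] by blast
  then show ?thesis by (simp add: num_induced_def)
qed

lemma ex_iso_canonical:
  assumes "simple_graph F" "card (verts F) = k"
  obtains F' :: "nat graph" where "simple_graph F'" "verts F' = {..<k}" "graph_iso F F'"
proof -
  have fin: "finite (verts F)" and E: "edges F \<subseteq> [verts F]\<^bsup>2\<^esup>"
    using assms(1) by (auto simp: simple_graph_def)
  obtain f where f: "bij_betw f (verts F) {..<k}"
    using ex_bij_betw_finite_nat[OF fin] assms(2) by (auto simp: atLeast0LessThan)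
  let ?F = "({..<k}, (image f) ` edges F)"
  have "f ` e \<in> [{..<k}]\<^bsup>2\<^esup>" if "e \<in> edges F" for e
  proof -
    have e: "e \<subseteq> verts F" "finite e" "card e = 2" using E that by (auto simp: nsets_def)
    have "card (f ` e) = 2" "f ` e \<subseteq> {..<k}"
      using e f by (auto simp: bij_betw_def card_image inj_on_subset)
    then show ?thesis using e by (auto simp: nsets_def)
  qed
  then have "simple_graph ?F" by (auto simp: simple_graph_def)
  moreover have "graph_iso F ?F" using f by (auto simp: graph_iso_def)
  ultimately show ?thesis using that by auto
qed

lemma finite_canonical: "finite {F :: nat graph. simple_graph F \<and> verts F = {..<k}}"
proof (rule finite_subset)
  show "{F :: nat graph. simple_graph F \<and> verts F = {..<k}} \<subseteq> {{..<k}} \<times> Pow ([{..<k}]\<^bsup>2\<^esup>)"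
    by (auto simp: simple_graph_def)
  show "finite ({{..<k}} \<times> Pow ([{..<k}]\<^bsup>2\<^esup>))"
    by (simp add: finite_imp_finite_nsets)
qed

lemma deviations_eq_image:
  "deviations k G p =
     (\<lambda>F. real (num_induced F G) - expected_num_induced F (card (verts G)) p) `
       {F :: nat graph. simple_graph F \<and> verts F = {..<k}}" (is "_ = ?d ` ?A")
proof
  show "deviations k G p \<subseteq> ?d ` ?A"
  proof
    fix x assume "x \<in> deviations k G p"
    then obtain F :: "nat graph" where F: "simple_graph F" "card (verts F) = k" "x = ?d F"
      by (auto simp: deviations_def)
    obtain F' :: "nat graph" where F': "simple_graph F'" "verts F' = {..<k}" "graph_iso F F'"
      using ex_iso_canonical[OF F(1,2)] .
    have "?d F = ?d F'"
      unfolding expected_num_induced_def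
      by (simp add: num_induced_cong_iso[OF F(1) F'(3), where ?'c = 'a]
          num_induced_cong_iso[OF F(1) F'(3), where ?'c = nat])
    then show "x \<in> ?d ` ?A" using F(3) F'(1,2) by auto
  qed
  show "?d ` ?A \<subseteq> deviations k G p"
    unfolding deviations_def by force
qed

lemma deviations_finite: "finite (deviations k G p)"
  by (simp add: deviations_eq_image finite_canonical)

lemma deviations_nonempty: "deviations k G p \<noteq> {}"
proof -
  have "({..<k}, {}) \<in> {F :: nat graph. simple_graph F \<and> verts F = {..<k}}"
    by (simp add: simple_graph_def)
  then show ?thesis unfolding deviations_eq_image by blast
qed

lemma u_graph_values_finite:
  "finite {u_graph k G p | G :: nat graph. simple_graph G \<and> card (verts G) = n}"
proof (rule finite_subset)
  let ?A = "{F :: nat graph. simple_graph F \<and> verts F = {..<k}}"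
  let ?B = "(\<lambda>(m, F). real m - expected_num_induced F n p) ` ({..2 ^ n} \<times> ?A)"
  show "finite ?B" by (simp add: finite_canonical)
  show "{u_graph k G p | G :: nat graph. simple_graph G \<and> card (verts G) = n} \<subseteq> ?B"
  proof
    fix x assume "x \<in> {u_graph k G p | G :: nat graph. simple_graph G \<and> card (verts G) = n}"
    then obtain G :: "nat graph"
      where G: "simple_graph G" "card (verts G) = n" "x = u_graph k G p" by auto
    have fin: "finite (verts G)" using G(1) by (simp add: simple_graph_def)
    have "x \<in> deviations k G p"
      using Max_in[OF deviations_finite deviations_nonempty] G(3) by (simp add: u_graph_def)
    then obtain F where F: "F \<in> ?A" "x = real (num_induced F G) - expected_num_induced F n p"
      using G(2) by (auto simp: deviations_eq_image)
    have "num_induced F G \<le> card (Pow (verts G))"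
      unfolding num_induced_def by (rule card_mono) (use fin in auto)
    then have "num_induced F G \<in> {..2 ^ n}" using G(2) fin by (simp add: card_Pow)
    with F show "x \<in> ?B" by (intro image_eqI[of _ _ "(num_induced F G, F)"]) auto
  qed
qed

lemma u_graph_values_nonempty:
  "{u_graph k G p | G :: nat graph. simple_graph G \<and> card (verts G) = n} \<noteq> {}"
proof -
  have "simple_graph ({..<n}, {}) \<and> card (verts ({..<n}, {})) = n"
    by (simp add: simple_graph_def)
  then show ?thesis by blast
qed

end

theory Submission
  imports Defs
begin

text \<open>
  Write \<open>\<alpha>\<close> for the centred indicator of the edges of \<open>G\<close>. The deviation of every induced count is a
  bounded combination of the sums \<open>X\<^sub>H\<close> of \<open>\<Prod>e\<in>H. \<alpha> (\<phi> ` e)\<close> over injections \<open>\<phi>\<close> of the vertices into \<open>G\<close>,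
  and conversely. The lower bound follows from the identity
  \<open>X\<^bsub>2K2\<^esub> = X\<^bsub>K2\<^esub>\<^sup>2 - 4 X\<^bsub>P3\<^esub> - 2 \<Sum>\<alpha>\<^sup>2\<close>, whose last sum is essentially \<open>p (1 - p) n (n - 1)\<close>, together with
  \<open>\<bar>X\<^bsub>K2\<^esub>\<bar> \<ge> 2 D\<close>.

  For the upper bound, a random graph has all \<open>X\<^sub>H\<close> with at least four vertices small enough, but \<open>X\<^bsub>K2\<^esub>\<close>,
  \<open>X\<^bsub>P3\<^esub>\<close> and \<open>X\<^bsub>K3\<^esub>\<close> are too large. They are corrected on a sparse set of reserved pairs, organised in
  disjoint complete bipartite blocks. A first group of blocks fixes the number of edges. In a second
  group, switching the edges of a vertex pair changes degrees but not the number of edges; in a third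
  group, switching a four-cycle changes triangles but not degrees. A single switch changes the target
  by little while all switches together outweigh the initial error, so a discrete intermediate value
  argument brings \<open>X\<^bsub>P3\<^esub>\<close> and \<open>X\<^bsub>K3\<^esub>\<close> to the order of a single switch.
\<close>

section \<open>Sums over injections\<close>

text \<open>Write n for the number of vertices and q for p (1 - p). The switches depend on the
  random part, so the sums on four or more vertices have to be small for every choice on the
  reserved pairs at once. This is possible because the reserved pairs form a graph of bounded degree
  with only about n sqrt q pairs, the order of the fluctuation of the edge count. They have just
  enough capacity: a switch of the second group moves the sum of squared degrees by about sqrt (n
  q), one of the third moves the triangle sum by about sqrt n * q, so all together reach n^(3/2) q
  and n^(3/2) q^(3/2), the orders of the random errors. The second-order effect of the reserved
  pairs is of order n sqrt q. It must stay below n^(3/2) q^(3/2), and this is where sqrt n * q being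
  large enters. Each later group must also outweigh the disturbance by the earlier ones, whence the
  growing constants 12, 40000 and 4 * 10^8. The reserved pairs are treated as having density 1/2, so
  the density on the remaining pairs is moved from p to a \<open>\<pi>\<close> that restores the
  average p.\<close>

definition injections :: "'i set \<Rightarrow> 'a set \<Rightarrow> ('i \<Rightarrow> 'a) set" where
  "injections I V = {\<phi> \<in> I \<rightarrow>\<^sub>E V. inj_on \<phi> I}"

lemma finite_injections: "finite I \<Longrightarrow> finite V \<Longrightarrow> finite (injections I V)"
  unfolding injections_def by (rule finite_subset[of _ "I \<rightarrow>\<^sub>E V"]) (auto simp: finite_PiE)

lemma injections_empty [simp]: "injections {} V = {\<lambda>_. undefined}"
  by (auto simp: injections_def)

lemma sum_injections_insert:
  fixes g :: "('i \<Rightarrow> 'a) \<Rightarrow> real"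
  assumes "x \<notin> I" "finite I" "finite V"
  shows "(\<Sum>\<phi>\<in>injections (insert x I) V. g \<phi>)
       = (\<Sum>\<phi>\<in>injections I V. \<Sum>v\<in>V - \<phi> ` I. g (\<phi>(x := v)))"
proof -
  have "(\<Sum>\<phi>\<in>injections I V. \<Sum>v\<in>V - \<phi> ` I. g (\<phi>(x := v)))
      = (\<Sum>(\<phi>, v)\<in>(SIGMA \<phi>:injections I V. V - \<phi> ` I). g (\<phi>(x := v)))"
    by (subst sum.Sigma) (use assms in \<open>auto simp: finite_injections\<close>)
  also have "\<dots> = (\<Sum>\<phi>\<in>injections (insert x I) V. g \<phi>)"
  proof (rule sum.reindex_bij_witness[where i = "\<lambda>\<phi>. (\<phi>(x := undefined), \<phi> x)"
        and j = "\<lambda>(\<phi>, v). \<phi>(x := v)"], goal_cases)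
    case (1 a)
    then show ?case using assms(1)
      by (auto simp: injections_def PiE_def extensional_def fun_eq_iff)
  next
    case (2 a)
    then obtain \<phi> v where a: "a = (\<phi>, v)" "\<phi> \<in> injections I V" "v \<in> V" "v \<notin> \<phi> ` I" by auto
    then have "inj_on (\<phi>(x := v)) (insert x I)"
      using assms(1) by (auto simp: injections_def inj_on_def)
    then show ?case using a assms(1)
      by (auto simp: injections_def PiE_def extensional_def)
  next
    case (3 \<phi>)
    then show ?case by simp
  next
    case (4 \<phi>)
    then have "\<phi> x \<notin> \<phi>(x := undefined) ` I" "inj_on (\<phi>(x := undefined)) I"
      using assms(1) by (auto simp: injections_def inj_on_def)
    then show ?case using 4 assms(1)
      by (auto simp: injections_def PiE_def extensional_def)
  next
    case (5 a) then show ?case by auto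
  qed
  finally show ?thesis by simp
qed

text \<open>The number of ways to extend an injection of \<open>h\<close> vertices into
  \<open>n\<close> by \<open>d\<close> more. Truncated subtraction makes it 0 when fewer than
  \<open>d\<close> vertices are left.\<close>

definition ext_count :: "nat \<Rightarrow> nat \<Rightarrow> nat \<Rightarrow> real" where
  "ext_count n h d = (\<Prod>i<d. real (n - h - i))"

lemma ext_count_le: "ext_count n h d \<le> real n ^ d"
proof -
  have "ext_count n h d \<le> (\<Prod>i<d. real n)"
    unfolding ext_count_def by (intro prod_mono) auto
  then show ?thesis by simp
qed

lemma ext_count_nonneg: "0 \<le> ext_count n h d"
  unfolding ext_count_def by (intro prod_nonneg) auto

lemma ext_count_ge: "h + d \<le> k \<Longrightarrow> real (n - k) ^ d \<le> ext_count n h d"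
proof -
  assume "h + d \<le> k"
  then have "(\<Prod>i<d. real (n - k)) \<le> ext_count n h d"
    unfolding ext_count_def by (intro prod_mono) auto
  then show ?thesis by simp
qed

lemma sum_injections_restrict:
  fixes f :: "('i \<Rightarrow> 'a) \<Rightarrow> real"
  assumes "finite D" "finite U" "U \<inter> D = {}" "finite V"
  shows "(\<Sum>\<phi>\<in>injections (U \<union> D) V. f (restrict \<phi> U))
       = ext_count (card V) (card U) (card D) * (\<Sum>\<psi>\<in>injections U V. f \<psi>)"
  using assms
proof (induction D rule: finite_induct)
  case empty
  have "restrict \<phi> U = \<phi>" if "\<phi> \<in> injections U V" for \<phi>
    using that by (auto simp: injections_def PiE_def extensional_restrict)
  then show ?case by (simp add: ext_count_def)
next
  case (insert x D)
  have "(\<Sum>\<phi>\<in>injections (U \<union> insert x D) V. f (restrict \<phi> U))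
      = (\<Sum>\<phi>\<in>injections (U \<union> D) V. \<Sum>v\<in>V - \<phi> ` (U \<union> D). f (restrict (\<phi>(x := v)) U))"
    using sum_injections_insert[of x "U \<union> D" V "\<lambda>\<phi>. f (restrict \<phi> U)"] insert by simp
  also have "\<dots> = (\<Sum>\<phi>\<in>injections (U \<union> D) V. real (card V - card U - card D) * f (restrict \<phi> U))"
  proof (rule sum.cong[OF refl])
    fix \<phi> assume \<phi>: "\<phi> \<in> injections (U \<union> D) V"
    have "restrict (\<phi>(x := v)) U = restrict \<phi> U" for v
      using insert by (auto simp: restrict_def fun_eq_iff)
    moreover have "card (V - \<phi> ` (U \<union> D)) = card V - card U - card D"
    proof -
      have "\<phi> ` (U \<union> D) \<subseteq> V" "card (\<phi> ` (U \<union> D)) = card (U \<union> D)"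
        using \<phi> by (auto simp: injections_def card_image)
      moreover have "card (U \<union> D) = card U + card D"
        using insert by (intro card_Un_disjoint) auto
      ultimately show ?thesis using insert by (simp add: card_Diff_subset finite_subset)
    qed
    ultimately show "(\<Sum>v\<in>V - \<phi> ` (U \<union> D). f (restrict (\<phi>(x := v)) U))
        = real (card V - card U - card D) * f (restrict \<phi> U)" by simp
  qed
  also have "\<dots> = ext_count (card V) (card U) (card (insert x D)) * (\<Sum>\<psi>\<in>injections U V. f \<psi>)"
    unfolding sum_distrib_left[symmetric]
    using insert.IH[OF insert.prems(1)] insert by (simp add: ext_count_def restrict_def)
  finally show ?case .
qed

text \<open>For \<open>I = \<Union>H\<close> this is the overview's \<open>X\<^sub>H\<close>; with
  \<open>I = {..<k}\<close> the isolated vertices of a graph on \<open>k\<close> vertices are placed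
  as well.\<close>

definition inj_sum :: "'a set \<Rightarrow> ('a set \<Rightarrow> real) \<Rightarrow> 'i set \<Rightarrow> 'i set set \<Rightarrow> real" where
  "inj_sum V \<alpha> I H = (\<Sum>\<phi>\<in>injections I V. \<Prod>e\<in>H. \<alpha> (\<phi> ` e))"

lemma inj_sum_support:
  assumes "finite K" "finite V" "\<Union>H \<subseteq> K"
  shows "inj_sum V \<alpha> K H
       = ext_count (card V) (card (\<Union>H)) (card K - card (\<Union>H)) * inj_sum V \<alpha> (\<Union>H) H"
proof -
  let ?U = "\<Union>H"
  have K: "K = ?U \<union> (K - ?U)" using assms by auto
  have fU: "finite ?U" using assms finite_subset by blast
  have "inj_sum V \<alpha> K H = (\<Sum>\<phi>\<in>injections (?U \<union> (K - ?U)) V. \<Prod>e\<in>H. \<alpha> (restrict \<phi> ?U ` e))"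
    unfolding inj_sum_def K[symmetric]
  proof (intro sum.cong prod.cong refl arg_cong[where f = \<alpha>])
    fix \<phi> e assume "e \<in> H"
    then show "\<phi> ` e = restrict \<phi> ?U ` e" by (intro image_cong) auto
  qed
  also have "\<dots> = ext_count (card V) (card ?U) (card (K - ?U)) * inj_sum V \<alpha> ?U H"
    unfolding inj_sum_def
    by (subst sum_injections_restrict[where f = "\<lambda>\<phi>. \<Prod>e\<in>H. \<alpha> (\<phi> ` e)"])
       (use assms fU in auto)
  finally show ?thesis using assms fU by (simp add: card_Diff_subset)
qed

text \<open>The value 0 off the pairs, in particular on singletons, lets sums over \<open>V\<close>
  run over coinciding vertices too.\<close>

definition centered :: "'a graph \<Rightarrow> real \<Rightarrow> 'a set \<Rightarrow> real" where
  "centered G p e = (if e \<in> [verts G]\<^bsup>2\<^esup> then of_bool (e \<in> edges G) - p else 0)"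

section \<open>Labelled embeddings and induced copies\<close>

definition pullback :: "'a graph \<Rightarrow> 'i set \<Rightarrow> ('i \<Rightarrow> 'a) \<Rightarrow> 'i set set" where
  "pullback G K \<phi> = {e \<in> [K]\<^bsup>2\<^esup>. \<phi> ` e \<in> edges G}"

definition embeddings :: "'i set \<Rightarrow> 'i set set \<Rightarrow> 'a graph \<Rightarrow> ('i \<Rightarrow> 'a) set" where
  "embeddings K F G = {\<phi> \<in> injections K (verts G). pullback G K \<phi> = F}"

text \<open>On a finite \<open>K\<close> an injection into \<open>K\<close> is a bijection. Using
  \<open>injections\<close> fixes the values outside \<open>K\<close>, so that the set is finite and
  can be counted.\<close>

definition automorphisms :: "'i set \<Rightarrow> 'i set set \<Rightarrow> ('i \<Rightarrow> 'i) set" where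
  "automorphisms K F = {\<pi> \<in> injections K K. image \<pi> ` F = F}"

lemma image_pair_injections:
  assumes "\<phi> \<in> injections K V" "e \<in> [K]\<^bsup>2\<^esup>" shows "\<phi> ` e \<in> [V]\<^bsup>2\<^esup>"
proof -
  have "e \<subseteq> K" "card e = 2" "finite e" "inj_on \<phi> K" "\<phi> \<in> K \<rightarrow> V"
    using assms by (auto simp: injections_def nsets_def)
  then show ?thesis by (auto simp: nsets_def card_image inj_on_subset)
qed

text \<open>Over each induced copy \<open>S\<close> the embeddings form one orbit of the
  automorphism group: composing a fixed embedding onto \<open>S\<close> with the automorphisms gives
  each of them exactly once. Summing over \<open>S\<close> gives the product.\<close>

lemma card_embeddings:
  assumes G: "simple_graph G" and K: "finite K" and F: "F \<subseteq> [K]\<^bsup>2\<^esup>"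
  shows "card (embeddings K F G) = card (automorphisms K F) * num_induced (K, F) G"
proof -
  let ?V = "verts G"
  define \<S> where "\<S> = {S. S \<subseteq> ?V \<and> graph_iso (induced_subgraph G S) (K, F)}"
  have fV: "finite ?V" and EV: "edges G \<subseteq> [?V]\<^bsup>2\<^esup>" using G by (auto simp: simple_graph_def)
  have fE: "finite (embeddings K F G)"
    unfolding embeddings_def using finite_injections[OF K fV] by auto
  have fS: "finite \<S>" unfolding \<S>_def using fV by auto
  have fib: "card {\<phi> \<in> embeddings K F G. \<phi> ` K = S} = card (automorphisms K F)" if S: "S \<in> \<S>" for S
  proof -
    obtain f where f: "bij_betw f S K" "F = image f ` {e \<in> edges G. e \<subseteq> S}"
      using S by (auto simp: \<S>_def graph_iso_def induced_subgraph_def)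
    define \<phi>\<^sub>0 where "\<phi>\<^sub>0 = restrict (inv_into S f) K"
    have b0: "bij_betw \<phi>\<^sub>0 K S"
      unfolding \<phi>\<^sub>0_def using bij_betw_inv_into[OF f(1)] by (simp add: bij_betw_def)
    have SV: "S \<subseteq> ?V" using S by (auto simp: \<S>_def)
    have backw: "\<phi>\<^sub>0 ` f ` e = e" if "e \<subseteq> S" for e
    proof -
      have "f ` e \<subseteq> K" using that f(1) by (auto simp: bij_betw_def)
      then have "\<phi>\<^sub>0 ` f ` e = inv_into S f ` f ` e" unfolding \<phi>\<^sub>0_def by (intro image_cong) auto
      also have "\<dots> = e" using that f(1) by (meson bij_betw_def inv_into_image_cancel)
      finally show ?thesis .
    qed
    have forth: "f ` \<phi>\<^sub>0 ` e = e" if "e \<subseteq> K" for e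
    proof -
      have "\<phi>\<^sub>0 ` e = inv_into S f ` e" unfolding \<phi>\<^sub>0_def using that by (intro image_cong) auto
      then show ?thesis using that f(1) by (simp add: bij_betw_def image_inv_into_cancel)
    qed
    have mem: "e \<in> F \<longleftrightarrow> \<phi>\<^sub>0 ` e \<in> edges G" if "e \<in> [K]\<^bsup>2\<^esup>" for e
    proof
      assume "e \<in> F"
      then obtain e' where e': "e' \<in> edges G" "e' \<subseteq> S" "e = f ` e'" using f(2) by auto
      then show "\<phi>\<^sub>0 ` e \<in> edges G" using backw by simp
    next
      assume "\<phi>\<^sub>0 ` e \<in> edges G"
      moreover have "e \<subseteq> K" using that by (auto simp: nsets_def)
      moreover have "\<phi>\<^sub>0 ` e \<subseteq> S" using b0 \<open>e \<subseteq> K\<close> by (auto simp: bij_betw_def)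
      ultimately show "e \<in> F" unfolding f(2) using forth[of e] by (intro image_eqI[of _ _ "\<phi>\<^sub>0 ` e"]) simp_all
    qed
    have "bij_betw (\<lambda>\<pi>. compose K \<phi>\<^sub>0 \<pi>) (automorphisms K F) {\<phi> \<in> embeddings K F G. \<phi> ` K = S}"
    proof (rule bij_betwI[where g = "\<lambda>\<phi>. compose K f \<phi>"])
      show "(\<lambda>\<pi>. compose K \<phi>\<^sub>0 \<pi>) \<in> automorphisms K F \<rightarrow> {\<phi> \<in> embeddings K F G. \<phi> ` K = S}"
      proof
        fix \<pi> assume "\<pi> \<in> automorphisms K F"
        then have \<pi>: "\<pi> \<in> injections K K" "image \<pi> ` F = F" by (auto simp: automorphisms_def)
        have inj: "inj_on \<pi> K" and "\<pi> ` K \<subseteq> K"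
          using \<pi>(1) by (auto simp: injections_def)
        then have im: "\<pi> ` K = K" using K endo_inj_surj by blast
        have c: "compose K \<phi>\<^sub>0 \<pi> ` e = \<phi>\<^sub>0 ` \<pi> ` e" if "e \<subseteq> K" for e
          unfolding image_image using that by (intro image_cong) (auto simp: compose_def)
        have "compose K \<phi>\<^sub>0 \<pi> ` K = S" using c[of K] im b0 by (auto simp: bij_betw_def)
        moreover have "inj_on (compose K \<phi>\<^sub>0 \<pi>) K"
          using inj im b0
          by (simp add: bij_betw_def inj_on_compose)
        moreover have "pullback G K (compose K \<phi>\<^sub>0 \<pi>) = F"
        proof -
          have "compose K \<phi>\<^sub>0 \<pi> ` e \<in> edges G \<longleftrightarrow> e \<in> F" if e: "e \<in> [K]\<^bsup>2\<^esup>" for e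
          proof -
            have eK: "e \<subseteq> K" using e by (auto simp: nsets_def)
            have "compose K \<phi>\<^sub>0 \<pi> ` e \<in> edges G \<longleftrightarrow> \<pi> ` e \<in> F"
              using c[OF eK] mem[OF image_pair_injections[OF \<pi>(1) e]] by simp
            also have "\<dots> \<longleftrightarrow> e \<in> F"
            proof
              assume "\<pi> ` e \<in> F"
              then obtain e' where "e' \<in> F" "\<pi> ` e = \<pi> ` e'" using \<pi>(2) by (metis imageE)
              moreover have "e' \<subseteq> K" using \<open>e' \<in> F\<close> F by (auto simp: nsets_def)
              ultimately show "e \<in> F" using inj eK by (metis inj_on_image_eq_iff)
            qed (use \<pi>(2) in blast)
            finally show ?thesis .
          qed
          then show ?thesis using F by (auto simp: pullback_def)
        qed
        ultimately show "compose K \<phi>\<^sub>0 \<pi> \<in> {\<phi> \<in> embeddings K F G. \<phi> ` K = S}"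
          using SV by (auto simp: embeddings_def injections_def compose_def)
      qed
      show "(\<lambda>\<phi>. compose K f \<phi>) \<in> {\<phi> \<in> embeddings K F G. \<phi> ` K = S} \<rightarrow> automorphisms K F"
      proof
        fix \<phi> assume \<phi>: "\<phi> \<in> {\<phi> \<in> embeddings K F G. \<phi> ` K = S}"
        then have inj: "inj_on \<phi> K" and im: "\<phi> ` K = S" and pb: "pullback G K \<phi> = F"
          and \<phi>i: "\<phi> \<in> injections K ?V"
          by (auto simp: embeddings_def injections_def)
        have c: "compose K f \<phi> ` e = f ` \<phi> ` e" if "e \<subseteq> K" for e
          unfolding image_image using that by (intro image_cong) (auto simp: compose_def)
        have "inj_on (compose K f \<phi>) K"
          using inj im f(1) by (simp add: bij_betw_def inj_on_compose)
        moreover have "compose K f \<phi> ` K = K"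
          using im f(1) c[of K] by (simp add: bij_betw_def)
        moreover have "image (compose K f \<phi>) ` F = F"
        proof (rule card_subset_eq)
          show "finite F" using F K finite_imp_finite_nsets finite_subset by metis
          show "image (compose K f \<phi>) ` F \<subseteq> F"
          proof
            fix x assume "x \<in> image (compose K f \<phi>) ` F"
            then obtain e where e: "e \<in> F" "x = compose K f \<phi> ` e" by auto
            have "e \<in> [K]\<^bsup>2\<^esup>" "\<phi> ` e \<in> edges G" using e(1) pb by (auto simp: pullback_def)
            moreover then have "e \<subseteq> K" by (auto simp: nsets_def)
            ultimately show "x \<in> F" using e(2) c[of e] f(2) im by auto
          qed
          show "card (image (compose K f \<phi>) ` F) = card F"
          proof (rule card_image)
            have "F \<subseteq> Pow K" using F by (auto simp: nsets_def)
            then show "inj_on (image (compose K f \<phi>)) F"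
              using inj_on_image_Pow[OF \<open>inj_on (compose K f \<phi>) K\<close>] inj_on_subset by blast
          qed
        qed
        moreover have fKK: "f (\<phi> x) \<in> K" if "x \<in> K" for x using that im f(1) by (auto simp: bij_betw_def)
        ultimately show "compose K f \<phi> \<in> automorphisms K F"
          unfolding automorphisms_def injections_def using fKK by (auto simp: compose_def)
      qed
      fix \<pi> assume "\<pi> \<in> automorphisms K F"
      then have "\<pi> \<in> K \<rightarrow>\<^sub>E K" by (auto simp: automorphisms_def injections_def)
      then have \<pi>K: "\<pi> x \<in> K" if "x \<in> K" for x using that by auto
      have fK: "f (inv_into S f y) = y" if "y \<in> K" for y
        using that f(1) by (simp add: bij_betw_def f_inv_into_f)
      show "compose K f (compose K \<phi>\<^sub>0 \<pi>) = \<pi>"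
      proof
        fix x show "compose K f (compose K \<phi>\<^sub>0 \<pi>) x = \<pi> x"
          using \<pi>K[of x] fK[of "\<pi> x"] PiE_arb[OF \<open>\<pi> \<in> K \<rightarrow>\<^sub>E K\<close>, of x]
          by (cases "x \<in> K") (simp_all add: compose_def \<phi>\<^sub>0_def)
      qed
    next
      fix \<phi> assume "\<phi> \<in> {\<phi> \<in> embeddings K F G. \<phi> ` K = S}"
      then have "\<phi> \<in> K \<rightarrow>\<^sub>E S" by (auto simp: embeddings_def injections_def)
      then have fK: "f (\<phi> x) \<in> K" "\<phi> x \<in> S" if "x \<in> K" for x
        using that f(1) by (auto simp: bij_betw_def)
      show "compose K \<phi>\<^sub>0 (compose K f \<phi>) = \<phi>"
      proof
        fix x show "compose K \<phi>\<^sub>0 (compose K f \<phi>) x = \<phi> x"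
          using fK[of x] PiE_arb[OF \<open>\<phi> \<in> K \<rightarrow>\<^sub>E S\<close>, of x] f(1)
          by (cases "x \<in> K") (simp_all add: compose_def \<phi>\<^sub>0_def bij_betw_def)
      qed
    qed
    then show ?thesis by (metis bij_betw_same_card)
  qed
  have img: "\<phi> ` K \<in> \<S>" if \<phi>: "\<phi> \<in> embeddings K F G" for \<phi>
  proof -
    have \<phi>': "\<phi> \<in> K \<rightarrow>\<^sub>E ?V" "inj_on \<phi> K" "pullback G K \<phi> = F"
      using \<phi> by (auto simp: embeddings_def injections_def)
    let ?g = "inv_into K \<phi>"
    have bg: "bij_betw ?g (\<phi> ` K) K" using \<phi>'(2) by (simp add: bij_betw_inv_into inj_on_imp_bij_betw)
    have "F = image ?g ` {e \<in> edges G. e \<subseteq> \<phi> ` K}"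
    proof
      show "F \<subseteq> image ?g ` {e \<in> edges G. e \<subseteq> \<phi> ` K}"
      proof
        fix e assume "e \<in> F"
        then have "\<phi> ` e \<in> edges G" "e \<subseteq> K" using \<phi>'(3) by (auto simp: pullback_def nsets_def)
        moreover then have "e = ?g ` \<phi> ` e" using \<phi>'(2) by (simp add: inv_into_image_cancel)
        ultimately show "e \<in> image ?g ` {e \<in> edges G. e \<subseteq> \<phi> ` K}" by blast
      qed
      show "image ?g ` {e \<in> edges G. e \<subseteq> \<phi> ` K} \<subseteq> F"
      proof
        fix x assume "x \<in> image ?g ` {e \<in> edges G. e \<subseteq> \<phi> ` K}"
        then obtain e where e: "e \<in> edges G" "e \<subseteq> \<phi> ` K" "x = ?g ` e" by auto
        have "\<phi> ` x = e" using e by (simp add: image_inv_into_cancel)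
        moreover have "x \<subseteq> K" using e bg by (auto simp: bij_betw_def)
        moreover have "card e = 2" "finite e" using e(1) EV by (auto simp: nsets_def)
        moreover have "card x = card e"
          using e(2,3) bg by (metis bij_betw_def card_image inj_on_subset)
        ultimately show "x \<in> F" using \<phi>'(3) e(1,3) by (auto simp: pullback_def nsets_def)
      qed
    qed
    then show ?thesis using bg \<phi>'(1) unfolding \<S>_def graph_iso_def induced_subgraph_def by auto
  qed
  have "card (embeddings K F G) = (\<Sum>S\<in>\<S>. card {\<phi> \<in> embeddings K F G. \<phi> ` K = S})"
    using sum.group[OF fE fS, of "\<lambda>\<phi>. \<phi> ` K" "\<lambda>_. 1::nat"] img by (simp add: image_subset_iff)
  also have "\<dots> = card (automorphisms K F) * card \<S>" using fib by simp
  finally show ?thesis by (simp add: \<S>_def num_induced_def)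
qed

section \<open>Deviations and centred subgraph sums\<close>

text \<open>Labelled counts expand exactly over injections. The subtracted term is their mean, by
  \<open>expectation_embeddings\<close>; division by the number of automorphisms gives the deviation
  of the induced count, by \<open>lab_dev_eq\<close>.\<close>

definition lab_dev :: "'i set \<Rightarrow> 'i set set \<Rightarrow> 'a graph \<Rightarrow> real \<Rightarrow> real" where
  "lab_dev K F G p = real (card (embeddings K F G))
     - real (card (injections K (verts G))) * (\<Prod>e\<in>[K]\<^bsup>2\<^esup>. if e \<in> F then p else 1 - p)"

lemma card_injections:
  "finite K \<Longrightarrow> finite V \<Longrightarrow> real (card (injections K V)) = ext_count (card V) 0 (card K)"
  using sum_injections_restrict[of K "{}" V "\<lambda>_. 1"] by simp

lemma card_embeddings_sum:
  assumes "finite K" "finite (verts G)"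
  shows "real (card (embeddings K F G))
       = (\<Sum>\<phi>\<in>injections K (verts G). of_bool (pullback G K \<phi> = F))"
proof -
  have "embeddings K F G = injections K (verts G) \<inter> {\<phi>. pullback G K \<phi> = F}"
    by (auto simp: embeddings_def)
  then show ?thesis using finite_injections[OF assms]
    by (simp add: sum.If_cases of_bool_def)
qed

lemma expectation_embeddings:
  assumes K: "finite K" and F: "F \<subseteq> [K]\<^bsup>2\<^esup>" and p: "0 \<le> p" "p \<le> 1"
  shows "measure_pmf.expectation (erdos_renyi n p) (\<lambda>G. real (card (embeddings K F G)))
       = real (card (injections K {..<n})) * (\<Prod>e\<in>[K]\<^bsup>2\<^esup>. if e \<in> F then p else 1 - p)"
proof -
  let ?Q = "[K]\<^bsup>2\<^esup>" and ?P = "[{..<n}]\<^bsup>2\<^esup>"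
  let ?M = "Pi_pmf ?P False (\<lambda>_. bernoulli_pmf p)"
  have fP: "finite ?P" by (simp add: finite_imp_finite_nsets)
  have single: "measure_pmf.expectation ?M (\<lambda>b. of_bool (pullback ({..<n}, {e \<in> ?P. b e}) K \<phi> = F))
      = (\<Prod>e\<in>?Q. if e \<in> F then p else 1 - p)" if \<phi>: "\<phi> \<in> injections K {..<n}" for \<phi>
  proof -
    \<comment> \<open>A factor 1 off the image of \<open>\<phi>\<close> turns the indicator into a
      product over all pairs, to which the product formula for independent coordinates
      applies.\<close>
    define h :: "nat set \<Rightarrow> bool \<Rightarrow> real" where
      "h = (\<lambda>e v. if e \<in> image \<phi> ` ?Q then if e \<in> image \<phi> ` F then of_bool v else of_bool (\<not> v) else 1)"
    have inj: "inj_on (image \<phi>) ?Q"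
    proof -
      have "inj_on \<phi> K" using \<phi> by (simp add: injections_def)
      moreover have "?Q \<subseteq> Pow K" by (auto simp: nsets_def)
      ultimately show ?thesis using inj_on_image_Pow inj_on_subset by blast
    qed
    have sub: "image \<phi> ` ?Q \<subseteq> ?P" using image_pair_injections[OF \<phi>] by auto
    have inF: "\<phi> ` e \<in> image \<phi> ` F \<longleftrightarrow> e \<in> F" if "e \<in> ?Q" for e
      using inj_on_image_mem_iff[OF inj that F] by simp
    have red: "(\<Prod>e\<in>?P. g e) = (\<Prod>e\<in>?Q. g (\<phi> ` e))"
      if "\<And>e. e \<notin> image \<phi> ` ?Q \<Longrightarrow> g e = 1" for g :: "nat set \<Rightarrow> real"
    proof -
      have "(\<Prod>e\<in>?P. g e) = (\<Prod>e\<in>image \<phi> ` ?Q. g e)"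
        using that sub fP by (intro prod.mono_neutral_right) auto
      then show ?thesis by (simp add: prod.reindex[OF inj])
    qed
    have "of_bool (pullback ({..<n}, {e \<in> ?P. b e}) K \<phi> = F) = (\<Prod>e\<in>?P. h e (b e))" for b
    proof -
      have "(\<Prod>e\<in>?P. h e (b e)) = (\<Prod>e\<in>?Q. of_bool (e \<in> F \<longleftrightarrow> b (\<phi> ` e)))"
        by (subst red) (auto simp: h_def inF intro!: prod.cong)
      also have "\<dots> = of_bool (\<forall>e\<in>?Q. e \<in> F \<longleftrightarrow> b (\<phi> ` e))"
        using finite_imp_finite_nsets[OF K] by (induction rule: finite_induct) auto
      also have "(\<forall>e\<in>?Q. e \<in> F \<longleftrightarrow> b (\<phi> ` e)) \<longleftrightarrow> pullback ({..<n}, {e \<in> ?P. b e}) K \<phi> = F"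
        using F image_pair_injections[OF \<phi>] by (auto simp: pullback_def)
      finally show ?thesis by simp
    qed
    then have "measure_pmf.expectation ?M (\<lambda>b. of_bool (pullback ({..<n}, {e \<in> ?P. b e}) K \<phi> = F))
        = measure_pmf.expectation ?M (\<lambda>b. \<Prod>e\<in>?P. h e (b e))" by simp
    also have "\<dots> = (\<Prod>e\<in>?P. measure_pmf.expectation (bernoulli_pmf p) (h e))"
      by (rule expectation_prod_Pi_pmf[OF fP])
        (auto simp: h_def intro!: measure_pmf.integrable_const_bound[where B = 1])
    also have "\<dots> = (\<Prod>e\<in>?Q. if e \<in> F then p else 1 - p)"
      using p by (subst red) (auto simp: h_def inF intro!: prod.cong)
    finally show ?thesis .
  qed
  have "measure_pmf.expectation (erdos_renyi n p) (\<lambda>G. real (card (embeddings K F G)))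
      = measure_pmf.expectation ?M (\<lambda>b. real (card (embeddings K F ({..<n}, {e \<in> ?P. b e}))))"
    unfolding erdos_renyi_def by simp
  also have "\<dots> = measure_pmf.expectation ?M (\<lambda>b. \<Sum>\<phi>\<in>injections K {..<n}.
                    of_bool (pullback ({..<n}, {e \<in> ?P. b e}) K \<phi> = F))"
    by (subst card_embeddings_sum) (use K in auto)
  also have "\<dots> = (\<Sum>\<phi>\<in>injections K {..<n}. measure_pmf.expectation ?M (\<lambda>b.
                    of_bool (pullback ({..<n}, {e \<in> ?P. b e}) K \<phi> = F)))"
    by (rule Bochner_Integration.integral_sum)
       (auto intro!: measure_pmf.integrable_const_bound[where B = 1])
  also have "\<dots> = real (card (injections K {..<n})) * (\<Prod>e\<in>?Q. if e \<in> F then p else 1 - p)"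
    using single by simp
  finally show ?thesis .
qed

lemma finite_automorphisms: "finite K \<Longrightarrow> finite (automorphisms K F)"
  unfolding automorphisms_def by (rule finite_subset[OF _ finite_injections]) auto

lemma card_automorphisms_pos: "finite K \<Longrightarrow> F \<subseteq> [K]\<^bsup>2\<^esup> \<Longrightarrow> card (automorphisms K F) \<ge> 1"
proof -
  assume K: "finite K" and F: "F \<subseteq> [K]\<^bsup>2\<^esup>"
  have "restrict id K ` e = e" if "e \<in> F" for e
  proof -
    have "e \<subseteq> K" using that F by (auto simp: nsets_def)
    then show ?thesis by force
  qed
  then have "image (restrict id K) ` F = F" by force
  then have "restrict id K \<in> automorphisms K F"
    by (auto simp: automorphisms_def injections_def inj_on_def)
  then show ?thesis using finite_automorphisms[OF K] by (metis One_nat_def Suc_leI card_gt_0_iff empty_iff)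
qed

lemma card_automorphisms_le: "finite K \<Longrightarrow> card (automorphisms K F) \<le> card (injections K K)"
  unfolding automorphisms_def by (intro card_mono) (auto simp: finite_injections)

text \<open>\<open>card_embeddings\<close> applies to \<open>G\<close> and to every graph in the
  support of the random graph, so the count and its mean carry the same factor.\<close>

lemma lab_dev_eq:
  fixes K :: "nat set"
  assumes G: "simple_graph G" and K: "finite K" and F: "F \<subseteq> [K]\<^bsup>2\<^esup>" and p: "0 \<le> p" "p \<le> 1"
  shows "lab_dev K F G p = real (card (automorphisms K F))
           * (real (num_induced (K, F) G) - expected_num_induced (K, F) (card (verts G)) p)"
proof -
  let ?n = "card (verts G)"
  have fV: "finite (verts G)" using G by (simp add: simple_graph_def)
  have "measure_pmf.expectation (erdos_renyi ?n p) (\<lambda>G. real (card (embeddings K F G)))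
      = measure_pmf.expectation (erdos_renyi ?n p)
          (\<lambda>G. real (card (automorphisms K F)) * real (num_induced (K, F) G))"
  proof (rule integral_cong_AE)
    show "AE G in measure_pmf (erdos_renyi ?n p). real (card (embeddings K F G))
        = real (card (automorphisms K F)) * real (num_induced (K, F) G)"
    proof (rule AE_pmfI)
      fix G assume "G \<in> set_pmf (erdos_renyi ?n p)"
      then have "simple_graph G" by (auto simp: erdos_renyi_def simple_graph_def)
      then show "real (card (embeddings K F G))
          = real (card (automorphisms K F)) * real (num_induced (K, F) G)"
        by (simp add: card_embeddings[OF _ K F])
    qed
  qed simp_all
  then have "real (card (automorphisms K F)) * expected_num_induced (K, F) ?n p
      = real (card (injections K {..<?n})) * (\<Prod>e\<in>[K]\<^bsup>2\<^esup>. if e \<in> F then p else 1 - p)"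
    unfolding expected_num_induced_def by (simp add: expectation_embeddings[OF K F p])
  moreover have "card (injections K {..<?n}) = card (injections K (verts G))"
    using card_injections[OF K, of "{..<?n}"] card_injections[OF K fV] by simp
  ultimately show ?thesis
    unfolding lab_dev_def using card_embeddings[OF G K F] by (simp add: algebra_simps)
qed

lemma sum_Pow_prod_weights:
  assumes "finite Q"
  shows "(\<Sum>F\<in>Pow Q. \<Prod>e\<in>Q. if e \<in> F then f e else g e) = (\<Prod>e\<in>Q. f e + g e :: real)"
proof -
  have "(\<Prod>e\<in>Q. if e \<in> F then f e else g e) = (\<Prod>e\<in>F. f e) * (\<Prod>e\<in>Q - F. g e)" if "F \<in> Pow Q" for F
  proof -
    have "Q = F \<union> (Q - F)" using that by auto
    then have "(\<Prod>e\<in>Q. if e \<in> F then f e else g e)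
        = (\<Prod>e\<in>F. if e \<in> F then f e else g e) * (\<Prod>e\<in>Q - F. if e \<in> F then f e else g e)"
      using assms that by (subst prod.subset_diff[of F]) (auto simp: mult.commute)
    then show ?thesis by simp
  qed
  then show ?thesis by (simp add: prod_add[OF assms])
qed

lemma centered_pullback:
  assumes "\<phi> \<in> injections K (verts G)" "e \<in> [K]\<^bsup>2\<^esup>"
  shows "centered G p (\<phi> ` e) = of_bool (e \<in> pullback G K \<phi>) - p"
  using image_pair_injections[OF assms] assms(2) by (simp add: centered_def pullback_def)

text \<open>For each pair, the indicator that its status agrees with \<open>F\<close> is its mean
  \<open>x\<close> plus the sign \<open>s\<close> times the centred indicator. Expanding the product
  over the pairs gives one term for each \<open>H\<close>; the term of the empty set is the
  expectation and cancels.\<close>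

lemma abs_lab_dev_le:
  assumes K: "finite K" and V: "finite (verts G)" and F: "F \<subseteq> [K]\<^bsup>2\<^esup>" and p: "0 \<le> p" "p \<le> 1"
  shows "\<bar>lab_dev K F G p\<bar> \<le> (\<Sum>H\<in>Pow ([K]\<^bsup>2\<^esup>) - {{}}. \<bar>inj_sum (verts G) (centered G p) K H\<bar>)"
proof -
  let ?Q = "[K]\<^bsup>2\<^esup>" and ?I = "injections K (verts G)"
  define x where "x = (\<lambda>e. if e \<in> F then p else 1 - p)"
  define s :: "'a set \<Rightarrow> real" where "s = (\<lambda>e. if e \<in> F then 1 else -1)"
  have fQ: "finite ?Q" using K by (simp add: finite_imp_finite_nsets)
  have ind: "of_bool (pullback G K \<phi> = F) = (\<Prod>e\<in>?Q. s e * centered G p (\<phi> ` e) + x e)"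
    if \<phi>: "\<phi> \<in> ?I" for \<phi>
  proof -
    have "(\<Prod>e\<in>?Q. s e * centered G p (\<phi> ` e) + x e) = (\<Prod>e\<in>?Q. of_bool (e \<in> F \<longleftrightarrow> e \<in> pullback G K \<phi>))"
      by (rule prod.cong) (auto simp: centered_pullback[OF \<phi>] s_def x_def)
    also have "\<dots> = of_bool (\<forall>e\<in>?Q. e \<in> F \<longleftrightarrow> e \<in> pullback G K \<phi>)"
      using fQ by (induction rule: finite_induct) auto
    also have "(\<forall>e\<in>?Q. e \<in> F \<longleftrightarrow> e \<in> pullback G K \<phi>) \<longleftrightarrow> pullback G K \<phi> = F"
      using F by (auto simp: pullback_def)
    finally show ?thesis by simp
  qed
  have "lab_dev K F G p = (\<Sum>\<phi>\<in>?I. (\<Prod>e\<in>?Q. s e * centered G p (\<phi> ` e) + x e) - (\<Prod>e\<in>?Q. x e))"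
    unfolding lab_dev_def card_embeddings_sum[OF K V] by (simp add: ind sum_subtractf x_def)
  also have "\<dots> = (\<Sum>\<phi>\<in>?I. \<Sum>H\<in>Pow ?Q - {{}}. (\<Prod>e\<in>H. s e * centered G p (\<phi> ` e)) * (\<Prod>e\<in>?Q - H. x e))"
    using fQ by (intro sum.cong refl) (simp add: prod_add sum_diff1)
  also have "\<dots> = (\<Sum>H\<in>Pow ?Q - {{}}. (\<Prod>e\<in>H. s e) * (\<Prod>e\<in>?Q - H. x e) * inj_sum (verts G) (centered G p) K H)"
    unfolding inj_sum_def by (subst sum.swap) (simp add: prod.distrib sum_distrib_left mult_ac)
  finally have "\<bar>lab_dev K F G p\<bar> \<le> (\<Sum>H\<in>Pow ?Q - {{}}.
      \<bar>(\<Prod>e\<in>H. s e) * (\<Prod>e\<in>?Q - H. x e) * inj_sum (verts G) (centered G p) K H\<bar>)"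
    by (simp add: sum_abs)
  also have "\<dots> \<le> (\<Sum>H\<in>Pow ?Q - {{}}. \<bar>inj_sum (verts G) (centered G p) K H\<bar>)"
  proof (rule sum_mono)
    fix H
    have "\<bar>\<Prod>e\<in>H. s e\<bar> = 1" by (auto simp: abs_prod s_def intro!: prod.neutral)
    moreover have "\<bar>\<Prod>e\<in>?Q - H. x e\<bar> \<le> 1"
      unfolding abs_prod using p by (intro prod_le_1) (auto simp: x_def)
    ultimately show "\<bar>(\<Prod>e\<in>H. s e) * (\<Prod>e\<in>?Q - H. x e) * inj_sum (verts G) (centered G p) K H\<bar>
        \<le> \<bar>inj_sum (verts G) (centered G p) K H\<bar>"
      by (simp add: abs_mult mult_left_le_one_le)
  qed
  finally show ?thesis .
qed

text \<open>Sort the injections by the graph that they pull back, which determines the product over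
  \<open>H\<close>. The expectations in \<open>lab_dev\<close> drop out because an edge of
  \<open>H\<close> contributes \<open>p * (1 - p) + (1 - p) * (- p) = 0\<close>.\<close>

lemma inj_sum_eq_lab_dev:
  assumes K: "finite K" and V: "finite (verts G)" and H: "H \<subseteq> [K]\<^bsup>2\<^esup>" "H \<noteq> {}"
  shows "inj_sum (verts G) (centered G p) K H
       = (\<Sum>F\<in>Pow ([K]\<^bsup>2\<^esup>). (\<Prod>e\<in>H. of_bool (e \<in> F) - p) * lab_dev K F G p)"
proof -
  let ?Q = "[K]\<^bsup>2\<^esup>" and ?I = "injections K (verts G)"
  define w where "w = (\<lambda>F. \<Prod>e\<in>H. of_bool (e \<in> F) - p)"
  have fQ: "finite ?Q" using K by (simp add: finite_imp_finite_nsets)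
  have "(\<Sum>F\<in>Pow ?Q. w F * real (card (embeddings K F G)))
      = (\<Sum>\<phi>\<in>?I. \<Sum>F\<in>Pow ?Q. w F * of_bool (pullback G K \<phi> = F))"
    unfolding card_embeddings_sum[OF K V] sum_distrib_left by (rule sum.swap)
  also have "\<dots> = (\<Sum>\<phi>\<in>?I. w (pullback G K \<phi>))"
  proof (rule sum.cong[OF refl])
    fix \<phi>
    have "pullback G K \<phi> \<in> Pow ?Q" by (auto simp: pullback_def)
    then show "(\<Sum>F\<in>Pow ?Q. w F * of_bool (pullback G K \<phi> = F)) = w (pullback G K \<phi>)"
      using fQ by (simp add: of_bool_def if_distrib[of "(*) _"] sum.delta cong: if_cong)
  qed
  also have "\<dots> = inj_sum (verts G) (centered G p) K H"
    unfolding inj_sum_def w_def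
    by (intro sum.cong prod.cong refl) (use H in \<open>auto simp: centered_pullback\<close>)
  finally have 1: "(\<Sum>F\<in>Pow ?Q. w F * real (card (embeddings K F G))) = inj_sum (verts G) (centered G p) K H" .
  have "(\<Sum>F\<in>Pow ?Q. w F * (\<Prod>e\<in>?Q. if e \<in> F then p else 1 - p))
      = (\<Sum>F\<in>Pow ?Q. \<Prod>e\<in>?Q. if e \<in> F then (if e \<in> H then 1 - p else 1) * p
                               else (if e \<in> H then - p else 1) * (1 - p))"
  proof (rule sum.cong[OF refl])
    fix F assume "F \<in> Pow ?Q"
    have "w F = (\<Prod>e\<in>?Q. if e \<in> H then of_bool (e \<in> F) - p else 1)"
      unfolding w_def using H fQ by (intro prod.mono_neutral_cong_left) auto
    then have "w F * (\<Prod>e\<in>?Q. if e \<in> F then p else 1 - p)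
        = (\<Prod>e\<in>?Q. (if e \<in> H then of_bool (e \<in> F) - p else 1) * (if e \<in> F then p else 1 - p))"
      by (simp only: prod.distrib)
    also have "\<dots> = (\<Prod>e\<in>?Q. if e \<in> F then (if e \<in> H then 1 - p else 1) * p
                               else (if e \<in> H then - p else 1) * (1 - p))"
      by (rule prod.cong) auto
    finally show "w F * (\<Prod>e\<in>?Q. if e \<in> F then p else 1 - p) = \<dots>" .
  qed
  also have "\<dots> = (\<Prod>e\<in>?Q. (if e \<in> H then 1 - p else 1) * p + (if e \<in> H then - p else 1) * (1 - p))"
    by (rule sum_Pow_prod_weights[OF fQ])
  also have "\<dots> = 0"
  proof -
    obtain e where "e \<in> H" using H by auto
    then show ?thesis using H fQ by (intro prod_zero) (auto intro!: bexI[of _ e] simp: algebra_simps)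
  qed
  finally have 2: "(\<Sum>F\<in>Pow ?Q. w F * (\<Prod>e\<in>?Q. if e \<in> F then p else 1 - p)) = 0" .
  have "(\<Sum>F\<in>Pow ?Q. w F * lab_dev K F G p) = (\<Sum>F\<in>Pow ?Q. w F * real (card (embeddings K F G)))
      - real (card ?I) * (\<Sum>F\<in>Pow ?Q. w F * (\<Prod>e\<in>?Q. if e \<in> F then p else 1 - p))"
    unfolding lab_dev_def by (simp add: sum_subtractf sum_distrib_left algebra_simps)
  then show ?thesis using 1 2 by (simp add: w_def)
qed

text \<open>Every injection pulls back exactly one graph, and the probabilities of all graphs sum to
  1. This is what turns upper bounds for all deviations into lower bounds.\<close>

lemma sum_lab_dev:
  assumes K: "finite K" and V: "finite (verts G)"
  shows "(\<Sum>F\<in>Pow ([K]\<^bsup>2\<^esup>). lab_dev K F G p) = 0"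
proof -
  let ?Q = "[K]\<^bsup>2\<^esup>" and ?I = "injections K (verts G)"
  have fQ: "finite ?Q" using K by (simp add: finite_imp_finite_nsets)
  have "(\<Sum>F\<in>Pow ?Q. real (card (embeddings K F G)))
      = (\<Sum>\<phi>\<in>?I. \<Sum>F\<in>Pow ?Q. of_bool (pullback G K \<phi> = F))"
    unfolding card_embeddings_sum[OF K V] by (rule sum.swap)
  also have "\<dots> = (\<Sum>\<phi>\<in>?I. 1)"
  proof (rule sum.cong[OF refl])
    fix \<phi>
    have "pullback G K \<phi> \<in> Pow ?Q" by (auto simp: pullback_def)
    then show "(\<Sum>F\<in>Pow ?Q. of_bool (pullback G K \<phi> = F)) = (1::real)"
      using fQ by (simp add: of_bool_def sum.delta)
  qed
  finally have 1: "(\<Sum>F\<in>Pow ?Q. real (card (embeddings K F G))) = real (card ?I)" by simp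
  have 2: "(\<Sum>F\<in>Pow ?Q. \<Prod>e\<in>?Q. if e \<in> F then p else 1 - p) = 1"
    by (subst sum_Pow_prod_weights[OF fQ]) simp
  show ?thesis unfolding lab_dev_def sum_subtractf 1 sum_distrib_left[symmetric] 2 by simp
qed

lemma u_graph_ge_dev:
  assumes "F \<subseteq> [{..<k}]\<^bsup>2\<^esup>"
  shows "real (num_induced ({..<k}, F) G) - expected_num_induced ({..<k}, F) (card (verts G)) p
     \<le> u_graph k G p"
  unfolding u_graph_def
proof (rule Max_ge[OF deviations_finite])
  show "real (num_induced ({..<k}, F) G) - expected_num_induced ({..<k}, F) (card (verts G)) p
      \<in> deviations k G p"
    unfolding deviations_eq_image using assms
    by (intro image_eqI[of _ _ "({..<k}, F)"]) (auto simp: simple_graph_def)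
qed

text \<open>There is at least one automorphism, so in absolute value the labelled deviation is the
  larger one.\<close>

lemma u_graph_le:
  assumes G: "simple_graph G" and p: "0 \<le> p" "p \<le> 1"
    and Z: "\<And>F. F \<subseteq> [{..<k}]\<^bsup>2\<^esup> \<Longrightarrow> \<bar>lab_dev {..<k} F G p\<bar> \<le> Z"
  shows "u_graph k G p \<le> Z"
  unfolding u_graph_def
proof (rule Max.boundedI[OF deviations_finite deviations_nonempty])
  fix d assume "d \<in> deviations k G p"
  then obtain F where F: "F \<subseteq> [{..<k}]\<^bsup>2\<^esup>"
    and d: "d = real (num_induced ({..<k}, F) G) - expected_num_induced ({..<k}, F) (card (verts G)) p"
    unfolding deviations_eq_image by (auto simp: simple_graph_def)
  have "1 * \<bar>d\<bar> \<le> real (card (automorphisms {..<k} F)) * \<bar>d\<bar>"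
    using card_automorphisms_pos[OF _ F] by (intro mult_right_mono) auto
  also have "\<dots> = \<bar>lab_dev {..<k} F G p\<bar>"
    using lab_dev_eq[OF G _ F p] by (simp add: d abs_mult)
  also have "\<dots> \<le> Z" using Z[OF F] .
  finally show "d \<le> Z" by simp
qed

text \<open>Every deviation is at most \<open>u_graph\<close>; since the labelled ones sum to 0,
  none can be very negative either. Inverting the expansion then bounds every centred sum.\<close>

lemma abs_inj_sum_le_u_graph:
  assumes G: "simple_graph G" and p: "0 \<le> p" "p \<le> 1" and H: "H \<subseteq> [{..<k}]\<^bsup>2\<^esup>" "H \<noteq> {}"
  shows "\<bar>inj_sum (verts G) (centered G p) {..<k} H\<bar>
    \<le> (2 ^ card ([{..<k}]\<^bsup>2\<^esup>))\<^sup>2 * real (card (injections {..<k} {..<k})) * u_graph k G p"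
proof -
  let ?K = "{..<k}" and ?u = "u_graph k G p"
  let ?Q = "[?K]\<^bsup>2\<^esup>" and ?A = "real (card (injections ?K ?K))"
  define B :: real where "B = 2 ^ card ?Q"
  have V: "finite (verts G)" using G by (simp add: simple_graph_def)
  have fQ: "finite ?Q" by (simp add: finite_imp_finite_nsets)
  have up0: "lab_dev ?K F G p \<le> real (card (automorphisms ?K F)) * ?u" if "F \<in> Pow ?Q" for F
    using lab_dev_eq[OF G _ _ p, of ?K F] u_graph_ge_dev[of F k G p] that
    by (auto intro!: mult_left_mono)
  \<comment> \<open>Otherwise all labelled deviations would be negative, against their sum
    0.\<close>
  have u0: "0 \<le> ?u"
  proof (rule ccontr)
    assume "\<not> 0 \<le> ?u"
    then have "lab_dev ?K F G p < 0" if "F \<in> Pow ?Q" for F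
      using up0[OF that] card_automorphisms_pos[of ?K F] that
      by (smt (verit) PowD finite_lessThan mult_pos_neg of_nat_0_less_iff less_le_trans zero_less_one)
    then have "(\<Sum>F\<in>Pow ?Q. lab_dev ?K F G p) < 0"
      using fQ by (intro sum_strict_mono[where g = "\<lambda>_. 0", simplified]) auto
    then show False using sum_lab_dev[of ?K G p] V by simp
  qed
  have up: "lab_dev ?K F G p \<le> ?A * ?u" if "F \<in> Pow ?Q" for F
    using up0[OF that] card_automorphisms_le[of ?K F] u0
    by (smt (verit) finite_lessThan mult_right_mono of_nat_mono)
  have Au: "0 \<le> ?A * ?u" using u0 by simp
  have "1 \<le> B" unfolding B_def by simp
  have cP: "real (card (Pow ?Q)) = B" using fQ by (simp add: card_Pow B_def)
  have ab: "\<bar>lab_dev ?K F G p\<bar> \<le> B * (?A * ?u)" if F: "F \<in> Pow ?Q" for F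
  proof -
    have "- lab_dev ?K F G p = (\<Sum>F'\<in>Pow ?Q - {F}. lab_dev ?K F' G p)"
      using sum_lab_dev[of ?K G p] V F fQ by (simp add: sum_diff1)
    also have "\<dots> \<le> (\<Sum>F'\<in>Pow ?Q - {F}. ?A * ?u)" by (intro sum_mono up) auto
    also have "\<dots> \<le> (\<Sum>F'\<in>Pow ?Q. ?A * ?u)" using Au fQ by (intro sum_mono2) auto
    finally have "- lab_dev ?K F G p \<le> B * (?A * ?u)" using cP by simp
    moreover have "?A * ?u \<le> B * (?A * ?u)" using Au \<open>1 \<le> B\<close> by (simp add: mult_le_cancel_right1)
    ultimately show ?thesis using up[OF F] by linarith
  qed
  have "\<bar>inj_sum (verts G) (centered G p) ?K H\<bar>
      \<le> (\<Sum>F\<in>Pow ?Q. \<bar>(\<Prod>e\<in>H. of_bool (e \<in> F) - p) * lab_dev ?K F G p\<bar>)"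
    using inj_sum_eq_lab_dev[OF _ V H] by (simp add: sum_abs)
  also have "\<dots> \<le> (\<Sum>F\<in>Pow ?Q. B * (?A * ?u))"
  proof (rule sum_mono)
    fix F assume F: "F \<in> Pow ?Q"
    have "\<bar>\<Prod>e\<in>H. of_bool (e \<in> F) - p\<bar> \<le> 1"
      unfolding abs_prod using p by (intro prod_le_1) (auto simp: of_bool_def)
    then have "\<bar>(\<Prod>e\<in>H. of_bool (e \<in> F) - p) * lab_dev ?K F G p\<bar> \<le> 1 * \<bar>lab_dev ?K F G p\<bar>"
      unfolding abs_mult by (intro mult_right_mono) auto
    then show "\<bar>(\<Prod>e\<in>H. of_bool (e \<in> F) - p) * lab_dev ?K F G p\<bar> \<le> B * (?A * ?u)"
      using ab[OF F] by simp
  qed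
  also have "\<dots> = B\<^sup>2 * ?A * ?u" using cP by (simp add: power2_eq_square)
  finally show ?thesis by (simp add: B_def)
qed

section \<open>Small supports and the lower bound\<close>

text \<open>The degree of \<open>i\<close> for the weights \<open>\<alpha>\<close>. The term
  \<open>w = i\<close> is the weight of a singleton, which is 0 in all applications.\<close>

definition wdeg :: "'a set \<Rightarrow> ('a set \<Rightarrow> real) \<Rightarrow> 'a \<Rightarrow> real" where
  "wdeg V \<alpha> i = (\<Sum>w\<in>V. \<alpha> {i, w})"

lemma sum_nsets2:
  fixes f :: "'a set \<Rightarrow> real"
  assumes "finite V"
  shows "(\<Sum>i\<in>V. \<Sum>j\<in>V - {i}. f {i, j}) = 2 * (\<Sum>e\<in>[V]\<^bsup>2\<^esup>. f e)"
  using assms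
proof (induction V rule: finite_induct)
  case empty
  have "[{}::'a set]\<^bsup>2\<^esup> = {}" by (auto simp: nsets_def)
  then show ?case by simp
next
  case (insert x V)
  have eq: "[insert x V]\<^bsup>2\<^esup> = [V]\<^bsup>2\<^esup> \<union> (\<lambda>v. {x, v}) ` V"
    using insert(2) unfolding nsets_2_eq by auto
  have "(\<lambda>v. {x, v}) ` V \<inter> [V]\<^bsup>2\<^esup> = {}" using insert(2) by (auto simp: nsets_def)
  moreover have "inj_on (\<lambda>v. {x, v}) V" using insert(2) by (auto simp: inj_on_def doubleton_eq_iff)
  ultimately have R: "(\<Sum>e\<in>[insert x V]\<^bsup>2\<^esup>. f e) = (\<Sum>e\<in>[V]\<^bsup>2\<^esup>. f e) + (\<Sum>v\<in>V. f {x, v})"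
    unfolding eq using insert(1)
    by (subst sum.union_disjoint) (auto simp: finite_imp_finite_nsets sum.reindex)
  have "(\<Sum>i\<in>V. \<Sum>j\<in>insert x V - {i}. f {i, j}) = (\<Sum>i\<in>V. (\<Sum>j\<in>V - {i}. f {i, j}) + f {x, i})"
  proof (rule sum.cong[OF refl])
    fix i assume "i \<in> V"
    then have "insert x V - {i} = insert x (V - {i})" using insert(2) by auto
    then show "(\<Sum>j\<in>insert x V - {i}. f {i, j}) = (\<Sum>j\<in>V - {i}. f {i, j}) + f {x, i}"
      using insert(1,2) by (simp add: insert_commute)
  qed
  moreover have "insert x V - {x} = V" using insert(2) by auto
  ultimately have "(\<Sum>i\<in>insert x V. \<Sum>j\<in>insert x V - {i}. f {i, j})
      = (\<Sum>v\<in>V. f {x, v}) + ((\<Sum>i\<in>V. \<Sum>j\<in>V - {i}. f {i, j}) + (\<Sum>v\<in>V. f {x, v}))"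
    using insert(1,2) by (simp add: sum.distrib)
  then show ?case using insert.IH R by simp
qed

context
  fixes V :: "'a set" and \<alpha> :: "'a set \<Rightarrow> real"
  assumes V: "finite V" and \<alpha>0: "\<And>i. \<alpha> {i} = 0"
begin

lemma sum_minus_self: "v \<in> V \<Longrightarrow> (\<Sum>w\<in>V - {v}. \<alpha> {v, w}) = wdeg V \<alpha> v"
  using V \<alpha>0 by (simp add: wdeg_def sum_diff1)

lemma sum_minus_two: "v \<in> V \<Longrightarrow> u \<in> V \<Longrightarrow> u \<noteq> v \<Longrightarrow> (\<Sum>w\<in>V - {u, v}. \<alpha> {v, w}) = wdeg V \<alpha> v - \<alpha> {u, v}"
proof -
  assume a: "v \<in> V" "u \<in> V" "u \<noteq> v"
  have "V - {u, v} = V - {v} - {u}" by auto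
  then have "(\<Sum>w\<in>V - {u, v}. \<alpha> {v, w}) = (\<Sum>w\<in>V - {v}. \<alpha> {v, w}) - \<alpha> {v, u}"
    using V a by (simp add: sum_diff1)
  then show ?thesis using sum_minus_self[OF a(1)] by (simp add: insert_commute)
qed

lemma inj_sum_K2:
  assumes "x \<noteq> y"
  shows "inj_sum V \<alpha> {x, y} {{x, y}} = (\<Sum>i\<in>V. wdeg V \<alpha> i)"
proof -
  have "inj_sum V \<alpha> {x, y} {{x, y}} = (\<Sum>v\<in>V. \<Sum>w\<in>V - {v}. \<alpha> {w, v})"
    unfolding inj_sum_def using assms V by (simp add: sum_injections_insert)
  also have "\<dots> = (\<Sum>v\<in>V. wdeg V \<alpha> v)"
    by (intro sum.cong refl) (simp add: insert_commute sum_minus_self[symmetric])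
  finally show ?thesis .
qed

text \<open>With the middle vertex fixed, the squared degree counts all ordered pairs of end points;
  the second sum removes the equal ones.\<close>

lemma inj_sum_P3:
  assumes "x \<noteq> y" "y \<noteq> z" "x \<noteq> z"
  shows "inj_sum V \<alpha> {x, y, z} {{x, y}, {y, z}}
       = (\<Sum>i\<in>V. (wdeg V \<alpha> i)\<^sup>2) - (\<Sum>i\<in>V. \<Sum>j\<in>V. (\<alpha> {i, j})\<^sup>2)"
proof -
  have ne: "{x, y} \<noteq> {y, z}" using assms by (auto simp: doubleton_eq_iff)
  have xyz: "{x, y, z} = {z, x, y}" by auto
  have "inj_sum V \<alpha> {x, y, z} {{x, y}, {y, z}}
      = (\<Sum>v\<in>V. \<Sum>u\<in>V - {v}. \<Sum>w\<in>V - {u, v}. \<alpha> {u, v} * \<alpha> {v, w})"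
    unfolding inj_sum_def xyz using assms V ne by (simp add: sum_injections_insert)
  also have "\<dots> = (\<Sum>v\<in>V. \<Sum>u\<in>V - {v}. \<alpha> {v, u} * (wdeg V \<alpha> v - \<alpha> {v, u}))"
  proof (intro sum.cong refl)
    fix v u assume "v \<in> V" "u \<in> V - {v}"
    then show "(\<Sum>w\<in>V - {u, v}. \<alpha> {u, v} * \<alpha> {v, w}) = \<alpha> {v, u} * (wdeg V \<alpha> v - \<alpha> {v, u})"
      using sum_minus_two[of v u] by (simp add: sum_distrib_left[symmetric] insert_commute[of u v])
  qed
  also have "\<dots> = (\<Sum>v\<in>V. \<Sum>u\<in>V. \<alpha> {v, u} * (wdeg V \<alpha> v - \<alpha> {v, u}))"
    by (intro sum.cong refl sum.mono_neutral_left) (use V \<alpha>0 in auto)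
  also have "\<dots> = (\<Sum>v\<in>V. (wdeg V \<alpha> v)\<^sup>2 - (\<Sum>u\<in>V. (\<alpha> {v, u})\<^sup>2))"
    by (intro sum.cong refl)
      (simp add: wdeg_def algebra_simps sum_subtractf sum_distrib_left power2_eq_square)
  finally show ?thesis by (simp add: sum_subtractf)
qed

lemma inj_sum_K3:
  assumes "x \<noteq> y" "y \<noteq> z" "x \<noteq> z"
  shows "inj_sum V \<alpha> {x, y, z} {{x, y}, {y, z}, {x, z}}
       = (\<Sum>i\<in>V. \<Sum>j\<in>V. \<Sum>k\<in>V. \<alpha> {i, j} * \<alpha> {j, k} * \<alpha> {i, k})"
proof -
  have ne: "{x, y} \<noteq> {y, z}" "{x, y} \<noteq> {x, z}" "{y, z} \<noteq> {x, z}"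
    using assms by (auto simp: doubleton_eq_iff)
  have xyz: "{x, y, z} = {z, y, x}" by auto
  have "inj_sum V \<alpha> {x, y, z} {{x, y}, {y, z}, {x, z}}
      = (\<Sum>i\<in>V. \<Sum>j\<in>V - {i}. \<Sum>k\<in>V - {j, i}. \<alpha> {i, j} * \<alpha> {j, k} * \<alpha> {i, k})"
    unfolding inj_sum_def xyz using assms V ne by (simp add: sum_injections_insert mult_ac)
  also have "\<dots> = (\<Sum>i\<in>V. \<Sum>j\<in>V - {i}. \<Sum>k\<in>V. \<alpha> {i, j} * \<alpha> {j, k} * \<alpha> {i, k})"
    by (intro sum.cong refl sum.mono_neutral_left) (use V \<alpha>0 in auto)
  also have "\<dots> = (\<Sum>i\<in>V. \<Sum>j\<in>V. \<Sum>k\<in>V. \<alpha> {i, j} * \<alpha> {j, k} * \<alpha> {i, k})"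
    by (intro sum.cong refl sum.mono_neutral_left) (use V \<alpha>0 in auto)
  finally show ?thesis .
qed

text \<open>Once the first edge \<open>{v, u}\<close> is placed, inclusion and exclusion gives the
  total weight of the ordered edges disjoint from it:
  \<open>?X - 2 * ?d u - 2 * ?d v + 2 * \<alpha> {v, u}\<close>.\<close>

lemma inj_sum_2K2:
  assumes "distinct [x, y, z, t]"
  shows "inj_sum V \<alpha> {x, y, z, t} {{x, y}, {z, t}}
       = (\<Sum>i\<in>V. wdeg V \<alpha> i)\<^sup>2 - 4 * (\<Sum>i\<in>V. (wdeg V \<alpha> i)\<^sup>2) + 2 * (\<Sum>i\<in>V. \<Sum>j\<in>V. (\<alpha> {i, j})\<^sup>2)"
proof -
  let ?d = "wdeg V \<alpha>"
  let ?X = "\<Sum>i\<in>V. ?d i"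
  have ne: "{x, y} \<noteq> {z, t}" using assms by (auto simp: doubleton_eq_iff)
  have xyz: "{x, y, z, t} = {t, z, y, x}" by auto
  have nin: "t \<noteq> z" "t \<noteq> y" "t \<noteq> x" "z \<noteq> y" "z \<noteq> x" "y \<noteq> x" "x \<noteq> y" "x \<noteq> z" "x \<noteq> t" "y \<noteq> z" "y \<noteq> t"
    "z \<noteq> t" using assms by auto
  have "inj_sum V \<alpha> {x, y, z, t} {{x, y}, {z, t}}
      = (\<Sum>v\<in>V. \<Sum>u\<in>V - {v}. \<Sum>w\<in>V - {u, v}. \<Sum>s\<in>V - {w, u, v}. \<alpha> {v, u} * \<alpha> {w, s})"
    unfolding inj_sum_def xyz using nin V ne by (simp add: sum_injections_insert)
  also have "\<dots> = (\<Sum>v\<in>V. \<Sum>u\<in>V - {v}. \<alpha> {v, u} * (?X - 2 * ?d u - 2 * ?d v + 2 * \<alpha> {v, u}))"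
  proof (intro sum.cong refl)
    fix v u assume v: "v \<in> V" and u: "u \<in> V - {v}"
    have "(\<Sum>s\<in>V - {w, u, v}. \<alpha> {w, s}) = ?d w - \<alpha> {u, w} - \<alpha> {v, w}" if w: "w \<in> V - {u, v}" for w
    proof -
      have "V - {w, u, v} = V - {u, w} - {v}" by auto
      then have "(\<Sum>s\<in>V - {w, u, v}. \<alpha> {w, s}) = (\<Sum>s\<in>V - {u, w}. \<alpha> {w, s}) - \<alpha> {w, v}"
        using V v u w by (auto simp: sum_diff1)
      moreover have "(\<Sum>s\<in>V - {u, w}. \<alpha> {w, s}) = ?d w - \<alpha> {u, w}"
        using u w by (intro sum_minus_two) auto
      ultimately show ?thesis by (simp add: insert_commute[of w v])
    qed
    then have "(\<Sum>w\<in>V - {u, v}. \<Sum>s\<in>V - {w, u, v}. \<alpha> {v, u} * \<alpha> {w, s})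
        = \<alpha> {v, u} * (\<Sum>w\<in>V - {u, v}. ?d w - \<alpha> {u, w} - \<alpha> {v, w})"
      by (simp add: sum_distrib_left[symmetric])
    also have "(\<Sum>w\<in>V - {u, v}. ?d w - \<alpha> {u, w} - \<alpha> {v, w})
        = (?X - ?d u - ?d v) - (?d u - \<alpha> {v, u}) - (?d v - \<alpha> {u, v})"
    proof -
      have "(\<Sum>w\<in>V - {u, v}. ?d w) = ?X - ?d u - ?d v"
      proof -
        have "V - {u, v} = V - {u} - {v}" by auto
        then show ?thesis using V u v by (auto simp: sum_diff1)
      qed
      moreover have "(\<Sum>w\<in>V - {u, v}. \<alpha> {u, w}) = ?d u - \<alpha> {v, u}"
        using sum_minus_two[of u v] u v by (auto simp: insert_commute)
      moreover have "(\<Sum>w\<in>V - {u, v}. \<alpha> {v, w}) = ?d v - \<alpha> {u, v}"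
        using sum_minus_two[of v u] u v by auto
      ultimately show ?thesis by (simp add: sum_subtractf)
    qed
    finally show "(\<Sum>w\<in>V - {u, v}. \<Sum>s\<in>V - {w, u, v}. \<alpha> {v, u} * \<alpha> {w, s})
        = \<alpha> {v, u} * (?X - 2 * ?d u - 2 * ?d v + 2 * \<alpha> {v, u})" by (simp add: insert_commute algebra_simps)
  qed
  also have "\<dots> = (\<Sum>v\<in>V. \<Sum>u\<in>V. \<alpha> {v, u} * (?X - 2 * ?d u - 2 * ?d v + 2 * \<alpha> {v, u}))"
    by (intro sum.cong refl sum.mono_neutral_left) (use V \<alpha>0 in auto)
  also have "\<dots> = (\<Sum>v\<in>V. \<Sum>u\<in>V. ?X * \<alpha> {v, u}) - 2 * (\<Sum>v\<in>V. \<Sum>u\<in>V. ?d u * \<alpha> {v, u})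
      - 2 * (\<Sum>v\<in>V. \<Sum>u\<in>V. ?d v * \<alpha> {v, u}) + 2 * (\<Sum>i\<in>V. \<Sum>j\<in>V. (\<alpha> {i, j})\<^sup>2)"
    by (simp add: algebra_simps sum.distrib sum_subtractf sum_distrib_left power2_eq_square)
  also have "(\<Sum>v\<in>V. \<Sum>u\<in>V. ?X * \<alpha> {v, u}) = ?X\<^sup>2"
    by (simp add: sum_distrib_left[symmetric] wdeg_def[symmetric] power2_eq_square)
  also have "(\<Sum>v\<in>V. \<Sum>u\<in>V. ?d v * \<alpha> {v, u}) = (\<Sum>i\<in>V. (?d i)\<^sup>2)"
    by (simp add: sum_distrib_left[symmetric] wdeg_def[symmetric] power2_eq_square)
  also have "(\<Sum>v\<in>V. \<Sum>u\<in>V. ?d u * \<alpha> {v, u}) = (\<Sum>i\<in>V. (?d i)\<^sup>2)"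
    by (subst sum.swap) (simp add: sum_distrib_left[symmetric] insert_commute[of _ _ "{}"]
        wdeg_def[symmetric] power2_eq_square)
  finally show ?thesis by simp
qed

end

lemma centered_singleton [simp]: "centered G p {i} = 0"
  by (auto simp: centered_def nsets_def)

lemma sum_wdeg_centered:
  assumes "simple_graph G"
  shows "(\<Sum>i\<in>verts G. wdeg (verts G) (centered G p) i)
       = 2 * (real (card (edges G)) - p * real (card (verts G) choose 2))"
proof -
  let ?V = "verts G"
  have V: "finite ?V" and E: "edges G \<subseteq> [?V]\<^bsup>2\<^esup>" using assms by (auto simp: simple_graph_def)
  have "(\<Sum>i\<in>?V. wdeg ?V (centered G p) i) = (\<Sum>i\<in>?V. \<Sum>j\<in>?V - {i}. centered G p {i, j})"
    by (intro sum.cong refl) (simp add: sum_minus_self[OF V, of "centered G p", symmetric])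
  also have "\<dots> = 2 * (\<Sum>e\<in>[?V]\<^bsup>2\<^esup>. centered G p e)" by (rule sum_nsets2[OF V])
  also have "(\<Sum>e\<in>[?V]\<^bsup>2\<^esup>. centered G p e) = (\<Sum>e\<in>[?V]\<^bsup>2\<^esup>. of_bool (e \<in> edges G)) - (\<Sum>e\<in>[?V]\<^bsup>2\<^esup>. p)"
    by (simp add: centered_def sum_subtractf)
  also have "(\<Sum>e\<in>[?V]\<^bsup>2\<^esup>. of_bool (e \<in> edges G)) = real (card (edges G))"
    using E V by (simp add: of_bool_def sum.If_cases finite_imp_finite_nsets Int_absorb1)
  finally show ?thesis by (simp add: card_nsets)
qed

text \<open>The two values - p and 1 - p are the roots of this quadratic equation.\<close>

lemma centered_sq: "e \<in> [verts G]\<^bsup>2\<^esup> \<Longrightarrow> (centered G p e)\<^sup>2 = (1 - 2 * p) * centered G p e + p * (1 - p)"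
  by (auto simp: centered_def of_bool_def power2_eq_square algebra_simps)

lemma sum_centered_sq:
  assumes "simple_graph G"
  shows "(\<Sum>i\<in>verts G. \<Sum>j\<in>verts G. (centered G p {i, j})\<^sup>2)
       = (1 - 2 * p) * (\<Sum>i\<in>verts G. wdeg (verts G) (centered G p) i)
         + p * (1 - p) * real (card (verts G)) * (real (card (verts G)) - 1)"
proof -
  let ?V = "verts G"
  have V: "finite ?V" using assms by (auto simp: simple_graph_def)
  have "(\<Sum>i\<in>?V. \<Sum>j\<in>?V. (centered G p {i, j})\<^sup>2) = (\<Sum>i\<in>?V. \<Sum>j\<in>?V - {i}. (centered G p {i, j})\<^sup>2)"
    by (intro sum.cong refl sum.mono_neutral_right) (use V in auto)
  also have "\<dots> = (\<Sum>i\<in>?V. \<Sum>j\<in>?V - {i}. (1 - 2 * p) * centered G p {i, j} + p * (1 - p))"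
    by (intro sum.cong refl centered_sq) (auto simp: nsets_def)
  also have "\<dots> = (\<Sum>i\<in>?V. (1 - 2 * p) * wdeg ?V (centered G p) i + (real (card ?V) - 1) * (p * (1 - p)))"
  proof (intro sum.cong refl)
    fix i assume i: "i \<in> ?V"
    then have "card ?V \<ge> 1" using V by (metis One_nat_def Suc_leI card_gt_0_iff empty_iff)
    then have "real (card (?V - {i})) = real (card ?V) - 1" using V i by (simp add: of_nat_diff)
    then show "(\<Sum>j\<in>?V - {i}. (1 - 2 * p) * centered G p {i, j} + p * (1 - p))
        = (1 - 2 * p) * wdeg ?V (centered G p) i + (real (card ?V) - 1) * (p * (1 - p))"
      by (simp add: sum.distrib sum_distrib_left[symmetric] sum_minus_self[OF V _ i])
  qed
  also have "\<dots> = (1 - 2 * p) * (\<Sum>i\<in>?V. wdeg ?V (centered G p) i)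
      + real (card ?V) * ((real (card ?V) - 1) * (p * (1 - p)))"
    by (simp only: sum.distrib sum_distrib_left sum_constant)
  finally show ?thesis by (simp add: mult_ac)
qed

text \<open>If \<open>u_graph\<close> were small, the sums for K2, P3 and 2K2 would be small by
  \<open>abs_inj_sum_le_u_graph\<close>, and the identity for 2K2 would make the sum of the squares
  smaller than it is.\<close>

lemma u_graph_lower_bound:
  fixes G :: "nat graph"
  assumes k: "k \<ge> 4" and n: "card (verts G) = n" "n \<ge> 2 * k" and G: "simple_graph G"
    and p: "0 < p" "p < 1"
  defines "A \<equiv> (2 ^ card ([{..<k}]\<^bsup>2\<^esup>))\<^sup>2 * real (card (injections {..<k} {..<k}))"
  shows "max (int_dist n p) (p * (1 - p)) * real n ^ (k - 2) \<le> 10 * 2 ^ k * A * u_graph k G p"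
proof -
  let ?V = "verts G" and ?\<alpha> = "centered G p" and ?u = "u_graph k G p" and ?q = "p * (1 - p)"
  define W where "W = 2 ^ k * (A * ?u)"
  have V: "finite ?V" using G by (simp add: simple_graph_def)
  have bound: "\<bar>inj_sum ?V ?\<alpha> (\<Union>H) H\<bar> * real n ^ (k - h) \<le> W"
    if H: "H \<subseteq> [{..<k}]\<^bsup>2\<^esup>" "H \<noteq> {}" and h: "card (\<Union>H) = h" for H h
  proof -
    have sub: "\<Union>H \<subseteq> {..<k}" using H by (auto simp: nsets_def)
    have hk: "h \<le> k" using card_mono[OF _ sub] h by simp
    \<comment> \<open>From n >= 2 k follows n - k >= n / 2. The loss is the factor
      \<open>2 ^ k\<close> in \<open>W\<close>.\<close>
    have "(real n / 2) ^ (k - h) \<le> real (n - k) ^ (k - h)"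
      using n by (intro power_mono) (auto simp: of_nat_diff)
    also have "\<dots> \<le> ext_count n h (k - h)" using hk by (intro ext_count_ge) auto
    finally have e: "(real n / 2) ^ (k - h) \<le> ext_count n h (k - h)" .
    have "\<bar>inj_sum ?V ?\<alpha> (\<Union>H) H\<bar> * real n ^ (k - h)
        = 2 ^ (k - h) * ((real n / 2) ^ (k - h) * \<bar>inj_sum ?V ?\<alpha> (\<Union>H) H\<bar>)"
      by (simp add: power_divide)
    also have "\<dots> \<le> 2 ^ (k - h) * (ext_count n h (k - h) * \<bar>inj_sum ?V ?\<alpha> (\<Union>H) H\<bar>)"
      using e by (intro mult_left_mono mult_right_mono) auto
    also have "ext_count n h (k - h) * \<bar>inj_sum ?V ?\<alpha> (\<Union>H) H\<bar> = \<bar>inj_sum ?V ?\<alpha> {..<k} H\<bar>"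
      using inj_sum_support[OF _ V sub] n(1) h by (simp add: abs_mult ext_count_nonneg)
    also have "2 ^ (k - h) * \<bar>inj_sum ?V ?\<alpha> {..<k} H\<bar> \<le> 2 ^ k * \<bar>inj_sum ?V ?\<alpha> {..<k} H\<bar>"
      by (intro mult_right_mono power_increasing) auto
    also have "\<dots> \<le> W"
      unfolding W_def A_def using abs_inj_sum_le_u_graph[OF G _ _ H] p by (intro mult_left_mono) auto
    finally show ?thesis .
  qed
  define X where "X = (\<Sum>i\<in>?V. wdeg ?V ?\<alpha> i)"
  define Y where "Y = inj_sum ?V ?\<alpha> {0, 1, 2::nat} {{0, 1}, {1, 2}}"
  define Z where "Z = inj_sum ?V ?\<alpha> {0, 1, 2, 3::nat} {{0, 1}, {2, 3}}"
  have Yeq: "Y = (\<Sum>i\<in>?V. (wdeg ?V ?\<alpha> i)\<^sup>2) - (\<Sum>i\<in>?V. \<Sum>j\<in>?V. (?\<alpha> {i, j})\<^sup>2)"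
    unfolding Y_def by (rule inj_sum_P3[OF V]) auto
  have "Z = X\<^sup>2 - 4 * (\<Sum>i\<in>?V. (wdeg ?V ?\<alpha> i)\<^sup>2) + 2 * (\<Sum>i\<in>?V. \<Sum>j\<in>?V. (?\<alpha> {i, j})\<^sup>2)"
    unfolding Z_def X_def by (rule inj_sum_2K2[OF V]) auto
  \<comment> \<open>The 2K2 identity solved for the sum of squares, which
    \<open>sum_centered_sq\<close> evaluates.\<close>
  then have id: "2 * ?q * real n * (real n - 1) = X\<^sup>2 - 4 * Y - Z - 2 * (1 - 2 * p) * X"
    using Yeq sum_centered_sq[OF G, of p] n(1) by (simp add: X_def algebra_simps)
  have bX: "\<bar>X\<bar> * real n ^ (k - 2) \<le> W"
    using bound[of "{{0, 1}}" 2] k inj_sum_K2[OF V, of ?\<alpha> "0::nat" 1]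
    by (auto simp: X_def nsets_def)
  have bY: "\<bar>Y\<bar> * real n ^ (k - 3) \<le> W"
  proof -
    have "\<Union>{{0, 1}, {1, 2}} = {0, 1, 2::nat}" by auto
    then show ?thesis using bound[of "{{0, 1}, {1, 2}}" 3] k by (auto simp: Y_def nsets_def)
  qed
  have bZ: "\<bar>Z\<bar> * real n ^ (k - 4) \<le> W"
  proof -
    have "\<Union>{{0, 1}, {2, 3}} = {0, 1, 2, 3::nat}" by auto
    then show ?thesis using bound[of "{{0, 1}, {2, 3}}" 4] k by (auto simp: Z_def nsets_def)
  qed
  have D: "int_dist n p * real n ^ (k - 2) \<le> W"
  proof -
    \<comment> \<open>No integer is closer than the rounded one, in particular not the number of
      edges.\<close>
    have "int_dist n p \<le> \<bar>p * real (n choose 2) - of_int (int (card (edges G)))\<bar>"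
      unfolding int_dist_def by (rule round_diff_minimal)
    also have "\<dots> \<le> \<bar>X\<bar>" using sum_wdeg_centered[OF G, of p] n(1) by (simp add: X_def)
    finally have "int_dist n p * real n ^ (k - 2) \<le> \<bar>X\<bar> * real n ^ (k - 2)"
      by (intro mult_right_mono) auto
    then show ?thesis using bX by simp
  qed
  have n8: "real n \<ge> 8" using n k by linarith
  have q0: "0 < ?q" using p by simp
  have q1: "?q \<le> 1" using p by (simp add: mult_le_one)
  have Q: "?q * real n ^ (k - 2) \<le> 10 * W"
  proof (rule ccontr)
    assume "\<not> ?thesis"
    \<comment> \<open>Then the three sums are below \<open>?q / 10\<close> times 1, n and n^2. The
      right side of \<open>id\<close> becomes about \<open>?q / 10\<close> times n^2, while the left
      side is about twenty times as large.\<close>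
    then have lt: "W < ?q / 10 * real n ^ (k - 2)" by simp
    have e3: "real n ^ (k - 2) = real n * real n ^ (k - 3)"
      using k by (simp add: power_Suc[symmetric] Suc_diff_Suc numeral_eq_Suc del: power_Suc)
    have "k - 2 = 2 + (k - 4)" using k by simp
    then have e4: "real n ^ (k - 2) = (real n)\<^sup>2 * real n ^ (k - 4)" by (metis power_add)
    have "\<bar>X\<bar> < ?q / 10" using order.strict_trans1[OF bX lt] n8 by simp
    moreover have "\<bar>Y\<bar> < ?q / 10 * real n"
      using order.strict_trans1[OF bY lt] n8 unfolding e3 mult.assoc[symmetric]
      by (simp add: mult_less_cancel_right)
    moreover have "\<bar>Z\<bar> < ?q / 10 * (real n)\<^sup>2"
      using order.strict_trans1[OF bZ lt] n8 unfolding e4 mult.assoc[symmetric]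
      by (simp add: mult_less_cancel_right)
    moreover have "X\<^sup>2 \<le> ?q"
    proof -
      have "\<bar>X\<bar> \<le> 1" using \<open>\<bar>X\<bar> < ?q / 10\<close> q1 by linarith
      then have "\<bar>X\<bar> * \<bar>X\<bar> \<le> 1 * \<bar>X\<bar>" by (intro mult_right_mono) auto
      then show ?thesis using \<open>\<bar>X\<bar> < ?q / 10\<close> q0 by (simp add: power2_eq_square abs_mult[symmetric])
    qed
    moreover have "\<bar>2 * (1 - 2 * p) * X\<bar> \<le> ?q"
    proof -
      have "\<bar>(1 - 2 * p) * X\<bar> \<le> 1 * \<bar>X\<bar>" unfolding abs_mult using p by (intro mult_right_mono) auto
      moreover have "\<bar>2 * (1 - 2 * p) * X\<bar> = 2 * \<bar>(1 - 2 * p) * X\<bar>" by (simp only: mult.assoc abs_mult abs_numeral)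
      ultimately show ?thesis using \<open>\<bar>X\<bar> < ?q / 10\<close> q0 by linarith
    qed
    ultimately have "2 * ?q * real n * (real n - 1) \<le> ?q + 4 * (?q / 10 * real n) + ?q / 10 * (real n)\<^sup>2 + ?q"
      using id by linarith
    moreover have "y + 4 * (y / 10 * x) + y / 10 * x\<^sup>2 + y = y * (2 + 4 / 10 * x + x\<^sup>2 / 10)"
      "2 * y * x * (x - 1) = y * (2 * x * (x - 1))" for x y :: real
      by (simp_all add: field_simps)
    ultimately have "?q * (2 * real n * (real n - 1)) \<le> ?q * (2 + 4 / 10 * real n + (real n)\<^sup>2 / 10)"
      by (simp only:)
    then have "2 * real n * (real n - 1) \<le> 2 + 4 / 10 * real n + (real n)\<^sup>2 / 10"
      using q0 by (rule mult_left_le_imp_le)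
    moreover have "8 * real n \<le> (real n)\<^sup>2" using n8 by (simp add: power2_eq_square)
    moreover have "2 * real n * (real n - 1) = 2 * (real n)\<^sup>2 - 2 * real n"
      by (simp add: power2_eq_square algebra_simps)
    ultimately show False using n8 by linarith
  qed
  have "W \<ge> 0" using bX by (smt (verit) mult_nonneg_nonneg zero_le_power of_nat_0_le_iff abs_ge_zero)
  then have "max (int_dist n p) ?q * real n ^ (k - 2) \<le> 10 * W" using D Q by (auto simp: max_def)
  then show ?thesis by (simp add: W_def)
qed

lemma u_min_lower_bound:
  assumes k: "k \<ge> 4"
  shows "\<exists>c>0. \<forall>n\<ge>2 * k. \<forall>p. 0 < p \<and> p < 1 \<longrightarrow>
     c * max (int_dist n p) (p * (1 - p)) * real n ^ (k - 2) \<le> u_min k n p"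
proof -
  define A where "A = (2 ^ card ([{..<k}]\<^bsup>2\<^esup>))\<^sup>2 * real (card (injections {..<k} {..<k}))"
  have "1 \<le> card (injections {..<k} {..<k})"
    using card_automorphisms_pos[of "{..<k}" "{}"] card_automorphisms_le[of "{..<k}" "{}"] by simp
  then have A: "A > 0" unfolding A_def by simp
  define c where "c = 1 / (10 * 2 ^ k * A)"
  have "c * max (int_dist n p) (p * (1 - p)) * real n ^ (k - 2) \<le> u_min k n p"
    if n: "n \<ge> 2 * k" and p: "0 < p" "p < 1" for n p
  proof -
    have "u_min k n p \<in> {u_graph k G p | G :: nat graph. simple_graph G \<and> card (verts G) = n}"
      unfolding u_min_def by (rule Min_in[OF u_graph_values_finite u_graph_values_nonempty])
    then obtain G :: "nat graph" where G: "simple_graph G" "card (verts G) = n" "u_min k n p = u_graph k G p"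
      by auto
    let ?m = "max (int_dist n p) (p * (1 - p)) * real n ^ (k - 2)"
    have "?m \<le> 10 * 2 ^ k * A * u_graph k G p"
      using u_graph_lower_bound[OF k G(2) n G(1) p] unfolding A_def .
    then have "c * ?m \<le> c * (10 * 2 ^ k * A * u_graph k G p)"
      using A by (intro mult_left_mono) (auto simp: c_def)
    also have "\<dots> = u_graph k G p" using A by (simp add: c_def)
    finally show ?thesis using G(3) by (simp add: mult.assoc)
  qed
  moreover have "c > 0" using A by (simp add: c_def)
  ultimately show ?thesis by blast
qed

section \<open>Random subsets of a finite set\<close>

text \<open>The expectation of \<open>f\<close> at a random subset of \<open>P\<close> that keeps
  each element independently with probability \<open>\<pi>\<close>. As a finite sum it can be
  manipulated without integrability conditions.\<close>

definition bexp :: "'e set \<Rightarrow> real \<Rightarrow> ('e set \<Rightarrow> real) \<Rightarrow> real" where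
  "bexp P \<pi> f = (\<Sum>S\<in>Pow P. \<pi> ^ card S * (1 - \<pi>) ^ card (P - S) * f S)"

definition depends_on :: "('e set \<Rightarrow> real) \<Rightarrow> 'e set \<Rightarrow> bool" where
  "depends_on f A \<longleftrightarrow> (\<forall>S. f S = f (S \<inter> A))"

lemma depends_on_mono: "depends_on f A \<Longrightarrow> A \<subseteq> B \<Longrightarrow> depends_on f B"
proof -
  assume a: "depends_on f A" "A \<subseteq> B"
  have "f S = f (S \<inter> B)" for S
  proof -
    have "S \<inter> B \<inter> A = S \<inter> A" using a(2) by auto
    then show ?thesis using a(1) unfolding depends_on_def by metis
  qed
  then show ?thesis by (simp add: depends_on_def)
qed

lemma depends_on_comp: "depends_on f A \<Longrightarrow> depends_on (\<lambda>S. g (f S)) A"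
  unfolding depends_on_def by metis

lemma depends_on_comp2: "depends_on f A \<Longrightarrow> depends_on f' A \<Longrightarrow> depends_on (\<lambda>S. g (f S) (f' S)) A"
  unfolding depends_on_def by metis

lemma depends_on_sum:
  "(\<And>w. w \<in> W \<Longrightarrow> depends_on (f w) A) \<Longrightarrow> depends_on (\<lambda>S. \<Sum>w\<in>W. f w S) A"
  unfolding depends_on_def by (intro allI sum.cong refl) blast

lemma bexp_union:
  assumes "finite A" "finite B" "A \<inter> B = {}"
  shows "bexp (A \<union> B) \<pi> f = bexp A \<pi> (\<lambda>S. bexp B \<pi> (\<lambda>T. f (S \<union> T)))"
proof -
  have "bexp A \<pi> (\<lambda>S. bexp B \<pi> (\<lambda>T. f (S \<union> T)))
      = (\<Sum>(S, T)\<in>Pow A \<times> Pow B. \<pi> ^ card S * (1 - \<pi>) ^ card (A - S)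
          * (\<pi> ^ card T * (1 - \<pi>) ^ card (B - T) * f (S \<union> T)))"
    unfolding bexp_def sum_distrib_left using assms by (simp add: sum.cartesian_product)
  also have "\<dots> = bexp (A \<union> B) \<pi> f"
    unfolding bexp_def
  proof (rule sum.reindex_bij_witness[where i = "\<lambda>S. (S \<inter> A, S \<inter> B)" and j = "\<lambda>(S, T). S \<union> T"], goal_cases)
    case (5 a)
    obtain S T where a: "a = (S, T)" "S \<subseteq> A" "T \<subseteq> B" using 5 by auto
    have f: "finite S" "finite T" using a assms by (auto intro: finite_subset)
    have "card (S \<union> T) = card S + card T" using a assms f by (intro card_Un_disjoint) auto
    moreover have "A \<union> B - (S \<union> T) = (A - S) \<union> (B - T)" using a assms by auto
    moreover have "card ((A - S) \<union> (B - T)) = card (A - S) + card (B - T)"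
      using a assms by (intro card_Un_disjoint) auto
    ultimately show ?case using a by (simp add: power_add mult_ac)
  qed (use assms in auto)
  finally show ?thesis by simp
qed

section \<open>Centred bits: moments, independence and concentration\<close>

locale bernoulli_set =
  fixes P :: "'e set" and \<pi> :: real
  assumes finP: "finite P" and \<pi>01: "0 \<le> \<pi>" "\<pi> \<le> 1"
begin

abbreviation E :: "('e set \<Rightarrow> real) \<Rightarrow> real" where "E f \<equiv> bexp P \<pi> f"

abbreviation var :: real where "var \<equiv> \<pi> * (1 - \<pi>)"

text \<open>The value 0 off \<open>P\<close> makes reserved pairs and singletons invisible in sums
  over all pairs.\<close>

definition bit :: "'e \<Rightarrow> 'e set \<Rightarrow> real" where
  "bit e S = (if e \<in> P then of_bool (e \<in> S) - \<pi> else 0)"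

lemma var_nonneg: "0 \<le> var" using \<pi>01 by simp

lemma abs_bit_le: "\<bar>bit e S\<bar> \<le> 1"
  using \<pi>01 by (auto simp: bit_def of_bool_def)

lemma depends_on_bit: "e \<in> A \<Longrightarrow> depends_on (bit e) A"
  by (auto simp: depends_on_def bit_def)

lemma weight_eq_prod:
  assumes "S \<subseteq> P"
  shows "\<pi> ^ card S * (1 - \<pi>) ^ card (P - S) = (\<Prod>e\<in>P. if e \<in> S then \<pi> else 1 - \<pi>)"
proof -
  have "(\<Prod>e\<in>P. if e \<in> S then \<pi> else 1 - \<pi>)
      = (\<Prod>e\<in>P - S. if e \<in> S then \<pi> else 1 - \<pi>) * (\<Prod>e\<in>S. if e \<in> S then \<pi> else 1 - \<pi>)"
    by (rule prod.subset_diff[OF assms finP])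
  then show ?thesis by simp
qed

lemma E_prod:
  assumes "T \<subseteq> P"
  shows "E (\<lambda>S. \<Prod>e\<in>T. h e (e \<in> S)) = (\<Prod>e\<in>T. \<pi> * h e True + (1 - \<pi>) * h e False)"
proof -
  let ?h = "\<lambda>e v. if e \<in> T then h e v else 1"
  have "E (\<lambda>S. \<Prod>e\<in>T. h e (e \<in> S))
      = (\<Sum>S\<in>Pow P. \<Prod>e\<in>P. if e \<in> S then \<pi> * ?h e True else (1 - \<pi>) * ?h e False)"
    unfolding bexp_def
  proof (rule sum.cong[OF refl])
    fix S assume "S \<in> Pow P"
    have "(\<Prod>e\<in>T. h e (e \<in> S)) = (\<Prod>e\<in>P. ?h e (e \<in> S))"
      using assms finP by (intro prod.mono_neutral_cong_left) auto
    then have "\<pi> ^ card S * (1 - \<pi>) ^ card (P - S) * (\<Prod>e\<in>T. h e (e \<in> S))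
        = (\<Prod>e\<in>P. (if e \<in> S then \<pi> else 1 - \<pi>) * ?h e (e \<in> S))"
      using \<open>S \<in> Pow P\<close> by (simp only: weight_eq_prod Pow_iff prod.distrib)
    also have "\<dots> = (\<Prod>e\<in>P. if e \<in> S then \<pi> * ?h e True else (1 - \<pi>) * ?h e False)"
      by (rule prod.cong) auto
    finally show "\<pi> ^ card S * (1 - \<pi>) ^ card (P - S) * (\<Prod>e\<in>T. h e (e \<in> S)) = \<dots>" .
  qed
  also have "\<dots> = (\<Prod>e\<in>P. \<pi> * ?h e True + (1 - \<pi>) * ?h e False)"
    by (rule sum_Pow_prod_weights[OF finP])
  also have "\<dots> = (\<Prod>e\<in>T. \<pi> * h e True + (1 - \<pi>) * h e False)"
    using assms finP by (intro prod.mono_neutral_cong_right) auto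
  finally show ?thesis .
qed

lemma E_const [simp]: "E (\<lambda>_. c) = c"
proof -
  have "E (\<lambda>_. 1) = 1" using E_prod[of "{}" "\<lambda>_ _. 1"] by simp
  then show ?thesis unfolding bexp_def by (simp add: sum_distrib_right[symmetric])
qed

lemma E_add: "E (\<lambda>S. f S + g S) = E f + E g"
  unfolding bexp_def by (simp add: algebra_simps sum.distrib)

lemma E_diff: "E (\<lambda>S. f S - g S) = E f - E g"
  unfolding bexp_def by (simp add: algebra_simps sum_subtractf)

lemma E_cmult: "E (\<lambda>S. c * f S) = c * E f"
  unfolding bexp_def by (simp add: sum_distrib_left mult_ac)

lemma E_cdiv: "E (\<lambda>S. f S / c) = E f / c"
  using E_cmult[of "1 / c" f] by simp

lemma E_sum: "E (\<lambda>S. \<Sum>i\<in>I. f i S) = (\<Sum>i\<in>I. E (f i))"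
  unfolding bexp_def sum_distrib_left by (rule sum.swap)

lemma E_cong: "(\<And>S. S \<subseteq> P \<Longrightarrow> f S = g S) \<Longrightarrow> E f = E g"
  unfolding bexp_def by (intro sum.cong) auto

lemma E_mono: "(\<And>S. S \<subseteq> P \<Longrightarrow> f S \<le> g S) \<Longrightarrow> E f \<le> E g"
  unfolding bexp_def using \<pi>01 by (intro sum_mono mult_left_mono) auto

lemma E_nonneg: "(\<And>S. S \<subseteq> P \<Longrightarrow> 0 \<le> f S) \<Longrightarrow> 0 \<le> E f"
  using E_mono[of "\<lambda>_. 0" f] by simp

lemma E_less_imp_ex:
  assumes "E f < c" shows "\<exists>S\<subseteq>P. f S < c"
proof (rule ccontr)
  assume "\<not> ?thesis"
  then have "E (\<lambda>_. c) \<le> E f" by (intro E_mono) auto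
  then show False using assms by simp
qed

text \<open>This is the nonnegativity of the variance of the absolute value.\<close>

lemma E_abs_sq_le: "(E (\<lambda>S. \<bar>f S\<bar>))\<^sup>2 \<le> E (\<lambda>S. (f S)\<^sup>2)"
proof -
  let ?m = "E (\<lambda>S. \<bar>f S\<bar>)"
  have "0 \<le> E (\<lambda>S. (\<bar>f S\<bar> - ?m)\<^sup>2)" by (intro E_nonneg) auto
  also have "\<dots> = E (\<lambda>S. (f S)\<^sup>2 - 2 * ?m * \<bar>f S\<bar> + ?m\<^sup>2)"
    by (intro E_cong) (simp add: power2_diff)
  also have "\<dots> = E (\<lambda>S. (f S)\<^sup>2) - 2 * ?m * ?m + ?m\<^sup>2"
    by (simp only: E_add E_diff E_cmult E_const)
  finally show ?thesis by (simp add: power2_eq_square)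
qed

lemma E_abs_le:
  assumes "E (\<lambda>S. (f S)\<^sup>2) \<le> c\<^sup>2" "0 \<le> c" shows "E (\<lambda>S. \<bar>f S\<bar>) \<le> c"
  using E_abs_sq_le[of f] assms power2_le_imp_le by (meson order_trans)

text \<open>Split \<open>P\<close> into \<open>A \<inter> P\<close> and the rest: \<open>f\<close>
  sees only the first part, \<open>g\<close> only the second, and the weight of a set factors
  accordingly.\<close>

lemma E_mult_indep:
  assumes f: "depends_on f A" and g: "depends_on g B" and AB: "A \<inter> B = {}"
  shows "E (\<lambda>S. f S * g S) = E f * E g"
proof -
  let ?A = "A \<inter> P" and ?B = "P - A"
  have P: "P = ?A \<union> ?B" by auto
  have split: "bexp P \<pi> h = bexp ?A \<pi> (\<lambda>S. bexp ?B \<pi> (\<lambda>T. h (S \<union> T)))" for h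
    by (subst P, rule bexp_union) (use finP in auto)
  have fu: "f (S \<union> T) = f S" if "T \<subseteq> ?B" for S T
  proof -
    have "(S \<union> T) \<inter> A = S \<inter> A" using that by auto
    then show ?thesis using f unfolding depends_on_def by metis
  qed
  have gu: "g (S \<union> T) = g T" if "S \<subseteq> ?A" for S T
  proof -
    have "(S \<union> T) \<inter> B = T \<inter> B" using that AB by auto
    then show ?thesis using g unfolding depends_on_def by metis
  qed
  have inner: "bexp ?B \<pi> (\<lambda>T. h S * k T) = h S * bexp ?B \<pi> k" for h k :: "'e set \<Rightarrow> real" and S
    unfolding bexp_def sum_distrib_left by (intro sum.cong refl) (simp only: mult_ac)
  have outer: "bexp ?A \<pi> (\<lambda>S. h S * c) = bexp ?A \<pi> h * c" for h :: "'e set \<Rightarrow> real" and c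
    unfolding bexp_def sum_distrib_right by (intro sum.cong refl) (simp only: mult_ac)
  have gen: "bexp P \<pi> (\<lambda>S. h S * k S) = bexp ?A \<pi> h * bexp ?B \<pi> k"
    if "\<And>S T. T \<subseteq> ?B \<Longrightarrow> h (S \<union> T) = h S" "\<And>S T. S \<subseteq> ?A \<Longrightarrow> k (S \<union> T) = k T" for h k
  proof -
    have "bexp P \<pi> (\<lambda>S. h S * k S) = bexp ?A \<pi> (\<lambda>S. bexp ?B \<pi> (\<lambda>T. h (S \<union> T) * k (S \<union> T)))"
      by (rule split)
    also have "\<dots> = bexp ?A \<pi> (\<lambda>S. bexp ?B \<pi> (\<lambda>T. h S * k T))"
      unfolding bexp_def using that by (intro sum.cong refl arg_cong2[where f = "(*)"]) auto
    finally show ?thesis by (simp add: inner outer)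
  qed
  have one: "bexp ?A \<pi> (\<lambda>_. 1) = 1" "bexp ?B \<pi> (\<lambda>_. 1) = 1"
  proof -
    interpret A: bernoulli_set ?A \<pi> using finP \<pi>01 by unfold_locales auto
    interpret B: bernoulli_set ?B \<pi> using finP \<pi>01 by unfold_locales auto
    show "bexp ?A \<pi> (\<lambda>_. 1) = 1" "bexp ?B \<pi> (\<lambda>_. 1) = 1" by (rule A.E_const B.E_const)+
  qed
  have "E f = bexp ?A \<pi> f" using gen[of f "\<lambda>_. 1"] fu one by simp
  moreover have "E g = bexp ?B \<pi> g" using gen[of "\<lambda>_. 1" g] gu one by simp
  ultimately show ?thesis using gen[OF fu gu] by simp
qed

text \<open>A bit occurring in only one of the monomials has mean 0 and is independent of the rest;
  a common one contributes its variance.\<close>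

lemma E_monomials:
  assumes "finite T" "finite T'"
  shows "E (\<lambda>S. (\<Prod>e\<in>T. bit e S) * (\<Prod>e\<in>T'. bit e S)) = (if T = T' \<and> T \<subseteq> P then var ^ card T else 0)"
proof (cases "T \<subseteq> P \<and> T' \<subseteq> P")
  case False
  then obtain e where "e \<in> T \<union> T'" "e \<notin> P" by auto
  then have "(\<Prod>e\<in>T. bit e S) * (\<Prod>e\<in>T'. bit e S) = 0" for S
    using assms by (auto simp: bit_def)
  then have "E (\<lambda>S. (\<Prod>e\<in>T. bit e S) * (\<Prod>e\<in>T'. bit e S)) = 0" by (simp only: E_const)
  then show ?thesis using False by auto
next
  case True
  define h where "h = (\<lambda>e v. (if e \<in> T then of_bool v - \<pi> else 1) * (if e \<in> T' then of_bool v - \<pi> else 1))"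
  have "(\<Prod>e\<in>T. bit e S) * (\<Prod>e\<in>T'. bit e S) = (\<Prod>e\<in>T \<union> T'. h e (e \<in> S))" for S
  proof -
    have "(\<Prod>e\<in>T. bit e S) = (\<Prod>e\<in>T \<union> T'. if e \<in> T then of_bool (e \<in> S) - \<pi> else 1)"
      using assms True by (intro prod.mono_neutral_cong_left) (auto simp: bit_def)
    moreover have "(\<Prod>e\<in>T'. bit e S) = (\<Prod>e\<in>T \<union> T'. if e \<in> T' then of_bool (e \<in> S) - \<pi> else 1)"
      using assms True by (intro prod.mono_neutral_cong_left) (auto simp: bit_def)
    ultimately show ?thesis by (simp only: h_def prod.distrib)
  qed
  then have eq: "E (\<lambda>S. (\<Prod>e\<in>T. bit e S) * (\<Prod>e\<in>T'. bit e S))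
      = (\<Prod>e\<in>T \<union> T'. \<pi> * h e True + (1 - \<pi>) * h e False)"
    using E_prod[of "T \<union> T'" h] True by simp
  show ?thesis
  proof (cases "T = T'")
    case True
    have "(\<Prod>e\<in>T \<union> T'. \<pi> * h e True + (1 - \<pi>) * h e False) = (\<Prod>e\<in>T. var)"
      using True by (intro prod.cong) (auto simp: h_def algebra_simps)
    then show ?thesis using eq True \<open>T \<subseteq> P \<and> T' \<subseteq> P\<close> by simp
  next
    case False
    then obtain e where e: "e \<in> T \<union> T'" "\<not> (e \<in> T \<and> e \<in> T')" by auto
    have "(\<Prod>e\<in>T \<union> T'. \<pi> * h e True + (1 - \<pi>) * h e False) = 0"
      using e assms by (intro prod_zero) (auto intro!: bexI[of _ e] simp: h_def algebra_simps)
    then show ?thesis using eq False by simp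
  qed
qed

text \<open>Distinct monomials in the centred bits are orthogonal, so only coinciding ones contribute.\<close>

lemma second_moment_le:
  fixes w :: "'i \<Rightarrow> real"
  assumes fin: "finite \<Phi>" and T: "\<And>\<phi>. \<phi> \<in> \<Phi> \<Longrightarrow> finite (T \<phi>) \<and> card (T \<phi>) = m"
    and M: "\<And>\<phi>. \<phi> \<in> \<Phi> \<Longrightarrow> real (card {\<psi> \<in> \<Phi>. T \<psi> = T \<phi>}) \<le> M"
  shows "E (\<lambda>S. (\<Sum>\<phi>\<in>\<Phi>. w \<phi> * (\<Prod>e\<in>T \<phi>. bit e S))\<^sup>2) \<le> M * var ^ m * (\<Sum>\<phi>\<in>\<Phi>. (w \<phi>)\<^sup>2)"
proof -
  have "E (\<lambda>S. (\<Sum>\<phi>\<in>\<Phi>. w \<phi> * (\<Prod>e\<in>T \<phi>. bit e S))\<^sup>2)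
      = E (\<lambda>S. \<Sum>\<phi>\<in>\<Phi>. \<Sum>\<psi>\<in>\<Phi>. (w \<phi> * w \<psi>) * ((\<Prod>e\<in>T \<phi>. bit e S) * (\<Prod>e\<in>T \<psi>. bit e S)))"
    by (simp add: power2_eq_square sum_product mult_ac)
  also have "\<dots> = (\<Sum>\<phi>\<in>\<Phi>. \<Sum>\<psi>\<in>\<Phi>. (w \<phi> * w \<psi>) * (if T \<phi> = T \<psi> \<and> T \<phi> \<subseteq> P then var ^ card (T \<phi>) else 0))"
    by (simp add: E_sum E_cmult E_monomials T)
  also have "\<dots> \<le> (\<Sum>\<phi>\<in>\<Phi>. \<Sum>\<psi>\<in>\<Phi>. if T \<psi> = T \<phi> then var ^ m * (((w \<phi>)\<^sup>2 + (w \<psi>)\<^sup>2) / 2) else 0)"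
  proof (intro sum_mono)
    fix \<phi> \<psi> assume "\<phi> \<in> \<Phi>" "\<psi> \<in> \<Phi>"
    have v: "0 \<le> var ^ m" using var_nonneg by simp
    have "w \<phi> * w \<psi> \<le> ((w \<phi>)\<^sup>2 + (w \<psi>)\<^sup>2) / 2"
      using sum_squares_bound[of "w \<phi>" "w \<psi>"] by simp
    from mult_left_mono[OF this v]
    have "w \<phi> * w \<psi> * var ^ m \<le> var ^ m * (((w \<phi>)\<^sup>2 + (w \<psi>)\<^sup>2) / 2)"
      by (simp only: mult.commute)
    moreover have "0 \<le> var ^ m * (((w \<phi>)\<^sup>2 + (w \<psi>)\<^sup>2) / 2)" using v by simp
    ultimately show "(w \<phi> * w \<psi>) * (if T \<phi> = T \<psi> \<and> T \<phi> \<subseteq> P then var ^ card (T \<phi>) else 0)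
        \<le> (if T \<psi> = T \<phi> then var ^ m * (((w \<phi>)\<^sup>2 + (w \<psi>)\<^sup>2) / 2) else 0)"
      using T[OF \<open>\<phi> \<in> \<Phi>\<close>] by auto
  qed
  also have "\<dots> = (\<Sum>\<phi>\<in>\<Phi>. \<Sum>\<psi>\<in>\<Phi>. if T \<psi> = T \<phi> then var ^ m * ((w \<phi>)\<^sup>2 / 2) else 0)
      + (\<Sum>\<phi>\<in>\<Phi>. \<Sum>\<psi>\<in>\<Phi>. if T \<psi> = T \<phi> then var ^ m * ((w \<psi>)\<^sup>2 / 2) else 0)"
    by (simp add: sum.distrib[symmetric] add_divide_distrib distrib_left if_distrib cong: if_cong)
  also have "(\<Sum>\<phi>\<in>\<Phi>. \<Sum>\<psi>\<in>\<Phi>. if T \<psi> = T \<phi> then var ^ m * ((w \<psi>)\<^sup>2 / 2) else 0)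
      = (\<Sum>\<phi>\<in>\<Phi>. \<Sum>\<psi>\<in>\<Phi>. if T \<psi> = T \<phi> then var ^ m * ((w \<phi>)\<^sup>2 / 2) else 0)"
    by (subst sum.swap) (simp add: eq_commute)
  also have "(\<Sum>\<phi>\<in>\<Phi>. \<Sum>\<psi>\<in>\<Phi>. if T \<psi> = T \<phi> then var ^ m * ((w \<phi>)\<^sup>2 / 2) else 0)
      + (\<Sum>\<phi>\<in>\<Phi>. \<Sum>\<psi>\<in>\<Phi>. if T \<psi> = T \<phi> then var ^ m * ((w \<phi>)\<^sup>2 / 2) else 0)
      = (\<Sum>\<phi>\<in>\<Phi>. real (card {\<psi> \<in> \<Phi>. T \<psi> = T \<phi>}) * (var ^ m * (w \<phi>)\<^sup>2))"
    using fin by (simp add: sum.distrib[symmetric] sum.inter_filter[symmetric] mult_ac)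
  also have "\<dots> \<le> (\<Sum>\<phi>\<in>\<Phi>. M * (var ^ m * (w \<phi>)\<^sup>2))"
    using var_nonneg by (intro sum_mono mult_right_mono M) auto
  finally show ?thesis by (simp add: sum_distrib_left mult_ac)
qed

lemma E_bit: "E (bit e) = 0"
  using E_monomials[of "{e}" "{}"] by (auto simp: )

lemma E_bit_sq: "E (\<lambda>S. (bit e S)\<^sup>2) = (if e \<in> P then var else 0)"
  using E_monomials[of "{e}" "{e}"] by (auto simp: power2_eq_square)

text \<open>Induction on \<open>W\<close>. In the fourth power of a new term plus the old sum, of
  variances a and b, the odd mixed moments vanish, and the term has fourth moment at most a because
  it is bounded by 1. It remains that a + 6 a b + 3 b^2 + b is at most 3 (a + b)^2 + a + b.\<close>

lemma moments_indep_sum: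
  assumes fin: "finite W" and dep: "\<And>w. w \<in> W \<Longrightarrow> depends_on (f w) (A w)"
    and dis: "\<And>w w'. w \<in> W \<Longrightarrow> w' \<in> W \<Longrightarrow> w \<noteq> w' \<Longrightarrow> A w \<inter> A w' = {}"
    and mean: "\<And>w. w \<in> W \<Longrightarrow> E (f w) = 0" and bd: "\<And>w S. w \<in> W \<Longrightarrow> \<bar>f w S\<bar> \<le> 1"
  shows "E (\<lambda>S. \<Sum>w\<in>W. f w S) = 0"
    and "E (\<lambda>S. (\<Sum>w\<in>W. f w S)\<^sup>2) = (\<Sum>w\<in>W. E (\<lambda>S. (f w S)\<^sup>2))"
    and "E (\<lambda>S. (\<Sum>w\<in>W. f w S) ^ 4) \<le> 3 * (\<Sum>w\<in>W. E (\<lambda>S. (f w S)\<^sup>2))\<^sup>2 + (\<Sum>w\<in>W. E (\<lambda>S. (f w S)\<^sup>2))"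
proof -
  show m1: "E (\<lambda>S. \<Sum>w\<in>W. f w S) = 0" by (simp add: E_sum mean)
  have "E (\<lambda>S. (\<Sum>w\<in>W. f w S)\<^sup>2) = (\<Sum>w\<in>W. E (\<lambda>S. (f w S)\<^sup>2)) \<and>
    E (\<lambda>S. (\<Sum>w\<in>W. f w S) ^ 4) \<le> 3 * (\<Sum>w\<in>W. E (\<lambda>S. (f w S)\<^sup>2))\<^sup>2 + (\<Sum>w\<in>W. E (\<lambda>S. (f w S)\<^sup>2))"
    using fin dep dis mean bd
  proof (induction W rule: finite_induct)
    case empty
    then show ?case by simp
  next
    case (insert x W)
    let ?X = "f x" and ?Z = "\<lambda>S. \<Sum>w\<in>W. f w S"
    let ?a = "E (\<lambda>S. (?X S)\<^sup>2)" and ?b = "\<Sum>w\<in>W. E (\<lambda>S. (f w S)\<^sup>2)"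
    have IH: "E (\<lambda>S. (?Z S)\<^sup>2) = ?b" "E (\<lambda>S. (?Z S) ^ 4) \<le> 3 * ?b\<^sup>2 + ?b"
      using insert.IH insert.prems by auto
    have dX: "depends_on ?X (A x)" using insert.prems(1) by simp
    have dZ: "depends_on ?Z (\<Union>w\<in>W. A w)"
      by (rule depends_on_sum, rule depends_on_mono) (use insert.prems(1) in auto)
    have disj: "A x \<inter> (\<Union>w\<in>W. A w) = {}" using insert.prems(2)[of x] insert.hyps by auto
    have ind: "E (\<lambda>S. g (?X S) * h (?Z S)) = E (\<lambda>S. g (?X S)) * E (\<lambda>S. h (?Z S))" for g h :: "real \<Rightarrow> real"
      by (rule E_mult_indep[OF depends_on_comp[OF dX] depends_on_comp[OF dZ] disj])
    have EX: "E ?X = 0" using insert.prems(3) by simp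
    have EZ: "E ?Z = 0" using insert.prems(3) by (simp add: E_sum)
    have sum: "(\<Sum>w\<in>insert x W. f w S) = ?X S + ?Z S" for S using insert.hyps by simp
    have "E (\<lambda>S. (?X S + ?Z S)\<^sup>2) = E (\<lambda>S. (?X S)\<^sup>2 + 2 * (?X S * ?Z S) + (?Z S)\<^sup>2)"
      by (intro E_cong) (simp add: power2_sum)
    also have "\<dots> = ?a + ?b"
      using ind[of "\<lambda>x. x" "\<lambda>x. x"] EX IH by (simp add: E_add E_cmult)
    finally have 2: "E (\<lambda>S. (?X S + ?Z S)\<^sup>2) = ?a + ?b" .
    have "E (\<lambda>S. (?X S + ?Z S) ^ 4) = E (\<lambda>S. (?X S) ^ 4 + 4 * ((?X S) ^ 3 * ?Z S)
        + 6 * ((?X S)\<^sup>2 * (?Z S)\<^sup>2) + 4 * (?X S * (?Z S) ^ 3) + (?Z S) ^ 4)"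
      by (intro E_cong) (simp add: eval_nat_numeral algebra_simps)
    also have "\<dots> = E (\<lambda>S. (?X S) ^ 4) + 6 * (?a * ?b) + E (\<lambda>S. (?Z S) ^ 4)"
      using ind[of "\<lambda>x. x ^ 3" "\<lambda>x. x"] ind[of "\<lambda>x. x" "\<lambda>x. x ^ 3"]
        ind[of "\<lambda>x. x\<^sup>2" "\<lambda>x. x\<^sup>2"] EX EZ IH by (simp add: E_add E_cmult)
    also have "E (\<lambda>S. (?X S) ^ 4) \<le> ?a"
    proof (rule E_mono)
      fix S
      have "(?X S)\<^sup>2 \<le> 1" using insert.prems(4)[of x S] by (simp add: abs_square_le_1)
      then have "(?X S)\<^sup>2 * (?X S)\<^sup>2 \<le> 1 * (?X S)\<^sup>2" by (intro mult_right_mono) auto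
      then show "(?X S) ^ 4 \<le> (?X S)\<^sup>2" by (simp add: power_add[symmetric])
    qed
    finally have "E (\<lambda>S. (?X S + ?Z S) ^ 4) \<le> ?a + 6 * (?a * ?b) + (3 * ?b\<^sup>2 + ?b)"
      using IH(2) by linarith
    also have "\<dots> \<le> 3 * (?a + ?b)\<^sup>2 + (?a + ?b)"
      by (simp add: power2_sum algebra_simps)
    finally show ?case using 2 insert.hyps by simp
  qed
  then show "E (\<lambda>S. (\<Sum>w\<in>W. f w S)\<^sup>2) = (\<Sum>w\<in>W. E (\<lambda>S. (f w S)\<^sup>2))"
    "E (\<lambda>S. (\<Sum>w\<in>W. f w S) ^ 4) \<le> 3 * (\<Sum>w\<in>W. E (\<lambda>S. (f w S)\<^sup>2))\<^sup>2 + (\<Sum>w\<in>W. E (\<lambda>S. (f w S)\<^sup>2))"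
    by auto
qed

text \<open>A small first moment with a given second moment would force a large fourth moment.
  Precisely, y - y^2 + y^4 / 4 >= 0 for y >= 0 is taken at the scale \<open>l\<close> and
  averaged.\<close>

lemma E_abs_ge:
  assumes m: "E (\<lambda>S. (f S)\<^sup>2) = m" "1 \<le> m" and 4: "E (\<lambda>S. f S ^ 4) \<le> 3 * m\<^sup>2 + m"
  shows "3 / 8 * sqrt m \<le> E (\<lambda>S. \<bar>f S\<bar>)"
proof -
  \<comment> \<open>With the fourth moment at most 4 m^2, this scale gives m / l - 4 m^2 / (4 l^3) =
    (1/2 - 1/8) sqrt m.\<close>
  define l where "l = 2 * sqrt m"
  have l: "l > 0" "l\<^sup>2 = 4 * m" using m by (auto simp: l_def power_mult_distrib)
  have pw: "(f S)\<^sup>2 / l - f S ^ 4 / (4 * l ^ 3) \<le> \<bar>f S\<bar>" for S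
  proof -
    define y where "y = \<bar>f S\<bar> / l"
    have y0: "0 \<le> y" using l by (simp add: y_def)
    have fy: "\<bar>f S\<bar> = l * y" using l by (simp add: y_def)
    \<comment> \<open>Of the two forms below, the first is positive for y < 2 and the second for y
      >= 2.\<close>
    have "0 \<le> 1 - y + y ^ 3 / 4"
    proof -
      have "1 - y + y ^ 3 / 4 = (y - 1)\<^sup>2 * (y + 2) / 4 + 1 / 2 - y / 4"
        by (simp add: eval_nat_numeral field_simps)
      moreover have "1 - y + y ^ 3 / 4 = y * (y\<^sup>2 / 4 - 1) + 1"
        by (simp add: eval_nat_numeral field_simps)
      moreover have "y * (y\<^sup>2 / 4 - 1) \<ge> 0" if "y \<ge> 2"
      proof -
        have "y\<^sup>2 \<ge> 2\<^sup>2" using that by (intro power_mono) auto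
        then show ?thesis using y0 by simp
      qed
      moreover have "(y - 1)\<^sup>2 * (y + 2) / 4 \<ge> 0" using y0 by simp
      ultimately show ?thesis by (cases "y \<ge> 2") linarith+
    qed
    then have "0 \<le> y * (1 - y + y ^ 3 / 4)" using y0 by simp
    then have "y\<^sup>2 - y ^ 4 / 4 \<le> y" by (simp add: eval_nat_numeral algebra_simps)
    then have "l * (y\<^sup>2 - y ^ 4 / 4) \<le> l * y" using l by (intro mult_left_mono) auto
    moreover have "(f S)\<^sup>2 = (l * y)\<^sup>2" using fy by (metis power2_abs)
    moreover have "f S ^ 4 = (l * y) ^ 4" using fy by (metis power_even_abs_numeral even_numeral)
    moreover have "(l * y)\<^sup>2 / l = l * y\<^sup>2" "(l * y) ^ 4 / (4 * l ^ 3) = l * (y ^ 4 / 4)"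
      using l(1) by (simp_all add: eval_nat_numeral field_simps)
    ultimately show ?thesis using fy by (simp only: right_diff_distrib)
  qed
  have "(f S)\<^sup>2 / l - f S ^ 4 / (4 * l ^ 3) = (1 / l) * (f S)\<^sup>2 - (1 / (4 * l ^ 3)) * f S ^ 4" for S by simp
  then have "(1 / l) * m - (1 / (4 * l ^ 3)) * E (\<lambda>S. f S ^ 4) = E (\<lambda>S. (f S)\<^sup>2 / l - f S ^ 4 / (4 * l ^ 3))"
    by (simp only: E_diff E_cmult m)
  also have "\<dots> \<le> E (\<lambda>S. \<bar>f S\<bar>)" by (intro E_mono pw)
  finally have le: "m / l - E (\<lambda>S. f S ^ 4) / (4 * l ^ 3) \<le> E (\<lambda>S. \<bar>f S\<bar>)" by simp
  have "m * 1 \<le> m * m" using m by (intro mult_left_mono) auto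
  then have "E (\<lambda>S. f S ^ 4) \<le> 4 * m\<^sup>2" using 4 by (simp add: power2_eq_square)
  then have "E (\<lambda>S. f S ^ 4) / (4 * l ^ 3) \<le> 4 * m\<^sup>2 / (4 * l ^ 3)"
    using l by (intro divide_right_mono) auto
  also have "\<dots> = m / (4 * l)"
  proof -
    have "4 * l ^ 3 = 4 * l * l\<^sup>2" by (simp add: eval_nat_numeral)
    also have "\<dots> = 16 * l * m" using l by simp
    finally have "4 * m\<^sup>2 / (4 * l ^ 3) = 4 * m\<^sup>2 / (16 * l * m)" by (rule arg_cong)
    also have "\<dots> = m / (4 * l)" using m l by (simp add: power2_eq_square field_simps)
    finally show ?thesis .
  qed
  finally have "m / l - m / (4 * l) \<le> E (\<lambda>S. \<bar>f S\<bar>)" using le by linarith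
  moreover have "m / l - m / (4 * l) = 3 / 8 * sqrt m"
  proof -
    have "m / l = sqrt m / 2" using m by (simp add: l_def real_div_sqrt field_simps)
    moreover have "m / (4 * l) = (m / l) / 4" by simp
    ultimately show ?thesis by simp
  qed
  ultimately show ?thesis by simp
qed

text \<open>\<open>near\<close> collects the pairs that are not assumed to be almost independent.\<close>

lemma sum_abs_concentrated:
  fixes X :: "'i \<Rightarrow> 'e set \<Rightarrow> real"
  assumes T: "finite T" and m: "\<And>i. i \<in> T \<Longrightarrow> E (\<lambda>S. (X i S)\<^sup>2) \<le> m"
    and far: "\<And>i j. i \<in> T \<Longrightarrow> j \<in> T \<Longrightarrow> (i, j) \<notin> near \<Longrightarrow>
       E (\<lambda>S. \<bar>X i S\<bar> * \<bar>X j S\<bar>) \<le> (E (\<lambda>S. \<bar>X i S\<bar>) + r) * (E (\<lambda>S. \<bar>X j S\<bar>) + r)"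
    and near: "\<And>i. i \<in> T \<Longrightarrow> real (card {j \<in> T. (i, j) \<in> near}) \<le> N" and r: "0 \<le> r"
    and mu: "\<And>i. i \<in> T \<Longrightarrow> \<mu> \<le> E (\<lambda>S. \<bar>X i S\<bar>)" "0 < \<mu>" and Tne: "T \<noteq> {}"
  shows "E (\<lambda>S. ((\<Sum>i\<in>T. \<bar>X i S\<bar>) / E (\<lambda>S. \<Sum>i\<in>T. \<bar>X i S\<bar>) - 1)\<^sup>2)
      \<le> 2 * r / \<mu> + (r / \<mu>)\<^sup>2 + N * m / (real (card T) * \<mu>\<^sup>2)"
proof -
  let ?Y = "\<lambda>S. \<Sum>i\<in>T. \<bar>X i S\<bar>" and ?t = "real (card T)"
  define \<nu> where "\<nu> = (\<lambda>i. E (\<lambda>S. \<bar>X i S\<bar>))"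
  define y where "y = E ?Y"
  have y: "y = (\<Sum>i\<in>T. \<nu> i)" by (simp add: y_def \<nu>_def E_sum)
  have t0: "?t > 0" using T Tne by (simp add: card_gt_0_iff)
  have ylow: "?t * \<mu> \<le> y" unfolding y using sum_mono[of T "\<lambda>_. \<mu>" \<nu>] mu by (simp add: \<nu>_def)
  have y0: "y > 0" using ylow mu(2) t0 by (meson less_le_trans mult_pos_pos)
  have \<nu>0: "0 \<le> \<nu> i" for i unfolding \<nu>_def by (intro E_nonneg) auto
  obtain i\<^sub>0 where i\<^sub>0: "i\<^sub>0 \<in> T" using Tne by auto
  have "0 \<le> E (\<lambda>S. (X i\<^sub>0 S)\<^sup>2)" by (intro E_nonneg) auto
  then have m0: "0 \<le> m" using m[OF i\<^sub>0] by linarith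
  have prod: "E (\<lambda>S. \<bar>X i S\<bar> * \<bar>X j S\<bar>) \<le> (\<nu> i + r) * (\<nu> j + r) + (if (i, j) \<in> near then m else 0)"
    if ij: "i \<in> T" "j \<in> T" for i j
  proof (cases "(i, j) \<in> near")
    case True
    \<comment> \<open>Without independence, the product is bounded by the average of the two
      squares.\<close>
    have "E (\<lambda>S. \<bar>X i S\<bar> * \<bar>X j S\<bar>) \<le> E (\<lambda>S. (1 / 2) * (X i S)\<^sup>2 + (1 / 2) * (X j S)\<^sup>2)"
    proof (rule E_mono)
      fix S show "\<bar>X i S\<bar> * \<bar>X j S\<bar> \<le> (1 / 2) * (X i S)\<^sup>2 + (1 / 2) * (X j S)\<^sup>2"
        using sum_squares_bound[of "\<bar>X i S\<bar>" "\<bar>X j S\<bar>"] by simp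
    qed
    also have "\<dots> = (1 / 2) * E (\<lambda>S. (X i S)\<^sup>2) + (1 / 2) * E (\<lambda>S. (X j S)\<^sup>2)"
      by (simp only: E_add E_cmult)
    also have "\<dots> \<le> m" using m[OF ij(1)] m[OF ij(2)] by simp
    finally show ?thesis using True r \<nu>0[of i] \<nu>0[of j] by (simp add: add_increasing)
  next
    case False
    then show ?thesis using far[OF ij False] by (simp add: \<nu>_def)
  qed
  have "E (\<lambda>S. (?Y S)\<^sup>2) = (\<Sum>i\<in>T. \<Sum>j\<in>T. E (\<lambda>S. \<bar>X i S\<bar> * \<bar>X j S\<bar>))"
    by (simp add: power2_eq_square sum_product E_sum)
  also have "\<dots> \<le> (\<Sum>i\<in>T. \<Sum>j\<in>T. (\<nu> i + r) * (\<nu> j + r) + (if (i, j) \<in> near then m else 0))"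
    by (intro sum_mono prod)
  also have "\<dots> = (\<Sum>i\<in>T. \<nu> i + r)\<^sup>2 + (\<Sum>i\<in>T. real (card {j \<in> T. (i, j) \<in> near}) * m)"
  proof -
    have "(\<Sum>i\<in>T. \<nu> i + r)\<^sup>2 = (\<Sum>i\<in>T. \<Sum>j\<in>T. (\<nu> i + r) * (\<nu> j + r))"
      by (simp only: power2_eq_square sum_product)
    moreover have "(\<Sum>i\<in>T. \<Sum>j\<in>T. if (i, j) \<in> near then m else 0)
        = (\<Sum>i\<in>T. real (card {j \<in> T. (i, j) \<in> near}) * m)"
      using T by (simp add: sum.inter_filter[symmetric])
    ultimately show ?thesis by (simp only: sum.distrib)
  qed
  also have "\<dots> \<le> (y + ?t * r)\<^sup>2 + ?t * (N * m)"
    using sum_mono[of T "\<lambda>i. real (card {j \<in> T. (i, j) \<in> near}) * m" "\<lambda>_. N * m"] near m0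
    by (simp add: sum.distrib y mult_right_mono)
  finally have Y2: "E (\<lambda>S. (?Y S)\<^sup>2) \<le> (y + ?t * r)\<^sup>2 + ?t * (N * m)" .
  have "E (\<lambda>S. (?Y S / y - 1)\<^sup>2) = E (\<lambda>S. (1 / y\<^sup>2) * (?Y S)\<^sup>2 - (2 / y) * ?Y S + 1)"
    using y0 by (intro E_cong) (simp add: power2_eq_square field_simps)
  also have "\<dots> = E (\<lambda>S. (?Y S)\<^sup>2) / y\<^sup>2 - 1"
    using y0 by (simp only: E_add E_diff E_cmult E_const y_def[symmetric]) (simp add: field_simps)
  also have "\<dots> \<le> ((y + ?t * r)\<^sup>2 + ?t * (N * m)) / y\<^sup>2 - 1"
    using Y2 by (intro diff_right_mono divide_right_mono) auto
  also have "\<dots> = 2 * (?t * r / y) + (?t * r / y)\<^sup>2 + ?t * (N * m) / y\<^sup>2"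
    using y0 by (simp add: power2_eq_square field_simps)
  also have "\<dots> \<le> 2 * (r / \<mu>) + (r / \<mu>)\<^sup>2 + N * m / (?t * \<mu>\<^sup>2)"
  proof -
    have a: "?t * r / y \<le> r / \<mu>"
    proof -
      have "?t * r / y \<le> ?t * r / (?t * \<mu>)"
        using ylow y0 t0 mu(2) r by (intro divide_left_mono mult_pos_pos) auto
      then show ?thesis using t0 by simp
    qed
    have a0: "0 \<le> ?t * r / y" using r y0 by simp
    have N0: "0 \<le> N" using near[OF i\<^sub>0] of_nat_0_le_iff order_trans by blast
    have "?t * (N * m) / y\<^sup>2 \<le> ?t * (N * m) / (?t * \<mu>)\<^sup>2"
      using ylow y0 t0 mu(2) m0 N0
      by (intro divide_left_mono power_mono mult_pos_pos zero_less_power) auto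
    also have "\<dots> = N * m / (?t * \<mu>\<^sup>2)" using t0 by (simp add: power2_eq_square field_simps)
    finally show ?thesis using a power_mono[OF a a0, of 2] by linarith
  qed
  finally show ?thesis by (simp add: y_def)
qed

end

section \<open>Sums over injections of a perturbed random function\<close>

lemma sum_PiE_insert:
  fixes g :: "('i \<Rightarrow> 'a) \<Rightarrow> real"
  assumes "u \<notin> U"
  shows "(\<Sum>\<psi>\<in>insert u U \<rightarrow>\<^sub>E V. g \<psi>) = (\<Sum>\<psi>\<in>U \<rightarrow>\<^sub>E V. \<Sum>v\<in>V. g (\<psi>(u := v)))"
proof -
  have "(\<Sum>\<psi>\<in>insert u U \<rightarrow>\<^sub>E V. g \<psi>) = (\<Sum>(v, \<psi>)\<in>V \<times> (U \<rightarrow>\<^sub>E V). g (\<psi>(u := v)))"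
    unfolding PiE_insert_eq using inj_combinator[OF assms, of "\<lambda>_. V"]
    by (subst sum.reindex) (auto simp: case_prod_unfold)
  also have "\<dots> = (\<Sum>v\<in>V. \<Sum>\<psi>\<in>U \<rightarrow>\<^sub>E V. g (\<psi>(u := v)))"
    by (simp add: sum.cartesian_product)
  also have "\<dots> = (\<Sum>\<psi>\<in>U \<rightarrow>\<^sub>E V. \<Sum>v\<in>V. g (\<psi>(u := v)))" by (rule sum.swap)
  finally show ?thesis .
qed

text \<open>A vertex whose removal leaves the remaining vertices covered costs a factor \<open>\<Delta>\<close>; if there is
  none, then \<open>J\<close> is a perfect matching, and an edge costs \<open>\<Delta>\<^sup>2\<close>.\<close>

lemma sum_prod_le_max_degree_power:
  fixes \<rho> :: "'a set \<Rightarrow> real" and J :: "'i set set"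
  assumes V: "finite V" and \<rho>: "\<And>e. 0 \<le> \<rho> e" "\<And>e. \<rho> e \<le> 1"
    and deg: "\<And>i. i \<in> V \<Longrightarrow> (\<Sum>w\<in>V. \<rho> {i, w}) \<le> \<Delta>"
    and tot: "(\<Sum>i\<in>V. \<Sum>w\<in>V. \<rho> {i, w}) \<le> \<Delta>\<^sup>2" and \<Delta>: "0 \<le> \<Delta>"
  shows "finite J \<Longrightarrow> (\<And>e. e \<in> J \<Longrightarrow> card e = 2) \<Longrightarrow>
    (\<Sum>\<psi>\<in>\<Union>J \<rightarrow>\<^sub>E V. \<Prod>e\<in>J. \<rho> (\<psi> ` e)) \<le> \<Delta> ^ card (\<Union>J)"
proof (induction "card (\<Union>J)" arbitrary: J rule: less_induct)
  case less
  let ?U = "\<Union>J"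
  have fe: "finite e" if "e \<in> J" for e using less.prems(2)[OF that] by (metis card.infinite zero_neq_numeral)
  have fU: "finite ?U" using less.prems(1) fe by auto
  have P0: "0 \<le> (\<Prod>e\<in>J'. \<rho> (\<psi> ` e))" for J' and \<psi> :: "'i \<Rightarrow> 'a" by (intro prod_nonneg) (use \<rho> in auto)
  \<comment> \<open>All factors other than those of \<open>e0\<close> and \<open>J'\<close> are at
    most 1 and are dropped.\<close>
  have drop: "(\<Prod>e\<in>J. \<rho> (\<psi> ` e)) \<le> \<rho> (\<psi> ` e0) * (\<Prod>e\<in>J'. \<rho> (\<psi> ` e))"
    if "e0 \<in> J" "J' \<subseteq> J" "e0 \<notin> J'" for e0 J' and \<psi> :: "'i \<Rightarrow> 'a"
  proof -
    have fJ': "finite J'" using that less.prems(1) finite_subset by auto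
    have sub: "insert e0 J' \<subseteq> J" using that by auto
    have "(\<Prod>e\<in>J. \<rho> (\<psi> ` e)) = (\<Prod>e\<in>J - insert e0 J'. \<rho> (\<psi> ` e)) * (\<Prod>e\<in>insert e0 J'. \<rho> (\<psi> ` e))"
      by (rule prod.subset_diff[OF sub less.prems(1)])
    also have "\<dots> \<le> 1 * (\<Prod>e\<in>insert e0 J'. \<rho> (\<psi> ` e))"
      using \<rho> by (intro mult_right_mono prod_le_1 prod_nonneg) auto
    finally show ?thesis using that fJ' by simp
  qed
  show ?case
  proof (cases "J = {}")
    case True
    then show ?thesis by simp
  next
    case False
    show ?thesis
    proof (cases "\<exists>u\<in>?U. \<Union>{e \<in> J. u \<notin> e} = ?U - {u}")
      case True
      then obtain u where u: "u \<in> ?U" "\<Union>{e \<in> J. u \<notin> e} = ?U - {u}" by auto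
      define J' where "J' = {e \<in> J. u \<notin> e}"
      have J': "\<Union>J' = ?U - {u}" "finite J'" "J' \<subseteq> J" using u less.prems(1) by (auto simp: J'_def)
      have UJ: "?U = insert u (\<Union>J')" "u \<notin> \<Union>J'" using u J' by auto
      obtain e0 where e0: "e0 \<in> J" "u \<in> e0" using u by auto
      then obtain t where t: "e0 = {u, t}" "t \<noteq> u" using less.prems(2)[OF e0(1)] by (auto simp: card_2_iff)
      have tU: "t \<in> \<Union>J'" using t e0 J' by auto
      have IH: "(\<Sum>\<psi>\<in>\<Union>J' \<rightarrow>\<^sub>E V. \<Prod>e\<in>J'. \<rho> (\<psi> ` e)) \<le> \<Delta> ^ card (\<Union>J')"
      proof (rule less.hyps)
        show "card (\<Union>J') < card ?U" unfolding J'(1) using fU u(1) by (rule card_Diff1_less)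
      qed (use J' less.prems in auto)
      have "(\<Sum>\<psi>\<in>?U \<rightarrow>\<^sub>E V. \<Prod>e\<in>J. \<rho> (\<psi> ` e))
          = (\<Sum>\<psi>\<in>\<Union>J' \<rightarrow>\<^sub>E V. \<Sum>v\<in>V. \<Prod>e\<in>J. \<rho> ((\<psi>(u := v)) ` e))"
        unfolding UJ(1) by (rule sum_PiE_insert[OF UJ(2)])
      also have "\<dots> \<le> (\<Sum>\<psi>\<in>\<Union>J' \<rightarrow>\<^sub>E V. \<Sum>v\<in>V. \<rho> {\<psi> t, v} * (\<Prod>e\<in>J'. \<rho> (\<psi> ` e)))"
      proof (intro sum_mono)
        fix \<psi> :: "'i \<Rightarrow> 'a" and v
        have "(\<psi>(u := v)) ` e0 = {\<psi> t, v}" using t by auto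
        moreover have "(\<psi>(u := v)) ` e = \<psi> ` e" if "e \<in> J'" for e
          using that by (intro image_cong) (auto simp: J'_def)
        moreover have "(\<Prod>e\<in>J. \<rho> ((\<psi>(u := v)) ` e))
            \<le> \<rho> ((\<psi>(u := v)) ` e0) * (\<Prod>e\<in>J'. \<rho> ((\<psi>(u := v)) ` e))"
          by (rule drop) (use e0 J' in \<open>auto simp: J'_def\<close>)
        ultimately show "(\<Prod>e\<in>J. \<rho> ((\<psi>(u := v)) ` e)) \<le> \<rho> {\<psi> t, v} * (\<Prod>e\<in>J'. \<rho> (\<psi> ` e))"
          by simp
      qed
      also have "\<dots> \<le> (\<Sum>\<psi>\<in>\<Union>J' \<rightarrow>\<^sub>E V. \<Delta> * (\<Prod>e\<in>J'. \<rho> (\<psi> ` e)))"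
        unfolding sum_distrib_right[symmetric] using tU by (intro sum_mono mult_right_mono deg P0) auto
      also have "\<dots> \<le> \<Delta> * \<Delta> ^ card (\<Union>J')"
        unfolding sum_distrib_left[symmetric] using IH \<Delta> by (intro mult_left_mono) auto
      also have "\<dots> = \<Delta> ^ card ?U"
        using UJ fU by (metis card_insert_disjoint finite_insert power_Suc)
      finally show ?thesis .
    next
      case noleaf: False
      \<comment> \<open>If removing \<open>u\<close> uncovers another vertex \<open>u'\<close>, then
        all edges at \<open>u'\<close> contain \<open>u\<close>, so \<open>{u, u'}\<close> is the
        only one.\<close>
      have pend: "\<exists>u'\<in>?U. u' \<noteq> u \<and> (\<forall>e\<in>J. u' \<in> e \<longrightarrow> e = {u, u'})" if u: "u \<in> ?U" for u
      proof -
        have "\<Union>{e \<in> J. u \<notin> e} \<noteq> ?U - {u}" using noleaf u by auto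
        then obtain u' where u': "u' \<in> ?U" "u' \<noteq> u" "u' \<notin> \<Union>{e \<in> J. u \<notin> e}" by auto
        have "e = {u, u'}" if "e \<in> J" "u' \<in> e" for e
        proof -
          have "u \<in> e" using u' that by auto
          then show ?thesis using less.prems(2)[OF that(1)] that u'(2) by (auto simp: card_2_iff)
        qed
        then show ?thesis using u' by auto
      qed
      obtain u where u: "u \<in> ?U" using False less.prems(2) by (metis Union_iff all_not_in_conv card.empty zero_neq_numeral)
      obtain u' where u': "u' \<in> ?U" "u' \<noteq> u" "\<And>e. e \<in> J \<Longrightarrow> u' \<in> e \<Longrightarrow> e = {u, u'}"
        using pend[OF u] by auto
      \<comment> \<open>Applied again at \<open>u'\<close>, whose only edge is
        \<open>{u, u'}\<close>, this leads back to \<open>u\<close>: the edge \<open>{u, u'}\<close>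
        is disjoint from all others.\<close>
      obtain u'' where u'': "u'' \<in> ?U" "u'' \<noteq> u'" "\<And>e. e \<in> J \<Longrightarrow> u'' \<in> e \<Longrightarrow> e = {u', u''}"
        using pend[OF u'(1)] by auto
      obtain e'' where "e'' \<in> J" "u'' \<in> e''" using u''(1) by auto
      then have "{u', u''} \<in> J" using u''(3) by auto
      then have "{u', u''} = {u, u'}" using u'(3) by auto
      then have "u'' = u" using u''(2) by (auto simp: doubleton_eq_iff)
      have com: "{u', u} = {u, u'}" by auto
      have uu: "{u, u'} \<in> J" "\<And>e. e \<in> J \<Longrightarrow> u \<in> e \<Longrightarrow> e = {u, u'}"
        using \<open>{u', u''} \<in> J\<close> u''(3) unfolding \<open>u'' = u\<close> com by blast+
      define J' where "J' = J - {{u, u'}}"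
      have J': "finite J'" "J' \<subseteq> J" "{u, u'} \<notin> J'" using less.prems(1) by (auto simp: J'_def)
      have notin: "u \<notin> e" "u' \<notin> e" if "e \<in> J'" for e using that uu(2) u'(3) by (auto simp: J'_def)
      have UJ: "?U = insert u (insert u' (\<Union>J'))" using uu(1) by (auto simp: J'_def)
      have un: "u \<notin> insert u' (\<Union>J')" "u' \<notin> \<Union>J'" using notin u'(2) by auto
      have fU': "finite (\<Union>J')" using fU UJ by auto
      have cU: "card ?U = Suc (Suc (card (\<Union>J')))" using UJ un fU' by simp
      have IH: "(\<Sum>\<psi>\<in>\<Union>J' \<rightarrow>\<^sub>E V. \<Prod>e\<in>J'. \<rho> (\<psi> ` e)) \<le> \<Delta> ^ card (\<Union>J')"
        using J' less.prems cU by (intro less.hyps) auto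
      have "(\<Sum>\<psi>\<in>?U \<rightarrow>\<^sub>E V. \<Prod>e\<in>J. \<rho> (\<psi> ` e))
          = (\<Sum>\<psi>\<in>\<Union>J' \<rightarrow>\<^sub>E V. \<Sum>v'\<in>V. \<Sum>v\<in>V. \<Prod>e\<in>J. \<rho> ((\<psi>(u' := v', u := v)) ` e))"
        unfolding UJ by (simp only: sum_PiE_insert[OF un(1)] sum_PiE_insert[OF un(2)])
      also have "\<dots> \<le> (\<Sum>\<psi>\<in>\<Union>J' \<rightarrow>\<^sub>E V. \<Sum>v'\<in>V. \<Sum>v\<in>V. \<rho> {v', v} * (\<Prod>e\<in>J'. \<rho> (\<psi> ` e)))"
      proof (intro sum_mono)
        fix \<psi> :: "'i \<Rightarrow> 'a" and v' v
        have "(\<psi>(u' := v', u := v)) ` {u, u'} = {v', v}" using u'(2) by auto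
        moreover have "(\<psi>(u' := v', u := v)) ` e = \<psi> ` e" if "e \<in> J'" for e
          using notin[OF that] by (intro image_cong) auto
        moreover have "(\<Prod>e\<in>J. \<rho> ((\<psi>(u' := v', u := v)) ` e))
            \<le> \<rho> ((\<psi>(u' := v', u := v)) ` {u, u'}) * (\<Prod>e\<in>J'. \<rho> ((\<psi>(u' := v', u := v)) ` e))"
          by (rule drop[OF uu(1) J'(2,3)])
        ultimately show "(\<Prod>e\<in>J. \<rho> ((\<psi>(u' := v', u := v)) ` e)) \<le> \<rho> {v', v} * (\<Prod>e\<in>J'. \<rho> (\<psi> ` e))"
          by simp
      qed
      also have "\<dots> = (\<Sum>i\<in>V. \<Sum>w\<in>V. \<rho> {i, w}) * (\<Sum>\<psi>\<in>\<Union>J' \<rightarrow>\<^sub>E V. \<Prod>e\<in>J'. \<rho> (\<psi> ` e))"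
        by (simp only: sum_distrib_right[symmetric] sum_distrib_left[symmetric])
      also have "\<dots> \<le> \<Delta>\<^sup>2 * \<Delta> ^ card (\<Union>J')"
        using IH tot \<rho> by (intro mult_mono sum_nonneg prod_nonneg) auto
      also have "\<dots> = \<Delta> ^ card ?U" unfolding cU by (simp add: power2_eq_square)
      finally show ?thesis .
    qed
  qed
qed

text \<open>\<open>J\<close> holds the edges at which the perturbation is taken. Its vertices are
  placed first, and the other vertices are summed inside the absolute value, where the random signs
  can still cancel. Only the bound \<open>\<rho>\<close> of the perturbation occurs, so the estimate
  is uniform over all perturbations below it, even those that depend on \<open>b\<close>.\<close>

definition envelope_sum :: "'a set \<Rightarrow> ('a set \<Rightarrow> real) \<Rightarrow> ('a set \<Rightarrow> real) \<Rightarrow> 'i set set \<Rightarrow> 'i set set \<Rightarrow> real" where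
  "envelope_sum V \<rho> b H J = (\<Sum>\<psi>\<in>injections (\<Union>J) V. (\<Prod>e\<in>J. \<rho> (\<psi> ` e)) *
     \<bar>\<Sum>\<phi>\<in>{\<phi> \<in> injections (\<Union>H) V. restrict \<phi> (\<Union>J) = \<psi>}. \<Prod>e\<in>H - J. b (\<phi> ` e)\<bar>)"

lemma restrict_injections: "\<phi> \<in> injections U V \<Longrightarrow> W \<subseteq> U \<Longrightarrow> restrict \<phi> W \<in> injections W V"
  by (auto simp: injections_def inj_on_def)

text \<open>Expand every factor \<open>b e + r e\<close> and let \<open>J\<close> be the edges that
  take \<open>r\<close>. Their product depends only on the restriction to \<open>\<Union>J\<close>,
  so it can be estimated by \<open>\<rho>\<close> outside the inner sum.\<close>

lemma abs_inj_sum_le_envelope_sum: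
  assumes V: "finite V" and H: "finite H" "\<And>e. e \<in> H \<Longrightarrow> finite e" and r: "\<And>e. \<bar>r e\<bar> \<le> \<rho> e"
  shows "\<bar>inj_sum V (\<lambda>e. b e + r e) (\<Union>H) H\<bar> \<le> (\<Sum>J\<in>Pow H. envelope_sum V \<rho> b H J)"
proof -
  let ?U = "\<Union>H"
  have fU: "finite ?U" using H by auto
  have fI: "finite (injections W V)" if "W \<subseteq> ?U" for W
    using that fU V finite_subset by (intro finite_injections) auto
  have "inj_sum V (\<lambda>e. b e + r e) ?U H
      = (\<Sum>\<phi>\<in>injections ?U V. \<Sum>J\<in>Pow H. (\<Prod>e\<in>J. r (\<phi> ` e)) * (\<Prod>e\<in>H - J. b (\<phi> ` e)))"
    unfolding inj_sum_def using H(1) by (simp add: prod_add[symmetric] add.commute)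
  also have "\<dots> = (\<Sum>J\<in>Pow H. \<Sum>\<phi>\<in>injections ?U V. (\<Prod>e\<in>J. r (\<phi> ` e)) * (\<Prod>e\<in>H - J. b (\<phi> ` e)))"
    by (rule sum.swap)
  finally have "\<bar>inj_sum V (\<lambda>e. b e + r e) ?U H\<bar>
      \<le> (\<Sum>J\<in>Pow H. \<bar>\<Sum>\<phi>\<in>injections ?U V. (\<Prod>e\<in>J. r (\<phi> ` e)) * (\<Prod>e\<in>H - J. b (\<phi> ` e))\<bar>)"
    by (simp add: sum_abs)
  also have "\<dots> \<le> (\<Sum>J\<in>Pow H. envelope_sum V \<rho> b H J)"
  proof (rule sum_mono)
    fix J assume "J \<in> Pow H"
    then have sub: "\<Union>J \<subseteq> ?U" by auto
    have "(\<Sum>\<phi>\<in>injections ?U V. (\<Prod>e\<in>J. r (\<phi> ` e)) * (\<Prod>e\<in>H - J. b (\<phi> ` e)))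
        = (\<Sum>\<psi>\<in>injections (\<Union>J) V. \<Sum>\<phi>\<in>{\<phi> \<in> injections ?U V. restrict \<phi> (\<Union>J) = \<psi>}.
            (\<Prod>e\<in>J. r (\<phi> ` e)) * (\<Prod>e\<in>H - J. b (\<phi> ` e)))"
      by (rule sum.group[symmetric]) (use fI sub restrict_injections in auto)
    also have "\<dots> = (\<Sum>\<psi>\<in>injections (\<Union>J) V. (\<Prod>e\<in>J. r (\<psi> ` e)) *
        (\<Sum>\<phi>\<in>{\<phi> \<in> injections ?U V. restrict \<phi> (\<Union>J) = \<psi>}. \<Prod>e\<in>H - J. b (\<phi> ` e)))"
      unfolding sum_distrib_left
    proof (intro sum.cong refl arg_cong2[where f = "(*)"] prod.cong arg_cong[where f = r])
      fix \<psi> \<phi> e assume "\<phi> \<in> {\<phi> \<in> injections ?U V. restrict \<phi> (\<Union>J) = \<psi>}" "e \<in> J"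
      then show "\<phi> ` e = \<psi> ` e" by (intro image_cong) auto
    qed
    finally have "\<bar>\<Sum>\<phi>\<in>injections ?U V. (\<Prod>e\<in>J. r (\<phi> ` e)) * (\<Prod>e\<in>H - J. b (\<phi> ` e))\<bar>
        \<le> (\<Sum>\<psi>\<in>injections (\<Union>J) V. \<bar>(\<Prod>e\<in>J. r (\<psi> ` e)) *
        (\<Sum>\<phi>\<in>{\<phi> \<in> injections ?U V. restrict \<phi> (\<Union>J) = \<psi>}. \<Prod>e\<in>H - J. b (\<phi> ` e))\<bar>)"
      by (simp add: sum_abs)
    also have "\<dots> \<le> envelope_sum V \<rho> b H J"
      unfolding envelope_sum_def abs_mult abs_prod
      by (intro sum_mono mult_right_mono prod_mono) (use r in auto)
    finally show "\<bar>\<Sum>\<phi>\<in>injections ?U V. (\<Prod>e\<in>J. r (\<phi> ` e)) * (\<Prod>e\<in>H - J. b (\<phi> ` e))\<bar>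
        \<le> envelope_sum V \<rho> b H J" .
  qed
  finally show ?thesis .
qed

section \<open>Mean of the envelope\<close>

locale bernoulli_graph = bernoulli_set P \<pi> for P :: "'a set set" and \<pi>
begin

text \<open>For a fixed placement of \<open>\<Union>J\<close> the inner sum has at most n^(h - w)
  monomials, where w is the size of \<open>\<Union>J\<close>, and they are orthogonal up to
  coincidences; its second moment gives the root. The outer sum costs \<open>\<Delta>\<close> for
  each vertex by \<open>sum_prod_le_max_degree_power\<close>.\<close>

lemma E_envelope_sum_le:
  fixes H J :: "'i set set"
  assumes V: "finite V" and \<rho>: "\<And>e. 0 \<le> \<rho> e" "\<And>e. \<rho> e \<le> 1"
    and deg: "\<And>i. i \<in> V \<Longrightarrow> (\<Sum>w\<in>V. \<rho> {i, w}) \<le> \<Delta>"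
    and tot: "(\<Sum>i\<in>V. \<Sum>w\<in>V. \<rho> {i, w}) \<le> \<Delta>\<^sup>2" and \<Delta>: "0 \<le> \<Delta>"
    and H: "finite H" "\<And>e. e \<in> H \<Longrightarrow> card e = 2" and J: "J \<subseteq> H"
  defines "h \<equiv> card (\<Union>H)"
  shows "E (\<lambda>S. envelope_sum V \<rho> (\<lambda>e. bit e S) H J)
    \<le> \<Delta> ^ card (\<Union>J) * sqrt (real h ^ h * var ^ card (H - J) * real (card V) ^ (h - card (\<Union>J)))"
proof -
  let ?U = "\<Union>H" and ?W = "\<Union>J" and ?n = "real (card V)"
  define c where "c = sqrt (real h ^ h * var ^ card (H - J) * ?n ^ (h - card ?W))"
  have fe: "finite e" if "e \<in> H" for e using H(2)[OF that] by (metis card.infinite zero_neq_numeral)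
  have fU: "finite ?U" using H fe by auto
  have sub: "?W \<subseteq> ?U" using J by auto
  have fW: "finite ?W" using sub fU finite_subset by auto
  have fJ: "finite J" using J H finite_subset by auto
  have cov: "?U - ?W \<subseteq> \<Union>(H - J)" using J by auto
  have c0: "0 \<le> c" unfolding c_def using var_nonneg by simp
  have inner: "E (\<lambda>S. \<bar>\<Sum>\<phi>\<in>{\<phi> \<in> injections ?U V. restrict \<phi> ?W = \<psi>}. \<Prod>e\<in>H - J. bit (\<phi> ` e) S\<bar>) \<le> c"
    (is "E (\<lambda>S. \<bar>?X S\<bar>) \<le> c") if \<psi>: "\<psi> \<in> injections ?W V" for \<psi>
  proof (rule E_abs_le[OF _ c0])
    define \<Phi> where "\<Phi> = {\<phi> \<in> injections ?U V. restrict \<phi> ?W = \<psi>}"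
    define T where "T = (\<lambda>\<phi> :: 'i \<Rightarrow> 'a. image \<phi> ` (H - J))"
    have f\<Phi>: "finite \<Phi>" unfolding \<Phi>_def using finite_injections[OF fU V] by auto
    have inj: "inj_on (image \<phi>) (H - J)" if "\<phi> \<in> \<Phi>" for \<phi>
    proof -
      have "inj_on \<phi> ?U" using that by (simp add: \<Phi>_def injections_def)
      moreover have "H - J \<subseteq> Pow ?U" by auto
      ultimately show ?thesis using inj_on_image_Pow inj_on_subset by blast
    qed
    have cT: "finite (T \<phi>) \<and> card (T \<phi>) = card (H - J)" if "\<phi> \<in> \<Phi>" for \<phi>
      unfolding T_def using inj[OF that] H by (auto simp: card_image)
    \<comment> \<open>Every vertex outside \<open>\<Union>J\<close> lies in an edge of
      \<open>H - J\<close>. Equal images of these edges and equal restrictions to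
      \<open>\<Union>J\<close> thus leave at most h values for each vertex.\<close>
    have M: "real (card {\<phi>' \<in> \<Phi>. T \<phi>' = T \<phi>}) \<le> real h ^ h" if \<phi>: "\<phi> \<in> \<Phi>" for \<phi>
    proof -
      have "{\<phi>' \<in> \<Phi>. T \<phi>' = T \<phi>} \<subseteq> ?U \<rightarrow>\<^sub>E \<phi> ` ?U"
      proof
        fix \<phi>' assume \<phi>': "\<phi>' \<in> {\<phi>' \<in> \<Phi>. T \<phi>' = T \<phi>}"
        have "\<phi>' x \<in> \<phi> ` ?U" if x: "x \<in> ?U" for x
        proof (cases "x \<in> ?W")
          case True
          have "restrict \<phi>' ?W x = restrict \<phi> ?W x" using \<phi> \<phi>' by (simp add: \<Phi>_def)
          then have "\<phi>' x = \<phi> x" using True by (simp add: restrict_def del: Union_iff)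
          then show ?thesis using x by (metis imageI)
        next
          case False
          then obtain e where e: "e \<in> H - J" "x \<in> e" using cov x by blast
          then have "\<phi>' ` e \<in> T \<phi>'" by (simp add: T_def)
          then have "\<phi>' ` e \<in> T \<phi>" using \<phi>' by simp
          then obtain e' where "e' \<in> H - J" "\<phi>' ` e = \<phi> ` e'" by (auto simp: T_def)
          then have "\<phi>' x \<in> \<phi> ` e'" "e' \<subseteq> ?U" using e(2) by auto
          then show ?thesis by blast
        qed
        moreover have "\<phi>' \<in> extensional ?U" using \<phi>' by (auto simp: \<Phi>_def injections_def PiE_def)
        ultimately show "\<phi>' \<in> ?U \<rightarrow>\<^sub>E \<phi> ` ?U" by (simp add: PiE_def Pi_def)
      qed
      then have "card {\<phi>' \<in> \<Phi>. T \<phi>' = T \<phi>} \<le> card (?U \<rightarrow>\<^sub>E \<phi> ` ?U)"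
        using fU by (intro card_mono finite_PiE) auto
      also have "\<dots> = card (\<phi> ` ?U) ^ h" using fU by (simp add: card_funcsetE h_def)
      also have "\<dots> \<le> h ^ h" unfolding h_def using fU by (intro power_mono card_image_le) auto
      finally show ?thesis by (metis of_nat_le_iff of_nat_power)
    qed
    have "card \<Phi> \<le> card ((?U - ?W) \<rightarrow>\<^sub>E V)"
    proof (rule card_inj_on_le[where f = "\<lambda>\<phi>. restrict \<phi> (?U - ?W)"])
      show "inj_on (\<lambda>\<phi>. restrict \<phi> (?U - ?W)) \<Phi>"
      proof (rule inj_onI)
        fix \<phi> \<phi>' assume a: "\<phi> \<in> \<Phi>" "\<phi>' \<in> \<Phi>" "restrict \<phi> (?U - ?W) = restrict \<phi>' (?U - ?W)"
        have w: "restrict \<phi> ?W = restrict \<phi>' ?W" using a by (simp add: \<Phi>_def)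
        have ex: "\<phi> \<in> extensional ?U" "\<phi>' \<in> extensional ?U"
          using a by (auto simp: \<Phi>_def injections_def PiE_def)
        show "\<phi> = \<phi>'"
        proof
          fix x
          consider "x \<in> ?W" | "x \<in> ?U - ?W" | "x \<notin> ?U" by blast
          then show "\<phi> x = \<phi>' x"
          proof cases
            case 1 then show ?thesis using fun_cong[OF w, of x] by (simp del: Union_iff)
          next
            case 2 then show ?thesis using fun_cong[OF a(3), of x] by (simp del: Union_iff)
          next
            case 3 then show ?thesis using ex by (simp add: extensional_def del: Union_iff)
          qed
        qed
      qed
      show "(\<lambda>\<phi>. restrict \<phi> (?U - ?W)) ` \<Phi> \<subseteq> (?U - ?W) \<rightarrow>\<^sub>E V"
      proof (rule image_subsetI)
        fix \<phi> assume "\<phi> \<in> \<Phi>"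
        then have "\<phi> \<in> ?U \<rightarrow>\<^sub>E V" by (simp add: \<Phi>_def injections_def)
        then show "restrict \<phi> (?U - ?W) \<in> (?U - ?W) \<rightarrow>\<^sub>E V"
          unfolding restrict_PiE_iff using PiE_mem by fast
      qed
      show "finite ((?U - ?W) \<rightarrow>\<^sub>E V)" using fU V by (intro finite_PiE) auto
    qed
    also have "card ((?U - ?W) \<rightarrow>\<^sub>E V) = card V ^ (h - card ?W)"
      using fU fW sub by (simp add: card_funcsetE card_Diff_subset h_def del: Union_iff)
    finally have c\<Phi>: "real (card \<Phi>) \<le> ?n ^ (h - card ?W)" by (metis of_nat_le_iff of_nat_power)
    have "E (\<lambda>S. (?X S)\<^sup>2) = E (\<lambda>S. (\<Sum>\<phi>\<in>\<Phi>. 1 * (\<Prod>e\<in>T \<phi>. bit e S))\<^sup>2)"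
    proof (rule E_cong)
      fix S
      have "(\<Sum>\<phi>\<in>\<Phi>. \<Prod>e\<in>H - J. bit (\<phi> ` e) S) = (\<Sum>\<phi>\<in>\<Phi>. 1 * (\<Prod>e\<in>T \<phi>. bit e S))"
      proof (rule sum.cong[OF refl])
        fix \<phi> assume "\<phi> \<in> \<Phi>"
        then show "(\<Prod>e\<in>H - J. bit (\<phi> ` e) S) = 1 * (\<Prod>e\<in>T \<phi>. bit e S)"
          unfolding T_def by (simp add: prod.reindex[OF inj])
      qed
      then show "(?X S)\<^sup>2 = (\<Sum>\<phi>\<in>\<Phi>. 1 * (\<Prod>e\<in>T \<phi>. bit e S))\<^sup>2" by (simp add: \<Phi>_def)
    qed
    also have "\<dots> \<le> real h ^ h * var ^ card (H - J) * (\<Sum>\<phi>\<in>\<Phi>. 1\<^sup>2)"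
      by (rule second_moment_le[OF f\<Phi> cT M])
    also have "\<dots> \<le> real h ^ h * var ^ card (H - J) * ?n ^ (h - card ?W)"
      using c\<Phi> var_nonneg by (intro mult_left_mono) auto
    also have "\<dots> = c\<^sup>2" unfolding c_def using var_nonneg by simp
    finally show "E (\<lambda>S. (?X S)\<^sup>2) \<le> c\<^sup>2" .
  qed
  have "E (\<lambda>S. envelope_sum V \<rho> (\<lambda>e. bit e S) H J) \<le> (\<Sum>\<psi>\<in>injections ?W V. (\<Prod>e\<in>J. \<rho> (\<psi> ` e)) * c)"
    unfolding envelope_sum_def E_sum E_cmult
    using inner \<rho> by (intro sum_mono mult_left_mono prod_nonneg) auto
  also have "\<dots> \<le> (\<Sum>\<psi>\<in>?W \<rightarrow>\<^sub>E V. (\<Prod>e\<in>J. \<rho> (\<psi> ` e)) * c)"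
    using \<rho> c0 fW V by (intro sum_mono2 mult_nonneg_nonneg prod_nonneg finite_PiE)
      (auto simp: injections_def)
  also have "\<dots> = (\<Sum>\<psi>\<in>?W \<rightarrow>\<^sub>E V. \<Prod>e\<in>J. \<rho> (\<psi> ` e)) * c" by (simp add: sum_distrib_right)
  also have "\<dots> \<le> \<Delta> ^ card ?W * c"
    using J H by (intro mult_right_mono c0 sum_prod_le_max_degree_power[OF V \<rho> deg tot \<Delta>] fJ) auto
  finally show ?thesis by (simp add: c_def)
qed

text \<open>Up to constants every vertex of \<open>H\<close> costs a factor sqrt n * y: a vertex of
  \<open>\<Union>J\<close> by the degree bound, any other because each edge of \<open>H - J\<close>
  covers at most two of them and contributes a standard deviation of order \<open>y ^ 2\<close>.
  With at least four vertices, n^(h/2) is at most n^(h - 2) and \<open>y ^ h\<close> at most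
  \<open>y ^ 4\<close>.\<close>

lemma E_envelope_sum_le_scaled:
  assumes V: "finite V" "card V \<ge> 1" and \<rho>: "\<And>e. 0 \<le> \<rho> e" "\<And>e. \<rho> e \<le> 1"
    and y: "0 < y" "y \<le> 1" and L: "1 \<le> L" and v: "var \<le> 2 * y ^ 4"
    and deg: "\<And>i. i \<in> V \<Longrightarrow> (\<Sum>w\<in>V. \<rho> {i, w}) \<le> L * sqrt (real (card V)) * y"
    and tot: "(\<Sum>i\<in>V. \<Sum>w\<in>V. \<rho> {i, w}) \<le> (L * sqrt (real (card V)) * y)\<^sup>2"
    and H: "finite H" "\<And>e. e \<in> H \<Longrightarrow> card e = 2" "card (\<Union>H) \<ge> 4" and J: "J \<subseteq> H"
  shows "E (\<lambda>S. envelope_sum V \<rho> (\<lambda>e. bit e S) H J)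
    \<le> L ^ card (\<Union>H) * sqrt (real (card (\<Union>H)) ^ card (\<Union>H) * 2 ^ card H)
        * (y ^ 4 * real (card V) ^ (card (\<Union>H) - 2))"
proof -
  define s where "s = sqrt (real (card V))"
  define h where "h = card (\<Union>H)"
  define w where "w = card (\<Union>J)"
  define m where "m = card (H - J)"
  have s1: "1 \<le> s" using V(2) by (simp add: s_def)
  have s2: "s\<^sup>2 = real (card V)" by (simp add: s_def)
  have fe: "finite e" if "e \<in> H" for e using H(2)[OF that] by (metis card.infinite zero_neq_numeral)
  have fU: "finite (\<Union>H)" using H fe by auto
  have wh: "w \<le> h" unfolding w_def h_def using J fU by (intro card_mono) auto
  have hm: "h - w \<le> 2 * m"
  proof -
    have "h - w = card (\<Union>H - \<Union>J)"
    proof -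
      have "\<Union>J \<subseteq> \<Union>H" using J by auto
      moreover from this have "finite (\<Union>J)" using fU by (rule finite_subset)
      ultimately show ?thesis by (simp add: h_def w_def card_Diff_subset)
    qed
    also have "\<dots> \<le> card (\<Union>(H - J))" using H fe by (intro card_mono) auto
    also have "\<dots> \<le> (\<Sum>e\<in>H - J. card e)" using H by (intro card_Union_le_sum_card)
    also have "\<dots> = 2 * m" using H by (simp add: m_def)
    finally show ?thesis .
  qed
  have mH: "m \<le> card H" unfolding m_def using H by (intro card_mono) auto
  have "var ^ m \<le> (2 * y ^ 4) ^ m" using v var_nonneg by (intro power_mono) auto
  also have "\<dots> = 2 ^ m * y ^ (4 * m)" by (simp add: power_mult_distrib power_mult)
  also have "\<dots> \<le> 2 ^ card H * y ^ (2 * (h - w))"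
  proof (rule mult_mono)
    show "(2::real) ^ m \<le> 2 ^ card H" using mH by (intro power_increasing) auto
    show "y ^ (4 * m) \<le> y ^ (2 * (h - w))" using y hm by (intro power_decreasing) auto
  qed (use y in auto)
  finally have vm: "var ^ m \<le> 2 ^ card H * y ^ (2 * (h - w))" .
  have "real h ^ h * var ^ m * real (card V) ^ (h - w)
      \<le> real h ^ h * (2 ^ card H * y ^ (2 * (h - w))) * real (card V) ^ (h - w)"
    using vm by (intro mult_right_mono mult_left_mono) auto
  also have "\<dots> = (real h ^ h * 2 ^ card H) * ((y * s) ^ (h - w))\<^sup>2"
    unfolding s2[symmetric] by (simp add: power_mult_distrib power_mult[symmetric] mult.commute)
  finally have "sqrt (real h ^ h * var ^ m * real (card V) ^ (h - w))
      \<le> sqrt ((real h ^ h * 2 ^ card H) * ((y * s) ^ (h - w))\<^sup>2)" by (rule real_sqrt_le_mono)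
  also have "\<dots> = sqrt (real h ^ h * 2 ^ card H) * (y * s) ^ (h - w)"
    using y s1 by (simp add: real_sqrt_mult)
  finally have sq: "sqrt (real h ^ h * var ^ m * real (card V) ^ (h - w))
      \<le> sqrt (real h ^ h * 2 ^ card H) * (y * s) ^ (h - w)" .
  let ?B = "sqrt (real h ^ h * 2 ^ card H)"
  have "E (\<lambda>S. envelope_sum V \<rho> (\<lambda>e. bit e S) H J)
      \<le> (L * s * y) ^ w * sqrt (real h ^ h * var ^ m * real (card V) ^ (h - w))"
    unfolding w_def h_def m_def s_def
    using L y by (intro E_envelope_sum_le[OF V(1) \<rho> deg tot _ H(1,2) J]) auto
  also have "\<dots> \<le> (L * s * y) ^ w * (?B * (y * s) ^ (h - w))"
    using sq L s1 y by (intro mult_left_mono) auto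
  also have "\<dots> = L ^ w * ?B * (y * s) ^ h"
  proof -
    have "(y * s) ^ h = (y * s) ^ w * (y * s) ^ (h - w)" using wh by (simp add: power_add[symmetric])
    then show ?thesis by (simp add: power_mult_distrib mult_ac)
  qed
  also have "\<dots> \<le> L ^ h * ?B * (y ^ 4 * real (card V) ^ (h - 2))"
  proof -
    have "(y * s) ^ h = y ^ h * s ^ h" by (simp add: power_mult_distrib)
    also have "\<dots> \<le> y ^ 4 * s ^ (2 * (h - 2))"
    proof (rule mult_mono)
      show "y ^ h \<le> y ^ 4" using y H(3) by (intro power_decreasing) (auto simp: h_def)
      show "s ^ h \<le> s ^ (2 * (h - 2))" using s1 H(3) by (intro power_increasing) (auto simp: h_def)
    qed (use y s1 in auto)
    also have "\<dots> = y ^ 4 * real (card V) ^ (h - 2)" by (simp add: power_mult s2)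
    finally have ys: "(y * s) ^ h \<le> y ^ 4 * real (card V) ^ (h - 2)" .
    have "L ^ w \<le> L ^ h" using L wh by (intro power_increasing) auto
    then show ?thesis using ys L y s1 by (intro mult_mono mult_nonneg_nonneg) auto
  qed
  finally show ?thesis by (simp add: h_def)
qed

end

section \<open>Reserved blocks of vertex pairs\<close>

text \<open>The trilinear form that gives \<open>inj_sum\<close> of a triangle on equal arguments,
  by \<open>inj_sum_K3\<close>; separate arguments allow a perturbed function to be
  expanded.\<close>

definition tri :: "'a set \<Rightarrow> ('a set \<Rightarrow> real) \<Rightarrow> ('a set \<Rightarrow> real) \<Rightarrow> ('a set \<Rightarrow> real) \<Rightarrow> real" where
  "tri V f g h = (\<Sum>i\<in>V. \<Sum>j\<in>V. \<Sum>k\<in>V. f {i, j} * g {j, k} * h {i, k})"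

lemma tri_swap12: "tri V f g h = tri V g f h"
proof -
  have "tri V f g h = (\<Sum>k\<in>V. \<Sum>j\<in>V. \<Sum>i\<in>V. f {i, j} * g {j, k} * h {i, k})"
    unfolding tri_def by (subst sum.swap, subst (2) sum.swap, subst sum.swap) simp
  then show ?thesis unfolding tri_def by (simp add: insert_commute mult_ac)
qed

lemma tri_swap13: "tri V f g h = tri V h g f"
proof -
  have "tri V f g h = (\<Sum>i\<in>V. \<Sum>k\<in>V. \<Sum>j\<in>V. f {i, j} * g {j, k} * h {i, k})"
    unfolding tri_def by (intro sum.cong refl sum.swap)
  then show ?thesis unfolding tri_def by (simp add: insert_commute mult_ac)
qed

lemma tri_add1: "tri V (\<lambda>e. f e + f' e) g h = tri V f g h + tri V f' g h"
  unfolding tri_def by (simp add: distrib_right sum.distrib)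

lemma tri_add2: "tri V f (\<lambda>e. g e + g' e) h = tri V f g h + tri V f g' h"
  unfolding tri_def by (simp add: distrib_right distrib_left sum.distrib)

lemma tri_add3: "tri V f g (\<lambda>e. h e + h' e) = tri V f g h + tri V f g h'"
  unfolding tri_def by (simp add: distrib_left sum.distrib)

lemma abs_tri_le:
  assumes f: "\<And>e. \<bar>f e\<bar> \<le> \<rho> e" and g: "\<And>e. \<bar>g e\<bar> \<le> \<rho> e" and h: "\<And>e. \<bar>h e\<bar> \<le> 1"
  shows "\<bar>tri V f g h\<bar> \<le> (\<Sum>j\<in>V. (wdeg V \<rho> j)\<^sup>2)"
proof -
  have \<rho>: "0 \<le> \<rho> e" for e using f[of e] by linarith
  have "\<bar>tri V f g h\<bar> \<le> (\<Sum>i\<in>V. \<Sum>j\<in>V. \<Sum>k\<in>V. \<bar>f {i, j} * g {j, k} * h {i, k}\<bar>)"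
    unfolding tri_def by (intro order_trans[OF sum_abs] sum_mono order_refl)
  also have "\<dots> \<le> (\<Sum>i\<in>V. \<Sum>j\<in>V. \<Sum>k\<in>V. \<rho> {i, j} * \<rho> {j, k})"
  proof (intro sum_mono)
    fix i j k
    have "\<bar>f {i, j}\<bar> * \<bar>g {j, k}\<bar> * \<bar>h {i, k}\<bar> \<le> \<rho> {i, j} * \<rho> {j, k} * 1"
      by (intro mult_mono f g h mult_nonneg_nonneg \<rho>) auto
    then show "\<bar>f {i, j} * g {j, k} * h {i, k}\<bar> \<le> \<rho> {i, j} * \<rho> {j, k}" by (simp add: abs_mult)
  qed
  also have "\<dots> = (\<Sum>j\<in>V. (wdeg V \<rho> j)\<^sup>2)"
    by (subst sum.swap) (simp add: wdeg_def power2_eq_square sum_product insert_commute)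
  finally show ?thesis .
qed

text \<open>Of the eight terms, the three that are linear in \<open>r\<close> coincide and are kept.
  In each of the four of higher order two factors \<open>r\<close> share a vertex, so
  \<open>abs_tri_le\<close> bounds it by squared degrees.\<close>

lemma tri_perturb:
  assumes r: "\<And>e. \<bar>r e\<bar> \<le> \<rho> e" "\<And>e. \<bar>r e\<bar> \<le> 1" and b: "\<And>e. \<bar>b e\<bar> \<le> 1"
  shows "\<bar>tri V (\<lambda>e. b e + r e) (\<lambda>e. b e + r e) (\<lambda>e. b e + r e) - tri V b b b - 3 * tri V r b b\<bar>
     \<le> 4 * (\<Sum>j\<in>V. (wdeg V \<rho> j)\<^sup>2)"
proof -
  have p: "tri V b r b = tri V r b b" "tri V b b r = tri V r b b" "tri V r b r = tri V r r b"
    "tri V b r r = tri V r r b"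
    using tri_swap12[of V b r b] tri_swap13[of V b b r] tri_swap13[of V b r r]
      tri_swap12[of V b r r] by auto
  have "tri V (\<lambda>e. b e + r e) (\<lambda>e. b e + r e) (\<lambda>e. b e + r e) - tri V b b b - 3 * tri V r b b
      = 3 * tri V r r b + tri V r r r"
    unfolding tri_add1 tri_add2 tri_add3 p by simp
  moreover have "\<bar>tri V r r b\<bar> \<le> (\<Sum>j\<in>V. (wdeg V \<rho> j)\<^sup>2)" "\<bar>tri V r r r\<bar> \<le> (\<Sum>j\<in>V. (wdeg V \<rho> j)\<^sup>2)"
    by (intro abs_tri_le r b)+
  ultimately show ?thesis by linarith
qed

lemma sum_pairs_eq:
  assumes "finite V" "\<And>i. f {i} = (0::real)"
  shows "(\<Sum>i\<in>V. \<Sum>j\<in>V. f {i, j}) = 2 * (\<Sum>e\<in>[V]\<^bsup>2\<^esup>. f e)"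
proof -
  have "(\<Sum>i\<in>V. \<Sum>j\<in>V. f {i, j}) = (\<Sum>i\<in>V. \<Sum>j\<in>V - {i}. f {i, j})"
    using assms by (intro sum.cong refl sum.mono_neutral_right) auto
  then show ?thesis using sum_nsets2[OF assms(1), of f] by simp
qed

text \<open>A pair counts for the degrees of both its ends. In this form the share of each reserved
  pair in the cross term of the squared degrees can be read off.\<close>

lemma sum_wdeg_mult_wdeg:
  assumes V: "finite V" and r: "\<And>i. r {i} = 0"
  shows "(\<Sum>i\<in>V. wdeg V r i * wdeg V b i) = (\<Sum>e\<in>[V]\<^bsup>2\<^esup>. r e * (\<Sum>i\<in>e. wdeg V b i))"
proof -
  let ?\<beta> = "wdeg V b"
  have 1: "(\<Sum>i\<in>V. wdeg V r i * ?\<beta> i) = (\<Sum>i\<in>V. \<Sum>w\<in>V. r {i, w} * ?\<beta> i)"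
    by (simp add: wdeg_def[of V r] sum_distrib_right)
  have 2: "\<dots> = (\<Sum>i\<in>V. \<Sum>w\<in>V. r {i, w} * ?\<beta> w)"
    by (subst sum.swap) (simp add: insert_commute)
  have "2 * (\<Sum>i\<in>V. wdeg V r i * ?\<beta> i) = (\<Sum>i\<in>V. \<Sum>w\<in>V. r {i, w} * ?\<beta> i + r {i, w} * ?\<beta> w)"
    unfolding sum.distrib using 1 2 by simp
  also have "\<dots> = (\<Sum>i\<in>V. \<Sum>w\<in>V. r {i, w} * (\<Sum>j\<in>{i, w}. ?\<beta> j))"
  proof (intro sum.cong refl)
    fix i w show "r {i, w} * ?\<beta> i + r {i, w} * ?\<beta> w = r {i, w} * (\<Sum>j\<in>{i, w}. ?\<beta> j)"
      using r[of i] by (cases "i = w") (auto simp: distrib_left)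
  qed
  also have "\<dots> = 2 * (\<Sum>e\<in>[V]\<^bsup>2\<^esup>. r e * (\<Sum>i\<in>e. ?\<beta> i))"
    using sum_pairs_eq[OF V, of "\<lambda>e. r e * (\<Sum>i\<in>e. ?\<beta> i)"] r by simp
  finally show ?thesis by simp
qed

text \<open>The product over \<open>i \<in> e\<close> expresses the codegree of an unordered pair;
  the sum over pairs again separates the shares of the reserved pairs.\<close>

lemma tri_eq_sum_codeg:
  assumes V: "finite V" and r: "\<And>i. r {i} = 0"
  shows "tri V r b b = 2 * (\<Sum>e\<in>[V]\<^bsup>2\<^esup>. r e * (\<Sum>k\<in>V. \<Prod>i\<in>e. b {i, k}))"
proof -
  have "tri V r b b = (\<Sum>i\<in>V. \<Sum>j\<in>V. r {i, j} * (\<Sum>k\<in>V. \<Prod>l\<in>{i, j}. b {l, k}))"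
    unfolding tri_def
  proof (intro sum.cong refl)
    fix i j show "(\<Sum>k\<in>V. r {i, j} * b {j, k} * b {i, k}) = r {i, j} * (\<Sum>k\<in>V. \<Prod>l\<in>{i, j}. b {l, k})"
      using r[of i] by (cases "i = j") (auto simp: sum_distrib_left mult_ac)
  qed
  then show ?thesis using sum_pairs_eq[OF V, of "\<lambda>e. r e * (\<Sum>k\<in>V. \<Prod>i\<in>e. b {i, k})"] r by simp
qed

text \<open>Block \<open>B\<close> has the left vertices \<open>lv B x \<sigma>\<close> and the right vertices \<open>rv B y \<tau>\<close>. A switch at \<open>(B, x)\<close>
  in the second group of blocks exchanges the roles of the twins \<open>lv B x False\<close> and \<open>lv B x True\<close>; a
  switch at \<open>(B, x, y)\<close> in the third group exchanges the two perfect matchings between two pairs of twins.\<close>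

locale gadget_graph =
  fixes V :: "'a set" and lv rv :: "nat \<Rightarrow> nat \<Rightarrow> bool \<Rightarrow> 'a" and c l1 l2 l3 :: nat
  assumes finV: "finite V" and c1: "c \<ge> 1"
    and lvV: "\<And>B x \<sigma>. B < l1 + l2 + l3 \<Longrightarrow> x < c \<Longrightarrow> lv B x \<sigma> \<in> V"
    and rvV: "\<And>B x \<sigma>. B < l1 + l2 + l3 \<Longrightarrow> x < c \<Longrightarrow> rv B x \<sigma> \<in> V"
    and lv_inj: "\<And>B x \<sigma> B' x' \<sigma>'. B < l1 + l2 + l3 \<Longrightarrow> x < c \<Longrightarrow> B' < l1 + l2 + l3 \<Longrightarrow> x' < c \<Longrightarrow>
        lv B x \<sigma> = lv B' x' \<sigma>' \<Longrightarrow> B = B' \<and> x = x' \<and> \<sigma> = \<sigma>'"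
    and rv_inj: "\<And>B x \<sigma> B' x' \<sigma>'. B < l1 + l2 + l3 \<Longrightarrow> x < c \<Longrightarrow> B' < l1 + l2 + l3 \<Longrightarrow> x' < c \<Longrightarrow>
        rv B x \<sigma> = rv B' x' \<sigma>' \<Longrightarrow> B = B' \<and> x = x' \<and> \<sigma> = \<sigma>'"
    and lv_rv: "\<And>B x \<sigma> B' x' \<sigma>'. B < l1 + l2 + l3 \<Longrightarrow> x < c \<Longrightarrow> B' < l1 + l2 + l3 \<Longrightarrow> x' < c \<Longrightarrow>
        lv B x \<sigma> \<noteq> rv B' x' \<sigma>'"
begin

abbreviation l :: nat where "l \<equiv> l1 + l2 + l3"

fun pr :: "nat \<times> nat \<times> bool \<times> nat \<times> bool \<Rightarrow> 'a set" where
  "pr (B, x, \<sigma>, y, \<tau>) = {lv B x \<sigma>, rv B y \<tau>}"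

definition idx :: "nat \<Rightarrow> nat \<Rightarrow> (nat \<times> nat \<times> bool \<times> nat \<times> bool) set" where
  "idx a b = {a..<b} \<times> {..<c} \<times> UNIV \<times> {..<c} \<times> UNIV"

text \<open>The pairs of the three groups, for edges, squared degrees and triangles in this order;
  \<open>P\<close> is left to the random graph.\<close>

definition R1 where "R1 = pr ` idx 0 l1"
definition R2 where "R2 = pr ` idx l1 (l1 + l2)"
definition R3 where "R3 = pr ` idx (l1 + l2) l"
definition R where "R = pr ` idx 0 l"
definition P where "P = [V]\<^bsup>2\<^esup> - R"

definition T2 :: "(nat \<times> nat) set" where "T2 = {l1..<l1 + l2} \<times> {..<c}"
definition T3 :: "(nat \<times> nat \<times> nat) set" where "T3 = {l1 + l2..<l} \<times> {..<c} \<times> {..<c}"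

text \<open>One twin is joined to the whole right side of its block and the other to none of it;
  membership in \<open>\<T>\<close> decides which. Exactly half of the pairs are edges.\<close>

definition F2 :: "(nat \<times> nat) set \<Rightarrow> 'a set set" where
  "F2 \<T> = pr ` {(B, x, \<sigma>, y, \<tau>) \<in> idx l1 (l1 + l2). (\<not> \<sigma>) = ((B, x) \<in> \<T>)}"

text \<open>Pairs with equal marks form one perfect matching of the gadget, those with different
  marks the other. Either way each vertex has one neighbour per gadget, so degrees do not depend on
  \<open>\<T>\<close>.\<close>

definition F3 :: "(nat \<times> nat \<times> nat) set \<Rightarrow> 'a set set" where
  "F3 \<T> = pr ` {(B, x, \<sigma>, y, \<tau>) \<in> idx (l1 + l2) l. (\<sigma> = \<tau>) = ((B, x, y) \<in> \<T>)}"

lemma finite_idx: "finite (idx a b)" unfolding idx_def by auto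

lemma card_idx: "card (idx a b) = 4 * c\<^sup>2 * (b - a)"
  by (simp add: idx_def card_cartesian_product power2_eq_square)

lemma inj_pr: "inj_on pr (idx 0 l)"
proof (rule inj_onI)
  fix s t assume a: "s \<in> idx 0 l" "t \<in> idx 0 l" "pr s = pr t"
  obtain B x \<sigma> y \<tau> where s: "s = (B, x, \<sigma>, y, \<tau>)" by (cases s) auto
  obtain B' x' \<sigma>' y' \<tau>' where t: "t = (B', x', \<sigma>', y', \<tau>')" by (cases t) auto
  have b: "B < l" "x < c" "y < c" "B' < l" "x' < c" "y' < c" using a s t by (auto simp: idx_def)
  have "{lv B x \<sigma>, rv B y \<tau>} = {lv B' x' \<sigma>', rv B' y' \<tau>'}" using a s t by simp
  then have "lv B x \<sigma> = lv B' x' \<sigma>'" "rv B y \<tau> = rv B' y' \<tau>'"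
    using lv_rv[OF b(1,2,4,6), of \<sigma> \<tau>'] by (auto simp: doubleton_eq_iff)
  then show "s = t" using lv_inj[OF b(1,2,4,5)] rv_inj[OF b(1,3,4,6)] s t by auto
qed

lemma idx_sub: "b \<le> l \<Longrightarrow> idx a b \<subseteq> idx 0 l" by (auto simp: idx_def)

lemma R_sub: "R \<subseteq> [V]\<^bsup>2\<^esup>"
proof
  fix e assume "e \<in> R"
  then obtain B x \<sigma> y \<tau> where e: "e = {lv B x \<sigma>, rv B y \<tau>}" and b: "B < l" "x < c" "y < c"
    by (auto simp: R_def idx_def)
  have "lv B x \<sigma> \<noteq> rv B y \<tau>" using lv_rv[OF b(1,2,1,3)] .
  then show "e \<in> [V]\<^bsup>2\<^esup>" using lvV[OF b(1,2)] rvV[OF b(1,3)] by (simp add: e nsets_def)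
qed

lemma finite_nV: "finite ([V]\<^bsup>2\<^esup>)" using finV by (rule finite_imp_finite_nsets)

lemma finite_R: "finite R" using R_sub finite_nV finite_subset by auto

lemma finite_P: "finite P" using finite_nV by (simp add: P_def)

lemma R_split: "R = R1 \<union> R2 \<union> R3"
proof -
  have "idx 0 l = idx 0 l1 \<union> idx l1 (l1 + l2) \<union> idx (l1 + l2) l" by (auto simp: idx_def)
  then show ?thesis by (simp add: R_def R1_def R2_def R3_def image_Un)
qed

lemma R_disj: "R1 \<inter> R2 = {}" "R1 \<inter> R3 = {}" "R2 \<inter> R3 = {}"
proof -
  have d: "pr ` X \<inter> pr ` Y = {}" if "X \<subseteq> idx 0 l" "Y \<subseteq> idx 0 l" "X \<inter> Y = {}" for X Y
    using inj_on_image_Int[OF inj_pr that(1,2)] that(3) by simp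
  show "R1 \<inter> R2 = {}" "R1 \<inter> R3 = {}" "R2 \<inter> R3 = {}"
    unfolding R1_def R2_def R3_def by (intro d idx_sub; auto simp: idx_def)+
qed

lemma sum_R_split: "(\<Sum>e\<in>R. f e) = (\<Sum>e\<in>R1. f e) + (\<Sum>e\<in>R2. f e) + (\<Sum>e\<in>R3. (f e :: real))"
proof -
  have "finite (R1 \<union> R2 \<union> R3)" using finite_R R_split by simp
  then show ?thesis unfolding R_split using R_disj by (subst sum.union_disjoint, auto)+
qed

lemma card_pr: "b \<le> l \<Longrightarrow> card (pr ` idx a b) = 4 * c\<^sup>2 * (b - a)"
  using card_image[OF inj_on_subset[OF inj_pr idx_sub]] card_idx by metis

lemma card_R: "card R = 4 * c\<^sup>2 * l" "card R1 = 4 * c\<^sup>2 * l1" "card R2 = 4 * c\<^sup>2 * l2" "card R3 = 4 * c\<^sup>2 * l3"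
  unfolding R_def R1_def R2_def R3_def by (simp_all add: card_pr)

lemma sum_pr:
  assumes "b \<le> l"
  shows "(\<Sum>e\<in>pr ` idx a b. f e :: real) = (\<Sum>B\<in>{a..<b}. \<Sum>x<c. \<Sum>y<c.
     f (pr (B, x, False, y, False)) + f (pr (B, x, True, y, True))
     + f (pr (B, x, False, y, True)) + f (pr (B, x, True, y, False)))"
proof -
  have "(\<Sum>e\<in>pr ` idx a b. f e) = (\<Sum>t\<in>idx a b. f (pr t))"
    by (subst sum.reindex[OF inj_on_subset[OF inj_pr idx_sub[OF assms]]]) simp
  also have "\<dots> = (\<Sum>B\<in>{a..<b}. \<Sum>x<c. \<Sum>\<sigma>\<in>UNIV. \<Sum>y<c. \<Sum>\<tau>\<in>UNIV. f (pr (B, x, \<sigma>, y, \<tau>)))"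
    unfolding idx_def by (simp add: sum.cartesian_product case_prod_unfold del: pr.simps)
  also have "\<dots> = (\<Sum>B\<in>{a..<b}. \<Sum>x<c. \<Sum>y<c. \<Sum>\<sigma>\<in>UNIV. \<Sum>\<tau>\<in>UNIV. f (pr (B, x, \<sigma>, y, \<tau>)))"
    by (intro sum.cong refl sum.swap)
  finally show ?thesis by (simp add: UNIV_bool add_ac)
qed

lemma mem_F2: "t \<in> idx 0 l \<Longrightarrow> pr t \<in> F2 \<T> \<longleftrightarrow> (case t of (B, x, \<sigma>, y, \<tau>) \<Rightarrow> B \<in> {l1..<l1 + l2} \<and> (\<not> \<sigma>) = ((B, x) \<in> \<T>))"
  unfolding F2_def by (subst inj_on_image_mem_iff[OF inj_pr]) (auto simp: idx_def)

lemma mem_F3: "t \<in> idx 0 l \<Longrightarrow> pr t \<in> F3 \<T> \<longleftrightarrow> (case t of (B, x, \<sigma>, y, \<tau>) \<Rightarrow> B \<in> {l1 + l2..<l} \<and> (\<sigma> = \<tau>) = ((B, x, y) \<in> \<T>))"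
  unfolding F3_def by (subst inj_on_image_mem_iff[OF inj_pr]) (auto simp: idx_def)

lemma F2_sub: "F2 \<T> \<subseteq> R2" unfolding F2_def R2_def by auto

lemma F3_sub: "F3 \<T> \<subseteq> R3" unfolding F3_def R3_def by auto

text \<open>The weight is 1/2 on edges and - 1/2 on other pairs, so every gadget contributes a
  signed difference between its twins.\<close>

lemma sum_R2:
  fixes f :: "'a set \<Rightarrow> real"
  assumes F: "F \<inter> R2 = F2 \<T>"
  shows "(\<Sum>e\<in>R2. (of_bool (e \<in> F) - 1 / 2) * f e) = (\<Sum>(B, x)\<in>T2. (if (B, x) \<in> \<T> then 1 / 2 else - 1 / 2) *
     (\<Sum>y<c. f (pr (B, x, False, y, False)) - f (pr (B, x, True, y, True))
        + f (pr (B, x, False, y, True)) - f (pr (B, x, True, y, False))))"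
proof -
  have m: "pr (B, x, \<sigma>, y, \<tau>) \<in> F \<longleftrightarrow> (\<not> \<sigma>) = ((B, x) \<in> \<T>)"
    if "B \<in> {l1..<l1 + l2}" "x < c" "y < c" for B x \<sigma> y \<tau>
  proof -
    have i: "(B, x, \<sigma>, y, \<tau>) \<in> idx l1 (l1 + l2)" using that by (auto simp: idx_def)
    then have "pr (B, x, \<sigma>, y, \<tau>) \<in> R2" unfolding R2_def by (rule imageI)
    then have "pr (B, x, \<sigma>, y, \<tau>) \<in> F \<longleftrightarrow> pr (B, x, \<sigma>, y, \<tau>) \<in> F2 \<T>" using F by blast
    then show ?thesis using mem_F2[of "(B, x, \<sigma>, y, \<tau>)" \<T>] idx_sub[of "l1 + l2" l1] i that by auto
  qed
  have "(\<Sum>e\<in>R2. (of_bool (e \<in> F) - 1 / 2) * f e) = (\<Sum>B\<in>{l1..<l1 + l2}. \<Sum>x<c. \<Sum>y<c.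
     (if (B, x) \<in> \<T> then 1 / 2 else - 1 / 2) * (f (pr (B, x, False, y, False)) - f (pr (B, x, True, y, True))
        + f (pr (B, x, False, y, True)) - f (pr (B, x, True, y, False))))"
    unfolding R2_def by (subst sum_pr, simp, intro sum.cong refl)
      (simp add: m algebra_simps del: pr.simps)
  then show ?thesis unfolding T2_def sum.cartesian_product[symmetric] by (simp only: sum_distrib_left)
qed

lemma sum_R3:
  fixes f :: "'a set \<Rightarrow> real"
  assumes F: "F \<inter> R3 = F3 \<T>"
  shows "(\<Sum>e\<in>R3. (of_bool (e \<in> F) - 1 / 2) * f e) = (\<Sum>(B, x, y)\<in>T3. (if (B, x, y) \<in> \<T> then 1 / 2 else - 1 / 2) *
     (f (pr (B, x, False, y, False)) + f (pr (B, x, True, y, True))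
        - f (pr (B, x, False, y, True)) - f (pr (B, x, True, y, False))))"
proof -
  have m: "pr (B, x, \<sigma>, y, \<tau>) \<in> F \<longleftrightarrow> (\<sigma> = \<tau>) = ((B, x, y) \<in> \<T>)"
    if "B \<in> {l1 + l2..<l}" "x < c" "y < c" for B x \<sigma> y \<tau>
  proof -
    have i: "(B, x, \<sigma>, y, \<tau>) \<in> idx (l1 + l2) l" using that by (auto simp: idx_def)
    then have "pr (B, x, \<sigma>, y, \<tau>) \<in> R3" unfolding R3_def by (rule imageI)
    then have "pr (B, x, \<sigma>, y, \<tau>) \<in> F \<longleftrightarrow> pr (B, x, \<sigma>, y, \<tau>) \<in> F3 \<T>" using F by blast
    then show ?thesis using mem_F3[of "(B, x, \<sigma>, y, \<tau>)" \<T>] idx_sub[of l "l1 + l2"] i that by auto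
  qed
  have "(\<Sum>e\<in>R3. (of_bool (e \<in> F) - 1 / 2) * f e) = (\<Sum>B\<in>{l1 + l2..<l}. \<Sum>x<c. \<Sum>y<c.
     (if (B, x, y) \<in> \<T> then 1 / 2 else - 1 / 2) * (f (pr (B, x, False, y, False)) + f (pr (B, x, True, y, True))
        - f (pr (B, x, False, y, True)) - f (pr (B, x, True, y, False))))"
    unfolding R3_def by (subst sum_pr, simp, intro sum.cong refl)
      (simp add: m algebra_simps del: pr.simps)
  then show ?thesis unfolding T3_def by (simp add: sum.cartesian_product del: pr.simps)
qed

text \<open>A vertex lies in at most one block, where its reserved partners are among the 2 c
  vertices of the other side.\<close>

lemma degree_R: "card {w \<in> V. {i, w} \<in> R} \<le> 2 * c"
proof -
  have im: "card (f ` ({..<c} \<times> (UNIV :: bool set))) \<le> 2 * c" for f :: "nat \<times> bool \<Rightarrow> 'a"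
    using card_image_le[of "{..<c} \<times> (UNIV :: bool set)" f] by (simp add: card_cartesian_product mult.commute)
  have fi: "finite (f ` ({..<c} \<times> (UNIV :: bool set)))" for f :: "nat \<times> bool \<Rightarrow> 'a" by simp
  have ex: "\<exists>B x \<sigma> y \<tau>. {i, w} = {lv B x \<sigma>, rv B y \<tau>} \<and> B < l \<and> x < c \<and> y < c" if m: "{i, w} \<in> R" for w
  proof -
    from m[unfolded R_def] obtain t where "{i, w} = pr t" "t \<in> idx 0 l" by (rule imageE)
    moreover obtain B x \<sigma> y \<tau> where "t = (B, x, \<sigma>, y, \<tau>)" by (cases t) auto
    ultimately have "{i, w} = {lv B x \<sigma>, rv B y \<tau>}" "B < l" "x < c" "y < c" by (auto simp: idx_def)
    then show ?thesis by blast
  qed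
  consider (a) B x \<sigma> where "i = lv B x \<sigma>" "B < l" "x < c" | (b) B y \<tau> where "i = rv B y \<tau>" "B < l" "y < c"
    | (none) "\<And>w. {i, w} \<notin> R"
  proof -
    { fix w assume "{i, w} \<in> R"
      then obtain B x \<sigma> y \<tau> where "{i, w} = {lv B x \<sigma>, rv B y \<tau>}" "B < l" "x < c" "y < c" using ex by blast
      then have ?thesis using a b by (auto simp: doubleton_eq_iff) }
    then show ?thesis using none by blast
  qed
  then show ?thesis
  proof cases
    case a
    have "{w \<in> V. {i, w} \<in> R} \<subseteq> (\<lambda>(y, \<tau>). rv B y \<tau>) ` ({..<c} \<times> UNIV)"
    proof
      fix w assume "w \<in> {w \<in> V. {i, w} \<in> R}"
      then obtain B' x' \<sigma>' y' \<tau>' where w: "{i, w} = {lv B' x' \<sigma>', rv B' y' \<tau>'}" "B' < l" "x' < c" "y' < c"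
        using ex by blast
      then have "i = lv B' x' \<sigma>'" "w = rv B' y' \<tau>'"
        using lv_rv[OF a(2,3) w(2,4), of \<sigma> \<tau>'] a(1) by (auto simp: doubleton_eq_iff)
      then have "w = rv B y' \<tau>'" using lv_inj[OF a(2,3) w(2,3)] a(1) by auto
      then show "w \<in> (\<lambda>(y, \<tau>). rv B y \<tau>) ` ({..<c} \<times> UNIV)" using w(4) by auto
    qed
    then show ?thesis using im fi by (meson card_mono order_trans)
  next
    case b
    have "{w \<in> V. {i, w} \<in> R} \<subseteq> (\<lambda>(y, \<tau>). lv B y \<tau>) ` ({..<c} \<times> UNIV)"
    proof
      fix w assume "w \<in> {w \<in> V. {i, w} \<in> R}"
      then obtain B' x' \<sigma>' y' \<tau>' where w: "{i, w} = {lv B' x' \<sigma>', rv B' y' \<tau>'}" "B' < l" "x' < c" "y' < c"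
        using ex by blast
      then have "i = rv B' y' \<tau>'" "w = lv B' x' \<sigma>'"
        using lv_rv[OF w(2,3) b(2,3), of \<sigma>' \<tau>] b(1) by (auto simp: doubleton_eq_iff)
      then have "w = lv B x' \<sigma>'" using rv_inj[OF b(2,3) w(2,4)] b(1) by auto
      then show "w \<in> (\<lambda>(y, \<tau>). lv B y \<tau>) ` ({..<c} \<times> UNIV)" using w(3) by auto
    qed
    then show ?thesis using im fi by (meson card_mono order_trans)
  next
    case none
    then show ?thesis by simp
  qed
qed

end

section \<open>Degree and triangle sums of a configuration\<close>

text \<open>Change the set one element at a time from \<open>A\<close> to \<open>B\<close>. Where
  \<open>f\<close> becomes positive, the value before the step is within one step of 0.\<close>

lemma discrete_ivt:
  fixes f :: "'b set \<Rightarrow> real"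
  assumes T: "finite T" and step: "\<And>X t. X \<subseteq> T \<Longrightarrow> t \<in> T - X \<Longrightarrow> \<bar>f (insert t X) - f X\<bar> \<le> \<eta>"
  shows "A \<subseteq> T \<Longrightarrow> B \<subseteq> T \<Longrightarrow> f A \<le> 0 \<Longrightarrow> 0 \<le> f B \<Longrightarrow> 0 \<le> \<eta> \<Longrightarrow> \<exists>X\<subseteq>T. \<bar>f X\<bar> \<le> \<eta>"
proof (induction "card ((A - B) \<union> (B - A))" arbitrary: A rule: less_induct)
  case less
  have fin: "finite ((A - B) \<union> (B - A))" using less.prems T by (auto intro: finite_subset)
  show ?case
  proof (cases "A = B")
    case True
    then show ?thesis using less.prems by (intro exI[of _ A]) auto
  next
    case False
    then obtain t where t: "t \<in> (A - B) \<union> (B - A)" by auto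
    define A' where "A' = (if t \<in> A then A - {t} else insert t A)"
    have A'T: "A' \<subseteq> T" using t less.prems by (auto simp: A'_def)
    have st: "\<bar>f A' - f A\<bar> \<le> \<eta>"
    proof (cases "t \<in> A")
      case True
      have "\<bar>f (insert t (A - {t})) - f (A - {t})\<bar> \<le> \<eta>" using True less.prems by (intro step) auto
      then show ?thesis using True by (simp add: A'_def insert_absorb abs_minus_commute)
    next
      case False
      then show ?thesis using t less.prems step[of A t] by (auto simp: A'_def)
    qed
    have "(A' - B) \<union> (B - A') = ((A - B) \<union> (B - A)) - {t}" using t by (auto simp: A'_def)
    then have lt: "card ((A' - B) \<union> (B - A')) < card ((A - B) \<union> (B - A))"
      using t fin by (metis card_Diff1_less)
    show ?thesis
    proof (cases "f A' \<le> 0")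
      case True
      then show ?thesis using less.hyps[OF lt A'T] less.prems by auto
    next
      case False
      then have "\<bar>f A\<bar> \<le> \<eta>" using st less.prems by linarith
      then show ?thesis using less.prems by auto
    qed
  qed
qed

section \<open>Degrees in a set of reserved pairs\<close>

context gadget_graph
begin

lemma of_bool_mem_pr:
  assumes "X \<subseteq> idx 0 l"
  shows "(of_bool (e \<in> pr ` X) :: real) = (\<Sum>s\<in>X. of_bool (e = pr s))"
proof -
  have fX: "finite X" using assms finite_idx by (rule finite_subset)
  show ?thesis
  proof (cases "e \<in> pr ` X")
    case True
    then obtain s where s: "s \<in> X" "e = pr s" by auto
    have "(\<Sum>t\<in>X. of_bool (e = pr t)) = (\<Sum>t\<in>X. if t = s then 1 else (0::real))"
    proof (rule sum.cong[OF refl])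
      fix t assume "t \<in> X"
      then show "of_bool (e = pr t) = (if t = s then 1 else (0::real))"
        using inj_onD[OF inj_pr, of s t] s assms by auto
    qed
    then show ?thesis using s fX by simp
  next
    case False
    then have "(\<Sum>s\<in>X. of_bool (e = pr s)) = (0::real)" by (intro sum.neutral) auto
    then show ?thesis using False by simp
  qed
qed

lemma wdeg_pair:
  assumes "u \<in> V" "v \<in> V" "u \<noteq> v"
  shows "wdeg V (\<lambda>e. of_bool (e = {u, v})) i = of_bool (i = u) + of_bool (i = v)"
proof -
  have "wdeg V (\<lambda>e. of_bool (e = {u, v})) i
      = (\<Sum>w\<in>V. (if w = v then of_bool (i = u) else 0) + (if w = u then of_bool (i = v) else 0))"
    unfolding wdeg_def using assms by (intro sum.cong refl) (auto simp: doubleton_eq_iff)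
  then show ?thesis using assms finV by (simp add: sum.distrib)
qed

lemma wdeg_pr:
  assumes "X \<subseteq> idx 0 l"
  shows "wdeg V (\<lambda>e. of_bool (e \<in> pr ` X)) i
     = (\<Sum>(B, x, \<sigma>, y, \<tau>)\<in>X. of_bool (i = lv B x \<sigma>) + of_bool (i = rv B y \<tau>))"
proof -
  have "wdeg V (\<lambda>e. of_bool (e \<in> pr ` X)) i = (\<Sum>w\<in>V. \<Sum>s\<in>X. of_bool ({i, w} = pr s))"
    unfolding wdeg_def by (simp only: of_bool_mem_pr[OF assms])
  also have "\<dots> = (\<Sum>s\<in>X. wdeg V (\<lambda>e. of_bool (e = pr s)) i)"
    unfolding wdeg_def by (rule sum.swap)
  also have "\<dots> = (\<Sum>(B, x, \<sigma>, y, \<tau>)\<in>X. of_bool (i = lv B x \<sigma>) + of_bool (i = rv B y \<tau>))"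
  proof (rule sum.cong[OF refl])
    fix s assume s: "s \<in> X"
    obtain B x \<sigma> y \<tau> where t: "s = (B, x, \<sigma>, y, \<tau>)" by (cases s) auto
    have b: "B < l" "x < c" "y < c" using s assms t by (auto simp: idx_def)
    show "wdeg V (\<lambda>e. of_bool (e = pr s)) i
        = (case s of (B, x, \<sigma>, y, \<tau>) \<Rightarrow> of_bool (i = lv B x \<sigma>) + of_bool (i = rv B y \<tau>))"
      unfolding t using wdeg_pair[OF lvV[OF b(1,2)] rvV[OF b(1,3)] lv_rv[OF b(1,2,1,3)]] by simp
  qed
  finally show ?thesis .
qed

end

text \<open>\<open>b\<close> is a fixed outcome of the centred bits; \<open>bsq\<close> says that
  its values on \<open>P\<close> are \<open>- \<pi>\<close> and \<open>1 - \<pi>\<close>. By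
  \<open>bal\<close>, density \<open>\<pi>\<close> on \<open>P\<close> and 1/2 on the reserved pairs
  average to \<open>p\<close>; by \<open>dl\<close>, the shift from \<open>p\<close> to
  \<open>\<pi>\<close> alters a degree by at most \<open>c\<close>.\<close>

locale gadget_bits = gadget_graph V lv rv c l1 l2 l3
  for V :: "'a set" and lv rv c l1 l2 l3 +
  fixes b :: "'a set \<Rightarrow> real" and p \<pi> :: real
  assumes b0: "\<And>e. e \<notin> P \<Longrightarrow> b e = 0" and b1: "\<And>e. \<bar>b e\<bar> \<le> 1"
    and bsq: "\<And>e. e \<in> P \<Longrightarrow> (b e)\<^sup>2 = (1 - 2 * \<pi>) * b e + \<pi> * (1 - \<pi>)"
    and p01: "0 \<le> p" "p \<le> 1" and \<pi>01: "0 \<le> \<pi>" "\<pi> \<le> 1"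
    and bal: "(\<pi> - p) * real (card P) + (1 / 2 - p) * real (card R) = 0"
    and dl: "real (card V) * \<bar>\<pi> - p\<bar> \<le> real c"
begin

text \<open>The perturbation of \<open>b\<close>: the shift of density on \<open>P\<close>, and the
  whole centred indicator on the reserved pairs, where \<open>b\<close> vanishes.\<close>

definition rr :: "'a set set \<Rightarrow> 'a set \<Rightarrow> real" where
  "rr F e = (if e \<in> P then \<pi> - p else if e \<in> R then of_bool (e \<in> F) - p else 0)"

definition al :: "'a set set \<Rightarrow> 'a set \<Rightarrow> real" where "al F e = b e + rr F e"

text \<open>A bound for \<open>rr F\<close> that is the same for all \<open>F\<close>.\<close>

definition rho :: "'a set \<Rightarrow> real" where
  "rho e = (if e \<in> P then \<bar>\<pi> - p\<bar> else if e \<in> R then 1 else 0)"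

definition be :: "'a \<Rightarrow> real" where "be i = wdeg V b i"
definition D :: "'a set \<Rightarrow> real" where "D e = (\<Sum>i\<in>e. be i)"
definition C :: "'a set \<Rightarrow> real" where "C e = (\<Sum>k\<in>V. \<Prod>i\<in>e. b {i, k})"
text \<open>\<open>Z1\<close>, \<open>Z2\<close> and \<open>Z7\<close> belong to the edges
  (unordered), paths and triangles of the random part; \<open>Z3\<close>, \<open>Z4\<close>,
  \<open>Z8\<close> and \<open>Z9\<close> measure its degrees and codegrees on reserved
  pairs.\<close>

definition Z1 where "Z1 = (\<Sum>e\<in>P. b e)"
definition Z2 where "Z2 = (\<Sum>i\<in>V. (be i)\<^sup>2) - (\<Sum>i\<in>V. \<Sum>j\<in>V. (b {i, j})\<^sup>2)"
definition Z3 where "Z3 = (\<Sum>e\<in>R. D e)"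
definition Z4 where "Z4 = (\<Sum>e\<in>R1. \<bar>D e\<bar>)"
definition Z7 where "Z7 = tri V b b b"
definition Z8 where "Z8 = (\<Sum>e\<in>R. C e)"
definition Z9 where "Z9 = (\<Sum>e\<in>R1. \<bar>C e\<bar>) + (\<Sum>e\<in>R2. \<bar>C e\<bar>)"
text \<open>\<open>\<Delta> t\<close> and \<open>g t\<close> are the coefficients of the signs of
  the switches, up to the factors 2 c and 3, in \<open>sum_sq_formula\<close> and
  \<open>tri_formula\<close>.\<close>

definition \<Delta> :: "nat \<times> nat \<Rightarrow> real" where
  "\<Delta> t = (case t of (B, x) \<Rightarrow> be (lv B x False) - be (lv B x True))"
definition g :: "nat \<times> nat \<times> nat \<Rightarrow> real" where
  "g t = (case t of (B, x, y) \<Rightarrow> \<Sum>k\<in>V. (b {lv B x False, k} - b {lv B x True, k})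
      * (b {rv B y False, k} - b {rv B y True, k}))"

lemma PR: "P \<union> R = [V]\<^bsup>2\<^esup>" "P \<inter> R = {}" using R_sub by (auto simp: P_def)

lemma singleton_notin: "{i} \<notin> P" "{i} \<notin> R"
proof -
  have "{i} \<notin> [V]\<^bsup>2\<^esup>" by (simp add: nsets_def)
  then show "{i} \<notin> P" "{i} \<notin> R" using PR(1) by auto
qed

lemma b_single: "b {i} = 0" using b0 singleton_notin by auto
lemma rr_single: "rr F {i} = 0" using singleton_notin by (simp add: rr_def)
lemma rho_single: "rho {i} = 0" using singleton_notin by (simp add: rho_def)

lemma abs_rr: "\<bar>rr F e\<bar> \<le> rho e" "\<bar>rr F e\<bar> \<le> 1"
  using p01 \<pi>01 by (auto simp: rr_def rho_def of_bool_def)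

lemma rho0: "0 \<le> rho e" by (simp add: rho_def)

lemma rho1: "rho e \<le> 1" using p01 \<pi>01 by (auto simp: rho_def)

text \<open>On \<open>P\<close> the shift in \<open>rr\<close> replaces \<open>\<pi>\<close> by
  \<open>p\<close>, so \<open>al F e\<close> is 0 or 1 minus \<open>p\<close>; elsewhere
  \<open>b\<close> vanishes.\<close>

lemma abs_al: "\<bar>al F e\<bar> \<le> 1"
proof (cases "e \<in> P")
  case True
  have "\<exists>z. (z = 0 \<or> z = 1) \<and> b e = z - \<pi>"
  proof -
    have "(b e + \<pi>) * (b e + \<pi> - 1) = 0" using bsq[OF True] by (simp add: power2_eq_square algebra_simps)
    then show ?thesis by (intro exI[of _ "b e + \<pi>"]) auto
  qed
  then show ?thesis using p01 True by (auto simp: al_def rr_def)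
next
  case False
  then show ?thesis using abs_rr(2)[of F e] b0 by (simp add: al_def)
qed

lemma sum_nV: "(\<Sum>e\<in>[V]\<^bsup>2\<^esup>. f e) = (\<Sum>e\<in>P. f e) + (\<Sum>e\<in>R. (f e :: real))"
  unfolding PR(1)[symmetric] using PR(2) finite_P finite_R by (intro sum.union_disjoint)

text \<open>The shift of the density contributes c, the reserved pairs at the vertex 2 c.\<close>

lemma wdeg_rho: assumes i: "i \<in> V" shows "wdeg V rho i \<le> 3 * real c"
proof -
  have "wdeg V rho i \<le> (\<Sum>w\<in>V. \<bar>\<pi> - p\<bar> + of_bool ({i, w} \<in> R))"
    unfolding wdeg_def by (intro sum_mono) (auto simp: rho_def)
  also have "\<dots> = real (card V) * \<bar>\<pi> - p\<bar> + real (card {w \<in> V. {i, w} \<in> R})"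
    using finV by (simp add: sum.distrib of_bool_def sum.inter_filter[symmetric])
  also have "\<dots> \<le> real c + real (2 * c)"
    using dl degree_R[of i] by (intro add_mono) (auto simp only: of_nat_le_iff)
  finally show ?thesis by simp
qed

lemma wdeg_rho_nonneg: "0 \<le> wdeg V rho i" unfolding wdeg_def by (intro sum_nonneg rho0)

lemma abs_delta_card_P: "\<bar>\<pi> - p\<bar> * real (card P) \<le> real (card R) / 2"
proof -
  have "\<bar>\<pi> - p\<bar> * real (card P) = \<bar>(\<pi> - p) * real (card P)\<bar>" by (simp add: abs_mult)
  also have "(\<pi> - p) * real (card P) = - ((1 / 2 - p) * real (card R))" using bal by linarith
  also have "\<bar>\<dots>\<bar> = \<bar>1 / 2 - p\<bar> * real (card R)" by (simp add: abs_mult)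
  also have "\<dots> \<le> 1 / 2 * real (card R)"
    using p01 by (intro mult_right_mono) (auto simp: abs_if)
  finally show ?thesis by simp
qed

lemma sum_wdeg_rho: "(\<Sum>i\<in>V. wdeg V rho i) \<le> 3 * real (card R)"
proof -
  have "(\<Sum>i\<in>V. wdeg V rho i) = 2 * (\<Sum>e\<in>[V]\<^bsup>2\<^esup>. rho e)"
    unfolding wdeg_def by (rule sum_pairs_eq[where f = rho, OF finV rho_single])
  also have "(\<Sum>e\<in>[V]\<^bsup>2\<^esup>. rho e) = \<bar>\<pi> - p\<bar> * real (card P) + real (card R)"
  proof -
    have "(\<Sum>e\<in>P. rho e) = (\<Sum>e\<in>P. \<bar>\<pi> - p\<bar>)" by (intro sum.cong) (auto simp: rho_def)
    moreover have "(\<Sum>e\<in>R. rho e) = (\<Sum>e\<in>R. 1)" using PR by (intro sum.cong) (auto simp: rho_def)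
    ultimately show ?thesis unfolding sum_nV by simp
  qed
  finally show ?thesis using abs_delta_card_P by simp
qed

lemma sum_wdeg_rho_sq: "(\<Sum>i\<in>V. (wdeg V rho i)\<^sup>2) \<le> 9 * real c * real (card R)"
proof -
  have "(\<Sum>i\<in>V. (wdeg V rho i)\<^sup>2) \<le> (\<Sum>i\<in>V. 3 * real c * wdeg V rho i)"
    unfolding power2_eq_square by (intro sum_mono mult_right_mono wdeg_rho wdeg_rho_nonneg)
  also have "\<dots> \<le> 3 * real c * (3 * real (card R))"
    unfolding sum_distrib_left[symmetric] by (intro mult_left_mono sum_wdeg_rho) auto
  finally show ?thesis by simp
qed

lemma abs_wdeg_rr: "\<bar>wdeg V (rr F) i\<bar> \<le> wdeg V rho i"
  unfolding wdeg_def by (intro order_trans[OF sum_abs] sum_mono abs_rr)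

lemma wdeg_al: "wdeg V (al F) i = be i + wdeg V (rr F) i"
  by (simp add: wdeg_def al_def be_def sum.distrib)

lemma sum_be: "(\<Sum>i\<in>V. be i) = 2 * Z1"
proof -
  have "(\<Sum>i\<in>V. be i) = 2 * (\<Sum>e\<in>[V]\<^bsup>2\<^esup>. b e)"
    unfolding be_def wdeg_def by (rule sum_pairs_eq[where f = b, OF finV b_single])
  also have "(\<Sum>e\<in>R. b e) = 0" using PR b0 by (intro sum.neutral) auto
  then have "(\<Sum>e\<in>[V]\<^bsup>2\<^esup>. b e) = Z1" unfolding sum_nV Z1_def by simp
  finally show ?thesis .
qed

lemma sum_b_sq: "(\<Sum>i\<in>V. \<Sum>j\<in>V. (b {i, j})\<^sup>2) = 2 * ((1 - 2 * \<pi>) * Z1 + \<pi> * (1 - \<pi>) * real (card P))"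
proof -
  have "(\<Sum>i\<in>V. \<Sum>j\<in>V. (b {i, j})\<^sup>2) = 2 * (\<Sum>e\<in>[V]\<^bsup>2\<^esup>. (b e)\<^sup>2)"
    using sum_pairs_eq[OF finV, of "\<lambda>e. (b e)\<^sup>2"] b_single by simp
  also have "(\<Sum>e\<in>R. (b e)\<^sup>2) = 0" using PR b0 by (intro sum.neutral) auto
  then have "(\<Sum>e\<in>[V]\<^bsup>2\<^esup>. (b e)\<^sup>2) = (\<Sum>e\<in>P. (b e)\<^sup>2)" unfolding sum_nV by simp
  also have "\<dots> = (1 - 2 * \<pi>) * Z1 + \<pi> * (1 - \<pi>) * real (card P)"
    by (simp add: bsq Z1_def sum.distrib sum_distrib_left)
  finally show ?thesis .
qed

lemma card_PR: "real (card P) + real (card R) = real (card V) * (real (card V) - 1) / 2"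
proof -
  have "card P + card R = card V choose 2"
    using card_Un_disjoint[OF finite_P finite_R PR(2)] PR(1) card_nsets[of V 2] finV by simp
  then have "real (card P) + real (card R) = real (card V choose 2)" by (metis of_nat_add)
  moreover have "real (card V choose 2) = real (card V) * (real (card V) - 1) / 2"
    by (cases "card V") (auto simp: choose_two real_of_nat_div algebra_simps)
  ultimately show ?thesis by simp
qed

text \<open>On \<open>R\<close> the constant part 1/2 - p is split as (\<open>\<pi>\<close> - p) +
  (1/2 - \<open>\<pi>\<close>), so that \<open>\<pi>\<close> - p is summed over all pairs, where
  \<open>sum_D_all\<close> and \<open>sum_C_all\<close> evaluate it. Only the last sum depends on
  \<open>F\<close>.\<close>

lemma sum_rr_split:
  "(\<Sum>e\<in>[V]\<^bsup>2\<^esup>. rr F e * f e) = (\<pi> - p) * (\<Sum>e\<in>[V]\<^bsup>2\<^esup>. f e) + (1 / 2 - \<pi>) * (\<Sum>e\<in>R. f e)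
     + (\<Sum>e\<in>R. (of_bool (e \<in> F) - 1 / 2) * f e)"
proof -
  have "(\<Sum>e\<in>P. rr F e * f e) = (\<pi> - p) * (\<Sum>e\<in>P. f e)"
    unfolding sum_distrib_left by (intro sum.cong) (auto simp: rr_def)
  moreover have "(\<Sum>e\<in>R. rr F e * f e) = (\<Sum>e\<in>R. (of_bool (e \<in> F) - 1 / 2) * f e + (1 / 2 - p) * f e)"
    using PR by (intro sum.cong) (auto simp: rr_def algebra_simps)
  ultimately show ?thesis
    unfolding sum_nV sum.distrib sum_distrib_left[symmetric] by (simp add: algebra_simps)
qed

lemma D_pair: "u \<noteq> v \<Longrightarrow> D {u, v} = be u + be v" by (simp add: D_def)

lemma C_pair: "u \<noteq> v \<Longrightarrow> C {u, v} = (\<Sum>k\<in>V. b {u, k} * b {v, k})" by (simp add: C_def)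

lemma abs_sum_half: "\<bar>\<Sum>e\<in>A. (of_bool (e \<in> F) - 1 / 2) * f e\<bar> \<le> 1 / 2 * (\<Sum>e\<in>A. \<bar>f e :: real\<bar>)"
proof -
  have "\<bar>\<Sum>e\<in>A. (of_bool (e \<in> F) - 1 / 2) * f e\<bar> \<le> (\<Sum>e\<in>A. \<bar>(of_bool (e \<in> F) - 1 / 2) * f e\<bar>)" by (rule sum_abs)
  also have "\<dots> = (\<Sum>e\<in>A. 1 / 2 * \<bar>f e\<bar>)" by (intro sum.cong) (auto simp: abs_mult of_bool_def)
  finally show ?thesis by (simp add: sum_distrib_left)
qed

lemma sum_D_all: "(\<Sum>e\<in>[V]\<^bsup>2\<^esup>. D e) = (real (card V) - 1) * (2 * Z1)"
proof -
  let ?r = "\<lambda>e. of_bool (e \<in> [V]\<^bsup>2\<^esup>) :: real"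
  have w: "wdeg V ?r i = real (card V) - 1" if i: "i \<in> V" for i
  proof -
    have "wdeg V ?r i = (\<Sum>w\<in>V. of_bool (w \<noteq> i))"
      unfolding wdeg_def using i by (intro sum.cong refl) (auto simp: nsets_def)
    also have "\<dots> = (\<Sum>w\<in>V - {i}. 1)" using finV by (intro sum.mono_neutral_cong_right) auto
    also have "\<dots> = real (card V) - 1"
    proof -
      have "card V \<ge> 1" using i finV by (metis One_nat_def Suc_leI card_gt_0_iff empty_iff)
      then show ?thesis using i finV by (simp add: of_nat_diff)
    qed
    finally show ?thesis .
  qed
  have "(\<Sum>e\<in>[V]\<^bsup>2\<^esup>. D e) = (\<Sum>e\<in>[V]\<^bsup>2\<^esup>. ?r e * (\<Sum>i\<in>e. wdeg V b i))"
    by (intro sum.cong) (auto simp: D_def be_def)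
  also have "\<dots> = (\<Sum>i\<in>V. wdeg V ?r i * wdeg V b i)"
    by (rule sum_wdeg_mult_wdeg[symmetric, OF finV]) (auto simp: nsets_def)
  also have "\<dots> = (real (card V) - 1) * (\<Sum>i\<in>V. be i)"
    unfolding sum_distrib_left by (intro sum.cong refl) (simp add: w be_def)
  finally show ?thesis by (simp add: sum_be)
qed

lemma sum_C_all: "2 * (\<Sum>e\<in>[V]\<^bsup>2\<^esup>. C e) = Z2"
proof -
  let ?r = "\<lambda>e. of_bool (e \<in> [V]\<^bsup>2\<^esup>) :: real"
  have "2 * (\<Sum>e\<in>[V]\<^bsup>2\<^esup>. C e) = 2 * (\<Sum>e\<in>[V]\<^bsup>2\<^esup>. ?r e * (\<Sum>k\<in>V. \<Prod>i\<in>e. b {i, k}))"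
    by (intro arg_cong[where f = "(*) 2"] sum.cong) (auto simp: C_def)
  also have "\<dots> = tri V ?r b b"
    by (rule tri_eq_sum_codeg[symmetric, OF finV]) (auto simp: nsets_def)
  also have "\<dots> = (\<Sum>i\<in>V. \<Sum>j\<in>V. \<Sum>k\<in>V. b {j, k} * b {i, k}) - (\<Sum>i\<in>V. \<Sum>k\<in>V. (b {i, k})\<^sup>2)"
  proof -
    have "(\<Sum>j\<in>V. \<Sum>k\<in>V. ?r {i, j} * b {j, k} * b {i, k})
        = (\<Sum>j\<in>V. \<Sum>k\<in>V. b {j, k} * b {i, k}) - (\<Sum>k\<in>V. (b {i, k})\<^sup>2)" if i: "i \<in> V" for i
    proof -
      have "(\<Sum>j\<in>V. \<Sum>k\<in>V. ?r {i, j} * b {j, k} * b {i, k}) = (\<Sum>j\<in>V - {i}. \<Sum>k\<in>V. b {j, k} * b {i, k})"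
        using finV i by (intro sum.mono_neutral_cong_right) (auto simp: nsets_def)
      then show ?thesis using finV i by (simp add: sum_diff1 power2_eq_square)
    qed
    then show ?thesis unfolding tri_def by (simp add: sum_subtractf)
  qed
  also have "(\<Sum>i\<in>V. \<Sum>j\<in>V. \<Sum>k\<in>V. b {j, k} * b {i, k}) = (\<Sum>k\<in>V. (be k)\<^sup>2)"
  proof -
    have "(\<Sum>i\<in>V. \<Sum>j\<in>V. \<Sum>k\<in>V. b {j, k} * b {i, k}) = (\<Sum>i\<in>V. \<Sum>k\<in>V. \<Sum>j\<in>V. b {j, k} * b {i, k})"
      by (intro sum.cong refl sum.swap)
    also have "\<dots> = (\<Sum>k\<in>V. \<Sum>i\<in>V. \<Sum>j\<in>V. b {j, k} * b {i, k})" by (rule sum.swap)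
    also have "\<dots> = (\<Sum>k\<in>V. (be k)\<^sup>2)"
      by (intro sum.cong refl) (simp add: be_def wdeg_def power2_eq_square sum_product insert_commute mult.commute)
    finally show ?thesis .
  qed
  finally show ?thesis by (simp add: Z2_def)
qed

section \<open>Expansion of the degree and triangle sums around the random part\<close>

definition err2 where
  "err2 = \<bar>Z2\<bar> + 2 * \<bar>Z1\<bar> + 2 * real (card R) + 4 * (real c * \<bar>Z1\<bar>) + \<bar>Z3\<bar> + Z4 + 9 * real c * real (card R)"

definition err3 where
  "err3 = \<bar>Z7\<bar> + 3 * (\<bar>\<pi> - p\<bar> * \<bar>Z2\<bar>) + 3 * \<bar>Z8\<bar> + 3 * Z9 + 36 * real c * real (card R)"

text \<open>Expand the square of random plus perturbing degree. In the cross term the third group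
  cancels, since each vertex of a gadget meets one pair of either sign, and the second group gives
  the \<open>\<Delta> t\<close>. The rest goes into \<open>err2\<close>.\<close>

lemma sum_sq_formula:
  assumes F2: "F \<inter> R2 = F2 \<T>2" and F3: "F \<inter> R3 = F3 \<T>3"
  shows "\<bar>(\<Sum>i\<in>V. (wdeg V (al F) i)\<^sup>2) - p * (1 - p) * real (card V) * (real (card V) - 1)
     - 2 * real c * (\<Sum>t\<in>T2. (if t \<in> \<T>2 then 1 else - 1) * \<Delta> t)\<bar> \<le> err2"
proof -
  let ?n = "real (card V)" and ?\<rho> = "wdeg V (rr F)" and ?S = "\<Sum>t\<in>T2. (if t \<in> \<T>2 then 1 else - 1) * \<Delta> t"
  have s2: "(\<Sum>e\<in>R2. (of_bool (e \<in> F) - 1 / 2) * D e) = real c * ?S"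
  proof -
    have "(\<Sum>e\<in>R2. (of_bool (e \<in> F) - 1 / 2) * D e)
        = (\<Sum>(B, x)\<in>T2. (if (B, x) \<in> \<T>2 then 1 / 2 else - 1 / 2) * (2 * real c * \<Delta> (B, x)))"
      unfolding sum_R2[OF F2]
    proof (intro sum.cong refl, clarify, intro arg_cong[where f = "(*) _"])
      fix B x assume "(B, x) \<in> T2"
      then have b: "B < l" "x < c" by (auto simp: T2_def)
      have ne: "lv B x \<sigma> \<noteq> rv B y \<tau>" if "y < c" for \<sigma> y \<tau> using lv_rv[OF b(1,2,1) that] .
      have "(\<Sum>y<c. D (pr (B, x, False, y, False)) - D (pr (B, x, True, y, True))
          + D (pr (B, x, False, y, True)) - D (pr (B, x, True, y, False))) = (\<Sum>y<c. 2 * \<Delta> (B, x))"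
        by (intro sum.cong refl) (simp add: D_pair ne \<Delta>_def)
      then show "(\<Sum>y<c. D (pr (B, x, False, y, False)) - D (pr (B, x, True, y, True))
          + D (pr (B, x, False, y, True)) - D (pr (B, x, True, y, False))) = 2 * real c * \<Delta> (B, x)" by simp
    qed
    also have "\<dots> = real c * ?S"
      unfolding sum_distrib_left by (intro sum.cong refl) auto
    finally show ?thesis .
  qed
  have s3: "(\<Sum>e\<in>R3. (of_bool (e \<in> F) - 1 / 2) * D e) = 0"
    unfolding sum_R3[OF F3]
  proof (intro sum.neutral ballI, clarify)
    fix B x y assume "(B, x, y) \<in> T3"
    then have b: "B < l" "x < c" "y < c" by (auto simp: T3_def)
    have "lv B x \<sigma> \<noteq> rv B y \<tau>" for \<sigma> \<tau> using lv_rv[OF b(1,2,1,3)] .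
    then show "(if (B, x, y) \<in> \<T>3 then 1 / 2 else - 1 / 2) * (D (pr (B, x, False, y, False)) + D (pr (B, x, True, y, True))
        - D (pr (B, x, False, y, True)) - D (pr (B, x, True, y, False))) = 0" by (simp add: D_pair)
  qed
  have "(\<Sum>i\<in>V. ?\<rho> i * be i) = (\<Sum>e\<in>[V]\<^bsup>2\<^esup>. rr F e * D e)"
    unfolding be_def D_def by (rule sum_wdeg_mult_wdeg[where r = "rr F", OF finV rr_single])
  also have "\<dots> = (\<pi> - p) * ((?n - 1) * (2 * Z1)) + (1 / 2 - \<pi>) * Z3
      + ((\<Sum>e\<in>R1. (of_bool (e \<in> F) - 1 / 2) * D e) + real c * ?S)"
    unfolding sum_rr_split sum_D_all Z3_def sum_R_split[of "\<lambda>e. (of_bool (e \<in> F) - 1 / 2) * D e"] s2 s3 by simp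
  finally have rb: "(\<Sum>i\<in>V. ?\<rho> i * be i) = (\<pi> - p) * ((?n - 1) * (2 * Z1)) + (1 / 2 - \<pi>) * Z3
      + ((\<Sum>e\<in>R1. (of_bool (e \<in> F) - 1 / 2) * D e) + real c * ?S)" .
  have "(\<Sum>i\<in>V. (wdeg V (al F) i)\<^sup>2) = (\<Sum>i\<in>V. (be i)\<^sup>2 + 2 * (?\<rho> i * be i) + (?\<rho> i)\<^sup>2)"
    by (intro sum.cong refl) (simp add: wdeg_al power2_sum)
  also have "\<dots> = (\<Sum>i\<in>V. (be i)\<^sup>2) + 2 * (\<Sum>i\<in>V. ?\<rho> i * be i) + (\<Sum>i\<in>V. (?\<rho> i)\<^sup>2)"
    by (simp add: sum.distrib sum_distrib_left)
  finally have main: "(\<Sum>i\<in>V. (wdeg V (al F) i)\<^sup>2) - 2 * real c * ?S = Z2 + 2 * ((1 - 2 * \<pi>) * Z1)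
      + 2 * (\<pi> * (1 - \<pi>) * real (card P)) + 4 * ((\<pi> - p) * (?n - 1) * Z1) + 2 * ((1 / 2 - \<pi>) * Z3)
      + 2 * (\<Sum>e\<in>R1. (of_bool (e \<in> F) - 1 / 2) * D e) + (\<Sum>i\<in>V. (?\<rho> i)\<^sup>2)"
    using Z2_def sum_b_sq rb by (simp add: algebra_simps)
  have a1: "\<bar>(1 - 2 * \<pi>) * Z1\<bar> \<le> 1 * \<bar>Z1\<bar>"
    unfolding abs_mult using \<pi>01 by (intro mult_right_mono) auto
  \<comment> \<open>The variances differ by (1 - \<open>\<pi>\<close> - p) (\<open>\<pi>\<close> -
    p), and (\<open>\<pi>\<close> - p) times the size of \<open>P\<close> is at most half the size
    of \<open>R\<close> by the balance.\<close>
  have a2: "\<bar>2 * (\<pi> * (1 - \<pi>) * real (card P)) - p * (1 - p) * ?n * (?n - 1)\<bar> \<le> 2 * real (card R)"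
  proof -
    have "?n * (?n - 1) = 2 * real (card P) + 2 * real (card R)" using card_PR by simp
    then have "p * (1 - p) * ?n * (?n - 1) = p * (1 - p) * (2 * real (card P) + 2 * real (card R))"
      by (simp only: mult.assoc)
    then have "2 * (\<pi> * (1 - \<pi>) * real (card P)) - p * (1 - p) * ?n * (?n - 1)
        = 2 * ((1 - \<pi> - p) * ((\<pi> - p) * real (card P))) - 2 * (p * (1 - p) * real (card R))"
      by (simp add: algebra_simps)
    moreover have "\<bar>(1 - \<pi> - p) * ((\<pi> - p) * real (card P))\<bar> \<le> 1 * (real (card R) / 2)"
      unfolding abs_mult[of "1 - \<pi> - p"] using p01 \<pi>01 abs_delta_card_P
      by (intro mult_mono) (auto simp: abs_mult)
    moreover have "\<bar>p * (1 - p) * real (card R)\<bar> \<le> 1 / 4 * real (card R)"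
    proof -
      have "p * (1 - p) \<le> 1 / 4" using sum_squares_ge_zero[of "p - 1 / 2" 0] by (simp add: algebra_simps power2_eq_square)
      from mult_right_mono[OF this, of "real (card R)"] show ?thesis using p01 by (simp add: abs_mult)
    qed
    ultimately show ?thesis by linarith
  qed
  have a3: "\<bar>(\<pi> - p) * (?n - 1) * Z1\<bar> \<le> real c * \<bar>Z1\<bar>"
  proof (cases "card V = 0")
    case True
    then have "V = {}" using finV by simp
    then have "[V]\<^bsup>2\<^esup> = {}" by (auto simp: nsets_def)
    then have "P = {}" using PR(1) by blast
    then show ?thesis by (simp add: Z1_def)
  next
    case False
    have "\<bar>(\<pi> - p) * (?n - 1)\<bar> \<le> \<bar>\<pi> - p\<bar> * ?n"
      unfolding abs_mult using False by (intro mult_left_mono) (auto simp: abs_if)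
    then have "\<bar>(\<pi> - p) * (?n - 1)\<bar> \<le> real c" using dl by (simp add: mult.commute)
    then show ?thesis unfolding abs_mult[of "(\<pi> - p) * (?n - 1)"] by (intro mult_right_mono) auto
  qed
  have a4: "\<bar>(1 / 2 - \<pi>) * Z3\<bar> \<le> 1 / 2 * \<bar>Z3\<bar>"
    unfolding abs_mult using \<pi>01 by (intro mult_right_mono) (auto simp: abs_if)
  have a5: "\<bar>\<Sum>e\<in>R1. (of_bool (e \<in> F) - 1 / 2) * D e\<bar> \<le> 1 / 2 * Z4" unfolding Z4_def by (rule abs_sum_half)
  have a6: "\<bar>\<Sum>i\<in>V. (?\<rho> i)\<^sup>2\<bar> \<le> 9 * real c * real (card R)"
  proof -
    have "(\<Sum>i\<in>V. (?\<rho> i)\<^sup>2) \<le> (\<Sum>i\<in>V. (wdeg V rho i)\<^sup>2)"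
      using abs_wdeg_rr[of F] wdeg_rho_nonneg by (intro sum_mono) (metis abs_ge_zero power2_abs power_mono)
    then show ?thesis using sum_wdeg_rho_sq by (simp add: sum_nonneg)
  qed
  have lin: "\<bar>T - K - Q\<bar> \<le> \<bar>Z\<bar> + 2 * z1 + y2 + 4 * y3 + z3 + z4 + y6"
    if "T - Q = Z + 2 * A1 + A2 + 4 * A3 + 2 * A4 + 2 * A5 + A6" "\<bar>A1\<bar> \<le> 1 * z1" "\<bar>A2 - K\<bar> \<le> y2"
      "\<bar>A3\<bar> \<le> y3" "\<bar>A4\<bar> \<le> 1 / 2 * z3" "\<bar>A5\<bar> \<le> 1 / 2 * z4" "\<bar>A6\<bar> \<le> y6"
    for T K Q Z A1 A2 A3 A4 A5 A6 z1 y2 y3 z3 z4 y6 :: real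
    using that abs_ge_self[of Z] abs_ge_minus_self[of Z] unfolding abs_le_iff by linarith
  show ?thesis unfolding err2_def by (rule lin[OF main a1 a2 a3 a4 a5 a6])
qed

text \<open>The linear term of \<open>tri_perturb\<close> is a sum of codegrees over pairs, and the
  four pairs of a gadget of the third group combine to \<open>g t\<close>. The first two groups are
  already fixed when the third is chosen, so they are only bounded, by \<open>Z9\<close>. The higher
  terms cost 4 times the bound of \<open>sum_wdeg_rho_sq\<close>.\<close>

lemma tri_formula:
  assumes F3: "F \<inter> R3 = F3 \<T>3"
  shows "\<bar>tri V (al F) (al F) (al F) - 3 * (\<Sum>t\<in>T3. (if t \<in> \<T>3 then 1 else - 1) * g t)\<bar> \<le> err3"
proof -
  let ?S = "\<Sum>t\<in>T3. (if t \<in> \<T>3 then 1 else - 1) * g t"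
  have s3: "(\<Sum>e\<in>R3. (of_bool (e \<in> F) - 1 / 2) * C e) = 1 / 2 * ?S"
    unfolding sum_R3[OF F3] sum_distrib_left
  proof (intro sum.cong refl, clarify)
    fix B x y assume "(B, x, y) \<in> T3"
    then have b: "B < l" "x < c" "y < c" by (auto simp: T3_def)
    have ne: "lv B x \<sigma> \<noteq> rv B y \<tau>" for \<sigma> \<tau> using lv_rv[OF b(1,2,1,3)] .
    have "C (pr (B, x, False, y, False)) + C (pr (B, x, True, y, True))
        - C (pr (B, x, False, y, True)) - C (pr (B, x, True, y, False)) = g (B, x, y)"
      by (simp add: C_pair ne g_def algebra_simps sum.distrib sum_subtractf)
    then show "(if (B, x, y) \<in> \<T>3 then 1 / 2 else - 1 / 2) * (C (pr (B, x, False, y, False)) + C (pr (B, x, True, y, True))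
        - C (pr (B, x, False, y, True)) - C (pr (B, x, True, y, False)))
        = 1 / 2 * ((if (B, x, y) \<in> \<T>3 then 1 else - 1) * g (B, x, y))" by simp
  qed
  have "tri V (rr F) b b = 2 * (\<Sum>e\<in>[V]\<^bsup>2\<^esup>. rr F e * C e)"
    unfolding C_def by (rule tri_eq_sum_codeg[where r = "rr F", OF finV rr_single])
  also have "\<dots> = (\<pi> - p) * Z2 + 2 * ((1 / 2 - \<pi>) * Z8) + 2 * ((\<Sum>e\<in>R1. (of_bool (e \<in> F) - 1 / 2) * C e)
      + (\<Sum>e\<in>R2. (of_bool (e \<in> F) - 1 / 2) * C e)) + ?S"
    unfolding sum_rr_split sum_R_split[of "\<lambda>e. (of_bool (e \<in> F) - 1 / 2) * C e"] s3 Z8_def sum_C_all[symmetric]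
    by (simp add: algebra_simps)
  finally have t: "tri V (rr F) b b = (\<pi> - p) * Z2 + 2 * ((1 / 2 - \<pi>) * Z8) + 2 * ((\<Sum>e\<in>R1. (of_bool (e \<in> F) - 1 / 2) * C e)
      + (\<Sum>e\<in>R2. (of_bool (e \<in> F) - 1 / 2) * C e)) + ?S" .
  have pert: "\<bar>tri V (al F) (al F) (al F) - Z7 - 3 * tri V (rr F) b b\<bar> \<le> 36 * real c * real (card R)"
    using tri_perturb[of "rr F" rho b V] abs_rr b1 sum_wdeg_rho_sq unfolding Z7_def al_def[abs_def] by force
  have a1: "\<bar>(1 / 2 - \<pi>) * Z8\<bar> \<le> 1 / 2 * \<bar>Z8\<bar>"
    unfolding abs_mult using \<pi>01 by (intro mult_right_mono) (auto simp: abs_if)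
  have a2: "\<bar>\<Sum>e\<in>R1. (of_bool (e \<in> F) - 1 / 2) * C e\<bar> \<le> 1 / 2 * (\<Sum>e\<in>R1. \<bar>C e\<bar>)"
    "\<bar>\<Sum>e\<in>R2. (of_bool (e \<in> F) - 1 / 2) * C e\<bar> \<le> 1 / 2 * (\<Sum>e\<in>R2. \<bar>C e\<bar>)" by (rule abs_sum_half)+
  have a3: "\<bar>(\<pi> - p) * Z2\<bar> = \<bar>\<pi> - p\<bar> * \<bar>Z2\<bar>" by (rule abs_mult)
  have lin: "\<bar>X - 3 * S\<bar> \<le> \<bar>Y\<bar> + 3 * \<bar>A\<bar> + 3 * z + 3 * (u + w) + E"
    if "W = A + 2 * B + 2 * (G + H) + S" "\<bar>X - Y - 3 * W\<bar> \<le> E" "\<bar>B\<bar> \<le> 1 / 2 * z" "\<bar>G\<bar> \<le> 1 / 2 * u" "\<bar>H\<bar> \<le> 1 / 2 * w"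
    for X S Y A B G H W z u w E :: real
    using that unfolding distrib_left by linarith
  show ?thesis unfolding err3_def Z9_def a3[symmetric] by (rule lin[OF t pert a1 a2])
qed

end

section \<open>Choosing the configuration\<close>

lemma wdeg_eq_sum_pairs:
  assumes V: "finite V" and i: "i \<in> V" and r: "r {i} = 0"
  shows "wdeg V r i = (\<Sum>e\<in>[V]\<^bsup>2\<^esup>. r e * of_bool (i \<in> e))"
proof -
  have inj: "inj_on (\<lambda>w. {i, w}) (V - {i})" by (auto simp: inj_on_def doubleton_eq_iff)
  have im: "(\<lambda>w. {i, w}) ` (V - {i}) = {e \<in> [V]\<^bsup>2\<^esup>. i \<in> e}"
    using i unfolding nsets_2_eq by auto
  have "wdeg V r i = (\<Sum>w\<in>V - {i}. r {i, w})"
    unfolding wdeg_def using V r by (intro sum.mono_neutral_right) auto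
  also have "\<dots> = (\<Sum>e\<in>{e \<in> [V]\<^bsup>2\<^esup>. i \<in> e}. r e)"
    unfolding im[symmetric] by (simp add: sum.reindex[OF inj])
  also have "\<dots> = (\<Sum>e\<in>[V]\<^bsup>2\<^esup>. r e * of_bool (i \<in> e))"
    using V by (intro sum.mono_neutral_cong_left) (auto simp: finite_imp_finite_nsets)
  finally show ?thesis .
qed

section \<open>Effect of single switches, and the choice of all switches\<close>

context gadget_bits
begin

definition cfg :: "'a set set \<Rightarrow> (nat \<times> nat) set \<Rightarrow> (nat \<times> nat \<times> nat) set \<Rightarrow> 'a set set" where
  "cfg F1 \<T>2 \<T>3 = F1 \<union> F2 \<T>2 \<union> F3 \<T>3"

lemma cfg_inter:
  assumes "F1 \<subseteq> R1"
  shows "cfg F1 \<T>2 \<T>3 \<inter> R1 = F1" "cfg F1 \<T>2 \<T>3 \<inter> R2 = F2 \<T>2" "cfg F1 \<T>2 \<T>3 \<inter> R3 = F3 \<T>3"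
    "cfg F1 \<T>2 \<T>3 \<subseteq> R"
  using assms F2_sub[of \<T>2] F3_sub[of \<T>3] R_disj R_split unfolding cfg_def by blast+

text \<open>This explicit form shows that a degree depends on the first group and on the switches of
  the second, but not on those of the third.\<close>

lemma wdeg_al_eq:
  assumes F: "F \<inter> R2 = F2 \<T>2" "F \<inter> R3 = F3 \<T>3" and i: "i \<in> V"
  shows "wdeg V (al F) i = be i + ((\<pi> - p) * (\<Sum>e\<in>[V]\<^bsup>2\<^esup>. of_bool (i \<in> e)) + (1 / 2 - \<pi>) * (\<Sum>e\<in>R. of_bool (i \<in> e))
      + (\<Sum>e\<in>R1. (of_bool (e \<in> F) - 1 / 2) * of_bool (i \<in> e)))
      + real c * (\<Sum>(B, x)\<in>T2. (if (B, x) \<in> \<T>2 then 1 else - 1) * (of_bool (i = lv B x False) - of_bool (i = lv B x True)))"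
proof -
  let ?f = "\<lambda>e. of_bool (i \<in> e) :: real"
  have ne: "?f (pr (B, x, \<sigma>, y, \<tau>)) = of_bool (i = lv B x \<sigma>) + of_bool (i = rv B y \<tau>)"
    if "B < l" "x < c" "y < c" for B x \<sigma> y \<tau>
    using lv_rv[OF that(1,2,1,3), of \<sigma> \<tau>] by auto
  have s2: "(\<Sum>e\<in>R2. (of_bool (e \<in> F) - 1 / 2) * ?f e)
      = real c * (\<Sum>(B, x)\<in>T2. (if (B, x) \<in> \<T>2 then 1 else - 1) * (of_bool (i = lv B x False) - of_bool (i = lv B x True)))"
    unfolding sum_R2[OF F(1)] sum_distrib_left
  proof (intro sum.cong refl, clarify)
    fix B x assume "(B, x) \<in> T2"
    then have b: "B < l" "x < c" by (auto simp: T2_def)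
    have "(\<Sum>y<c. ?f (pr (B, x, False, y, False)) - ?f (pr (B, x, True, y, True))
        + ?f (pr (B, x, False, y, True)) - ?f (pr (B, x, True, y, False)))
        = (\<Sum>y<c. 2 * (of_bool (i = lv B x False) - of_bool (i = lv B x True)))"
      by (intro sum.cong refl) (simp add: ne b del: pr.simps)
    then show "(\<Sum>y<c. (if (B, x) \<in> \<T>2 then 1 / 2 else - 1 / 2) * (?f (pr (B, x, False, y, False)) - ?f (pr (B, x, True, y, True))
        + ?f (pr (B, x, False, y, True)) - ?f (pr (B, x, True, y, False))))
        = real c * ((if (B, x) \<in> \<T>2 then 1 else - 1) * (of_bool (i = lv B x False) - of_bool (i = lv B x True)))"
      unfolding sum_distrib_left[symmetric] by simp
  qed
  have s3: "(\<Sum>e\<in>R3. (of_bool (e \<in> F) - 1 / 2) * ?f e) = 0"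
    unfolding sum_R3[OF F(2)]
  proof (intro sum.neutral ballI, clarify)
    fix B x y assume "(B, x, y) \<in> T3"
    then have b: "B < l" "x < c" "y < c" by (auto simp: T3_def)
    show "(if (B, x, y) \<in> \<T>3 then 1 / 2 else - 1 / 2) * (?f (pr (B, x, False, y, False)) + ?f (pr (B, x, True, y, True))
        - ?f (pr (B, x, False, y, True)) - ?f (pr (B, x, True, y, False))) = 0" by (simp add: ne b del: pr.simps)
  qed
  have "wdeg V (rr F) i = (\<Sum>e\<in>[V]\<^bsup>2\<^esup>. rr F e * ?f e)" by (rule wdeg_eq_sum_pairs[where r = "rr F", OF finV i rr_single])
  then show ?thesis
    unfolding wdeg_al sum_rr_split sum_R_split[of "\<lambda>e. (of_bool (e \<in> F) - 1 / 2) * ?f e"] s2 s3 by simp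
qed

lemma wdeg_al_cfg3:
  assumes "F1 \<subseteq> R1" "i \<in> V"
  shows "wdeg V (al (cfg F1 \<T>2 \<T>3)) i = wdeg V (al (cfg F1 \<T>2 \<T>3')) i"
proof -
  have "(e \<in> cfg F1 \<T>2 \<T>3) = (e \<in> cfg F1 \<T>2 \<T>3')" if "e \<in> R1" for e
    using cfg_inter(1)[OF assms(1)] that by blast
  then have "(\<Sum>e\<in>R1. (of_bool (e \<in> cfg F1 \<T>2 \<T>3) - 1 / 2) * of_bool (i \<in> e))
      = (\<Sum>e\<in>R1. (of_bool (e \<in> cfg F1 \<T>2 \<T>3') - 1 / 2) * (of_bool (i \<in> e) :: real))"
    by (intro sum.cong) auto
  then show ?thesis
    unfolding wdeg_al_eq[OF cfg_inter(2,3)[OF assms(1)] assms(2)] by simp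
qed

lemma finite_T2: "finite T2" and finite_T3: "finite T3" by (auto simp: T2_def T3_def)

text \<open>Inserting the switch joins one twin to all 2 c right vertices of its block and separates
  the other twin from them.\<close>

lemma wdeg_al_insert:
  assumes F1: "F1 \<subseteq> R1" and i: "i \<in> V" and t: "(B, x) \<in> T2 - \<T>2"
  shows "wdeg V (al (cfg F1 (insert (B, x) \<T>2) \<T>3)) i = wdeg V (al (cfg F1 \<T>2 \<T>3)) i
     + 2 * real c * (of_bool (i = lv B x False) - of_bool (i = lv B x True))"
proof -
  let ?\<xi> = "\<lambda>t. case t of (B, x) \<Rightarrow> (of_bool (i = lv B x False) - of_bool (i = lv B x True) :: real)"
  have "(e \<in> cfg F1 (insert (B, x) \<T>2) \<T>3) = (e \<in> cfg F1 \<T>2 \<T>3)" if "e \<in> R1" for e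
    using cfg_inter(1)[OF F1] that by blast
  then have s1: "(\<Sum>e\<in>R1. (of_bool (e \<in> cfg F1 (insert (B, x) \<T>2) \<T>3) - 1 / 2) * of_bool (i \<in> e))
      = (\<Sum>e\<in>R1. (of_bool (e \<in> cfg F1 \<T>2 \<T>3) - 1 / 2) * (of_bool (i \<in> e) :: real))"
    by (intro sum.cong) auto
  have "(\<Sum>t\<in>T2. (if t \<in> insert (B, x) \<T>2 then 1 else - 1) * ?\<xi> t)
      = (\<Sum>t\<in>T2. (if t \<in> \<T>2 then 1 else - 1) * ?\<xi> t + (if t = (B, x) then 2 * ?\<xi> t else 0))"
    using t by (intro sum.cong) auto
  also have "\<dots> = (\<Sum>t\<in>T2. (if t \<in> \<T>2 then 1 else - 1) * ?\<xi> t) + 2 * ?\<xi> (B, x)"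
    using t finite_T2 by (simp add: sum.distrib)
  finally have s2: "(\<Sum>t\<in>T2. (if t \<in> insert (B, x) \<T>2 then 1 else - 1) * ?\<xi> t)
      = (\<Sum>t\<in>T2. (if t \<in> \<T>2 then 1 else - 1) * ?\<xi> t) + 2 * ?\<xi> (B, x)" .
  have conv: "(\<Sum>(B, x)\<in>T2. (if (B, x) \<in> \<T> then 1 else - 1) * (of_bool (i = lv B x False) - of_bool (i = lv B x True)))
      = (\<Sum>t\<in>T2. (if t \<in> \<T> then 1 else - 1) * ?\<xi> t)" for \<T>
    by (intro sum.cong refl) (auto split: prod.splits)
  show ?thesis
    unfolding wdeg_al_eq[OF cfg_inter(2,3)[OF F1] i] s1 conv s2 by (simp add: algebra_simps)
qed

text \<open>The squared degrees of the twins u and v change by 4 c d(u) + 4 c^2 and by - 4 c d(v) +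
  4 c^2. The difference of the degrees is \<open>\<Delta> t\<close> up to 3 c for each twin from the
  perturbation.\<close>

lemma sum_sq_step:
  assumes F1: "F1 \<subseteq> R1" and t: "t \<in> T2 - \<T>2" and M: "\<bar>\<Delta> t\<bar> \<le> M"
  shows "\<bar>(\<Sum>i\<in>V. (wdeg V (al (cfg F1 (insert t \<T>2) \<T>3)) i)\<^sup>2) - (\<Sum>i\<in>V. (wdeg V (al (cfg F1 \<T>2 \<T>3)) i)\<^sup>2)\<bar>
     \<le> 4 * real c * (M + 6 * real c) + 8 * (real c)\<^sup>2"
proof -
  obtain B x where Bx: "t = (B, x)" by (cases t) auto
  have b: "B < l" "x < c" using t Bx by (auto simp: T2_def)
  let ?u = "lv B x False" and ?v = "lv B x True" and ?d = "wdeg V (al (cfg F1 \<T>2 \<T>3))"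
  have uV: "?u \<in> V" "?v \<in> V" using lvV[OF b] by auto
  have uv: "?u \<noteq> ?v" using lv_inj[OF b b, of False True] by auto
  have "(\<Sum>i\<in>V. (wdeg V (al (cfg F1 (insert t \<T>2) \<T>3)) i)\<^sup>2)
      = (\<Sum>i\<in>V. (?d i)\<^sup>2 + (if i = ?u then 4 * real c * ?d i + 4 * (real c)\<^sup>2 else 0)
           + (if i = ?v then - (4 * real c * ?d i) + 4 * (real c)\<^sup>2 else 0))"
  proof (intro sum.cong refl)
    fix i assume i: "i \<in> V"
    have eq: "wdeg V (al (cfg F1 (insert t \<T>2) \<T>3)) i = ?d i + 2 * real c * (of_bool (i = ?u) - of_bool (i = ?v))"
      unfolding Bx by (rule wdeg_al_insert[OF F1 i]) (use t Bx in auto)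
    show "(wdeg V (al (cfg F1 (insert t \<T>2) \<T>3)) i)\<^sup>2
        = (?d i)\<^sup>2 + (if i = ?u then 4 * real c * ?d i + 4 * (real c)\<^sup>2 else 0)
           + (if i = ?v then - (4 * real c * ?d i) + 4 * (real c)\<^sup>2 else 0)"
      unfolding eq using uv by (auto simp: power2_eq_square algebra_simps)
  qed
  also have "\<dots> = (\<Sum>i\<in>V. (?d i)\<^sup>2) + (4 * real c * ?d ?u + 4 * (real c)\<^sup>2) + (- (4 * real c * ?d ?v) + 4 * (real c)\<^sup>2)"
    using uV finV by (simp add: sum.distrib)
  finally have eq: "(\<Sum>i\<in>V. (wdeg V (al (cfg F1 (insert t \<T>2) \<T>3)) i)\<^sup>2) - (\<Sum>i\<in>V. (?d i)\<^sup>2)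
      = 4 * real c * (?d ?u - ?d ?v) + 8 * (real c)\<^sup>2" by (simp add: algebra_simps)
  have "?d ?u - ?d ?v = \<Delta> t + (wdeg V (rr (cfg F1 \<T>2 \<T>3)) ?u - wdeg V (rr (cfg F1 \<T>2 \<T>3)) ?v)"
    unfolding wdeg_al by (simp add: \<Delta>_def Bx)
  moreover have "\<bar>wdeg V (rr (cfg F1 \<T>2 \<T>3)) ?u\<bar> \<le> 3 * real c" "\<bar>wdeg V (rr (cfg F1 \<T>2 \<T>3)) ?v\<bar> \<le> 3 * real c"
    using abs_wdeg_rr wdeg_rho uV order_trans by blast+
  ultimately have "\<bar>?d ?u - ?d ?v\<bar> \<le> M + 6 * real c" using M by linarith
  then have "\<bar>4 * real c * (?d ?u - ?d ?v)\<bar> \<le> 4 * real c * (M + 6 * real c)"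
    unfolding abs_mult by (intro mult_mono) auto
  then show ?thesis unfolding eq by (smt (verit) zero_le_power2)
qed

text \<open>Both differences are at most 2 in absolute value, and replacing \<open>b\<close> by
  \<open>al\<close> costs the total perturbation 3 c at each of the four vertices: 4 * 2 * 3 =
  24.\<close>

lemma abs_diff_codeg_le:
  assumes V: "u0 \<in> V" "u1 \<in> V" "v0 \<in> V" "v1 \<in> V"
  shows "\<bar>(\<Sum>k\<in>V. (al F {u0, k} - al F {u1, k}) * (al F {v0, k} - al F {v1, k}))
     - (\<Sum>k\<in>V. (b {u0, k} - b {u1, k}) * (b {v0, k} - b {v1, k}))\<bar> \<le> 24 * real c"
proof -
  have "\<bar>(\<Sum>k\<in>V. (al F {u0, k} - al F {u1, k}) * (al F {v0, k} - al F {v1, k}))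
     - (\<Sum>k\<in>V. (b {u0, k} - b {u1, k}) * (b {v0, k} - b {v1, k}))\<bar>
     \<le> (\<Sum>k\<in>V. \<bar>(al F {u0, k} - al F {u1, k}) * (al F {v0, k} - al F {v1, k})
          - (b {u0, k} - b {u1, k}) * (b {v0, k} - b {v1, k})\<bar>)"
    unfolding sum_subtractf[symmetric] by (rule sum_abs)
  also have "\<dots> \<le> (\<Sum>k\<in>V. 2 * rho {u0, k} + 2 * rho {u1, k} + 2 * rho {v0, k} + 2 * rho {v1, k})"
  proof (rule sum_mono)
    fix k
    define x y X Y where "x = b {u0, k} - b {u1, k}" "y = b {v0, k} - b {v1, k}"
      "X = al F {u0, k} - al F {u1, k}" "Y = al F {v0, k} - al F {v1, k}"
    have "\<bar>X - x\<bar> \<le> rho {u0, k} + rho {u1, k}"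
      using abs_rr(1)[of F "{u0, k}"] abs_rr(1)[of F "{u1, k}"] by (simp add: x_y_X_Y_def al_def)
    moreover have "\<bar>Y - y\<bar> \<le> rho {v0, k} + rho {v1, k}"
      using abs_rr(1)[of F "{v0, k}"] abs_rr(1)[of F "{v1, k}"] by (simp add: x_y_X_Y_def al_def)
    moreover have "\<bar>Y\<bar> \<le> 2" using abs_al[of F "{v0, k}"] abs_al[of F "{v1, k}"] by (simp add: x_y_X_Y_def)
    moreover have "\<bar>x\<bar> \<le> 2" using b1[of "{u0, k}"] b1[of "{u1, k}"] by (simp add: x_y_X_Y_def)
    ultimately have "\<bar>X - x\<bar> * \<bar>Y\<bar> \<le> (rho {u0, k} + rho {u1, k}) * 2" "\<bar>x\<bar> * \<bar>Y - y\<bar> \<le> 2 * (rho {v0, k} + rho {v1, k})"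
      by (intro mult_mono; simp add: rho0)+
    moreover have "X * Y - x * y = (X - x) * Y + x * (Y - y)" by (simp add: algebra_simps)
    then have "\<bar>X * Y - x * y\<bar> \<le> \<bar>X - x\<bar> * \<bar>Y\<bar> + \<bar>x\<bar> * \<bar>Y - y\<bar>" by (metis abs_mult abs_triangle_ineq)
    ultimately show "\<bar>X * Y - x * y\<bar> \<le> 2 * rho {u0, k} + 2 * rho {u1, k} + 2 * rho {v0, k} + 2 * rho {v1, k}"
      by simp
  qed
  also have "\<dots> = 2 * wdeg V rho u0 + 2 * wdeg V rho u1 + 2 * wdeg V rho v0 + 2 * wdeg V rho v1"
    by (simp add: wdeg_def sum.distrib sum_distrib_left)
  also have "\<dots> \<le> 24 * real c" using wdeg_rho[OF V(1)] wdeg_rho[OF V(2)] wdeg_rho[OF V(3)] wdeg_rho[OF V(4)] by linarith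
  finally show ?thesis .
qed

text \<open>The linear effect is three times twice the alternating codegree sum of the gadget; taken
  for the present \<open>al\<close> instead of \<open>b\<close>, this sum is at most
  \<open>M + 24 * real c\<close>. The 256 bounds the terms of higher order in the four switched
  pairs.\<close>

lemma tri_step:
  fixes \<T>2 :: "(nat \<times> nat) set"
  assumes F1: "F1 \<subseteq> R1" and t: "t \<in> T3 - \<T>3" and M: "\<bar>g t\<bar> \<le> M"
  defines "F \<equiv> cfg F1 \<T>2 \<T>3" and "F' \<equiv> cfg F1 \<T>2 (insert t \<T>3)"
  shows "\<bar>tri V (al F') (al F') (al F') - tri V (al F) (al F) (al F)\<bar> \<le> 6 * (M + 24 * real c) + 256"
proof -
  obtain B x y where Bxy: "t = (B, x, y)" by (cases t) auto
  have b: "B < l" "x < c" "y < c" using t Bxy by (auto simp: T3_def)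
  have BI: "B \<in> {l1 + l2..<l}" using t Bxy by (auto simp: T3_def)
  define \<xi> :: "'a set \<Rightarrow> real" where "\<xi> e = of_bool (e \<in> F') - of_bool (e \<in> F)" for e
  define X where "X = {(B, x, False, y, False), (B, x, True, y, True), (B, x, False, y, True), (B, x, True, y, False)}"
  have XI: "X \<subseteq> idx 0 l" using b by (auto simp: X_def idx_def)
  have FR: "F \<subseteq> R" "F' \<subseteq> R" using cfg_inter(4)[OF F1] by (auto simp: F_def F'_def)
  have I: "F \<inter> R3 = F3 \<T>3" "F' \<inter> R3 = F3 (insert t \<T>3)" "F \<inter> R2 = F' \<inter> R2" "F \<inter> R1 = F' \<inter> R1"
    using cfg_inter[OF F1] by (auto simp: F_def F'_def)
  have al': "al F' e = al F e + \<xi> e" for e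
    using FR PR by (auto simp: al_def rr_def \<xi>_def)
  have off3: "\<xi> e = 0" if "e \<notin> R3" for e
  proof -
    have "e \<in> F \<longleftrightarrow> e \<in> F'" using I FR R_split that by blast
    then show ?thesis by (simp add: \<xi>_def)
  qed
  have supp: "\<xi> e = 0" if "e \<notin> pr ` X" for e
  proof (cases "e \<in> R3")
    case True
    then obtain s where s: "s \<in> idx (l1 + l2) l" "e = pr s" by (auto simp: R3_def)
    obtain B' x' \<sigma> y' \<tau> where s': "s = (B', x', \<sigma>, y', \<tau>)" by (cases s) auto
    have sI: "s \<in> idx 0 l" using s idx_sub[of l "l1 + l2"] by auto
    have "(B', x', y') \<noteq> t"
    proof
      assume "(B', x', y') = t"
      then have "s \<in> X" using s' Bxy by (cases \<sigma>; cases \<tau>) (auto simp: X_def)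
      then show False using that s(2) by blast
    qed
    moreover have "e \<in> F3 \<T> \<longleftrightarrow> B' \<in> {l1 + l2..<l} \<and> (\<sigma> = \<tau>) = ((B', x', y') \<in> \<T>)" for \<T>
      unfolding s(2) using mem_F3[OF sI, of \<T>] by (simp add: s' del: pr.simps)
    ultimately have "e \<in> F3 (insert t \<T>3) \<longleftrightarrow> e \<in> F3 \<T>3" by simp
    then have "e \<in> F' \<longleftrightarrow> e \<in> F" using I True by blast
    then show ?thesis by (simp add: \<xi>_def)
  qed (rule off3)
  have chi_le: "\<bar>\<xi> e\<bar> \<le> of_bool (e \<in> pr ` X)" for e
    using supp[of e] by (auto simp: \<xi>_def of_bool_def)
  define \<rho> :: "'a set \<Rightarrow> real" where "\<rho> e = of_bool (e \<in> pr ` X)" for e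
  have w: "wdeg V \<rho> j = 2 * of_bool (j = lv B x False) + 2 * of_bool (j = lv B x True)
      + 2 * of_bool (j = rv B y False) + 2 * of_bool (j = rv B y True)" for j
    unfolding \<rho>_def[abs_def] wdeg_pr[OF XI] by (simp add: X_def)
  have inV: "lv B x False \<in> V" "lv B x True \<in> V" "rv B y False \<in> V" "rv B y True \<in> V"
    using lvV[OF b(1,2)] rvV[OF b(1,3)] by auto
  \<comment> \<open>The four vertices have degree 2 in \<open>\<rho>\<close>, so the degrees sum to
    8, and each is crudely at most 8.\<close>
  have sq: "(\<Sum>j\<in>V. (wdeg V \<rho> j)\<^sup>2) \<le> 64"
  proof -
    have "(\<Sum>j\<in>V. (wdeg V \<rho> j)\<^sup>2) \<le> (\<Sum>j\<in>V. 8 * wdeg V \<rho> j)"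
      unfolding power2_eq_square by (intro sum_mono mult_right_mono) (auto simp: w of_bool_def)
    also have "\<dots> = 64"
      unfolding w using inV finV
      by (simp add: sum.distrib sum_distrib_left[symmetric] of_bool_def sum.delta' del: sum_distrib_left)
    finally show ?thesis .
  qed
  have pert: "\<bar>tri V (al F') (al F') (al F') - tri V (al F) (al F) (al F) - 3 * tri V \<xi> (al F) (al F)\<bar> \<le> 4 * 64"
  proof -
    have "\<bar>\<xi> e\<bar> \<le> 1" for e by (auto simp: \<xi>_def of_bool_def)
    then have "\<bar>tri V (\<lambda>e. al F e + \<xi> e) (\<lambda>e. al F e + \<xi> e) (\<lambda>e. al F e + \<xi> e) - tri V (al F) (al F) (al F)
        - 3 * tri V \<xi> (al F) (al F)\<bar> \<le> 4 * (\<Sum>j\<in>V. (wdeg V \<rho> j)\<^sup>2)"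
      using chi_le by (intro tri_perturb abs_al) (auto simp: \<rho>_def)
    then show ?thesis using sq unfolding al'[symmetric] by simp
  qed
  define Ca where "Ca e = (\<Sum>k\<in>V. \<Prod>i\<in>e. al F {i, k})" for e
  have Cap: "Ca (pr (B, x, \<sigma>, y, \<tau>)) = (\<Sum>k\<in>V. al F {lv B x \<sigma>, k} * al F {rv B y \<tau>, k})" for \<sigma> \<tau>
    using lv_rv[OF b(1,2,1,3), of \<sigma> \<tau>] by (simp add: Ca_def)
  let ?G = "\<Sum>k\<in>V. (al F {lv B x False, k} - al F {lv B x True, k}) * (al F {rv B y False, k} - al F {rv B y True, k})"
  let ?h = "\<lambda>t. case t of (B, x, y) \<Rightarrow> Ca (pr (B, x, False, y, False)) + Ca (pr (B, x, True, y, True))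
        - Ca (pr (B, x, False, y, True)) - Ca (pr (B, x, True, y, False))"
  have "(\<Sum>e\<in>[V]\<^bsup>2\<^esup>. \<xi> e * Ca e) = (\<Sum>e\<in>R3. \<xi> e * Ca e)"
    using off3 finite_nV R_sub R_split by (intro sum.mono_neutral_right) auto
  also have "\<dots> = (\<Sum>e\<in>R3. (of_bool (e \<in> F') - 1 / 2) * Ca e) - (\<Sum>e\<in>R3. (of_bool (e \<in> F) - 1 / 2) * Ca e)"
    unfolding sum_subtractf[symmetric] by (intro sum.cong refl) (simp add: \<xi>_def algebra_simps)
  also have "\<dots> = (\<Sum>s\<in>T3. (if s \<in> insert t \<T>3 then 1 / 2 else - 1 / 2) * ?h s)
      - (\<Sum>s\<in>T3. (if s \<in> \<T>3 then 1 / 2 else - 1 / 2) * ?h s)"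
    unfolding sum_R3[OF I(1)] sum_R3[OF I(2)]
    by (intro arg_cong2[where f = "(-)"] sum.cong refl) (auto split: prod.splits)
  also have "\<dots> = (\<Sum>s\<in>T3. if s = t then ?h s else 0)"
    unfolding sum_subtractf[symmetric] using t by (intro sum.cong refl) (auto simp: algebra_simps)
  also have "\<dots> = ?h t" using t finite_T3 by simp
  also have "\<dots> = ?G"
    unfolding Bxy prod.case Cap by (simp add: algebra_simps sum.distrib sum_subtractf)
  finally have G: "(\<Sum>e\<in>[V]\<^bsup>2\<^esup>. \<xi> e * Ca e) = ?G" .
  have "\<xi> {i} = 0" for i using off3[of "{i}"] singleton_notin R_split by auto
  then have "tri V \<xi> (al F) (al F) = 2 * ?G"
    using tri_eq_sum_codeg[OF finV, of \<xi> "al F"] G unfolding Ca_def by simp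
  moreover have "\<bar>?G - g t\<bar> \<le> 24 * real c"
    using abs_diff_codeg_le[OF inV, of F] by (simp add: g_def Bxy)
  ultimately have "\<bar>3 * tri V \<xi> (al F) (al F)\<bar> \<le> 6 * (M + 24 * real c)" using M unfolding distrib_left by linarith
  then show ?thesis using pert by linarith
qed

text \<open>For constant \<open>f\<close> the sum in \<open>sum_R2\<close> vanishes: half of the
  pairs of the group are edges whatever the switches, so switching preserves the number of
  edges.\<close>

lemma card_F2: "real (card (F2 \<T>)) = 2 * (real c)\<^sup>2 * real l2"
proof -
  have i: "F2 \<T> \<inter> R2 = F2 \<T>" using F2_sub by blast
  have "(\<Sum>e\<in>R2. (of_bool (e \<in> F2 \<T>) - 1 / 2) * 1) = (0::real)"
    unfolding sum_R2[OF i] by (intro sum.neutral) auto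
  moreover have fR: "finite R2" using finite_R R_split by auto
  moreover have "(\<Sum>e\<in>R2. of_bool (e \<in> F2 \<T>)) = real (card (F2 \<T>))"
    using fR i by (simp add: of_bool_def sum.If_cases Int_commute)
  ultimately show ?thesis by (simp add: sum_subtractf card_R)
qed

lemma card_F3: "real (card (F3 \<T>)) = 2 * (real c)\<^sup>2 * real l3"
proof -
  have i: "F3 \<T> \<inter> R3 = F3 \<T>" using F3_sub by blast
  have "(\<Sum>e\<in>R3. (of_bool (e \<in> F3 \<T>) - 1 / 2) * 1) = (0::real)"
    unfolding sum_R3[OF i] by (intro sum.neutral) auto
  moreover have fR: "finite R3" using finite_R R_split by auto
  moreover have "(\<Sum>e\<in>R3. of_bool (e \<in> F3 \<T>)) = real (card (F3 \<T>))"
    using fR i by (simp add: of_bool_def sum.If_cases Int_commute)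
  ultimately show ?thesis by (simp add: sum_subtractf card_R)
qed

lemma sum_signs: "(\<Sum>t\<in>T. (if t \<in> {t \<in> T. 0 \<le> f t} then 1 else - 1) * f t) = (\<Sum>t\<in>T. \<bar>f t :: real\<bar>)"
  "(\<Sum>t\<in>T. (if t \<in> {t \<in> T. f t \<le> 0} then 1 else - 1) * f t) = - (\<Sum>t\<in>T. \<bar>f t :: real\<bar>)"
  unfolding sum_negf[symmetric] by (intro sum.cong refl; auto)+

text \<open>Each choice preserves the earlier ones: \<open>F1\<close> settles the number of edges,
  which no switch changes; then the second group is set with the third at rest, and the third leaves
  all degrees alone. Aligning the signs with \<open>\<Delta>\<close> or \<open>g\<close>, or against
  them, gives values on both sides of 0, because the capacities exceed the errors.\<close>

lemma ex_config:
  assumes k1: "k1 \<le> card R1"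
    and M2: "\<And>t. t \<in> T2 \<Longrightarrow> \<bar>\<Delta> t\<bar> \<le> M2" "0 \<le> M2" and M3: "\<And>t. t \<in> T3 \<Longrightarrow> \<bar>g t\<bar> \<le> M3" "0 \<le> M3"
    and cap2: "err2 \<le> 2 * real c * (\<Sum>t\<in>T2. \<bar>\<Delta> t\<bar>)" and cap3: "err3 \<le> 3 * (\<Sum>t\<in>T3. \<bar>g t\<bar>)"
  shows "\<exists>F\<subseteq>R. real (card F) = real k1 + 2 * (real c)\<^sup>2 * real l2 + 2 * (real c)\<^sup>2 * real l3
     \<and> \<bar>(\<Sum>i\<in>V. (wdeg V (al F) i)\<^sup>2) - p * (1 - p) * real (card V) * (real (card V) - 1)\<bar>
         \<le> 4 * real c * (M2 + 6 * real c) + 8 * (real c)\<^sup>2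
     \<and> \<bar>tri V (al F) (al F) (al F)\<bar> \<le> 6 * (M3 + 24 * real c) + 256"
proof -
  obtain F1 where F1: "F1 \<subseteq> R1" "card F1 = k1" using k1 obtain_subset_with_card_n by metis
  let ?S = "\<lambda>\<T>2 \<T>3. (\<Sum>i\<in>V. (wdeg V (al (cfg F1 \<T>2 \<T>3)) i)\<^sup>2) - p * (1 - p) * real (card V) * (real (card V) - 1)"
  have "\<exists>\<T>\<subseteq>T2. \<bar>?S \<T> {}\<bar> \<le> 4 * real c * (M2 + 6 * real c) + 8 * (real c)\<^sup>2"
  proof (rule discrete_ivt[OF finite_T2])
    show "\<bar>?S (insert t X) {} - ?S X {}\<bar> \<le> 4 * real c * (M2 + 6 * real c) + 8 * (real c)\<^sup>2"
      if "X \<subseteq> T2" "t \<in> T2 - X" for X t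
      using sum_sq_step[OF F1(1) that(2) M2(1), of "{}"] that by simp
    show "?S {t \<in> T2. \<Delta> t \<le> 0} {} \<le> 0"
      using sum_sq_formula[OF cfg_inter(2,3)[OF F1(1)], of "{t \<in> T2. \<Delta> t \<le> 0}" "{}"] cap2
      unfolding sum_signs by linarith
    show "0 \<le> ?S {t \<in> T2. 0 \<le> \<Delta> t} {}"
      using sum_sq_formula[OF cfg_inter(2,3)[OF F1(1)], of "{t \<in> T2. 0 \<le> \<Delta> t}" "{}"] cap2
      unfolding sum_signs by linarith
  qed (use M2 in auto)
  then obtain \<T>2 where T2: "\<bar>?S \<T>2 {}\<bar> \<le> 4 * real c * (M2 + 6 * real c) + 8 * (real c)\<^sup>2" by auto
  have inv: "?S \<T>2 \<T>3 = ?S \<T>2 {}" for \<T>3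
    using wdeg_al_cfg3[OF F1(1), of _ \<T>2 \<T>3 "{}"] by simp
  let ?t = "\<lambda>\<T>3. tri V (al (cfg F1 \<T>2 \<T>3)) (al (cfg F1 \<T>2 \<T>3)) (al (cfg F1 \<T>2 \<T>3))"
  have "\<exists>\<T>\<subseteq>T3. \<bar>?t \<T>\<bar> \<le> 6 * (M3 + 24 * real c) + 256"
  proof (rule discrete_ivt[OF finite_T3])
    show "\<bar>?t (insert t X) - ?t X\<bar> \<le> 6 * (M3 + 24 * real c) + 256" if "X \<subseteq> T3" "t \<in> T3 - X" for X t
      using tri_step[OF F1(1) that(2) M3(1)] that by simp
    show "?t {t \<in> T3. g t \<le> 0} \<le> 0"
      using tri_formula[OF cfg_inter(3)[OF F1(1)], of \<T>2 "{t \<in> T3. g t \<le> 0}"] cap3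
      unfolding sum_signs by linarith
    show "0 \<le> ?t {t \<in> T3. 0 \<le> g t}"
      using tri_formula[OF cfg_inter(3)[OF F1(1)], of \<T>2 "{t \<in> T3. 0 \<le> g t}"] cap3
      unfolding sum_signs by linarith
  qed (use M3 in auto)
  then obtain \<T>3 where T3: "\<bar>?t \<T>3\<bar> \<le> 6 * (M3 + 24 * real c) + 256" by auto
  have fin: "finite R1" "finite R2" "finite R3" using finite_R R_split by auto
  have "card (cfg F1 \<T>2 \<T>3) = card F1 + card (F2 \<T>2) + card (F3 \<T>3)"
  proof -
    have "finite F1" "finite (F2 \<T>2)" "finite (F3 \<T>3)"
      using finite_subset[OF F1(1) fin(1)] finite_subset[OF F2_sub fin(2)] finite_subset[OF F3_sub fin(3)] by auto
    moreover have "F1 \<inter> F2 \<T>2 = {}" "(F1 \<union> F2 \<T>2) \<inter> F3 \<T>3 = {}"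
      using F1(1) F2_sub[of \<T>2] F3_sub[of \<T>3] R_disj by blast+
    ultimately show ?thesis unfolding cfg_def by (simp add: card_Un_disjoint)
  qed
  then have "real (card (cfg F1 \<T>2 \<T>3)) = real k1 + 2 * (real c)\<^sup>2 * real l2 + 2 * (real c)\<^sup>2 * real l3"
    using F1(2) card_F2[of \<T>2] card_F3[of \<T>3] by simp
  then show ?thesis using T2 T3 inv[of \<T>3] cfg_inter(4)[OF F1(1), of \<T>2 \<T>3] by metis
qed

end

section \<open>Moments of degrees, codegrees and triangles\<close>

context bernoulli_graph
begin

definition dtriples :: "'a set \<Rightarrow> ('a \<times> 'a \<times> 'a) set" where
  "dtriples V = {(i, j, k). i \<in> V \<and> j \<in> V \<and> k \<in> V \<and> i \<noteq> j \<and> j \<noteq> k \<and> i \<noteq> k}"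

lemma sum_dtriples:
  fixes f :: "'a \<Rightarrow> 'a \<Rightarrow> 'a \<Rightarrow> real"
  assumes "finite V" "\<And>i j k. i = j \<or> j = k \<or> i = k \<Longrightarrow> f i j k = 0"
  shows "(\<Sum>(i, j, k)\<in>dtriples V. f i j k) = (\<Sum>i\<in>V. \<Sum>j\<in>V. \<Sum>k\<in>V. f i j k)"
proof -
  have "(\<Sum>(i, j, k)\<in>dtriples V. f i j k) = (\<Sum>(i, j, k)\<in>V \<times> V \<times> V. f i j k)"
    using assms by (intro sum.mono_neutral_left) (auto simp: dtriples_def)
  then show ?thesis by (simp add: sum.cartesian_product)
qed

lemma finite_dtriples: "finite V \<Longrightarrow> finite (dtriples V)"
  by (rule finite_subset[of _ "V \<times> V \<times> V"]) (auto simp: dtriples_def)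

text \<open>The union of a monomial's pairs is its set of three vertices, so at most 3^3 triples
  share a monomial.\<close>

lemma triple_mult:
  assumes "\<And>i j k. \<Union>(T (i, j, k)) = {i, j, k}"
  shows "real (card {t \<in> dtriples V. T t = T t0}) \<le> 27"
proof -
  obtain i j k where t0: "t0 = (i, j, k)" by (cases t0) auto
  have "{t \<in> dtriples V. T t = T t0} \<subseteq> {i, j, k} \<times> {i, j, k} \<times> {i, j, k}"
  proof clarify
    fix a b c assume "T (a, b, c) = T t0"
    then have "{a, b, c} \<subseteq> {i, j, k}" using assms[of a b c] assms[of i j k] t0 by simp
    then show "a \<in> {i, j, k} \<and> (b, c) \<in> {i, j, k} \<times> {i, j, k}" by blast
  qed
  then have "card {t \<in> dtriples V. T t = T t0} \<le> card ({i, j, k} \<times> {i, j, k} \<times> {i, j, k})"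
    by (intro card_mono) auto
  also have "\<dots> = card {i, j, k} * (card {i, j, k} * card {i, j, k})" by (simp only: card_cartesian_product)
  also have "\<dots> \<le> 3 * (3 * 3)" by (intro mult_mono) (simp_all add: card_insert_le_m1)
  finally show ?thesis by simp
qed

lemma second_moment_tri:
  assumes V: "finite V" and P: "\<And>i. {i} \<notin> P"
  shows "E (\<lambda>S. (tri V (\<lambda>e. bit e S) (\<lambda>e. bit e S) (\<lambda>e. bit e S))\<^sup>2) \<le> 27 * var ^ 3 * real (card V) ^ 3"
proof -
  define T :: "'a \<times> 'a \<times> 'a \<Rightarrow> 'a set set" where "T t = (case t of (i, j, k) \<Rightarrow> {{i, j}, {j, k}, {i, k}})" for t
  have ne: "{i, j} \<noteq> {j, k}" "{i, j} \<noteq> {i, k}" "{j, k} \<noteq> {i, k}" if "(i, j, k) \<in> dtriples V" for i j k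
    using that by (auto simp: dtriples_def doubleton_eq_iff)
  have cT: "finite (T t) \<and> card (T t) = 3" if "t \<in> dtriples V" for t
  proof (cases t)
    case (fields i j k)
    then show ?thesis using ne[of i j k] that by (simp add: T_def)
  qed
  have b0: "bit {i} S = 0" for i S using P by (simp add: bit_def)
  have eq: "tri V (\<lambda>e. bit e S) (\<lambda>e. bit e S) (\<lambda>e. bit e S) = (\<Sum>t\<in>dtriples V. 1 * (\<Prod>e\<in>T t. bit e S))" for S
  proof -
    have "(\<Sum>t\<in>dtriples V. 1 * (\<Prod>e\<in>T t. bit e S))
        = (\<Sum>(i, j, k)\<in>dtriples V. bit {i, j} S * bit {j, k} S * bit {i, k} S)"
    proof (intro sum.cong refl)
      fix t assume t: "t \<in> dtriples V"
      obtain i j k where ijk: "t = (i, j, k)" by (cases t) auto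
      show "1 * (\<Prod>e\<in>T t. bit e S) = (case t of (i, j, k) \<Rightarrow> bit {i, j} S * bit {j, k} S * bit {i, k} S)"
        using ne[of i j k] t ijk by (simp add: T_def)
    qed
    also have "\<dots> = tri V (\<lambda>e. bit e S) (\<lambda>e. bit e S) (\<lambda>e. bit e S)"
      unfolding tri_def by (rule sum_dtriples[OF V]) (auto simp: b0)
    finally show ?thesis by simp
  qed
  have "E (\<lambda>S. (tri V (\<lambda>e. bit e S) (\<lambda>e. bit e S) (\<lambda>e. bit e S))\<^sup>2) \<le> 27 * var ^ 3 * (\<Sum>t\<in>dtriples V. 1\<^sup>2)"
    unfolding eq by (rule second_moment_le[OF finite_dtriples[OF V] cT triple_mult]) (auto simp: T_def)
  also have "(\<Sum>t\<in>dtriples V. 1\<^sup>2) \<le> real (card V) ^ 3"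
  proof -
    have "card (dtriples V) \<le> card (V \<times> V \<times> V)" using V by (intro card_mono) (auto simp: dtriples_def)
    also have "\<dots> = card V ^ 3" by (simp add: card_cartesian_product eval_nat_numeral)
    finally show ?thesis by (simp flip: of_nat_power)
  qed
  finally show ?thesis using var_nonneg by (simp add: mult_left_mono)
qed

text \<open>Weights let one bound serve single codegrees and sums over any set of pairs.
  \<open>W i i = 0\<close> excludes squares of bits, whose means are not 0.\<close>

lemma second_moment_codeg:
  fixes W :: "'a \<Rightarrow> 'a \<Rightarrow> real"
  assumes V: "finite V" and P: "\<And>i. {i} \<notin> P" and W: "\<And>i. W i i = 0"
  shows "E (\<lambda>S. (\<Sum>i\<in>V. \<Sum>k\<in>V. W i k * (\<Sum>j\<in>V. bit {i, j} S * bit {k, j} S))\<^sup>2)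
     \<le> 27 * var\<^sup>2 * (real (card V) * (\<Sum>i\<in>V. \<Sum>k\<in>V. (W i k)\<^sup>2))"
proof -
  define T :: "'a \<times> 'a \<times> 'a \<Rightarrow> 'a set set" where "T t = (case t of (i, j, k) \<Rightarrow> {{i, j}, {k, j}})" for t
  have ne: "{i, j} \<noteq> {k, j}" if "(i, j, k) \<in> dtriples V" for i j k
    using that by (auto simp: dtriples_def doubleton_eq_iff)
  have cT: "finite (T t) \<and> card (T t) = 2" if "t \<in> dtriples V" for t
  proof (cases t)
    case (fields i j k)
    then show ?thesis using ne[of i j k] that by (simp add: T_def)
  qed
  define w where "w t = (case t of (i, j, k) \<Rightarrow> W i k)" for t :: "'a \<times> 'a \<times> 'a"
  have b0: "bit {i} S = 0" for i S using P by (simp add: bit_def)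
  have eq: "(\<Sum>i\<in>V. \<Sum>k\<in>V. W i k * (\<Sum>j\<in>V. bit {i, j} S * bit {k, j} S))
      = (\<Sum>t\<in>dtriples V. w t * (\<Prod>e\<in>T t. bit e S))" for S
  proof -
    have "(\<Sum>t\<in>dtriples V. w t * (\<Prod>e\<in>T t. bit e S))
        = (\<Sum>(i, j, k)\<in>dtriples V. W i k * (bit {i, j} S * bit {k, j} S))"
    proof (intro sum.cong refl)
      fix t assume t: "t \<in> dtriples V"
      obtain i j k where ijk: "t = (i, j, k)" by (cases t) auto
      show "w t * (\<Prod>e\<in>T t. bit e S) = (case t of (i, j, k) \<Rightarrow> W i k * (bit {i, j} S * bit {k, j} S))"
        using ne[of i j k] t ijk by (simp add: T_def w_def)
    qed
    also have "\<dots> = (\<Sum>i\<in>V. \<Sum>j\<in>V. \<Sum>k\<in>V. W i k * (bit {i, j} S * bit {k, j} S))"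
      by (rule sum_dtriples[OF V]) (auto simp: b0 W)
    also have "\<dots> = (\<Sum>i\<in>V. \<Sum>k\<in>V. \<Sum>j\<in>V. W i k * (bit {i, j} S * bit {k, j} S))"
      by (intro sum.cong refl sum.swap)
    finally show ?thesis by (simp add: sum_distrib_left)
  qed
  have "E (\<lambda>S. (\<Sum>i\<in>V. \<Sum>k\<in>V. W i k * (\<Sum>j\<in>V. bit {i, j} S * bit {k, j} S))\<^sup>2) \<le> 27 * var\<^sup>2 * (\<Sum>t\<in>dtriples V. (w t)\<^sup>2)"
    unfolding eq by (rule second_moment_le[OF finite_dtriples[OF V] cT triple_mult]) (auto simp: T_def)
  also have "(\<Sum>t\<in>dtriples V. (w t)\<^sup>2) \<le> (\<Sum>t\<in>V \<times> V \<times> V. (w t)\<^sup>2)"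
    using V by (intro sum_mono2) (auto simp: dtriples_def)
  also have "\<dots> = (\<Sum>i\<in>V. \<Sum>j\<in>V. \<Sum>k\<in>V. (W i k)\<^sup>2)"
    unfolding sum.cartesian_product by (intro sum.cong refl) (auto simp: w_def)
  also have "\<dots> = real (card V) * (\<Sum>i\<in>V. \<Sum>k\<in>V. (W i k)\<^sup>2)"
    by (simp add: sum_distrib_left)
  finally show ?thesis using var_nonneg by (simp add: mult_left_mono)
qed

lemma second_moment_deg:
  fixes w :: "'a \<Rightarrow> real"
  assumes V: "finite V" and P: "\<And>i. {i} \<notin> P"
  shows "E (\<lambda>S. (\<Sum>i\<in>V. w i * wdeg V (\<lambda>e. bit e S) i)\<^sup>2) \<le> 4 * var * (real (card V) * (\<Sum>i\<in>V. (w i)\<^sup>2))"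
proof -
  define \<Phi> where "\<Phi> = {(i, j). i \<in> V \<and> j \<in> V \<and> i \<noteq> j}"
  define T :: "'a \<times> 'a \<Rightarrow> 'a set set" where "T t = (case t of (i, j) \<Rightarrow> {{i, j}})" for t
  have f\<Phi>: "finite \<Phi>" by (rule finite_subset[of _ "V \<times> V"]) (use V in \<open>auto simp: \<Phi>_def\<close>)
  have cT: "finite (T t) \<and> card (T t) = 1" for t by (cases t) (simp add: T_def)
  have M: "real (card {t \<in> \<Phi>. T t = T t0}) \<le> 4" for t0
  proof -
    obtain i j where t0: "t0 = (i, j)" by (cases t0) auto
    have "{t \<in> \<Phi>. T t = T t0} \<subseteq> {(i, j), (j, i)}" by (auto simp: T_def t0 doubleton_eq_iff)
    then have "card {t \<in> \<Phi>. T t = T t0} \<le> card {(i, j), (j, i)}" by (intro card_mono) auto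
    also have "\<dots> \<le> 4" by (simp add: card_insert_le_m1)
    finally show ?thesis by simp
  qed
  have b0: "bit {i} S = 0" for i S using P by (simp add: bit_def)
  have eq: "(\<Sum>i\<in>V. w i * wdeg V (\<lambda>e. bit e S) i) = (\<Sum>t\<in>\<Phi>. w (fst t) * (\<Prod>e\<in>T t. bit e S))" for S
  proof -
    have "(\<Sum>t\<in>\<Phi>. w (fst t) * (\<Prod>e\<in>T t. bit e S)) = (\<Sum>(i, j)\<in>V \<times> V. w i * bit {i, j} S)"
      using V by (intro sum.mono_neutral_cong_left) (auto simp: \<Phi>_def T_def b0)
    also have "\<dots> = (\<Sum>i\<in>V. \<Sum>j\<in>V. w i * bit {i, j} S)" by (simp add: sum.cartesian_product)
    finally show ?thesis by (simp add: wdeg_def sum_distrib_left)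
  qed
  have "E (\<lambda>S. (\<Sum>i\<in>V. w i * wdeg V (\<lambda>e. bit e S) i)\<^sup>2) \<le> 4 * var ^ 1 * (\<Sum>t\<in>\<Phi>. (w (fst t))\<^sup>2)"
    unfolding eq by (rule second_moment_le[OF f\<Phi> cT M])
  also have "(\<Sum>t\<in>\<Phi>. (w (fst t))\<^sup>2) \<le> (\<Sum>t\<in>V \<times> V. (w (fst t))\<^sup>2)"
    using V by (intro sum_mono2) (auto simp: \<Phi>_def)
  also have "\<dots> = (\<Sum>i\<in>V. \<Sum>j\<in>V. (w i)\<^sup>2)" unfolding sum.cartesian_product by (intro sum.cong refl) auto
  also have "\<dots> = real (card V) * (\<Sum>i\<in>V. (w i)\<^sup>2)" by (simp add: sum_distrib_left)
  finally show ?thesis using var_nonneg by (simp add: mult_left_mono)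
qed

end

text \<open>A common frame for the effects \<open>\<Delta>\<close> and \<open>g\<close> of a switch
  \<open>t\<close>: a sum over vertices \<open>k\<close> outside the gadget \<open>Q t\<close>,
  whose terms depend only on the pairs between \<open>k\<close> and \<open>Q t\<close>. Terms of
  different \<open>k\<close> are independent, and gadgets without a common vertex are almost
  so.\<close>

locale local_stats = bernoulli_graph P \<pi> for P :: "'a set set" and \<pi> +
  fixes V :: "'a set" and Q :: "'t \<Rightarrow> 'a set" and f :: "'t \<Rightarrow> 'a \<Rightarrow> 'a set set \<Rightarrow> real" and T :: "'t set"
    and mlo mhi :: real
  assumes finV: "finite V" and finT: "finite T"
    and dep: "\<And>t k. t \<in> T \<Longrightarrow> depends_on (f t k) ((\<lambda>u. {u, k}) ` Q t)"
    and bd: "\<And>t k S. t \<in> T \<Longrightarrow> \<bar>f t k S\<bar> \<le> 1" and mean: "\<And>t k. t \<in> T \<Longrightarrow> E (f t k) = 0"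
    and Q4: "\<And>t. t \<in> T \<Longrightarrow> finite (Q t) \<and> card (Q t) \<le> 4"
    and mlo: "\<And>t. t \<in> T \<Longrightarrow> mlo \<le> (\<Sum>k\<in>V - Q t. E (\<lambda>S. (f t k S)\<^sup>2))" "1 \<le> mlo"
    and mhi: "\<And>t. t \<in> T \<Longrightarrow> (\<Sum>k\<in>V - Q t. E (\<lambda>S. (f t k S)\<^sup>2)) \<le> mhi"
begin

definition st :: "'t \<Rightarrow> 'a set set \<Rightarrow> real" where "st t S = (\<Sum>k\<in>V - Q t. f t k S)"

lemma dis:
  assumes "k \<notin> Q t" "k' \<notin> Q t" "k \<noteq> k'"
  shows "(\<lambda>u. {u, k}) ` Q t \<inter> (\<lambda>u. {u, k'}) ` Q t = {}"
  using assms by (auto simp: doubleton_eq_iff)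

lemma st_moments:
  assumes t: "t \<in> T"
  shows "E (\<lambda>S. (st t S)\<^sup>2) = (\<Sum>k\<in>V - Q t. E (\<lambda>S. (f t k S)\<^sup>2))"
    and "E (\<lambda>S. (st t S) ^ 4) \<le> 3 * (\<Sum>k\<in>V - Q t. E (\<lambda>S. (f t k S)\<^sup>2))\<^sup>2 + (\<Sum>k\<in>V - Q t. E (\<lambda>S. (f t k S)\<^sup>2))"
proof -
  have d: "(\<lambda>u. {u, w}) ` Q t \<inter> (\<lambda>u. {u, w'}) ` Q t = {}" if "w \<in> V - Q t" "w' \<in> V - Q t" "w \<noteq> w'" for w w'
    using that by (intro dis) auto
  have f: "finite (V - Q t)" using finV by simp
  show "E (\<lambda>S. (st t S)\<^sup>2) = (\<Sum>k\<in>V - Q t. E (\<lambda>S. (f t k S)\<^sup>2))"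
    unfolding st_def by (rule moments_indep_sum(2)[OF f dep[OF t] d mean[OF t] bd[OF t]])
  show "E (\<lambda>S. (st t S) ^ 4) \<le> 3 * (\<Sum>k\<in>V - Q t. E (\<lambda>S. (f t k S)\<^sup>2))\<^sup>2 + (\<Sum>k\<in>V - Q t. E (\<lambda>S. (f t k S)\<^sup>2))"
    unfolding st_def by (rule moments_indep_sum(3)[OF f dep[OF t] d mean[OF t] bd[OF t]])
qed

lemma E_st_sq_le: "t \<in> T \<Longrightarrow> E (\<lambda>S. (st t S)\<^sup>2) \<le> mhi" using st_moments(1) mhi by simp

lemma E_st_4_le: "t \<in> T \<Longrightarrow> E (\<lambda>S. (st t S) ^ 4) \<le> 4 * mhi\<^sup>2"
proof -
  assume t: "t \<in> T"
  let ?m = "\<Sum>k\<in>V - Q t. E (\<lambda>S. (f t k S)\<^sup>2)"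
  have m: "1 \<le> ?m" "?m \<le> mhi" using mlo(1)[OF t] mlo(2) mhi[OF t] by auto
  have "?m * 1 \<le> ?m * ?m" using m by (intro mult_left_mono) auto
  moreover have "?m\<^sup>2 \<le> mhi\<^sup>2" using m by (intro power_mono) auto
  ultimately show ?thesis using st_moments(2)[OF t] by (simp add: power2_eq_square)
qed

lemma E_abs_st_ge: "t \<in> T \<Longrightarrow> 3 / 8 * sqrt mlo \<le> E (\<lambda>S. \<bar>st t S\<bar>)"
proof -
  assume t: "t \<in> T"
  let ?m = "\<Sum>k\<in>V - Q t. E (\<lambda>S. (f t k S)\<^sup>2)"
  have "3 / 8 * sqrt mlo \<le> 3 / 8 * sqrt ?m" using mlo(1)[OF t] by simp
  also have "\<dots> \<le> E (\<lambda>S. \<bar>st t S\<bar>)"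
    using st_moments[OF t] mlo(1)[OF t] mlo(2) by (intro E_abs_ge) auto
  finally show ?thesis .
qed

text \<open>Without the at most four terms at vertices of the other gadget, each of size at most 1,
  the two statistics depend on disjoint sets of pairs. The 8 counts this loss twice, on the way to
  independence and back.\<close>

lemma far:
  assumes t: "t \<in> T" "t' \<in> T" and disj: "Q t \<inter> Q t' = {}"
  shows "E (\<lambda>S. \<bar>st t S\<bar> * \<bar>st t' S\<bar>) \<le> (E (\<lambda>S. \<bar>st t S\<bar>) + 8) * (E (\<lambda>S. \<bar>st t' S\<bar>) + 8)"
proof -
  define W where "W = V - Q t - Q t'"
  define z where "z s S = (\<Sum>k\<in>W. f s k S)" for s S
  have close: "\<bar>st s S - z s S\<bar> \<le> 4" if s: "(s = t \<and> s' = t') \<or> (s = t' \<and> s' = t)" for s s' S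
  proof -
    have sT: "s \<in> T" "s' \<in> T" using s t by auto
    have "W \<subseteq> V - Q s" using s by (auto simp: W_def)
    then have "st s S - z s S = (\<Sum>k\<in>V - Q s - W. f s k S)"
      unfolding st_def z_def using finV by (simp add: sum_diff)
    also have "\<bar>\<dots>\<bar> \<le> (\<Sum>k\<in>V - Q s - W. \<bar>f s k S\<bar>)" by (rule sum_abs)
    also have "\<dots> \<le> (\<Sum>k\<in>V - Q s - W. 1)" using bd[OF sT(1)] by (intro sum_mono) auto
    also have "\<dots> \<le> real (card (Q s'))"
    proof -
      have "V - Q s - W \<subseteq> Q s'" using s by (auto simp: W_def)
      then show ?thesis using Q4[OF sT(2)] by (simp add: card_mono)
    qed
    also have "\<dots> \<le> 4" using Q4[OF sT(2)] by simp
    finally show ?thesis .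
  qed
  have dz: "depends_on (\<lambda>S. \<bar>z s S\<bar> + 4) (\<Union>k\<in>W. (\<lambda>u. {u, k}) ` Q s)" if "s \<in> T" for s
    unfolding z_def
    by (rule depends_on_comp, rule depends_on_sum, rule depends_on_mono[OF dep[OF that]]) auto
  have dd: "(\<Union>k\<in>W. (\<lambda>u. {u, k}) ` Q t) \<inter> (\<Union>k\<in>W. (\<lambda>u. {u, k}) ` Q t') = {}"
    using disj by (auto simp: W_def doubleton_eq_iff)
  have E4: "E (\<lambda>S. \<bar>h S\<bar> + 4) = E (\<lambda>S. \<bar>h S\<bar>) + 4" for h by (simp add: E_add)
  have le: "E (\<lambda>S. \<bar>z s S\<bar>) \<le> E (\<lambda>S. \<bar>st s S\<bar>) + 4" if s: "(s = t \<and> s' = t') \<or> (s = t' \<and> s' = t)" for s s'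
    unfolding E4[symmetric]
  proof (rule E_mono)
    fix S show "\<bar>z s S\<bar> \<le> \<bar>st s S\<bar> + 4" using close[OF s, of S] by linarith
  qed
  have "E (\<lambda>S. \<bar>st t S\<bar> * \<bar>st t' S\<bar>) \<le> E (\<lambda>S. (\<bar>z t S\<bar> + 4) * (\<bar>z t' S\<bar> + 4))"
  proof (rule E_mono)
    fix S
    show "\<bar>st t S\<bar> * \<bar>st t' S\<bar> \<le> (\<bar>z t S\<bar> + 4) * (\<bar>z t' S\<bar> + 4)"
      using close[of t t' S] close[of t' t S] by (intro mult_mono) auto
  qed
  also have "\<dots> = E (\<lambda>S. \<bar>z t S\<bar> + 4) * E (\<lambda>S. \<bar>z t' S\<bar> + 4)"
    by (rule E_mult_indep[OF dz[OF t(1)] dz[OF t(2)] dd])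
  also have "\<dots> \<le> (E (\<lambda>S. \<bar>st t S\<bar>) + 8) * (E (\<lambda>S. \<bar>st t' S\<bar>) + 8)"
  proof (rule mult_mono)
    show "E (\<lambda>S. \<bar>z t S\<bar> + 4) \<le> E (\<lambda>S. \<bar>st t S\<bar>) + 8" using le[of t t'] unfolding E4 by simp
    show "E (\<lambda>S. \<bar>z t' S\<bar> + 4) \<le> E (\<lambda>S. \<bar>st t' S\<bar>) + 8" using le[of t' t] unfolding E4 by simp
    show "0 \<le> E (\<lambda>S. \<bar>st t S\<bar>) + 8" using E_nonneg[of "\<lambda>S. \<bar>st t S\<bar>"] by simp
    show "0 \<le> E (\<lambda>S. \<bar>z t' S\<bar> + 4)" by (intro E_nonneg) auto
  qed
  finally show ?thesis .
qed

lemma capacity: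
  assumes near: "\<And>t. t \<in> T \<Longrightarrow> real (card {t' \<in> T. Q t \<inter> Q t' \<noteq> {}}) \<le> N" and ne: "T \<noteq> {}"
  shows "E (\<lambda>S. ((\<Sum>t\<in>T. \<bar>st t S\<bar>) / E (\<lambda>S. \<Sum>t\<in>T. \<bar>st t S\<bar>) - 1)\<^sup>2)
      \<le> 2 * 8 / (3 / 8 * sqrt mlo) + (8 / (3 / 8 * sqrt mlo))\<^sup>2 + N * mhi / (real (card T) * (3 / 8 * sqrt mlo)\<^sup>2)"
    and "real (card T) * (3 / 8 * sqrt mlo) \<le> E (\<lambda>S. \<Sum>t\<in>T. \<bar>st t S\<bar>)"
proof -
  show "E (\<lambda>S. ((\<Sum>t\<in>T. \<bar>st t S\<bar>) / E (\<lambda>S. \<Sum>t\<in>T. \<bar>st t S\<bar>) - 1)\<^sup>2)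
      \<le> 2 * 8 / (3 / 8 * sqrt mlo) + (8 / (3 / 8 * sqrt mlo))\<^sup>2 + N * mhi / (real (card T) * (3 / 8 * sqrt mlo)\<^sup>2)"
  proof (rule sum_abs_concentrated[where near = "{(t, t'). Q t \<inter> Q t' \<noteq> {}}"])
    show "E (\<lambda>S. \<bar>st i S\<bar> * \<bar>st j S\<bar>) \<le> (E (\<lambda>S. \<bar>st i S\<bar>) + 8) * (E (\<lambda>S. \<bar>st j S\<bar>) + 8)"
      if "i \<in> T" "j \<in> T" "(i, j) \<notin> {(t, t'). Q t \<inter> Q t' \<noteq> {}}" for i j
      using that by (intro far) auto
    show "real (card {j \<in> T. (i, j) \<in> {(t, t'). Q t \<inter> Q t' \<noteq> {}}}) \<le> N" if "i \<in> T" for i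
      using near[OF that] by simp
    show "0 < 3 / 8 * sqrt mlo" using mlo(2) by simp
  qed (use finT ne E_st_sq_le E_abs_st_ge in auto)
  show "real (card T) * (3 / 8 * sqrt mlo) \<le> E (\<lambda>S. \<Sum>t\<in>T. \<bar>st t S\<bar>)"
    unfolding E_sum using sum_mono[of T "\<lambda>_. 3 / 8 * sqrt mlo" "\<lambda>t. E (\<lambda>S. \<bar>st t S\<bar>)"] E_abs_st_ge by simp
qed

text \<open>A sum of these fourth powers below 1 bounds all the statistics by \<open>a\<close> at
  once; fourth powers are high enough to beat the number of gadgets.\<close>

lemma E_sum_st_4_le: "E (\<lambda>S. \<Sum>t\<in>T. (st t S / a) ^ 4) \<le> real (card T) * (4 * mhi\<^sup>2 / a ^ 4)"
proof -
  have "E (\<lambda>S. \<Sum>t\<in>T. (st t S / a) ^ 4) = (\<Sum>t\<in>T. E (\<lambda>S. st t S ^ 4) / a ^ 4)"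
    by (simp add: E_sum power_divide E_cdiv)
  also have "\<dots> \<le> (\<Sum>t\<in>T. 4 * mhi\<^sup>2 / a ^ 4)"
    by (intro sum_mono divide_right_mono E_st_4_le) auto
  finally show ?thesis by simp
qed

end

section \<open>Random part of the graph\<close>

context bernoulli_graph
begin

definition bdiff :: "'a \<Rightarrow> 'a \<Rightarrow> 'a \<Rightarrow> 'a set set \<Rightarrow> real" where
  "bdiff u v k S = bit {u, k} S - bit {v, k} S"

lemma pair_ne: "u \<noteq> v \<Longrightarrow> {u, k} \<noteq> {v, k}" by (auto simp: doubleton_eq_iff)

lemma depends_on_bdiff: "depends_on (bdiff u v k) ((\<lambda>u. {u, k}) ` {u, v})"
  unfolding bdiff_def by (intro depends_on_comp2[of _ _ _ "(-)"] depends_on_bit) auto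

text \<open>When both bits are random their means cancel, so their difference stays within 1, as
  \<open>local_stats\<close> requires.\<close>

lemma abs_bdiff: "\<bar>bdiff u v k S\<bar> \<le> 1"
  using \<pi>01 by (auto simp: bdiff_def bit_def of_bool_def)

lemma E_bdiff: "E (bdiff u v k) = 0"
  unfolding bdiff_def by (simp add: E_diff E_bit)

lemma E_bdiff_sq:
  assumes "u \<noteq> v"
  shows "E (\<lambda>S. (bdiff u v k S)\<^sup>2) = var * (of_bool ({u, k} \<in> P) + of_bool ({v, k} \<in> P))"
proof -
  have "E (\<lambda>S. (bdiff u v k S)\<^sup>2) = E (\<lambda>S. (bit {u, k} S)\<^sup>2 - 2 * (bit {u, k} S * bit {v, k} S) + (bit {v, k} S)\<^sup>2)"
    by (intro E_cong) (simp add: bdiff_def power2_diff)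
  also have "\<dots> = E (\<lambda>S. (bit {u, k} S)\<^sup>2) - 2 * E (\<lambda>S. bit {u, k} S * bit {v, k} S) + E (\<lambda>S. (bit {v, k} S)\<^sup>2)"
    by (simp only: E_add E_diff E_cmult)
  also have "E (\<lambda>S. bit {u, k} S * bit {v, k} S) = 0"
    using E_monomials[of "{{u, k}}" "{{v, k}}"] pair_ne[OF assms, of k] by simp
  finally show ?thesis by (simp add: E_bit_sq)
qed

end

locale gadget_random = gadget_graph V lv rv c l1 l2 l3
  for V :: "'a set" and lv rv c l1 l2 l3 +
  fixes p \<pi> :: real
  assumes p01': "0 \<le> p" "p \<le> 1" and \<pi>01': "0 \<le> \<pi>" "\<pi> \<le> 1"
    and bal': "(\<pi> - p) * real (card P) + (1 / 2 - p) * real (card R) = 0"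
    and dl': "real (card V) * \<bar>\<pi> - p\<bar> \<le> real c"
begin

sublocale bernoulli_graph P \<pi>
  using finite_P \<pi>01' by unfold_locales auto

lemma bits: "gadget_bits V lv rv c l1 l2 l3 (\<lambda>e. bit e S) p \<pi>"
proof unfold_locales
  fix e
  show "e \<notin> P \<Longrightarrow> bit e S = 0" by (simp add: bit_def)
  show "\<bar>bit e S\<bar> \<le> 1" by (rule abs_bit_le)
  show "e \<in> P \<Longrightarrow> (bit e S)\<^sup>2 = (1 - 2 * \<pi>) * bit e S + \<pi> * (1 - \<pi>)"
    by (auto simp: bit_def of_bool_def power2_eq_square algebra_simps)
qed (use p01' \<pi>01' bal' dl' in auto)

lemma PR': "P \<union> R = [V]\<^bsup>2\<^esup>" "P \<inter> R = {}" using R_sub by (auto simp: P_def)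

lemma single_notin: "{i} \<notin> P" "{i} \<notin> R"
proof -
  have "{i} \<notin> [V]\<^bsup>2\<^esup>" by (simp add: nsets_def)
  then show "{i} \<notin> P" "{i} \<notin> R" using PR'(1) by auto
qed

definition Q2 :: "nat \<times> nat \<Rightarrow> 'a set" where "Q2 t = (case t of (B, x) \<Rightarrow> {lv B x False, lv B x True})"
definition f2 :: "nat \<times> nat \<Rightarrow> 'a \<Rightarrow> 'a set set \<Rightarrow> real" where
  "f2 t = (case t of (B, x) \<Rightarrow> bdiff (lv B x False) (lv B x True))"
definition Q3 :: "nat \<times> nat \<times> nat \<Rightarrow> 'a set" where
  "Q3 t = (case t of (B, x, y) \<Rightarrow> {lv B x False, lv B x True, rv B y False, rv B y True})"
definition f3 :: "nat \<times> nat \<times> nat \<Rightarrow> 'a \<Rightarrow> 'a set set \<Rightarrow> real" where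
  "f3 t k S = (case t of (B, x, y) \<Rightarrow> bdiff (lv B x False) (lv B x True) k S * bdiff (rv B y False) (rv B y True) k S)"

text \<open>The loss consists of the at most four vertices of \<open>W\<close> and the at most 2 c
  reserved partners of each.\<close>

lemma card_good:
  assumes "W \<subseteq> V" "card W \<le> 4"
  shows "real (card V) - 4 - 8 * real c \<le> real (card {k \<in> V - W. \<forall>u\<in>W. {u, k} \<in> P})"
proof -
  have fW: "finite W" using assms finV finite_subset by auto
  have "V \<subseteq> W \<union> {k \<in> V - W. \<forall>u\<in>W. {u, k} \<in> P} \<union> (\<Union>u\<in>W. {k \<in> V. {u, k} \<in> R})"
  proof
    fix k assume k: "k \<in> V"
    { assume "k \<notin> W" "k \<notin> (\<Union>u\<in>W. {k \<in> V. {u, k} \<in> R})"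
      then have "{u, k} \<in> P" if "u \<in> W" for u
      proof -
        have "u \<noteq> k" "u \<in> V" using that \<open>k \<notin> W\<close> assms(1) by auto
        then have "{u, k} \<in> [V]\<^bsup>2\<^esup>" using k by (simp add: nsets_def)
        moreover have "{u, k} \<notin> R" using that k \<open>k \<notin> (\<Union>u\<in>W. {k \<in> V. {u, k} \<in> R})\<close> by auto
        ultimately show ?thesis by (simp add: P_def)
      qed
      then have "k \<in> {k \<in> V - W. \<forall>u\<in>W. {u, k} \<in> P}" using k \<open>k \<notin> W\<close> by auto }
    then show "k \<in> W \<union> {k \<in> V - W. \<forall>u\<in>W. {u, k} \<in> P} \<union> (\<Union>u\<in>W. {k \<in> V. {u, k} \<in> R})" by blast
  qed
  then have "card V \<le> card (W \<union> {k \<in> V - W. \<forall>u\<in>W. {u, k} \<in> P} \<union> (\<Union>u\<in>W. {k \<in> V. {u, k} \<in> R}))"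
    using fW finV by (intro card_mono) auto
  also have "\<dots> \<le> card W + card {k \<in> V - W. \<forall>u\<in>W. {u, k} \<in> P} + card (\<Union>u\<in>W. {k \<in> V. {u, k} \<in> R})"
    by (meson card_Un_le add_le_mono1 order_trans)
  also have "card (\<Union>u\<in>W. {k \<in> V. {u, k} \<in> R}) \<le> (\<Sum>u\<in>W. card {k \<in> V. {u, k} \<in> R})" by (rule card_UN_le[OF fW])
  also have "\<dots> \<le> (\<Sum>u\<in>W. 2 * c)" by (intro sum_mono degree_R)
  also have "\<dots> \<le> 4 * (2 * c)" using assms(2) by simp
  finally have "card V \<le> card W + card {k \<in> V - W. \<forall>u\<in>W. {u, k} \<in> P} + 8 * c" by simp
  then have "card V \<le> 4 + card {k \<in> V - W. \<forall>u\<in>W. {u, k} \<in> P} + 8 * c" using assms(2) by linarith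
  then show ?thesis by linarith
qed

lemma T2_facts:
  assumes "t \<in> T2"
  obtains B x where "t = (B, x)" "B < l" "x < c" "lv B x False \<in> V" "lv B x True \<in> V" "lv B x False \<noteq> lv B x True"
proof -
  obtain B x where t: "t = (B, x)" by (cases t) auto
  have b: "B < l" "x < c" using assms t by (auto simp: T2_def)
  show ?thesis using that[OF t b lvV[OF b] lvV[OF b]] lv_inj[OF b b, of False True] by auto
qed

lemma T3_facts:
  assumes "t \<in> T3"
  obtains B x y where "t = (B, x, y)" "B < l" "x < c" "y < c" "lv B x False \<in> V" "lv B x True \<in> V"
    "rv B y False \<in> V" "rv B y True \<in> V" "lv B x False \<noteq> lv B x True" "rv B y False \<noteq> rv B y True"
    "\<forall>\<sigma> \<tau>. lv B x \<sigma> \<noteq> rv B y \<tau>"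
proof -
  obtain B x y where t: "t = (B, x, y)" by (cases t) auto
  have b: "B < l" "x < c" "y < c" using assms t by (auto simp: T3_def)
  show ?thesis using that[OF t b lvV[OF b(1,2)] lvV[OF b(1,2)] rvV[OF b(1,3)] rvV[OF b(1,3)]]
      lv_inj[OF b(1,2,1,2), of False True] rv_inj[OF b(1,3,1,3), of False True] lv_rv[OF b(1,2,1,3)] by auto
qed

lemma local_stats2:
  assumes n: "8 + 16 * real c \<le> real (card V)" and v: "1 \<le> real (card V) * var"
  shows "local_stats P \<pi> V Q2 f2 T2 (real (card V) * var) (2 * real (card V) * var)"
proof unfold_locales
  show "finite V" "finite T2" using finV by (auto simp: T2_def)
  show "1 \<le> real (card V) * var" by (rule v)
  fix t assume t: "t \<in> T2"
  obtain B x where f: "t = (B, x)" "B < l" "x < c" "lv B x False \<in> V" "lv B x True \<in> V" "lv B x False \<noteq> lv B x True"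
    using T2_facts[OF t] .
  let ?u = "lv B x False" and ?v = "lv B x True"
  have Q: "Q2 t = {?u, ?v}" and ft: "f2 t = bdiff ?u ?v" by (simp_all add: Q2_def f2_def f(1))
  show "depends_on (f2 t k) ((\<lambda>u. {u, k}) ` Q2 t)" for k unfolding Q ft by (rule depends_on_bdiff)
  show "\<bar>f2 t k S\<bar> \<le> 1" for k S unfolding ft by (rule abs_bdiff)
  show "E (f2 t k) = 0" for k unfolding ft by (rule E_bdiff)
  show Q4: "finite (Q2 t) \<and> card (Q2 t) \<le> 4" unfolding Q by (simp add: card_insert_le_m1)
  let ?A = "{k \<in> V - Q2 t. \<forall>u\<in>Q2 t. {u, k} \<in> P}"
  have e: "E (\<lambda>S. (f2 t k S)\<^sup>2) = var * (of_bool ({?u, k} \<in> P) + of_bool ({?v, k} \<in> P))" for k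
    unfolding ft by (rule E_bdiff_sq[OF f(6)])
  \<comment> \<open>By \<open>n\<close>, at least half of the vertices are joined to both twins by
    random pairs, and each of these contributes \<open>2 * var\<close>.\<close>
  have "real (card V) * var \<le> 2 * (real (card V) - 4 - 8 * real c) * var"
    using n var_nonneg by (intro mult_right_mono) auto
  also have "\<dots> \<le> 2 * real (card ?A) * var"
  proof -
    have "Q2 t \<subseteq> V" unfolding Q using f by simp
    from card_good[OF this conjunct2[OF Q4]] show ?thesis
      using var_nonneg by (intro mult_right_mono mult_left_mono) auto
  qed
  also have "\<dots> = (\<Sum>k\<in>?A. var * (of_bool ({?u, k} \<in> P) + of_bool ({?v, k} \<in> P)))"
    by (simp add: Q)
  also have "\<dots> \<le> (\<Sum>k\<in>V - Q2 t. var * (of_bool ({?u, k} \<in> P) + of_bool ({?v, k} \<in> P)))"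
    using finV var_nonneg by (intro sum_mono2) auto
  finally show "real (card V) * var \<le> (\<Sum>k\<in>V - Q2 t. E (\<lambda>S. (f2 t k S)\<^sup>2))" unfolding e .
  have "(\<Sum>k\<in>V - Q2 t. E (\<lambda>S. (f2 t k S)\<^sup>2)) \<le> (\<Sum>k\<in>V - Q2 t. var * 2)"
    unfolding e using var_nonneg by (intro sum_mono mult_left_mono) auto
  also have "\<dots> \<le> (\<Sum>k\<in>V. var * 2)" using finV var_nonneg by (intro sum_mono2) auto
  finally show "(\<Sum>k\<in>V - Q2 t. E (\<lambda>S. (f2 t k S)\<^sup>2)) \<le> 2 * real (card V) * var" by (simp add: mult_ac)
qed

lemma local_stats3:
  assumes n: "8 + 16 * real c \<le> real (card V)" and v: "1 \<le> 2 * real (card V) * var\<^sup>2"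
  shows "local_stats P \<pi> V Q3 f3 T3 (2 * real (card V) * var\<^sup>2) (4 * real (card V) * var\<^sup>2)"
proof unfold_locales
  show "finite V" "finite T3" using finV by (auto simp: T3_def)
  show "1 \<le> 2 * real (card V) * var\<^sup>2" by (rule v)
  fix t assume t: "t \<in> T3"
  obtain B x y where f: "t = (B, x, y)" "B < l" "x < c" "y < c" "lv B x False \<in> V" "lv B x True \<in> V"
    "rv B y False \<in> V" "rv B y True \<in> V" "lv B x False \<noteq> lv B x True" "rv B y False \<noteq> rv B y True"
    and lr: "\<forall>\<sigma> \<tau>. lv B x \<sigma> \<noteq> rv B y \<tau>"
    using T3_facts[OF t] .
  let ?u = "lv B x False" and ?v = "lv B x True" and ?r = "rv B y False" and ?s = "rv B y True"
  let ?g = "bdiff ?u ?v" and ?h = "bdiff ?r ?s"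
  have Q: "Q3 t = {?u, ?v, ?r, ?s}" and ft: "f3 t = (\<lambda>k S. ?g k S * ?h k S)"
    by (simp_all add: Q3_def f3_def f(1) fun_eq_iff)
  show "depends_on (f3 t k) ((\<lambda>u. {u, k}) ` Q3 t)" for k
    unfolding Q ft by (intro depends_on_comp2[of _ _ _ "(*)"] depends_on_mono[OF depends_on_bdiff]) auto
  show "\<bar>f3 t k S\<bar> \<le> 1" for k S
    unfolding ft abs_mult using abs_bdiff by (intro mult_le_one) auto
  have disj: "(\<lambda>u. {u, k}) ` {?u, ?v} \<inter> (\<lambda>u. {u, k}) ` {?r, ?s} = {}" for k
    using lr pair_ne[of "lv B x \<sigma>" "rv B y \<tau>" k for \<sigma> \<tau>] by auto
  show "E (f3 t k) = 0" for k
    unfolding ft using E_mult_indep[OF depends_on_bdiff depends_on_bdiff disj] by (simp add: E_bdiff)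
  show Q4: "finite (Q3 t) \<and> card (Q3 t) \<le> 4" unfolding Q by (simp add: card_insert_le_m1)
  let ?A = "{k \<in> V - Q3 t. \<forall>u\<in>Q3 t. {u, k} \<in> P}"
  let ?w = "\<lambda>k. var\<^sup>2 * ((of_bool ({?u, k} \<in> P) + of_bool ({?v, k} \<in> P)) * (of_bool ({?r, k} \<in> P) + of_bool ({?s, k} \<in> P)))"
  have e: "E (\<lambda>S. (f3 t k S)\<^sup>2) = ?w k" for k
  proof -
    have "E (\<lambda>S. (f3 t k S)\<^sup>2) = E (\<lambda>S. (?g k S)\<^sup>2 * (?h k S)\<^sup>2)" unfolding ft by (simp add: power_mult_distrib)
    also have "\<dots> = E (\<lambda>S. (?g k S)\<^sup>2) * E (\<lambda>S. (?h k S)\<^sup>2)"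
      by (rule E_mult_indep[OF depends_on_comp[OF depends_on_bdiff] depends_on_comp[OF depends_on_bdiff] disj])
    finally show ?thesis unfolding E_bdiff_sq[OF f(9)] E_bdiff_sq[OF f(10)] by (simp add: power2_eq_square mult_ac)
  qed
  have "2 * real (card V) * var\<^sup>2 \<le> 4 * (real (card V) - 4 - 8 * real c) * var\<^sup>2"
    using n by (intro mult_right_mono) auto
  also have "\<dots> \<le> 4 * real (card ?A) * var\<^sup>2"
  proof -
    have "Q3 t \<subseteq> V" unfolding Q using f by simp
    from card_good[OF this conjunct2[OF Q4]] show ?thesis
      by (intro mult_right_mono mult_left_mono) auto
  qed
  also have "\<dots> = (\<Sum>k\<in>?A. ?w k)"
    by (simp add: Q)
  also have "\<dots> \<le> (\<Sum>k\<in>V - Q3 t. ?w k)"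
    using finV by (intro sum_mono2) auto
  finally show "2 * real (card V) * var\<^sup>2 \<le> (\<Sum>k\<in>V - Q3 t. E (\<lambda>S. (f3 t k S)\<^sup>2))" unfolding e .
  have "(\<Sum>k\<in>V - Q3 t. E (\<lambda>S. (f3 t k S)\<^sup>2)) \<le> (\<Sum>k\<in>V - Q3 t. var\<^sup>2 * (2 * 2))"
    unfolding e by (intro sum_mono mult_left_mono mult_mono) auto
  also have "\<dots> \<le> (\<Sum>k\<in>V. var\<^sup>2 * (2 * 2))" using finV by (intro sum_mono2) auto
  finally show "(\<Sum>k\<in>V - Q3 t. E (\<lambda>S. (f3 t k S)\<^sup>2)) \<le> 4 * real (card V) * var\<^sup>2" by (simp add: mult_ac)
qed

lemma near2: "t \<in> T2 \<Longrightarrow> real (card {t' \<in> T2. Q2 t \<inter> Q2 t' \<noteq> {}}) \<le> 1"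
proof -
  assume t: "t \<in> T2"
  have "{t' \<in> T2. Q2 t \<inter> Q2 t' \<noteq> {}} \<subseteq> {t}"
  proof clarify
    fix B' x' assume t': "(B', x') \<in> T2" "Q2 t \<inter> Q2 (B', x') \<noteq> {}"
    obtain B x where tt: "t = (B, x)" by (cases t) auto
    have b: "B < l" "x < c" "B' < l" "x' < c" using t t' tt by (auto simp: T2_def)
    obtain z where "z \<in> Q2 t" "z \<in> Q2 (B', x')" using t'(2) by auto
    then have "\<exists>\<sigma>. z = lv B x \<sigma>" "\<exists>\<sigma>. z = lv B' x' \<sigma>" using tt by (auto simp: Q2_def)
    then obtain \<sigma> \<sigma>' where "lv B x \<sigma> = lv B' x' \<sigma>'" by metis
    then show "(B', x') = t" using lv_inj[OF b] tt by auto
  qed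
  then have "card {t' \<in> T2. Q2 t \<inter> Q2 t' \<noteq> {}} \<le> card {t}" by (intro card_mono) auto
  then show ?thesis by simp
qed

text \<open>Gadgets of different blocks are disjoint, and a block has c^2 gadgets.\<close>

lemma near3: "t \<in> T3 \<Longrightarrow> real (card {t' \<in> T3. Q3 t \<inter> Q3 t' \<noteq> {}}) \<le> (real c)\<^sup>2"
proof -
  assume t: "t \<in> T3"
  obtain B x y where tt: "t = (B, x, y)" by (cases t) auto
  have "{t' \<in> T3. Q3 t \<inter> Q3 t' \<noteq> {}} \<subseteq> {B} \<times> {..<c} \<times> {..<c}"
  proof clarify
    fix B' x' y' assume t': "(B', x', y') \<in> T3" "Q3 t \<inter> Q3 (B', x', y') \<noteq> {}"
    have b: "B < l" "x < c" "y < c" "B' < l" "x' < c" "y' < c" using t t' tt by (auto simp: T3_def)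
    obtain z where "z \<in> Q3 t" "z \<in> Q3 (B', x', y')" using t'(2) by auto
    then have "(\<exists>\<sigma>. z = lv B x \<sigma>) \<or> (\<exists>\<sigma>. z = rv B y \<sigma>)" "(\<exists>\<sigma>. z = lv B' x' \<sigma>) \<or> (\<exists>\<sigma>. z = rv B' y' \<sigma>)"
      using tt by (auto simp: Q3_def)
    then have "(\<exists>\<sigma> \<sigma>'. lv B x \<sigma> = lv B' x' \<sigma>') \<or> (\<exists>\<sigma> \<sigma>'. rv B y \<sigma> = rv B' y' \<sigma>')"
      using lv_rv[OF b(1,2,4,6)] lv_rv[OF b(4,5,1,3)] by metis
    then have "B' = B" using lv_inj[OF b(1,2,4,5)] rv_inj[OF b(1,3,4,6)] by metis
    then show "B' \<in> {B} \<and> (x', y') \<in> {..<c} \<times> {..<c}" using b by auto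
  qed
  then have "card {t' \<in> T3. Q3 t \<inter> Q3 t' \<noteq> {}} \<le> card ({B} \<times> {..<c} \<times> {..<c})" by (intro card_mono) auto
  also have "\<dots> = c * c" by (simp add: card_cartesian_product)
  finally show ?thesis by (simp add: power2_eq_square flip: of_nat_mult)
qed

lemma card_T: "card T2 = l2 * c" "card T3 = l3 * c\<^sup>2"
  by (simp_all add: T2_def T3_def card_cartesian_product power2_eq_square)

text \<open>At a twin itself the only possible terms are the pair of the twins, on which both
  differences would involve it equally, and a singleton; the two terms over \<open>Q2 t\<close>
  cancel.\<close>

lemma Delta_eq_sum: "t \<in> T2 \<Longrightarrow> gadget_bits.\<Delta> V lv (\<lambda>e. bit e S) t = (\<Sum>k\<in>V - Q2 t. f2 t k S)"
proof -
  interpret G: gadget_bits V lv rv c l1 l2 l3 "\<lambda>e. bit e S" p \<pi> by (rule bits)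
  assume t: "t \<in> T2"
  obtain B x where f: "t = (B, x)" "B < l" "x < c" "lv B x False \<in> V" "lv B x True \<in> V" "lv B x False \<noteq> lv B x True"
    using T2_facts[OF t] .
  let ?u = "lv B x False" and ?v = "lv B x True"
  have b0: "bit {i} S = 0" for i using single_notin by (simp add: bit_def)
  have "G.\<Delta> t = (\<Sum>k\<in>V. f2 t k S)"
    by (simp add: G.\<Delta>_def G.be_def wdeg_def f(1) f2_def bdiff_def sum_subtractf)
  also have "\<dots> = (\<Sum>k\<in>V - Q2 t. f2 t k S) + (\<Sum>k\<in>Q2 t. f2 t k S)"
    using f finV by (intro sum.subset_diff) (auto simp: Q2_def)
  also have "(\<Sum>k\<in>Q2 t. f2 t k S) = 0"
    using f(6) by (simp add: Q2_def f2_def f(1) bdiff_def b0 insert_commute)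
  finally show ?thesis by simp
qed

text \<open>For \<open>k\<close> in the gadget one of the two factors consists of pairs between its
  sides; these are reserved, so their bits vanish.\<close>

lemma g_eq_sum: "t \<in> T3 \<Longrightarrow> gadget_bits.g V lv rv (\<lambda>e. bit e S) t = (\<Sum>k\<in>V - Q3 t. f3 t k S)"
proof -
  interpret G: gadget_bits V lv rv c l1 l2 l3 "\<lambda>e. bit e S" p \<pi> by (rule bits)
  assume t: "t \<in> T3"
  obtain B x y where f: "t = (B, x, y)" "B < l" "x < c" "y < c" "lv B x False \<in> V" "lv B x True \<in> V"
    "rv B y False \<in> V" "rv B y True \<in> V" "lv B x False \<noteq> lv B x True" "rv B y False \<noteq> rv B y True"
    and lr: "\<forall>\<sigma> \<tau>. lv B x \<sigma> \<noteq> rv B y \<tau>"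
    using T3_facts[OF t] .
  have "B \<in> {l1 + l2..<l}" using t f(1) by (auto simp: T3_def)
  then have z: "bit {lv B x \<sigma>, rv B y \<tau>} S = 0" for \<sigma> \<tau>
  proof -
    have "(B, x, \<sigma>, y, \<tau>) \<in> idx 0 l" using f by (auto simp: idx_def)
    then have "pr (B, x, \<sigma>, y, \<tau>) \<in> R" unfolding R_def by (rule imageI)
    then show ?thesis using PR'(2) by (auto simp: bit_def)
  qed
  then have z': "bit {rv B y \<tau>, lv B x \<sigma>} S = 0" for \<sigma> \<tau> by (simp add: insert_commute)
  have "G.g t = (\<Sum>k\<in>V. f3 t k S)"
    by (simp add: G.g_def f(1) f3_def bdiff_def)
  also have "\<dots> = (\<Sum>k\<in>V - Q3 t. f3 t k S) + (\<Sum>k\<in>Q3 t. f3 t k S)"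
    using f finV by (intro sum.subset_diff) (auto simp: Q3_def)
  also have "(\<Sum>k\<in>Q3 t. f3 t k S) = 0"
    by (intro sum.neutral) (auto simp: Q3_def f3_def f(1) bdiff_def z z')
  finally show ?thesis by simp
qed

end

section \<open>Moments of degrees and codegrees over reserved pairs\<close>

context gadget_random
begin

text \<open>\<open>C\<close> and \<open>D\<close> as functions of the random outcome, before it is
  fixed.\<close>

definition Cs :: "'a set set \<Rightarrow> 'a set \<Rightarrow> real" where "Cs S e = (\<Sum>k\<in>V. \<Prod>i\<in>e. bit {i, k} S)"
definition Ds :: "'a set set \<Rightarrow> 'a set \<Rightarrow> real" where "Ds S e = (\<Sum>i\<in>e. wdeg V (\<lambda>e. bit e S) i)"

lemma E_sum_bit: "E (\<lambda>S. (\<Sum>e\<in>P. bit e S)\<^sup>2) \<le> var * real (card P)"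
proof -
  have "E (\<lambda>S. (\<Sum>e\<in>P. 1 * (\<Prod>e'\<in>{e}. bit e' S))\<^sup>2) \<le> 1 * var ^ 1 * (\<Sum>e\<in>P. 1\<^sup>2)"
  proof (rule second_moment_le[OF finite_P])
    fix e assume e: "e \<in> P"
    have "{x \<in> P. {x} = {e}} = {e}" using e by auto
    then show "real (card {x \<in> P. {x} = {e}}) \<le> 1" by simp
  qed auto
  then show ?thesis by simp
qed

text \<open>The double sum counts each pair of \<open>A\<close> twice, and squaring this factor
  gives 4; 14 rounds up 27 * 2 / 4.\<close>

lemma E_sum_Cs:
  assumes A: "A \<subseteq> [V]\<^bsup>2\<^esup>"
  shows "E (\<lambda>S. (\<Sum>e\<in>A. Cs S e)\<^sup>2) \<le> 14 * var\<^sup>2 * real (card V) * real (card A)"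
proof -
  let ?W = "\<lambda>i k. of_bool ({i, k} \<in> A) :: real"
  have sA: "{i} \<notin> A" for i using A by (auto simp: nsets_def)
  have sumA: "(\<Sum>e\<in>[V]\<^bsup>2\<^esup>. of_bool (e \<in> A) * h e) = (\<Sum>e\<in>A. h e)" for h :: "'a set \<Rightarrow> real"
    using A finite_nV by (intro sum.mono_neutral_cong_right) auto
  have eq: "(\<Sum>i\<in>V. \<Sum>k\<in>V. ?W i k * (\<Sum>j\<in>V. bit {i, j} S * bit {k, j} S)) = 2 * (\<Sum>e\<in>A. Cs S e)" for S
  proof -
    have "(\<Sum>i\<in>V. \<Sum>k\<in>V. ?W i k * (\<Sum>j\<in>V. bit {i, j} S * bit {k, j} S))
        = (\<Sum>i\<in>V. \<Sum>k\<in>V. of_bool ({i, k} \<in> A) * Cs S {i, k})"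
    proof (intro sum.cong refl)
      fix i k show "?W i k * (\<Sum>j\<in>V. bit {i, j} S * bit {k, j} S) = of_bool ({i, k} \<in> A) * Cs S {i, k}"
        using sA by (cases "i = k") (auto simp: Cs_def)
    qed
    also have "\<dots> = 2 * (\<Sum>e\<in>[V]\<^bsup>2\<^esup>. of_bool (e \<in> A) * Cs S e)"
      using sum_pairs_eq[OF finV, of "\<lambda>e. of_bool (e \<in> A) * Cs S e"] sA by simp
    finally show ?thesis unfolding sumA .
  qed
  have "(\<Sum>i\<in>V. \<Sum>k\<in>V. (?W i k)\<^sup>2) = (\<Sum>i\<in>V. \<Sum>k\<in>V. of_bool ({i, k} \<in> A))" by (simp add: power2_eq_square flip: of_bool_conj)
  also have "\<dots> = 2 * real (card A)"
    using sum_pairs_eq[OF finV, of "\<lambda>e. of_bool (e \<in> A)"] sA sumA[of "\<lambda>_. 1"] by simp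
  finally have sq: "(\<Sum>i\<in>V. \<Sum>k\<in>V. (?W i k)\<^sup>2) = 2 * real (card A)" .
  have "4 * E (\<lambda>S. (\<Sum>e\<in>A. Cs S e)\<^sup>2) = E (\<lambda>S. (2 * (\<Sum>e\<in>A. Cs S e))\<^sup>2)"
    by (simp add: power_mult_distrib E_cmult)
  also have "\<dots> \<le> 27 * var\<^sup>2 * (real (card V) * (2 * real (card A)))"
    unfolding eq[symmetric] sq[symmetric] by (rule second_moment_codeg[OF finV single_notin(1)]) (use sA in auto)
  also have "\<dots> \<le> 4 * (14 * var\<^sup>2 * real (card V) * real (card A))"
  proof -
    have "0 \<le> var\<^sup>2 * (real (card V) * real (card A))" by simp
    then show ?thesis by simp
  qed
  finally show ?thesis by linarith
qed

lemma E_abs_Cs: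
  assumes "e \<in> [V]\<^bsup>2\<^esup>" shows "E (\<lambda>S. \<bar>Cs S e\<bar>) \<le> 4 * var * sqrt (real (card V))"
proof (rule E_abs_le)
  have "E (\<lambda>S. (Cs S e)\<^sup>2) \<le> 14 * var\<^sup>2 * real (card V)" using E_sum_Cs[of "{e}"] assms by simp
  also have "\<dots> \<le> 16 * var\<^sup>2 * real (card V)" by (intro mult_right_mono) auto
  also have "\<dots> = (4 * var * sqrt (real (card V)))\<^sup>2" by (simp add: power_mult_distrib)
  finally show "E (\<lambda>S. (Cs S e)\<^sup>2) \<le> (4 * var * sqrt (real (card V)))\<^sup>2" .
  show "0 \<le> 4 * var * sqrt (real (card V))" using var_nonneg by simp
qed

lemma E_abs_Ds:
  assumes e: "e \<in> [V]\<^bsup>2\<^esup>" shows "E (\<lambda>S. \<bar>Ds S e\<bar>) \<le> 3 * sqrt (var * real (card V))"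
proof (rule E_abs_le)
  have eV: "e \<subseteq> V" "card e = 2" "finite e" using e by (auto simp: nsets_def)
  have eq: "Ds S e = (\<Sum>i\<in>V. of_bool (i \<in> e) * wdeg V (\<lambda>e. bit e S) i)" for S
    unfolding Ds_def using eV finV by (intro sum.mono_neutral_cong_left) auto
  have "(\<Sum>i\<in>V. (of_bool (i \<in> e) :: real)\<^sup>2) = (\<Sum>i\<in>e. 1)"
    using eV finV by (intro sum.mono_neutral_cong_right) auto
  then have "E (\<lambda>S. (Ds S e)\<^sup>2) \<le> 4 * var * (real (card V) * 2)"
    unfolding eq using second_moment_deg[OF finV single_notin(1), of "\<lambda>i. of_bool (i \<in> e)"] eV by simp
  also have "\<dots> \<le> 9 * (var * real (card V))"
  proof -
    have "0 \<le> var * real (card V)" using var_nonneg by simp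
    then show ?thesis by simp
  qed
  also have "\<dots> = (3 * sqrt (var * real (card V)))\<^sup>2" using var_nonneg by (simp add: power_mult_distrib)
  finally show "E (\<lambda>S. (Ds S e)\<^sup>2) \<le> (3 * sqrt (var * real (card V)))\<^sup>2" .
  show "0 \<le> 3 * sqrt (var * real (card V))" using var_nonneg by simp
qed

lemma E_sum_R_Ds: "E (\<lambda>S. (\<Sum>e\<in>R. Ds S e)\<^sup>2) \<le> 16 * (real c)\<^sup>2 * var * (real (card V))\<^sup>2"
proof -
  let ?r = "\<lambda>e. of_bool (e \<in> R) :: real"
  have eq: "(\<Sum>e\<in>R. Ds S e) = (\<Sum>i\<in>V. wdeg V ?r i * wdeg V (\<lambda>e. bit e S) i)" for S
  proof -
    have "(\<Sum>i\<in>V. wdeg V ?r i * wdeg V (\<lambda>e. bit e S) i) = (\<Sum>e\<in>[V]\<^bsup>2\<^esup>. ?r e * Ds S e)"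
      unfolding Ds_def by (rule sum_wdeg_mult_wdeg[OF finV]) (simp add: single_notin)
    also have "\<dots> = (\<Sum>e\<in>R. Ds S e)"
      using R_sub finite_nV by (intro sum.mono_neutral_cong_right) auto
    finally show ?thesis by simp
  qed
  have w: "0 \<le> wdeg V ?r i" "wdeg V ?r i \<le> 2 * real c" for i
  proof -
    show "0 \<le> wdeg V ?r i" unfolding wdeg_def by (intro sum_nonneg) auto
    have "wdeg V ?r i = real (card {w \<in> V. {i, w} \<in> R})"
      unfolding wdeg_def using finV by (simp add: of_bool_def sum.inter_filter[symmetric])
    then show "wdeg V ?r i \<le> 2 * real c" using degree_R[of i] by (simp flip: of_nat_mult)
  qed
  have "E (\<lambda>S. (\<Sum>e\<in>R. Ds S e)\<^sup>2) \<le> 4 * var * (real (card V) * (\<Sum>i\<in>V. (wdeg V ?r i)\<^sup>2))"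
    unfolding eq by (rule second_moment_deg[OF finV single_notin(1)])
  also have "\<dots> \<le> 4 * var * (real (card V) * (\<Sum>i\<in>V. (2 * real c)\<^sup>2))"
    using var_nonneg w by (intro mult_left_mono sum_mono power_mono) auto
  finally show ?thesis by (simp add: power2_eq_square mult_ac)
qed

end

text \<open>The tolerances of the random part: \<open>s\<close> and \<open>x\<close> stand for the square roots of the number of
  vertices and of \<open>p (1 - p)\<close>, so that \<open>s\<^sup>2 x\<close> is the order of the fluctuation of the number of edges.\<close>

locale gadget_scaled = gadget_random V lv rv c l1 l2 l3 p \<pi>
  for V :: "'a set" and lv rv c l1 l2 l3 p \<pi> +
  fixes s x y A :: real
  assumes s_def: "s = sqrt (real (card V))" and x_def: "p * (1 - p) = x\<^sup>2" and x: "0 < x" "x \<le> 1 / 2"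
    and y_def: "y\<^sup>2 = x" "0 < y" and A: "A = 100000 * (real c)\<^sup>2" "A \<le> s * x\<^sup>2"
    and var_lo: "x\<^sup>2 / 2 \<le> var" and var_hi: "var \<le> 2 * x\<^sup>2"
    and R1lo: "12 * (s\<^sup>2 * x) \<le> real (card R1)" and R1hi: "real (card R1) \<le> 24 * (s\<^sup>2 * x)"
    and R2lo: "40000 * (s\<^sup>2 * x) \<le> real (card R2)" and R2hi: "real (card R2) \<le> 80000 * (s\<^sup>2 * x)"
    and R3lo: "400000000 * (s\<^sup>2 * x) \<le> real (card R3)"
    and Rhi: "real (card R) \<le> real c * (s\<^sup>2 * x)"
begin

abbreviation \<nu> :: real where "\<nu> \<equiv> s\<^sup>2 * x"

lemma cc: "1 \<le> real c" using c1 by simp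

lemma s2: "s\<^sup>2 = real (card V)" by (simp add: s_def)

lemma s0: "0 \<le> s" by (simp add: s_def)

lemma c2: "real c \<le> (real c)\<^sup>2" "1 \<le> (real c)\<^sup>2"
proof -
  have "real c * 1 \<le> real c * real c" using cc by (intro mult_left_mono) auto
  then show "real c \<le> (real c)\<^sup>2" by (simp add: power2_eq_square)
  then show "1 \<le> (real c)\<^sup>2" using cc by linarith
qed

lemma A5: "100000 \<le> A" "100000 * real c \<le> A" using A c2 by auto

lemma x2: "x\<^sup>2 \<le> x" "x\<^sup>2 \<le> 1 / 4" "0 < x\<^sup>2"
proof -
  show "x\<^sup>2 \<le> x" using x by (simp add: power2_eq_square mult_left_le_one_le)
  have "x\<^sup>2 \<le> (1 / 2)\<^sup>2" using x by (intro power_mono) auto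
  then show "x\<^sup>2 \<le> 1 / 4" by (simp add: power2_eq_square)
  show "0 < x\<^sup>2" using x by simp
qed

lemma sx: "A \<le> s * x" "A \<le> s"
proof -
  have "s * x\<^sup>2 \<le> s * x" using s0 x2(1) by (intro mult_left_mono) auto
  then show a: "A \<le> s * x" using A(2) by linarith
  have "s * x \<le> s * 1" using s0 x by (intro mult_left_mono) auto
  then show "A \<le> s" using a by simp
qed

lemma spos: "0 < s" using sx A5 by linarith

lemma nu_ge: "A * s \<le> \<nu>" "A * A \<le> s\<^sup>2 * x\<^sup>2" "A * A \<le> \<nu>"
proof -
  have "s * A \<le> s * (s * x)" using s0 sx(1) by (intro mult_left_mono) auto
  then show "A * s \<le> \<nu>" by (simp add: power2_eq_square mult_ac)
  have "A * A \<le> (s * x) * (s * x)" using sx(1) A5 by (intro mult_mono) auto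
  then show "A * A \<le> s\<^sup>2 * x\<^sup>2" by (simp add: power2_eq_square mult_ac)
  moreover have "s\<^sup>2 * x\<^sup>2 \<le> \<nu>" using x2(1) by (intro mult_left_mono) auto
  ultimately show "A * A \<le> \<nu>" by linarith
qed

lemma nu_ge': "A \<le> \<nu>" "A \<le> s\<^sup>2 * x\<^sup>2" "0 < \<nu>"
proof -
  have "A * 1 \<le> A * A" using A5 by (intro mult_left_mono) auto
  then show "A \<le> \<nu>" "A \<le> s\<^sup>2 * x\<^sup>2" using nu_ge by auto
  then show "0 < \<nu>" using A5 by linarith
qed

lemma bound_Z1: "E (\<lambda>S. ((\<Sum>e\<in>P. bit e S) / (5 * \<nu>))\<^sup>2) \<le> 1 / 25"
proof -
  have "E (\<lambda>S. (\<Sum>e\<in>P. bit e S)\<^sup>2) \<le> var * real (card P)" by (rule E_sum_bit)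
  also have "\<dots> \<le> (2 * x\<^sup>2) * (s\<^sup>2 * s\<^sup>2 / 2)"
  proof (rule mult_mono[OF var_hi])
    interpret G: gadget_bits V lv rv c l1 l2 l3 "\<lambda>e. bit e {}" p \<pi> by (rule bits)
    have "real (card P) \<le> real (card V) * (real (card V) - 1) / 2" using G.card_PR by simp
    also have "\<dots> \<le> real (card V) * real (card V) / 2"
      by (intro divide_right_mono mult_left_mono) auto
    finally show "real (card P) \<le> s\<^sup>2 * s\<^sup>2 / 2" by (simp add: s2)
  qed (use x in auto)
  also have "\<dots> = \<nu>\<^sup>2" by (simp add: power2_eq_square)
  finally have "E (\<lambda>S. (\<Sum>e\<in>P. bit e S)\<^sup>2) / (5 * \<nu>)\<^sup>2 \<le> \<nu>\<^sup>2 / (5 * \<nu>)\<^sup>2"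
    by (intro divide_right_mono) auto
  also have "\<dots> = 1 / 25" using spos x by (simp add: power_mult_distrib)
  finally show ?thesis by (simp only: power_divide E_cdiv)
qed

text \<open>The margins 5 and 20 keep the means of all penalties at most 1/25 or 1/20, so that their
  total is below 1. The 11, 6, 15 and 8 in \<open>bound_Z2\<close>, \<open>bound_Z3\<close>,
  \<open>bound_Z7\<close> and \<open>bound_Z8\<close> are square roots rounded up.\<close>

lemma scaled_sq:
  assumes "E (\<lambda>S. (Z S)\<^sup>2) \<le> w\<^sup>2" "0 < w"
  shows "E (\<lambda>S. (Z S / (5 * w))\<^sup>2) \<le> 1 / 25"
proof -
  have "E (\<lambda>S. (Z S)\<^sup>2) / (5 * w)\<^sup>2 \<le> w\<^sup>2 / (5 * w)\<^sup>2" using assms(1) by (intro divide_right_mono) auto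
  also have "\<dots> = 1 / 25" using assms(2) by (simp add: power_mult_distrib)
  finally show ?thesis by (simp only: power_divide E_cdiv)
qed

lemma scaled_abs:
  assumes "E Z \<le> w" "0 < w"
  shows "E (\<lambda>S. Z S / (20 * w)) \<le> 1 / 20"
proof -
  have "E Z / (20 * w) \<le> w / (20 * w)" using assms by (intro divide_right_mono) auto
  then show ?thesis using assms(2) by (simp add: E_cdiv)
qed

lemma bound_Z2: "E (\<lambda>S. ((2 * (\<Sum>e\<in>[V]\<^bsup>2\<^esup>. Cs S e)) / (5 * (11 * (s ^ 3 * x\<^sup>2))))\<^sup>2) \<le> 1 / 25"
proof (rule scaled_sq)
  have cn: "real (card ([V]\<^bsup>2\<^esup>)) \<le> s\<^sup>2 * s\<^sup>2 / 2"
  proof -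
    have "real (card ([V]\<^bsup>2\<^esup>)) = real (card V choose 2)" using finV by (simp add: card_nsets)
    also have "\<dots> = real (card V) * (real (card V) - 1) / 2"
      by (cases "card V") (auto simp: choose_two real_of_nat_div algebra_simps)
    also have "\<dots> \<le> real (card V) * real (card V) / 2"
      by (intro divide_right_mono mult_left_mono) auto
    finally show ?thesis by (simp add: s2)
  qed
  have "E (\<lambda>S. (2 * (\<Sum>e\<in>[V]\<^bsup>2\<^esup>. Cs S e))\<^sup>2) = 4 * E (\<lambda>S. (\<Sum>e\<in>[V]\<^bsup>2\<^esup>. Cs S e)\<^sup>2)"
    by (simp add: power_mult_distrib E_cmult)
  also have "\<dots> \<le> 4 * (14 * var\<^sup>2 * real (card V) * real (card ([V]\<^bsup>2\<^esup>)))" by (intro mult_left_mono E_sum_Cs) auto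
  also have "\<dots> \<le> 4 * (14 * (2 * x\<^sup>2)\<^sup>2 * s\<^sup>2 * (s\<^sup>2 * s\<^sup>2 / 2))"
  proof -
    have "var\<^sup>2 \<le> (2 * x\<^sup>2)\<^sup>2" using var_hi var_nonneg by (intro power_mono) auto
    then have "14 * var\<^sup>2 * s\<^sup>2 \<le> 14 * (2 * x\<^sup>2)\<^sup>2 * s\<^sup>2" by (intro mult_right_mono mult_left_mono) auto
    then have "14 * var\<^sup>2 * s\<^sup>2 * real (card ([V]\<^bsup>2\<^esup>)) \<le> 14 * (2 * x\<^sup>2)\<^sup>2 * s\<^sup>2 * (s\<^sup>2 * s\<^sup>2 / 2)"
      using cn by (rule mult_mono) auto
    then show ?thesis unfolding s2[symmetric] by linarith
  qed
  also have "\<dots> = 112 * (s ^ 3 * x\<^sup>2)\<^sup>2" by (simp add: power_mult_distrib flip: power_mult power_add)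
  also have "\<dots> \<le> 121 * (s ^ 3 * x\<^sup>2)\<^sup>2" by (intro mult_right_mono) auto
  also have "\<dots> = (11 * (s ^ 3 * x\<^sup>2))\<^sup>2" by (simp add: power_mult_distrib)
  finally show "E (\<lambda>S. (2 * (\<Sum>e\<in>[V]\<^bsup>2\<^esup>. Cs S e))\<^sup>2) \<le> (11 * (s ^ 3 * x\<^sup>2))\<^sup>2" .
  show "0 < 11 * (s ^ 3 * x\<^sup>2)" using spos x by simp
qed

lemma bound_Z3: "E (\<lambda>S. ((\<Sum>e\<in>R. Ds S e) / (5 * (6 * (real c * \<nu>))))\<^sup>2) \<le> 1 / 25"
proof (rule scaled_sq)
  have "E (\<lambda>S. (\<Sum>e\<in>R. Ds S e)\<^sup>2) \<le> 16 * (real c)\<^sup>2 * var * (real (card V))\<^sup>2" by (rule E_sum_R_Ds)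
  also have "\<dots> \<le> 16 * (real c)\<^sup>2 * (2 * x\<^sup>2) * (s\<^sup>2)\<^sup>2"
    unfolding s2 using var_hi by (intro mult_right_mono mult_left_mono) auto
  also have "\<dots> = 32 * (real c * \<nu>)\<^sup>2" by (simp add: power_mult_distrib)
  also have "\<dots> \<le> 36 * (real c * \<nu>)\<^sup>2" by (intro mult_right_mono) auto
  also have "\<dots> = (6 * (real c * \<nu>))\<^sup>2" by (simp add: power_mult_distrib)
  finally show "E (\<lambda>S. (\<Sum>e\<in>R. Ds S e)\<^sup>2) \<le> (6 * (real c * \<nu>))\<^sup>2" .
  show "0 < 6 * (real c * \<nu>)" using nu_ge'(3) cc by simp
qed

lemma sub_nV: "R1 \<subseteq> [V]\<^bsup>2\<^esup>" "R2 \<subseteq> [V]\<^bsup>2\<^esup>" "R3 \<subseteq> [V]\<^bsup>2\<^esup>" using R_sub R_split by auto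

lemma bound_Z4: "E (\<lambda>S. (\<Sum>e\<in>R1. \<bar>Ds S e\<bar>) / (20 * (5 * (real (card R1) * (s * x))))) \<le> 1 / 20"
proof (rule scaled_abs)
  have "E (\<lambda>S. \<Sum>e\<in>R1. \<bar>Ds S e\<bar>) \<le> (\<Sum>e\<in>R1. 3 * sqrt (var * real (card V)))"
    unfolding E_sum using sub_nV by (intro sum_mono E_abs_Ds) auto
  also have "\<dots> = real (card R1) * (3 * sqrt (var * real (card V)))" by simp
  also have "\<dots> \<le> real (card R1) * (5 * (s * x))"
  proof (intro mult_left_mono)
    have "sqrt (var * real (card V)) \<le> sqrt ((25 / 9) * (s * x)\<^sup>2)"
    proof (intro real_sqrt_le_mono)
      have "var * real (card V) \<le> 2 * x\<^sup>2 * s\<^sup>2" unfolding s2 using var_hi by (intro mult_right_mono) auto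
      also have "\<dots> \<le> (25 / 9) * (s * x)\<^sup>2"
      proof -
        have "0 \<le> s\<^sup>2 * x\<^sup>2" by simp
        then show ?thesis by (simp add: power_mult_distrib)
      qed
      finally show "var * real (card V) \<le> (25 / 9) * (s * x)\<^sup>2" .
    qed
    also have "\<dots> = 5 / 3 * (s * x)"
    proof -
      have "sqrt (25 / 9) = (5 / 3 :: real)" by (rule real_sqrt_unique) (auto simp: power2_eq_square)
      then show ?thesis using spos x by (simp only: real_sqrt_mult real_sqrt_abs abs_of_pos mult_pos_pos)
    qed
    finally show "3 * sqrt (var * real (card V)) \<le> 5 * (s * x)" by simp
  qed simp
  finally show "E (\<lambda>S. \<Sum>e\<in>R1. \<bar>Ds S e\<bar>) \<le> 5 * (real (card R1) * (s * x))" by (simp add: mult_ac)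
  have "0 < real (card R1)" using R1lo nu_ge'(3) by linarith
  then show "0 < 5 * (real (card R1) * (s * x))" using spos x by simp
qed

lemma bound_Z7: "E (\<lambda>S. (tri V (\<lambda>e. bit e S) (\<lambda>e. bit e S) (\<lambda>e. bit e S) / (5 * (15 * (s ^ 3 * x ^ 3))))\<^sup>2) \<le> 1 / 25"
proof (rule scaled_sq)
  have "E (\<lambda>S. (tri V (\<lambda>e. bit e S) (\<lambda>e. bit e S) (\<lambda>e. bit e S))\<^sup>2) \<le> 27 * var ^ 3 * real (card V) ^ 3"
    by (rule second_moment_tri[OF finV single_notin(1)])
  also have "\<dots> \<le> 27 * (2 * x\<^sup>2) ^ 3 * (s\<^sup>2) ^ 3"
    unfolding s2 using var_hi var_nonneg by (intro mult_right_mono mult_left_mono power_mono) auto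
  also have "\<dots> = 216 * (s ^ 3 * x ^ 3)\<^sup>2" by (simp add: power_mult_distrib flip: power_mult)
  also have "\<dots> \<le> 225 * (s ^ 3 * x ^ 3)\<^sup>2" by (intro mult_right_mono) auto
  also have "\<dots> = (15 * (s ^ 3 * x ^ 3))\<^sup>2" by (simp add: power_mult_distrib)
  finally show "E (\<lambda>S. (tri V (\<lambda>e. bit e S) (\<lambda>e. bit e S) (\<lambda>e. bit e S))\<^sup>2) \<le> (15 * (s ^ 3 * x ^ 3))\<^sup>2" .
  show "0 < 15 * (s ^ 3 * x ^ 3)" using spos x by simp
qed

lemma Rpos: "0 < real (card R)" "real (card R1) + real (card R2) + real (card R3) = real (card R)"
proof -
  show eq: "real (card R1) + real (card R2) + real (card R3) = real (card R)"
    using sum_R_split[of "\<lambda>_. 1"] by simp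
  show "0 < real (card R)" using eq R1lo nu_ge'(3) by linarith
qed

lemma bound_Z8: "E (\<lambda>S. ((\<Sum>e\<in>R. Cs S e) / (5 * (8 * (x\<^sup>2 * s * sqrt (real (card R))))))\<^sup>2) \<le> 1 / 25"
proof (rule scaled_sq)
  have "E (\<lambda>S. (\<Sum>e\<in>R. Cs S e)\<^sup>2) \<le> 14 * var\<^sup>2 * real (card V) * real (card R)" by (rule E_sum_Cs[OF R_sub])
  also have "\<dots> \<le> 14 * (2 * x\<^sup>2)\<^sup>2 * s\<^sup>2 * real (card R)"
    unfolding s2 using var_hi var_nonneg by (intro mult_right_mono mult_left_mono power_mono) auto
  also have "\<dots> = 56 * (x\<^sup>2 * s * sqrt (real (card R)))\<^sup>2" by (simp add: power_mult_distrib)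
  also have "\<dots> \<le> 64 * (x\<^sup>2 * s * sqrt (real (card R)))\<^sup>2" by (intro mult_right_mono) auto
  also have "\<dots> = (8 * (x\<^sup>2 * s * sqrt (real (card R))))\<^sup>2" by (simp add: power_mult_distrib)
  finally show "E (\<lambda>S. (\<Sum>e\<in>R. Cs S e)\<^sup>2) \<le> (8 * (x\<^sup>2 * s * sqrt (real (card R))))\<^sup>2" .
  show "0 < 8 * (x\<^sup>2 * s * sqrt (real (card R)))" using spos x Rpos by simp
qed

lemma bound_Z9: "E (\<lambda>S. ((\<Sum>e\<in>R1. \<bar>Cs S e\<bar>) + (\<Sum>e\<in>R2. \<bar>Cs S e\<bar>))
   / (20 * (8 * ((real (card R1) + real (card R2)) * (x\<^sup>2 * s))))) \<le> 1 / 20"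
proof (rule scaled_abs)
  have le: "4 * var * sqrt (real (card V)) \<le> 8 * (x\<^sup>2 * s)"
    using mult_right_mono[OF var_hi s0] unfolding s_def[symmetric] by (simp only: mult.assoc)
  have "E (\<lambda>S. (\<Sum>e\<in>R1. \<bar>Cs S e\<bar>) + (\<Sum>e\<in>R2. \<bar>Cs S e\<bar>)) \<le> (\<Sum>e\<in>R1. 8 * (x\<^sup>2 * s)) + (\<Sum>e\<in>R2. 8 * (x\<^sup>2 * s))"
    unfolding E_add E_sum using sub_nV le by (intro add_mono sum_mono order_trans[OF E_abs_Cs]) auto
  then show "E (\<lambda>S. (\<Sum>e\<in>R1. \<bar>Cs S e\<bar>) + (\<Sum>e\<in>R2. \<bar>Cs S e\<bar>)) \<le> 8 * ((real (card R1) + real (card R2)) * (x\<^sup>2 * s))"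
    by (simp add: algebra_simps)
  have "0 < real (card R1) + real (card R2)" using R1lo nu_ge'(3) by linarith
  then show "0 < 8 * ((real (card R1) + real (card R2)) * (x\<^sup>2 * s))" using spos x by simp
qed

end

definition large_supports :: "nat \<Rightarrow> nat set set set" where
  "large_supports k = {H. H \<subseteq> [{..<k}]\<^bsup>2\<^esup> \<and> 4 \<le> card (\<Union>H)}"

lemma finite_large_supports: "finite (large_supports k)"
  unfolding large_supports_def by (rule finite_subset[of _ "Pow ([{..<k}]\<^bsup>2\<^esup>)"]) (auto simp: finite_imp_finite_nsets)

text \<open>A quantity that depends on \<open>k\<close> and \<open>c\<close> alone; the summand 1
  makes it positive.\<close>

definition envelope_const :: "nat \<Rightarrow> nat \<Rightarrow> real" where
  "envelope_const k c = 1 + (\<Sum>H\<in>large_supports k. \<Sum>J\<in>Pow H. (3 * real c) ^ card (\<Union>H)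
      * sqrt (real (card (\<Union>H)) ^ card (\<Union>H) * 2 ^ card H))"

lemma envelope_const_pos: "0 < envelope_const k c"
  unfolding envelope_const_def by (intro add_pos_nonneg sum_nonneg mult_nonneg_nonneg) auto

lemma sq_less_imp: "(z / w)\<^sup>2 < 1 \<Longrightarrow> 0 < w \<Longrightarrow> \<bar>z\<bar> \<le> (w::real)"
  by (simp add: abs_square_less_1 abs_divide)

section \<open>Large supports, and the capacities and sizes of the switches\<close>

context gadget_scaled
begin

text \<open>The bound \<open>rho\<close>, restated so that it is available before an outcome is
  fixed.\<close>

definition rhoS :: "'a set \<Rightarrow> real" where
  "rhoS e = (if e \<in> P then \<bar>\<pi> - p\<bar> else if e \<in> R then 1 else 0)"

text \<open>One penalty for all large supports, each sum divided by its target p (1 - p) n^(h - 2)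
  on h vertices.\<close>

definition env :: "nat \<Rightarrow> 'a set set \<Rightarrow> real" where
  "env k S = (\<Sum>H\<in>large_supports k. (\<Sum>J\<in>Pow H. envelope_sum V rhoS (\<lambda>e. bit e S) H J)
      / (x\<^sup>2 * real (card V) ^ (card (\<Union>H) - 2)))"

lemma y4: "y ^ 4 = x\<^sup>2" using y_def by (simp add: power2_eq_square power4_eq_xxxx mult.assoc)

lemma y1: "y \<le> 1" "x \<le> y"
proof -
  have "y\<^sup>2 \<le> 1\<^sup>2" using y_def x by simp
  then show "y \<le> 1" using y_def(2) by (simp add: power2_le_imp_le)
  then have "y * y \<le> 1 * y" using y_def(2) by (intro mult_right_mono) auto
  then show "x \<le> y" unfolding y_def(1)[symmetric] power2_eq_square by simp
qed

lemma n_ge1: "1 \<le> real (card V)"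
proof -
  have "1 * 1 \<le> s * s" using sx(2) A5 by (intro mult_mono) auto
  then show ?thesis using s2 by (simp add: power2_eq_square)
qed

lemma env_nonneg: "0 \<le> env k S"
  unfolding env_def envelope_sum_def
  by (intro sum_nonneg divide_nonneg_nonneg mult_nonneg_nonneg prod_nonneg) (auto simp: rhoS_def)

text \<open>Since \<open>y\<^sup>2 = x\<close>, the square of s y is \<open>\<nu>\<close>, the order
  of the number of reserved pairs. Hence 3 c s y serves as \<open>\<Delta>\<close> for both the
  degree and the total weight of \<open>rhoS\<close>; for the degree it suffices that s y is at
  least 1.\<close>

lemma bound_env: "E (\<lambda>S. env k S / (20 * envelope_const k c)) \<le> 1 / 20"
proof (rule scaled_abs[OF _ envelope_const_pos])
  interpret G: gadget_bits V lv rv c l1 l2 l3 "\<lambda>e. bit e {}" p \<pi> by (rule bits)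
  have rho: "G.rho = rhoS" by (rule ext) (simp add: G.rho_def rhoS_def)
  have sy: "1 \<le> s * y"
  proof -
    have "s * x \<le> s * y" using s0 y1 by (intro mult_left_mono) auto
    then show ?thesis using sx(1) A5 by linarith
  qed
  have "E (env k) = (\<Sum>H\<in>large_supports k. (\<Sum>J\<in>Pow H. E (\<lambda>S. envelope_sum V rhoS (\<lambda>e. bit e S) H J))
      / (x\<^sup>2 * real (card V) ^ (card (\<Union>H) - 2)))"
    unfolding env_def by (simp only: E_sum E_cdiv)
  also have "\<dots> \<le> (\<Sum>H\<in>large_supports k. \<Sum>J\<in>Pow H. (3 * real c) ^ card (\<Union>H)
      * sqrt (real (card (\<Union>H)) ^ card (\<Union>H) * 2 ^ card H))"
  proof (rule sum_mono)
    fix H assume H: "H \<in> large_supports k"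
    let ?c = "\<lambda>J. (3 * real c) ^ card (\<Union>H) * sqrt (real (card (\<Union>H)) ^ card (\<Union>H) * 2 ^ card H)"
    let ?d = "x\<^sup>2 * real (card V) ^ (card (\<Union>H) - 2)"
    have Hf: "finite H" "\<And>e. e \<in> H \<Longrightarrow> card e = 2" "4 \<le> card (\<Union>H)"
      using H finite_subset[OF _ finite_imp_finite_nsets[of "{..<k}" 2]] by (auto simp: large_supports_def nsets_def)
    have d: "0 < ?d" using x n_ge1 by simp
    have "E (\<lambda>S. envelope_sum V rhoS (\<lambda>e. bit e S) H J) \<le> ?c J * ?d" if J: "J \<in> Pow H" for J
      unfolding y4[symmetric]
    proof (rule E_envelope_sum_le_scaled)
      show "1 \<le> card V" using n_ge1 by simp
      show "var \<le> 2 * y ^ 4" using var_hi y4 by simp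
      show "(\<Sum>w\<in>V. rhoS {i, w}) \<le> 3 * real c * sqrt (real (card V)) * y" if "i \<in> V" for i
      proof -
        have "(\<Sum>w\<in>V. rhoS {i, w}) \<le> 3 * real c * 1" using G.wdeg_rho[OF that] rho by (simp add: wdeg_def)
        also have "\<dots> \<le> 3 * real c * (s * y)" using sy by (intro mult_left_mono) auto
        finally show ?thesis by (simp add: s_def mult.assoc)
      qed
      show "(\<Sum>i\<in>V. \<Sum>w\<in>V. rhoS {i, w}) \<le> (3 * real c * sqrt (real (card V)) * y)\<^sup>2"
      proof -
        have "(\<Sum>i\<in>V. \<Sum>w\<in>V. rhoS {i, w}) \<le> 3 * real (card R)" using G.sum_wdeg_rho rho by (simp add: wdeg_def)
        also have "\<dots> \<le> 3 * (real c * \<nu>)" using Rhi by simp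
        also have "\<dots> \<le> 9 * ((real c)\<^sup>2 * \<nu>)"
        proof -
          have "real c * \<nu> \<le> (real c)\<^sup>2 * \<nu>" using c2 nu_ge'(3) by (intro mult_right_mono) auto
          moreover have "0 \<le> (real c)\<^sup>2 * \<nu>" using nu_ge'(3) by simp
          ultimately show ?thesis by linarith
        qed
        also have "\<dots> = (3 * real c * sqrt (real (card V)) * y)\<^sup>2"
          using y_def s2 by (simp add: power_mult_distrib)
        finally show ?thesis .
      qed
    qed (use finV J Hf y1 y_def cc G.rho0 G.rho1 rho in auto)
    then have "(\<Sum>J\<in>Pow H. E (\<lambda>S. envelope_sum V rhoS (\<lambda>e. bit e S) H J)) \<le> (\<Sum>J\<in>Pow H. ?c J * ?d)"
      by (rule sum_mono)
    then show "(\<Sum>J\<in>Pow H. E (\<lambda>S. envelope_sum V rhoS (\<lambda>e. bit e S) H J)) / ?d \<le> (\<Sum>J\<in>Pow H. ?c J)"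
      unfolding sum_distrib_right[symmetric] using d by (simp add: pos_divide_le_eq)
  qed
  also have "\<dots> \<le> envelope_const k c" unfolding envelope_const_def by simp
  finally show "E (env k) \<le> envelope_const k c" .
qed

definition d2 :: "nat \<times> nat \<Rightarrow> 'a set set \<Rightarrow> real" where "d2 t S = (\<Sum>k\<in>V - Q2 t. f2 t k S)"
definition d3 :: "nat \<times> nat \<times> nat \<Rightarrow> 'a set set \<Rightarrow> real" where "d3 t S = (\<Sum>k\<in>V - Q3 t. f3 t k S)"

lemma n_large: "8 + 16 * real c \<le> real (card V)"
proof -
  have "s * 1 \<le> s * s" using sx(2) A5 by (intro mult_left_mono) auto
  then have "A \<le> real (card V)" using sx(2) s2 by (simp add: power2_eq_square)
  then show ?thesis using A5 cc by linarith
qed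

text \<open>7/10 is a rational number below 1 / sqrt 2. In \<open>mlo3\<close> it plays the same
  part, with \<open>s * x\<^sup>2\<close> in place of \<open>s * x\<close>.\<close>

lemma mlo2: "s\<^sup>2 * x\<^sup>2 / 2 \<le> real (card V) * var" "7 / 10 * (s * x) \<le> sqrt (real (card V) * var)"
proof -
  show a: "s\<^sup>2 * x\<^sup>2 / 2 \<le> real (card V) * var"
    unfolding s2[symmetric] using mult_left_mono[OF var_lo, of "s\<^sup>2"] by simp
  have "(7 / 10 * (s * x))\<^sup>2 \<le> s\<^sup>2 * x\<^sup>2 / 2"
  proof -
    have "0 \<le> s\<^sup>2 * x\<^sup>2" by simp
    moreover have "(7 / 10 * (s * x))\<^sup>2 = 49 / 100 * (s\<^sup>2 * x\<^sup>2)" by (simp add: power2_eq_square)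
    ultimately show ?thesis by linarith
  qed
  then show "7 / 10 * (s * x) \<le> sqrt (real (card V) * var)" using a by (intro real_le_rsqrt) linarith
qed

lemma mlo3: "s\<^sup>2 * x ^ 4 / 2 \<le> 2 * real (card V) * var\<^sup>2" "7 / 10 * (s * x\<^sup>2) \<le> sqrt (2 * real (card V) * var\<^sup>2)"
proof -
  have "(x\<^sup>2 / 2)\<^sup>2 \<le> var\<^sup>2" using var_lo by (intro power_mono) auto
  from mult_left_mono[OF this, of "2 * s\<^sup>2"]
  show a: "s\<^sup>2 * x ^ 4 / 2 \<le> 2 * real (card V) * var\<^sup>2"
    unfolding s2[symmetric] by (simp add: power_divide flip: power_mult)
  have "(7 / 10 * (s * x\<^sup>2))\<^sup>2 \<le> s\<^sup>2 * x ^ 4 / 2"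
  proof -
    have "0 \<le> s\<^sup>2 * x ^ 4" by simp
    moreover have "(7 / 10 * (s * x\<^sup>2))\<^sup>2 = 49 / 100 * (s\<^sup>2 * x ^ 4)"
      by (simp add: power2_eq_square power4_eq_xxxx)
    ultimately show ?thesis by linarith
  qed
  then show "7 / 10 * (s * x\<^sup>2) \<le> sqrt (2 * real (card V) * var\<^sup>2)" using a by (intro real_le_rsqrt) linarith
qed

lemma ls2: "local_stats P \<pi> V Q2 f2 T2 (real (card V) * var) (2 * real (card V) * var)"
  using mlo2(1) nu_ge'(2) A5 by (intro local_stats2[OF n_large]) linarith

lemma ls3: "local_stats P \<pi> V Q3 f3 T3 (2 * real (card V) * var\<^sup>2) (4 * real (card V) * var\<^sup>2)"
proof (rule local_stats3[OF n_large])
  have "1 \<le> 7 / 10 * (s * x\<^sup>2)" using A(2) A5 by linarith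
  then have "1 \<le> sqrt (2 * real (card V) * var\<^sup>2)" using mlo3(2) by linarith
  then show "1 \<le> 2 * real (card V) * var\<^sup>2" by simp
qed

lemma l_large: "10000 \<le> real l2" "10000 \<le> real l3"
proof -
  have "(real c)\<^sup>2 \<le> \<nu>" using nu_ge'(1) A c2(2) by linarith
  moreover have "real (card R2) = 4 * (real c)\<^sup>2 * real l2" "real (card R3) = 4 * (real c)\<^sup>2 * real l3" by (simp_all add: card_R)
  ultimately have "(4 * (real c)\<^sup>2) * 10000 \<le> (4 * (real c)\<^sup>2) * real l2" "(4 * (real c)\<^sup>2) * 10000 \<le> (4 * (real c)\<^sup>2) * real l3"
    using R2lo R3lo by linarith+
  then show "10000 \<le> real l2" "10000 \<le> real l3" using c1 by simp_all
qed

text \<open>26000 lies below 3/8 * 7/10 * 100000 = 26250, see \<open>mu_large\<close>, and 15 above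
  128/9, the ratio that arises in \<open>bound_cap2\<close> and \<open>bound_cap3\<close>.\<close>

lemma capacity_small:
  assumes "26000 \<le> \<mu>" "q \<le> 15 / 10000"
  shows "4 * (2 * 8 / \<mu> + (8 / \<mu>)\<^sup>2 + q) \<le> (1 / 20 :: real)"
proof -
  have "8 / \<mu> \<le> 8 / 26000" using assms(1) by (intro divide_left_mono) auto
  then have a: "8 / \<mu> \<le> 1 / 1000" by simp
  have "0 \<le> 8 / \<mu>" using assms(1) by simp
  then have "(8 / \<mu>)\<^sup>2 \<le> (1 / 1000)\<^sup>2" using a by (intro power_mono)
  then have "(8 / \<mu>)\<^sup>2 \<le> 1 / 1000" by (simp add: power2_eq_square)
  then show ?thesis using a assms(2) by simp
qed

lemma mu_large: "26000 \<le> 3 / 8 * sqrt (real (card V) * var)" "26000 \<le> 3 / 8 * sqrt (2 * real (card V) * var\<^sup>2)"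
  using mlo2(2) mlo3(2) sx(1) A(2) A5 by linarith+

text \<open>A value of this penalty below 1 means that the capacity exceeds half of its mean, see
  \<open>half_le_of_close\<close>.\<close>

lemma bound_cap2:
  "E (\<lambda>S. 4 * ((\<Sum>t\<in>T2. \<bar>d2 t S\<bar>) / E (\<lambda>S. \<Sum>t\<in>T2. \<bar>d2 t S\<bar>) - 1)\<^sup>2) \<le> 1 / 20"
  "real (card T2) * (3 / 8 * sqrt (real (card V) * var)) \<le> E (\<lambda>S. \<Sum>t\<in>T2. \<bar>d2 t S\<bar>)"
proof -
  interpret L: local_stats P \<pi> V Q2 f2 T2 "real (card V) * var" "2 * real (card V) * var" by (rule ls2)
  have st: "L.st = d2" by (intro ext) (simp add: L.st_def d2_def)
  have T: "10000 \<le> real (card T2)"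
  proof -
    have "real l2 * 1 \<le> real l2 * real c" using cc by (intro mult_left_mono) auto
    moreover have "real (card T2) = real l2 * real c" by (simp add: card_T)
    ultimately show ?thesis using l_large by linarith
  qed
  then have ne: "T2 \<noteq> {}" by auto
  let ?m = "real (card V) * var" and ?\<mu> = "3 / 8 * sqrt (real (card V) * var)"
  have m0: "0 < ?m" using L.mlo(2) by linarith
  show "real (card T2) * ?\<mu> \<le> E (\<lambda>S. \<Sum>t\<in>T2. \<bar>d2 t S\<bar>)"
    using L.capacity(2)[OF near2 ne] unfolding st .
  have "?\<mu>\<^sup>2 = (3 / 8)\<^sup>2 * (sqrt ?m)\<^sup>2" by (rule power_mult_distrib)
  then have \<mu>2: "?\<mu>\<^sup>2 = 9 / 64 * ?m" using m0 by (simp add: power2_eq_square[of "3 / 8 :: real"])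
  have "1 * (2 * z) / (real (card T2) * (9 / 64 * z)) = 128 / 9 / real (card T2)" if "0 < z" for z :: real
    using that T by (simp add: field_simps)
  from this[OF m0] have "1 * (2 * real (card V) * var) / (real (card T2) * ?\<mu>\<^sup>2) = 128 / 9 / real (card T2)"
    unfolding \<mu>2 by (simp only: mult.assoc)
  also have "\<dots> \<le> 128 / 9 / 10000" using T by (intro divide_left_mono) auto
  finally have q: "1 * (2 * real (card V) * var) / (real (card T2) * ?\<mu>\<^sup>2) \<le> 15 / 10000" by simp
  have "E (\<lambda>S. 4 * ((\<Sum>t\<in>T2. \<bar>d2 t S\<bar>) / E (\<lambda>S. \<Sum>t\<in>T2. \<bar>d2 t S\<bar>) - 1)\<^sup>2)
      \<le> 4 * (2 * 8 / ?\<mu> + (8 / ?\<mu>)\<^sup>2 + 1 * (2 * real (card V) * var) / (real (card T2) * ?\<mu>\<^sup>2))"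
    unfolding E_cmult using L.capacity(1)[OF near2 ne] unfolding st by (intro mult_left_mono) auto
  also have "\<dots> \<le> 1 / 20" by (rule capacity_small[OF mu_large(1) q])
  finally show "E (\<lambda>S. 4 * ((\<Sum>t\<in>T2. \<bar>d2 t S\<bar>) / E (\<lambda>S. \<Sum>t\<in>T2. \<bar>d2 t S\<bar>) - 1)\<^sup>2) \<le> 1 / 20" .
qed

lemma bound_cap3:
  "E (\<lambda>S. 4 * ((\<Sum>t\<in>T3. \<bar>d3 t S\<bar>) / E (\<lambda>S. \<Sum>t\<in>T3. \<bar>d3 t S\<bar>) - 1)\<^sup>2) \<le> 1 / 20"
  "real (card T3) * (3 / 8 * sqrt (2 * real (card V) * var\<^sup>2)) \<le> E (\<lambda>S. \<Sum>t\<in>T3. \<bar>d3 t S\<bar>)"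
proof -
  interpret L: local_stats P \<pi> V Q3 f3 T3 "2 * real (card V) * var\<^sup>2" "4 * real (card V) * var\<^sup>2" by (rule ls3)
  have st: "L.st = d3" by (intro ext) (simp add: L.st_def d3_def)
  have cT: "real (card T3) = real l3 * (real c)\<^sup>2" by (simp add: card_T)
  have T0: "0 < real (card T3)" unfolding cT using l_large c1 by simp
  then have ne: "T3 \<noteq> {}" by auto
  let ?m = "2 * real (card V) * var\<^sup>2" and ?\<mu> = "3 / 8 * sqrt (2 * real (card V) * var\<^sup>2)"
  have m0: "0 < ?m" using L.mlo(2) by linarith
  show "real (card T3) * ?\<mu> \<le> E (\<lambda>S. \<Sum>t\<in>T3. \<bar>d3 t S\<bar>)"
    using L.capacity(2)[OF near3 ne] unfolding st .
  have "?\<mu>\<^sup>2 = (3 / 8)\<^sup>2 * (sqrt ?m)\<^sup>2" by (rule power_mult_distrib)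
  then have \<mu>2: "?\<mu>\<^sup>2 = 9 / 64 * ?m" using m0 by (simp add: power2_eq_square[of "3 / 8 :: real"])
  have "(real c)\<^sup>2 * (4 * real (card V) * var\<^sup>2) = (real c)\<^sup>2 * (2 * ?m)" by simp
  moreover have "(real c)\<^sup>2 * (2 * z) / (real l3 * (real c)\<^sup>2 * (9 / 64 * z)) = 128 / 9 / real l3" if "0 < z" for z :: real
    using that c1 l_large by (simp add: field_simps)
  ultimately have "(real c)\<^sup>2 * (4 * real (card V) * var\<^sup>2) / (real (card T3) * ?\<mu>\<^sup>2) = 128 / 9 / real l3"
    unfolding \<mu>2 cT using m0 by metis
  also have "\<dots> \<le> 128 / 9 / 10000" using l_large by (intro divide_left_mono) auto
  finally have q: "(real c)\<^sup>2 * (4 * real (card V) * var\<^sup>2) / (real (card T3) * ?\<mu>\<^sup>2) \<le> 15 / 10000" by simp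
  have "E (\<lambda>S. 4 * ((\<Sum>t\<in>T3. \<bar>d3 t S\<bar>) / E (\<lambda>S. \<Sum>t\<in>T3. \<bar>d3 t S\<bar>) - 1)\<^sup>2)
      \<le> 4 * (2 * 8 / ?\<mu> + (8 / ?\<mu>)\<^sup>2 + (real c)\<^sup>2 * (4 * real (card V) * var\<^sup>2) / (real (card T3) * ?\<mu>\<^sup>2))"
    unfolding E_cmult using L.capacity(1)[OF near3 ne] unfolding st by (intro mult_left_mono) auto
  also have "\<dots> \<le> 1 / 20" by (rule capacity_small[OF mu_large(2) q])
  finally show "E (\<lambda>S. 4 * ((\<Sum>t\<in>T3. \<bar>d3 t S\<bar>) / E (\<lambda>S. \<Sum>t\<in>T3. \<bar>d3 t S\<bar>) - 1)\<^sup>2) \<le> 1 / 20" .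
qed

lemma card_T_le: "real (card T2) \<le> real (card R2)" "real (card T3) \<le> real (card R3)"
proof -
  have "l2 * c * 1 \<le> l2 * c * (4 * c)" using c1 by (intro mult_left_mono) auto
  then have "card T2 \<le> card R2" by (simp add: card_T card_R power2_eq_square mult_ac)
  then show "real (card T2) \<le> real (card R2)" by simp
  have "card T3 \<le> card R3" by (simp add: card_T card_R)
  then show "real (card T3) \<le> real (card R3)" by simp
qed

lemma bound_max2: "E (\<lambda>S. \<Sum>t\<in>T2. (d2 t S / (s\<^sup>2 * x\<^sup>2)) ^ 4) \<le> 1 / 20"
proof -
  interpret L: local_stats P \<pi> V Q2 f2 T2 "real (card V) * var" "2 * real (card V) * var" by (rule ls2)
  have st: "L.st = d2" by (intro ext) (simp add: L.st_def d2_def)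
  let ?a = "s\<^sup>2 * x\<^sup>2"
  have a0: "0 < ?a" using spos x by simp
  have "2 * real (card V) * var \<le> 4 * ?a" unfolding s2[symmetric] using mult_left_mono[OF var_hi, of "2 * s\<^sup>2"] by simp
  then have "(2 * real (card V) * var)\<^sup>2 \<le> (4 * ?a)\<^sup>2" using var_nonneg by (intro power_mono) auto
  then have m: "4 * (2 * real (card V) * var)\<^sup>2 / ?a ^ 4 \<le> 4 * (4 * ?a)\<^sup>2 / ?a ^ 4"
    using a0 by (intro divide_right_mono mult_left_mono) auto
  have e: "4 * (4 * z)\<^sup>2 / z ^ 4 = 64 / z\<^sup>2" if "0 < z" for z :: real using that by (simp add: field_simps eval_nat_numeral)
  have "E (\<lambda>S. \<Sum>t\<in>T2. (d2 t S / ?a) ^ 4) \<le> real (card T2) * (4 * (2 * real (card V) * var)\<^sup>2 / ?a ^ 4)"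
    using L.E_sum_st_4_le unfolding st .
  also have "\<dots> \<le> (80000 * \<nu>) * (64 / ?a\<^sup>2)"
    using m e[OF a0] card_T_le(1) R2hi by (intro mult_mono) auto
  also have "\<dots> = 5120000 / (s\<^sup>2 * x ^ 3)" using spos x by (simp add: field_simps eval_nat_numeral)
  also have "\<dots> \<le> 5120000 / 10000000000"
  proof (rule divide_left_mono)
    have "100000 * 100000 \<le> A * A" using A5 by (intro mult_mono) auto
    also have "\<dots> \<le> (s * x\<^sup>2) * (s * x\<^sup>2)" using A A5 by (intro mult_mono) auto
    also have "\<dots> = s\<^sup>2 * x ^ 4" by (simp add: power_mult_distrib eval_nat_numeral mult_ac)
    also have "\<dots> \<le> s\<^sup>2 * x ^ 3" using x by (intro mult_left_mono power_decreasing) auto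
    finally show "10000000000 \<le> s\<^sup>2 * x ^ 3" by simp
  qed (use spos x in auto)
  finally show ?thesis by simp
qed

lemma bound_max3: "E (\<lambda>S. \<Sum>t\<in>T3. (d3 t S / (s\<^sup>2 * x\<^sup>2)) ^ 4) \<le> 1 / 20"
proof -
  interpret L: local_stats P \<pi> V Q3 f3 T3 "2 * real (card V) * var\<^sup>2" "4 * real (card V) * var\<^sup>2" by (rule ls3)
  have st: "L.st = d3" by (intro ext) (simp add: L.st_def d3_def)
  let ?a = "s\<^sup>2 * x\<^sup>2"
  have a0: "0 < ?a" using spos x by simp
  have "var\<^sup>2 \<le> (2 * x\<^sup>2)\<^sup>2" using var_hi var_nonneg by (intro power_mono) auto
  from mult_left_mono[OF this, of "4 * s\<^sup>2"]
  have "4 * real (card V) * var\<^sup>2 \<le> 16 * (s\<^sup>2 * x ^ 4)" unfolding s2[symmetric] by (simp add: power_mult_distrib flip: power_mult)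
  then have "(4 * real (card V) * var\<^sup>2)\<^sup>2 \<le> (16 * (s\<^sup>2 * x ^ 4))\<^sup>2" by (intro power_mono) auto
  then have m: "4 * (4 * real (card V) * var\<^sup>2)\<^sup>2 / ?a ^ 4 \<le> 4 * (16 * (s\<^sup>2 * x ^ 4))\<^sup>2 / ?a ^ 4"
    using a0 by (intro divide_right_mono mult_left_mono) auto
  have e: "4 * (16 * (s\<^sup>2 * x ^ 4))\<^sup>2 / ?a ^ 4 = 1024 / s ^ 4" using spos x by (simp add: field_simps eval_nat_numeral)
  have R3: "real (card R3) \<le> real c * \<nu>" using Rpos(2) Rhi by linarith
  have "E (\<lambda>S. \<Sum>t\<in>T3. (d3 t S / ?a) ^ 4) \<le> real (card T3) * (4 * (4 * real (card V) * var\<^sup>2)\<^sup>2 / ?a ^ 4)"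
    using L.E_sum_st_4_le unfolding st .
  also have "\<dots> \<le> (real c * \<nu>) * (1024 / s ^ 4)"
    using m e card_T_le(2) R3 by (intro mult_mono) auto
  also have "\<dots> = 1024 * (real c * x) / s\<^sup>2" using spos by (simp add: field_simps eval_nat_numeral)
  also have "\<dots> \<le> 1024 * (real c * 1) / (100000 * real c)"
  proof (rule frac_le)
    show "1024 * (real c * x) \<le> 1024 * (real c * 1)" using x by (intro mult_left_mono) auto
    have "s * 1 \<le> s * s" using sx(2) A5 by (intro mult_left_mono) auto
    then show "100000 * real c \<le> s\<^sup>2" using sx(2) A5(2) by (simp add: power2_eq_square)
  qed (use cc in auto)
  also have "\<dots> = 1024 / 100000" using cc by simp
  finally show ?thesis by simp
qed

end

lemma (in bernoulli_set) ex_small_penalties: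
  assumes nonneg: "list_all (\<lambda>f. \<forall>S. 0 \<le> f S) fs" and small: "(\<Sum>f\<leftarrow>fs. E f) < 1"
  shows "\<exists>S\<subseteq>P. list_all (\<lambda>f. f S < 1) fs"
proof -
  have "E (\<lambda>S. \<Sum>f\<leftarrow>fs. f S) = (\<Sum>f\<leftarrow>fs. E f)" by (induction fs) (auto simp: E_add)
  then obtain S where S: "S \<subseteq> P" "(\<Sum>f\<leftarrow>fs. f S) < 1" using E_less_imp_ex small by metis
  have "f S \<le> (\<Sum>f\<leftarrow>fs. f S)" if "f \<in> set fs" for f
    using nonneg that
  proof (induction fs)
    case (Cons g fs)
    have "0 \<le> (\<Sum>f\<leftarrow>fs. f S)" using Cons.prems by (intro sum_list_nonneg) (auto simp: list_all_iff)
    moreover have "0 \<le> g S" using Cons.prems by simp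
    moreover have "f \<noteq> g \<Longrightarrow> f S \<le> (\<Sum>f\<leftarrow>fs. f S)" using Cons.prems by (intro Cons.IH) auto
    ultimately show ?case by (cases "f = g") auto
  qed simp
  then have "\<forall>f\<in>set fs. f S < 1" using S(2) le_less_trans by blast
  then show ?thesis using S(1) by (auto simp: list_all_iff)
qed

lemma half_le_of_close: "4 * (y / e - 1)\<^sup>2 < 1 \<Longrightarrow> 0 < e \<Longrightarrow> e / 2 \<le> (y :: real)"
proof -
  assume a: "4 * (y / e - 1)\<^sup>2 < 1" "0 < e"
  have "(2 * (y / e - 1))\<^sup>2 = 4 * (y / e - 1)\<^sup>2" by (rule trans[OF power_mult_distrib]) simp
  then have "(2 * (y / e - 1))\<^sup>2 < 1" using a(1) by (simp only:)
  then have "1 / 2 < y / e" by (simp only: abs_square_less_1 right_diff_distrib)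
  then show ?thesis using a(2) by (simp add: field_simps)
qed

lemma abs_le_of_sum_power4:
  fixes f :: "'b \<Rightarrow> real"
  assumes "finite T" "t \<in> T" "(\<Sum>t\<in>T. (f t / a) ^ 4) < 1" "0 < a"
  shows "\<bar>f t\<bar> \<le> a"
proof (rule sq_less_imp)
  have "(f t / a) ^ 4 \<le> (\<Sum>t\<in>T. (f t / a) ^ 4)" using assms by (intro member_le_sum) auto
  then have "((f t / a)\<^sup>2)\<^sup>2 < 1" using assms(3) by (simp flip: power_mult)
  then show "(f t / a)\<^sup>2 < 1" using abs_square_less_1[of "(f t / a)\<^sup>2"] by linarith
qed (rule assms(4))

section \<open>A good outcome of the random part and its correction\<close>

context gadget_scaled
begin

lemma capacity_pos:
  "0 < E (\<lambda>S. \<Sum>t\<in>T2. \<bar>d2 t S\<bar>)" "0 < E (\<lambda>S. \<Sum>t\<in>T3. \<bar>d3 t S\<bar>)"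
proof -
  have "0 < real (card T2)" "0 < real (card T3)" using l_large c1 by (auto simp: card_T)
  then have "0 < real (card T2) * (3 / 8 * sqrt (real (card V) * var))"
    "0 < real (card T3) * (3 / 8 * sqrt (2 * real (card V) * var\<^sup>2))"
    using mu_large by (intro mult_pos_pos; linarith)+
  then show "0 < E (\<lambda>S. \<Sum>t\<in>T2. \<bar>d2 t S\<bar>)" "0 < E (\<lambda>S. \<Sum>t\<in>T3. \<bar>d3 t S\<bar>)"
    using bound_cap2(2) bound_cap3(2) by linarith+
qed

text \<open>2625 = 40000 / 4 * (3/8) * (7/10): c times the number of switches is a quarter of the
  number of pairs, and 2 c absorbs the halved mean.\<close>

lemma capacity2: 
  assumes "E (\<lambda>S. \<Sum>t\<in>T2. \<bar>d2 t S\<bar>) / 2 \<le> (\<Sum>t\<in>T2. \<bar>d2 t S\<bar>)"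
  shows "2625 * (s ^ 3 * x\<^sup>2) \<le> 2 * real c * (\<Sum>t\<in>T2. \<bar>d2 t S\<bar>)"
proof -
  have "real (card T2) * (3 / 8 * (7 / 10 * (s * x))) \<le> real (card T2) * (3 / 8 * sqrt (real (card V) * var))"
    using mlo2(2) by (intro mult_left_mono) auto
  then have "real (card T2) * (3 / 8 * (7 / 10 * (s * x))) / 2 \<le> (\<Sum>t\<in>T2. \<bar>d2 t S\<bar>)"
    using assms bound_cap2(2) by linarith
  from mult_left_mono[OF this, of "2 * real c"]
  have a: "(real c * real (card T2)) * (21 / 80 * (s * x)) \<le> 2 * real c * (\<Sum>t\<in>T2. \<bar>d2 t S\<bar>)"
    by (simp add: mult_ac)
  have "real c * real (card T2) = real (card R2) / 4" by (simp add: card_T card_R power2_eq_square)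
  then have "10000 * \<nu> \<le> real c * real (card T2)" using R2lo by linarith
  then have "10000 * \<nu> * (21 / 80 * (s * x)) \<le> (real c * real (card T2)) * (21 / 80 * (s * x))"
    using spos x by (intro mult_right_mono) auto
  moreover have "10000 * \<nu> * (21 / 80 * (s * x)) = 2625 * (s ^ 3 * x\<^sup>2)" by (simp add: eval_nat_numeral)
  ultimately show ?thesis using a by linarith
qed

text \<open>39375000 = 4 * 10^8 / 4 * (3/2) * (3/8) * (7/10), where 3/2 is the factor 3 times the
  halved mean.\<close>

lemma capacity3: 
  assumes "E (\<lambda>S. \<Sum>t\<in>T3. \<bar>d3 t S\<bar>) / 2 \<le> (\<Sum>t\<in>T3. \<bar>d3 t S\<bar>)"
  shows "39375000 * (s ^ 3 * x ^ 3) \<le> 3 * (\<Sum>t\<in>T3. \<bar>d3 t S\<bar>)"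
proof -
  have "real (card T3) * (3 / 8 * (7 / 10 * (s * x\<^sup>2))) \<le> real (card T3) * (3 / 8 * sqrt (2 * real (card V) * var\<^sup>2))"
    using mlo3(2) by (intro mult_left_mono) auto
  then have "real (card T3) * (3 / 8 * (7 / 10 * (s * x\<^sup>2))) / 2 \<le> (\<Sum>t\<in>T3. \<bar>d3 t S\<bar>)"
    using assms bound_cap3(2) by linarith
  from mult_left_mono[OF this, of 3]
  have a: "real (card T3) * (63 / 160 * (s * x\<^sup>2)) \<le> 3 * (\<Sum>t\<in>T3. \<bar>d3 t S\<bar>)"
    by (simp add: mult_ac)
  have "real (card T3) = real (card R3) / 4" by (simp add: card_T card_R)
  then have "100000000 * \<nu> \<le> real (card T3)" using R3lo by linarith
  then have "100000000 * \<nu> * (63 / 160 * (s * x\<^sup>2)) \<le> real (card T3) * (63 / 160 * (s * x\<^sup>2))"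
    using spos x by (intro mult_right_mono) auto
  moreover have "100000000 * \<nu> * (63 / 160 * (s * x\<^sup>2)) = 39375000 * (s ^ 3 * x ^ 3)" by (simp add: eval_nat_numeral)
  ultimately show ?thesis using a by linarith
qed

definition good :: "nat \<Rightarrow> 'a set set \<Rightarrow> bool" where
  "good k S \<longleftrightarrow> \<bar>\<Sum>e\<in>P. bit e S\<bar> \<le> 5 * \<nu> \<and> \<bar>2 * (\<Sum>e\<in>[V]\<^bsup>2\<^esup>. Cs S e)\<bar> \<le> 5 * (11 * (s ^ 3 * x\<^sup>2))
     \<and> \<bar>\<Sum>e\<in>R. Ds S e\<bar> \<le> 5 * (6 * (real c * \<nu>)) \<and> (\<Sum>e\<in>R1. \<bar>Ds S e\<bar>) \<le> 20 * (5 * (real (card R1) * (s * x)))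
     \<and> \<bar>tri V (\<lambda>e. bit e S) (\<lambda>e. bit e S) (\<lambda>e. bit e S)\<bar> \<le> 5 * (15 * (s ^ 3 * x ^ 3))
     \<and> \<bar>\<Sum>e\<in>R. Cs S e\<bar> \<le> 5 * (8 * (x\<^sup>2 * s * sqrt (real (card R))))
     \<and> (\<Sum>e\<in>R1. \<bar>Cs S e\<bar>) + (\<Sum>e\<in>R2. \<bar>Cs S e\<bar>) \<le> 20 * (8 * ((real (card R1) + real (card R2)) * (x\<^sup>2 * s)))
     \<and> 2625 * (s ^ 3 * x\<^sup>2) \<le> 2 * real c * (\<Sum>t\<in>T2. \<bar>d2 t S\<bar>)
     \<and> 39375000 * (s ^ 3 * x ^ 3) \<le> 3 * (\<Sum>t\<in>T3. \<bar>d3 t S\<bar>)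
     \<and> (\<forall>t\<in>T2. \<bar>d2 t S\<bar> \<le> s\<^sup>2 * x\<^sup>2) \<and> (\<forall>t\<in>T3. \<bar>d3 t S\<bar> \<le> s\<^sup>2 * x\<^sup>2)
     \<and> env k S \<le> 20 * envelope_const k c"

lemma ex_good: "\<exists>S\<subseteq>P. good k S"
proof -
  let ?fs = "[\<lambda>S. ((\<Sum>e\<in>P. bit e S) / (5 * \<nu>))\<^sup>2,
    \<lambda>S. ((2 * (\<Sum>e\<in>[V]\<^bsup>2\<^esup>. Cs S e)) / (5 * (11 * (s ^ 3 * x\<^sup>2))))\<^sup>2,
    \<lambda>S. ((\<Sum>e\<in>R. Ds S e) / (5 * (6 * (real c * \<nu>))))\<^sup>2,
    \<lambda>S. (\<Sum>e\<in>R1. \<bar>Ds S e\<bar>) / (20 * (5 * (real (card R1) * (s * x)))),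
    \<lambda>S. (tri V (\<lambda>e. bit e S) (\<lambda>e. bit e S) (\<lambda>e. bit e S) / (5 * (15 * (s ^ 3 * x ^ 3))))\<^sup>2,
    \<lambda>S. ((\<Sum>e\<in>R. Cs S e) / (5 * (8 * (x\<^sup>2 * s * sqrt (real (card R))))))\<^sup>2,
    \<lambda>S. ((\<Sum>e\<in>R1. \<bar>Cs S e\<bar>) + (\<Sum>e\<in>R2. \<bar>Cs S e\<bar>)) / (20 * (8 * ((real (card R1) + real (card R2)) * (x\<^sup>2 * s)))),
    \<lambda>S. 4 * ((\<Sum>t\<in>T2. \<bar>d2 t S\<bar>) / E (\<lambda>S. \<Sum>t\<in>T2. \<bar>d2 t S\<bar>) - 1)\<^sup>2,
    \<lambda>S. 4 * ((\<Sum>t\<in>T3. \<bar>d3 t S\<bar>) / E (\<lambda>S. \<Sum>t\<in>T3. \<bar>d3 t S\<bar>) - 1)\<^sup>2,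
    \<lambda>S. \<Sum>t\<in>T2. (d2 t S / (s\<^sup>2 * x\<^sup>2)) ^ 4,
    \<lambda>S. \<Sum>t\<in>T3. (d3 t S / (s\<^sup>2 * x\<^sup>2)) ^ 4,
    \<lambda>S. env k S / (20 * envelope_const k c)]"
  have pos: "0 < s ^ 3 * x\<^sup>2" "0 < s ^ 3 * x ^ 3" "0 < real c * \<nu>" "0 < real (card R1) * (s * x)"
    "0 < x\<^sup>2 * s * sqrt (real (card R))" "0 < (real (card R1) + real (card R2)) * (x\<^sup>2 * s)" "0 < s\<^sup>2 * x\<^sup>2"
    "0 < s * x" "0 < x\<^sup>2 * s" "0 < real (card R1)"
  proof -
    have "0 < real (card R1)" using R1lo nu_ge'(3) by linarith
    then show "0 < s ^ 3 * x\<^sup>2" "0 < s ^ 3 * x ^ 3" "0 < real c * \<nu>" "0 < real (card R1) * (s * x)"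
      "0 < x\<^sup>2 * s * sqrt (real (card R))" "0 < (real (card R1) + real (card R2)) * (x\<^sup>2 * s)" "0 < s\<^sup>2 * x\<^sup>2"
      "0 < s * x" "0 < x\<^sup>2 * s" "0 < real (card R1)"
      using spos x c1 Rpos(1) nu_ge'(3) by (auto intro!: mult_pos_pos add_pos_nonneg)
  qed
  have "\<exists>S\<subseteq>P. list_all (\<lambda>f. f S < 1) ?fs"
  proof (rule ex_small_penalties)
    show "list_all (\<lambda>f. \<forall>S. 0 \<le> f S) ?fs"
      unfolding list.pred_inject
      by (intro conjI allI zero_le_power2 divide_nonneg_pos add_nonneg_nonneg sum_nonneg abs_ge_zero env_nonneg
          mult_nonneg_nonneg zero_le_even_power mult_pos_pos envelope_const_pos TrueI
          pos spos x(1) zero_less_numeral zero_le_numeral add_pos_nonneg of_nat_0_le_iff) simp_all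
    \<comment> \<open>Five means of at most 1/25 and seven of at most 1/20 give 11/20.\<close>
    have "(\<Sum>f\<leftarrow>?fs. E f) \<le> 1 / 25 + (1 / 25 + (1 / 25 + (1 / 20 + (1 / 25 + (1 / 25
        + (1 / 20 + (1 / 20 + (1 / 20 + (1 / 20 + (1 / 20 + (1 / 20 + 0)))))))))))"
      unfolding list.map sum_list.Cons sum_list.Nil
      by (intro add_mono bound_Z1 bound_Z2 bound_Z3 bound_Z4 bound_Z7 bound_Z8 bound_Z9 bound_cap2(1) bound_cap3(1)
        bound_max2 bound_max3 bound_env order_refl)
    also have "\<dots> < 1" by simp
    finally show "(\<Sum>f\<leftarrow>?fs. E f) < 1" .
  qed
  then obtain S where S: "S \<subseteq> P" "list_all (\<lambda>f. f S < 1) ?fs" by blast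
  note f = S(2)[unfolded list.pred_inject]
  have lin: "Z \<le> w" if "Z / w < 1" "0 < w" for Z w :: real using that by (simp add: divide_less_eq)
  have "\<bar>\<Sum>e\<in>P. bit e S\<bar> \<le> 5 * \<nu>" 
    by (rule sq_less_imp) (use f in blast, use nu_ge'(3) in linarith)
  moreover have "\<bar>2 * (\<Sum>e\<in>[V]\<^bsup>2\<^esup>. Cs S e)\<bar> \<le> 5 * (11 * (s ^ 3 * x\<^sup>2))"
    by (rule sq_less_imp) (use f in blast, use pos in linarith)
  moreover have "\<bar>\<Sum>e\<in>R. Ds S e\<bar> \<le> 5 * (6 * (real c * \<nu>))"
    by (rule sq_less_imp) (use f in blast, use pos in linarith)
  moreover have "(\<Sum>e\<in>R1. \<bar>Ds S e\<bar>) \<le> 20 * (5 * (real (card R1) * (s * x)))"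
    by (rule lin) (use f in blast, use pos in linarith)
  moreover have "\<bar>tri V (\<lambda>e. bit e S) (\<lambda>e. bit e S) (\<lambda>e. bit e S)\<bar> \<le> 5 * (15 * (s ^ 3 * x ^ 3))"
    by (rule sq_less_imp) (use f in blast, use pos in linarith)
  moreover have "\<bar>\<Sum>e\<in>R. Cs S e\<bar> \<le> 5 * (8 * (x\<^sup>2 * s * sqrt (real (card R))))"
    by (rule sq_less_imp) (use f in blast, use pos in linarith)
  moreover have "(\<Sum>e\<in>R1. \<bar>Cs S e\<bar>) + (\<Sum>e\<in>R2. \<bar>Cs S e\<bar>) \<le> 20 * (8 * ((real (card R1) + real (card R2)) * (x\<^sup>2 * s)))"
    by (rule lin) (use f in blast, use pos in linarith)
  moreover have "2625 * (s ^ 3 * x\<^sup>2) \<le> 2 * real c * (\<Sum>t\<in>T2. \<bar>d2 t S\<bar>)"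
    by (rule capacity2, rule half_le_of_close) (use f in blast, rule capacity_pos)
  moreover have "39375000 * (s ^ 3 * x ^ 3) \<le> 3 * (\<Sum>t\<in>T3. \<bar>d3 t S\<bar>)"
    by (rule capacity3, rule half_le_of_close) (use f in blast, rule capacity_pos)
  moreover have "\<bar>d2 t S\<bar> \<le> s\<^sup>2 * x\<^sup>2" if "t \<in> T2" for t
    by (rule abs_le_of_sum_power4[of T2 _ "\<lambda>t. d2 t S"]) (simp add: T2_def, rule that, use f in blast, rule pos(7))
  moreover have "\<bar>d3 t S\<bar> \<le> s\<^sup>2 * x\<^sup>2" if "t \<in> T3" for t
    by (rule abs_le_of_sum_power4[of T3 _ "\<lambda>t. d3 t S"]) (simp add: T3_def, rule that, use f in blast, rule pos(7))
  moreover have "env k S \<le> 20 * envelope_const k c"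
    by (rule lin) (use f in blast, use envelope_const_pos[of k c] in linarith)
  ultimately show ?thesis unfolding good_def using S(1) by (intro exI[of _ S] conjI ballI)
qed

text \<open>The outcome \<open>S\<close> on the random pairs is fixed first, by
  \<open>ex_good\<close>, and \<open>F\<close> on the reserved pairs afterwards, by
  \<open>ex_config\<close>. The bounds for large supports hold for whatever \<open>F\<close>
  results, because \<open>env\<close> involves only \<open>rhoS\<close>.\<close>

lemma ex_graph:
  "\<exists>M \<subseteq> [V]\<^bsup>2\<^esup>. real (card M) = of_int (round (p * real (card V choose 2)))
     \<and> \<bar>(\<Sum>i\<in>V. (wdeg V (centered (V, M) p) i)\<^sup>2) - p * (1 - p) * real (card V) * (real (card V) - 1)\<bar>
         \<le> 5 * real c * (p * (1 - p) * real (card V))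
     \<and> \<bar>tri V (centered (V, M) p) (centered (V, M) p) (centered (V, M) p)\<bar> \<le> 7 * (p * (1 - p) * real (card V))
     \<and> (\<forall>H\<in>large_supports k. \<bar>inj_sum V (centered (V, M) p) (\<Union>H) H\<bar>
         \<le> 20 * envelope_const k c * (p * (1 - p) * real (card V) ^ (card (\<Union>H) - 2)))"
proof -
  obtain S where S: "S \<subseteq> P" "good k S" using ex_good by blast
  note g = S(2)[unfolded good_def]
  interpret G: gadget_bits V lv rv c l1 l2 l3 "\<lambda>e. bit e S" p \<pi> by (rule bits)
  have rho: "G.rho = rhoS" by (rule ext) (simp add: G.rho_def rhoS_def)
  have CD: "G.C = Cs S" "G.D = Ds S"
    by (auto simp: fun_eq_iff G.C_def Cs_def G.D_def Ds_def G.be_def)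
  have Z: "G.Z1 = (\<Sum>e\<in>P. bit e S)" "G.Z2 = 2 * (\<Sum>e\<in>[V]\<^bsup>2\<^esup>. Cs S e)" "G.Z3 = (\<Sum>e\<in>R. Ds S e)"
    "G.Z4 = (\<Sum>e\<in>R1. \<bar>Ds S e\<bar>)" "G.Z8 = (\<Sum>e\<in>R. Cs S e)" "G.Z9 = (\<Sum>e\<in>R1. \<bar>Cs S e\<bar>) + (\<Sum>e\<in>R2. \<bar>Cs S e\<bar>)"
    unfolding CD[symmetric] using G.sum_C_all by (simp_all add: G.Z1_def G.Z3_def G.Z4_def G.Z8_def G.Z9_def)
  have z1: "\<bar>G.Z1\<bar> \<le> 5 * \<nu>" unfolding Z using g by blast
  have z2: "\<bar>G.Z2\<bar> \<le> 5 * (11 * (s ^ 3 * x\<^sup>2))" unfolding Z using g by blast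
  have z3: "\<bar>G.Z3\<bar> \<le> 5 * (6 * (real c * \<nu>))" unfolding Z using g by blast
  have z4: "G.Z4 \<le> 20 * (5 * (real (card R1) * (s * x)))" unfolding Z using g by blast
  have z7: "\<bar>G.Z7\<bar> \<le> 5 * (15 * (s ^ 3 * x ^ 3))" unfolding G.Z7_def using g by blast
  have z8: "\<bar>G.Z8\<bar> \<le> 5 * (8 * (x\<^sup>2 * s * sqrt (real (card R))))" unfolding Z using g by blast
  have z9: "G.Z9 \<le> 20 * (8 * ((real (card R1) + real (card R2)) * (x\<^sup>2 * s)))" unfolding Z using g by blast
  have y2: "2625 * (s ^ 3 * x\<^sup>2) \<le> 2 * real c * (\<Sum>t\<in>T2. \<bar>d2 t S\<bar>)" using g by blast
  have y3: "39375000 * (s ^ 3 * x ^ 3) \<le> 3 * (\<Sum>t\<in>T3. \<bar>d3 t S\<bar>)" using g by blast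
  have ev: "env k S \<le> 20 * envelope_const k c" using g by blast
  have \<Delta>: "G.\<Delta> t = d2 t S" if "t \<in> T2" for t using Delta_eq_sum[OF that] by (simp add: d2_def)
  have gd: "G.g t = d3 t S" if "t \<in> T3" for t using g_eq_sum[OF that] by (simp add: d3_def)
  have c\<nu>: "100000 * ((real c)\<^sup>2 * \<nu>) \<le> s ^ 3 * x ^ 3" "100000 * ((real c)\<^sup>2 * \<nu>) \<le> s ^ 3 * x\<^sup>2"
    "real c * \<nu> \<le> (real c)\<^sup>2 * \<nu>" "\<nu> \<le> (real c)\<^sup>2 * \<nu>" "real c * real (card R) \<le> (real c)\<^sup>2 * \<nu>"
  proof -
    have "\<nu> * A \<le> \<nu> * (s * x\<^sup>2)" using A(2) nu_ge'(3) by (intro mult_left_mono) auto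
    then show a: "100000 * ((real c)\<^sup>2 * \<nu>) \<le> s ^ 3 * x ^ 3" by (simp add: A(1) eval_nat_numeral mult_ac)
    have "\<nu> * A \<le> \<nu> * (s * x)" using sx(1) nu_ge'(3) by (intro mult_left_mono) auto
    then show "100000 * ((real c)\<^sup>2 * \<nu>) \<le> s ^ 3 * x\<^sup>2" by (simp add: A(1) eval_nat_numeral mult_ac)
    show "real c * \<nu> \<le> (real c)\<^sup>2 * \<nu>" using c2(1) nu_ge'(3) by (intro mult_right_mono) auto
    show "\<nu> \<le> (real c)\<^sup>2 * \<nu>" using mult_right_mono[OF c2(2), of \<nu>] nu_ge'(3) by simp
    have "real c * real (card R) \<le> real c * (real c * \<nu>)" using Rhi by (intro mult_left_mono) auto
    then show "real c * real (card R) \<le> (real c)\<^sup>2 * \<nu>" by (simp add: power2_eq_square)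
  qed
  \<comment> \<open>The largest part is \<open>Z4\<close> with 20 * 5 * 24 = 2400, followed by
    \<open>Z2\<close> with 55; all else is at most 71 c^2 \<open>\<nu>\<close> and negligible. The
    capacity 2625, hence the constant 40000, has to exceed this.\<close>
  have e2: "G.err2 \<le> 2 * real c * (\<Sum>t\<in>T2. \<bar>G.\<Delta> t\<bar>)"
  proof -
    have "real (card R1) * (s * x) \<le> (24 * \<nu>) * (s * x)" using R1hi spos x by (intro mult_right_mono) auto
    then have "real (card R1) * (s * x) \<le> 24 * (s ^ 3 * x\<^sup>2)" by (simp add: eval_nat_numeral mult_ac)
    then have "G.Z4 \<le> 2400 * (s ^ 3 * x\<^sup>2)" using z4 by linarith
    moreover have "real c * \<bar>G.Z1\<bar> \<le> real c * (5 * \<nu>)" using z1 by (intro mult_left_mono) auto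
    then have "4 * (real c * \<bar>G.Z1\<bar>) \<le> 20 * ((real c)\<^sup>2 * \<nu>)" using c\<nu>(3) by linarith
    moreover have "9 * real c * real (card R) \<le> 9 * ((real c)\<^sup>2 * \<nu>)" using c\<nu>(5) by simp
    moreover have "\<bar>G.Z3\<bar> \<le> 30 * ((real c)\<^sup>2 * \<nu>)" using z3 c\<nu>(3) by linarith
    moreover have "2 * real (card R) \<le> 2 * ((real c)\<^sup>2 * \<nu>)" using Rhi c\<nu>(3) by linarith
    moreover have "2 * \<bar>G.Z1\<bar> \<le> 10 * ((real c)\<^sup>2 * \<nu>)" using z1 c\<nu>(4) by linarith
    moreover have "\<bar>G.Z2\<bar> \<le> 55 * (s ^ 3 * x\<^sup>2)" using z2 by linarith
    ultimately have "G.err2 \<le> 2625 * (s ^ 3 * x\<^sup>2)" unfolding G.err2_def using c\<nu>(2) by linarith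
    then show ?thesis using y2 sum.cong[OF refl, of T2 "\<lambda>t. \<bar>G.\<Delta> t\<bar>" "\<lambda>t. \<bar>d2 t S\<bar>"] \<Delta> by simp
  qed
  \<comment> \<open>The largest part is \<open>3 * Z9\<close>, at most 3 * 160 * (24 + 80000) =
    38411520, from the codegrees on the first two groups. The capacity 39375000 of the third group
    has to exceed it.\<close>
  have e3: "G.err3 \<le> 3 * (\<Sum>t\<in>T3. \<bar>G.g t\<bar>)"
  proof -
    have "(real (card R1) + real (card R2)) * (x\<^sup>2 * s) \<le> (80024 * \<nu>) * (x\<^sup>2 * s)"
      using R1hi R2hi spos x by (intro mult_right_mono) auto
    also have "\<dots> = 80024 * (s ^ 3 * x ^ 3)" by (simp add: eval_nat_numeral mult_ac)
    finally have "3 * G.Z9 \<le> 38411520 * (s ^ 3 * x ^ 3)" using z9 by linarith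
    moreover have "36 * real c * real (card R) \<le> 36 * ((real c)\<^sup>2 * \<nu>)" using c\<nu>(5) by simp
    moreover have "\<bar>G.Z7\<bar> \<le> 75 * (s ^ 3 * x ^ 3)" using z7 by linarith
    moreover have "3 * (\<bar>\<pi> - p\<bar> * \<bar>G.Z2\<bar>) \<le> s ^ 3 * x ^ 3"
    proof -
      have "\<bar>\<pi> - p\<bar> * \<bar>G.Z2\<bar> \<le> \<bar>\<pi> - p\<bar> * (55 * (s ^ 3 * x\<^sup>2))" using z2 by (intro mult_left_mono) auto
      also have "\<dots> = (s\<^sup>2 * \<bar>\<pi> - p\<bar>) * (55 * (s * x\<^sup>2))" by (simp add: eval_nat_numeral mult_ac)
      also have "\<dots> \<le> real c * (55 * (s * x\<^sup>2))" using dl' s2 spos by (intro mult_right_mono) auto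
      also have "\<dots> \<le> (\<nu> / 1000) * (55 * (s * x\<^sup>2))"
        using nu_ge'(1) A5(2) spos by (intro mult_right_mono) auto
      also have "\<dots> = 55 / 1000 * (s ^ 3 * x ^ 3)" by (simp add: eval_nat_numeral mult_ac)
      finally have "\<bar>\<pi> - p\<bar> * \<bar>G.Z2\<bar> \<le> 55 / 1000 * (s ^ 3 * x ^ 3)" .
      moreover have "0 \<le> s ^ 3 * x ^ 3" using spos x by simp
      ultimately show ?thesis by linarith
    qed
    moreover have "3 * \<bar>G.Z8\<bar> \<le> s ^ 3 * x ^ 3"
    proof -
      \<comment> \<open>120 = 3 * 40, where 40 is the factor 5 * 8 in \<open>z8\<close>.\<close>
      have "sqrt (real (card R)) \<le> \<nu> / 120"
      proof (rule real_le_lsqrt)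
        have "real (card R) \<le> real c * \<nu>" by (rule Rhi)
        also have "\<dots> \<le> (\<nu> / 14400) * \<nu>" using nu_ge'(1,3) A5(2) cc by (intro mult_right_mono) auto
        also have "\<dots> = (\<nu> / 120)\<^sup>2" by (simp add: power2_eq_square)
        finally show "real (card R) \<le> (\<nu> / 120)\<^sup>2" .
      qed (use nu_ge'(3) in auto)
      then have "x\<^sup>2 * s * sqrt (real (card R)) \<le> x\<^sup>2 * s * (\<nu> / 120)" using spos by (intro mult_left_mono) auto
      also have "\<dots> = (s ^ 3 * x ^ 3) / 120" by (simp add: eval_nat_numeral mult_ac)
      finally show ?thesis using z8 by linarith
    qed
    moreover have "0 \<le> (real c)\<^sup>2 * \<nu>" using nu_ge'(3) by simp
    ultimately have "G.err3 \<le> 39375000 * (s ^ 3 * x ^ 3)" unfolding G.err3_def using c\<nu>(1) by linarith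
    then show ?thesis using y3 sum.cong[OF refl, of T3 "\<lambda>t. \<bar>G.g t\<bar>" "\<lambda>t. \<bar>d3 t S\<bar>"] gd by simp
  qed
  define m :: int where "m = round (p * real (card V choose 2))"
  have N: "real (card V choose 2) = real (card P) + real (card R)"
    using G.card_PR by (cases "card V") (auto simp: choose_two real_of_nat_div algebra_simps)
  have cS: "real (card S) = G.Z1 + \<pi> * real (card P)"
  proof -
    have "(\<Sum>e\<in>P. bit e S) = (\<Sum>e\<in>P. of_bool (e \<in> S) - \<pi>)" by (intro sum.cong refl) (simp add: bit_def)
    also have "\<dots> = (\<Sum>e\<in>P. of_bool (e \<in> S)) - \<pi> * real (card P)" by (simp add: sum_subtractf)
    also have "(\<Sum>e\<in>P. of_bool (e \<in> S)) = (\<Sum>e\<in>S. 1 :: real)"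
      using S(1) finite_P by (intro sum.mono_neutral_cong_right) auto
    finally show ?thesis using Z(1) by simp
  qed
  \<comment> \<open>The number of edges that the first group must supply. It is within 5
    \<open>\<nu>\<close> + 1/2 of half the size of \<open>R1\<close>, hence between 0 and that size,
    because \<open>R1\<close> has at least 12 \<open>\<nu>\<close> pairs.\<close>
  define k1 :: int where "k1 = m - int (card S) - 2 * int c ^ 2 * int l2 - 2 * int c ^ 2 * int l3"
  have k1: "real_of_int k1 = (of_int m - p * real (card V choose 2)) - G.Z1 + real (card R1) / 2"
  proof -
    have "real_of_int k1 = of_int m - real (card S) - real (card R2) / 2 - real (card R3) / 2"
      by (simp add: k1_def card_R)
    moreover have "p * real (card V choose 2) = \<pi> * real (card P) + real (card R) / 2"
      using bal' unfolding N by (simp add: algebra_simps)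
    ultimately show ?thesis using cS Rpos(2) by linarith
  qed
  have "\<bar>of_int m - p * real (card V choose 2)\<bar> \<le> 1 / 2" unfolding m_def by (rule of_int_round_abs_le)
  moreover have "1 \<le> \<nu>" using nu_ge'(1) A5 by linarith
  moreover note z1
  ultimately have "0 \<le> real_of_int k1" "real_of_int k1 \<le> real (card R1)" using R1lo unfolding k1 by linarith+
  then have k1': "real (nat k1) = real_of_int k1" "nat k1 \<le> card R1" by linarith+
  have M: "\<And>t. t \<in> T2 \<Longrightarrow> \<bar>G.\<Delta> t\<bar> \<le> s\<^sup>2 * x\<^sup>2" "\<And>t. t \<in> T3 \<Longrightarrow> \<bar>G.g t\<bar> \<le> s\<^sup>2 * x\<^sup>2" "0 \<le> s\<^sup>2 * x\<^sup>2"
    using g \<Delta> gd by simp_all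
  obtain F where F: "F \<subseteq> R" "real (card F) = real (nat k1) + 2 * (real c)\<^sup>2 * real l2 + 2 * (real c)\<^sup>2 * real l3"
     "\<bar>(\<Sum>i\<in>V. (wdeg V (G.al F) i)\<^sup>2) - p * (1 - p) * real (card V) * (real (card V) - 1)\<bar>
         \<le> 4 * real c * (s\<^sup>2 * x\<^sup>2 + 6 * real c) + 8 * (real c)\<^sup>2"
     "\<bar>tri V (G.al F) (G.al F) (G.al F)\<bar> \<le> 6 * (s\<^sup>2 * x\<^sup>2 + 24 * real c) + 256"
    using G.ex_config[OF k1'(2) M(1) M(3) M(2) M(3) e2 e3] by blast
  have q: "s\<^sup>2 * x\<^sup>2 = p * (1 - p) * real (card V)" by (simp add: s2 x_def)
  have M: "S \<union> F \<subseteq> [V]\<^bsup>2\<^esup>" "S \<inter> F = {}" using S(1) F(1) PR' by auto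
  have al: "centered (V, S \<union> F) p = G.al F"
  proof
    fix e
    have "e \<in> [V]\<^bsup>2\<^esup> \<longleftrightarrow> e \<in> P \<or> e \<in> R" "e \<in> P \<Longrightarrow> e \<notin> R" using PR' by auto
    then show "centered (V, S \<union> F) p e = G.al F e"
      unfolding G.al_def G.rr_def using S(1) F(1) by (auto simp: centered_def bit_def of_bool_def)
  qed
  have "finite S" "finite F" using M(1) finite_nV finite_subset by auto
  then have "real (card (S \<union> F)) = real (card S) + real (card F)" using M(2) by (simp add: card_Un_disjoint)
  also have "\<dots> = of_int m"
  proof -
    have "real_of_int k1 = of_int m - real (card S) - 2 * (real c)\<^sup>2 * real l2 - 2 * (real c)\<^sup>2 * real l3"
      by (simp add: k1_def)
    then show ?thesis using F(2) k1'(1) by linarith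
  qed
  finally have c1: "real (card (S \<union> F)) = of_int (round (p * real (card V choose 2)))" by (simp add: m_def)
  have c3: "4 * real c * (s\<^sup>2 * x\<^sup>2 + 6 * real c) + 8 * (real c)\<^sup>2 \<le> 5 * real c * (s\<^sup>2 * x\<^sup>2)"
  proof -
    have "real c * (32 * real c) \<le> real c * (s\<^sup>2 * x\<^sup>2)" using nu_ge'(2) A5(2) by (intro mult_left_mono) auto
    then show ?thesis by (simp add: power2_eq_square algebra_simps)
  qed
  have c4: "6 * (s\<^sup>2 * x\<^sup>2 + 24 * real c) + 256 \<le> 7 * (s\<^sup>2 * x\<^sup>2)" unfolding distrib_left using nu_ge'(2) A5(2) cc by linarith
  have c5: "\<bar>inj_sum V (G.al F) (\<Union>H) H\<bar> \<le> 20 * envelope_const k c * (p * (1 - p) * real (card V) ^ (card (\<Union>H) - 2))"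
    if H: "H \<in> large_supports k" for H
  proof -
    let ?d = "x\<^sup>2 * real (card V) ^ (card (\<Union>H) - 2)"
    let ?e = "\<lambda>H. \<Sum>J\<in>Pow H. envelope_sum V rhoS (\<lambda>e. bit e S) H J"
    have d: "0 < ?d" using x n_ge1 by simp
    have "H \<subseteq> [{..<k}]\<^bsup>2\<^esup>" using H by (simp add: large_supports_def)
    then have Hf: "finite H" "\<And>e. e \<in> H \<Longrightarrow> finite e"
      using finite_subset[OF _ finite_imp_finite_nsets[of "{..<k}" 2]] by (auto simp: nsets_def)
    have "\<bar>inj_sum V (\<lambda>e. bit e S + G.rr F e) (\<Union>H) H\<bar> \<le> ?e H"
    proof (rule abs_inj_sum_le_envelope_sum[OF finV Hf(1)])
      show "finite e" if "e \<in> H" for e using Hf(2) that .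
      show "\<bar>G.rr F e\<bar> \<le> rhoS e" for e using G.abs_rr(1)[of F e] unfolding rho .
    qed
    moreover have "G.al F = (\<lambda>e. bit e S + G.rr F e)" by (simp add: fun_eq_iff G.al_def)
    moreover have e0: "0 \<le> ?e H'" for H'
      unfolding envelope_sum_def
      by (intro sum_nonneg mult_nonneg_nonneg prod_nonneg) (auto simp: rhoS_def)
    have "?e H / ?d \<le> env k S"
      unfolding env_def
      by (rule member_le_sum[OF H, of "\<lambda>H. ?e H / (x\<^sup>2 * real (card V) ^ (card (\<Union>H) - 2))"])
        (auto intro!: divide_nonneg_nonneg mult_nonneg_nonneg e0 simp: finite_large_supports)
    then have "?e H / ?d \<le> 20 * envelope_const k c" using ev by linarith
    then have "?e H \<le> 20 * envelope_const k c * ?d" using d by (simp add: pos_divide_le_eq)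
    ultimately show ?thesis by (simp add: x_def)
  qed
  show ?thesis
  proof (intro exI[of _ "S \<union> F"] conjI ballI)
    show "\<bar>(\<Sum>i\<in>V. (wdeg V (centered (V, S \<union> F) p) i)\<^sup>2) - p * (1 - p) * real (card V) * (real (card V) - 1)\<bar>
         \<le> 5 * real c * (p * (1 - p) * real (card V))"
      using F(3) c3 unfolding al q by linarith
    show "\<bar>tri V (centered (V, S \<union> F) p) (centered (V, S \<union> F) p) (centered (V, S \<union> F) p)\<bar> \<le> 7 * (p * (1 - p) * real (card V))"
      using F(4) c4 unfolding al q by linarith
  qed (use M(1) c1 c5 al in auto)
qed

end

section \<open>The upper bound\<close>

text \<open>Rounding up adds at most one block of \<open>w\<close> pairs, and
  \<open>w \<le> \<nu>\<close>.\<close>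

lemma ex_block_count:
  fixes \<nu> w K :: real
  assumes "1 \<le> w" "w \<le> \<nu>" "1 \<le> K"
  obtains l :: nat where "K * \<nu> \<le> w * real l" "w * real l \<le> 2 * K * \<nu>"
proof
  let ?l = "nat \<lceil>K * \<nu> / w\<rceil>"
  have n: "0 \<le> K * \<nu> / w" using assms by simp
  have l: "K * \<nu> / w \<le> real ?l" "real ?l \<le> K * \<nu> / w + 1" using n by linarith+
  show "K * \<nu> \<le> w * real ?l" using l(1) assms(1) by (simp add: field_simps)
  have "w * real ?l \<le> w * (K * \<nu> / w + 1)" using l(2) assms(1) by (intro mult_left_mono) auto
  also have "\<dots> = K * \<nu> + w" using assms(1) by (simp add: field_simps)
  also have "w \<le> K * \<nu>" using mult_mono[OF assms(3,2)] assms by simp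
  finally show "w * real ?l \<le> 2 * K * \<nu>" by simp
qed

text \<open>Block \<open>B\<close> occupies the 4 c numbers from \<open>4 * c * B\<close> on, left
  vertices in the first half and right ones in the second; parity tells twins apart.\<close>

lemma gadget_graph_interval:
  assumes c: "1 \<le> c" and n: "4 * c * (l1 + l2 + l3) \<le> n"
  shows "gadget_graph {..<n} (\<lambda>B x \<sigma>. 4 * c * B + (2 * x + of_bool \<sigma>)) (\<lambda>B x \<sigma>. 4 * c * B + (2 * c + 2 * x + of_bool \<sigma>)) c l1 l2 l3"
proof
  have uniq: "B = B' \<and> r = r'" if "4 * c * B + r = 4 * c * B' + r'" "r < 4 * c" "r' < 4 * c" for B B' r r' :: nat
  proof -
    have "(4 * c * B + r) div (4 * c) = B" "(4 * c * B' + r') div (4 * c) = B'" using that(2,3) by simp_all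
    then have "B = B'" using that(1) by simp
    then show ?thesis using that(1) by simp
  qed
  have bit: "x = x' \<and> \<sigma> = \<sigma>'" if "2 * x + of_bool \<sigma> = 2 * x' + (of_bool \<sigma>' :: nat)" for x x' \<sigma> \<sigma>'
    using that by (cases \<sigma>; cases \<sigma>') (simp_all, presburger+)
  have ran: "4 * c * B + r \<in> {..<n}" if "B < l1 + l2 + l3" "r < 4 * c" for B r
  proof -
    have "4 * c * B + r < 4 * c * (B + 1)" using that(2) by simp
    also have "\<dots> \<le> 4 * c * (l1 + l2 + l3)" using that(1) by (intro mult_left_mono) auto
    finally show ?thesis using n by simp
  qed
  have sm: "2 * x + of_bool \<sigma> < 2 * c" "2 * x + of_bool \<sigma> < 4 * c" "2 * c + 2 * x + of_bool \<sigma> < 4 * c" if "x < c" for x \<sigma>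
    using that by (cases \<sigma>; simp)+
  show "1 \<le> c" by (rule c)
  fix B x \<sigma> B' x' \<sigma>'
  assume a: "B < l1 + l2 + l3" "x < c"
  show "4 * c * B + (2 * x + of_bool \<sigma>) \<in> {..<n}" "4 * c * B + (2 * c + 2 * x + of_bool \<sigma>) \<in> {..<n}"
    by (intro ran a sm)+
  assume b: "B' < l1 + l2 + l3" "x' < c"
  show "4 * c * B + (2 * x + of_bool \<sigma>) \<noteq> 4 * c * B' + (2 * c + 2 * x' + of_bool \<sigma>')"
  proof
    assume "4 * c * B + (2 * x + of_bool \<sigma>) = 4 * c * B' + (2 * c + 2 * x' + of_bool \<sigma>')"
    from uniq[OF this sm(2)[OF a(2)] sm(3)[OF b(2)]] show False using sm(1)[OF a(2), of \<sigma>] by linarith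
  qed
  show "B = B' \<and> x = x' \<and> \<sigma> = \<sigma>'" if "4 * c * B + (2 * x + of_bool \<sigma>) = 4 * c * B' + (2 * x' + of_bool \<sigma>')"
    using uniq[OF that sm(2)[OF a(2)] sm(2)[OF b(2)]] bit by blast
  show "B = B' \<and> x = x' \<and> \<sigma> = \<sigma>'" if "4 * c * B + (2 * c + 2 * x + of_bool \<sigma>) = 4 * c * B' + (2 * c + 2 * x' + of_bool \<sigma>')"
    using uniq[OF that sm(3)[OF a(2)] sm(3)[OF b(2)]] bit[of x \<sigma> x' \<sigma>'] by simp
qed simp

text \<open>The constant is \<open>2 (12 + 40000 + 4 \<cdot> 10\<^sup>8)\<close>, from the sizes of the three groups of blocks.\<close>

lemma ex_gadget_scaled:
  fixes p A :: real
  assumes c: "800080024 \<le> real c" and p: "0 < p" "p < 1"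
    and A: "A = 100000 * (real c)\<^sup>2" "A \<le> sqrt (real n) * (p * (1 - p))"
  shows "\<exists>lv rv l1 l2 l3 \<pi> s x y. gadget_scaled {..<n} lv rv c l1 l2 l3 p \<pi> s x y A"
proof -
  define s x y where "s = sqrt (real n)" and "x = sqrt (p * (1 - p))" and "y = sqrt x"
  define \<nu> where "\<nu> = s\<^sup>2 * x"
  have q: "0 < p * (1 - p)" "p * (1 - p) \<le> 1 / 4"
  proof -
    show "0 < p * (1 - p)" using p by simp
    have "0 \<le> (p - 1 / 2)\<^sup>2" by simp
    then show "p * (1 - p) \<le> 1 / 4" by (simp add: power2_eq_square algebra_simps)
  qed
  have x2: "x\<^sup>2 = p * (1 - p)" using q by (simp add: x_def)
  have x: "0 < x" "x \<le> 1 / 2"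
  proof -
    show "0 < x" using q by (simp add: x_def)
    show "x \<le> 1 / 2" unfolding x_def using q by (intro real_le_lsqrt) (auto simp: power2_eq_square)
  qed
  have xx: "x\<^sup>2 \<le> x" using x by (simp add: power2_eq_square mult_left_le_one_le)
  have y: "y\<^sup>2 = x" "0 < y" using x by (simp_all add: y_def)
  have s2: "s\<^sup>2 = real n" and s0: "0 \<le> s" by (simp_all add: s_def)
  have A2: "A \<le> s * x\<^sup>2" using A(2) by (simp add: s_def x2)
  have c2: "800080024 * real c \<le> (real c)\<^sup>2" using mult_right_mono[OF c, of "real c"] by (simp add: power2_eq_square)
  have A1: "100000 * real c \<le> A" "1 \<le> A" using A(1) c2 c by linarith+
  have sx: "A \<le> s * x" "A \<le> s"
  proof -
    have "s * x\<^sup>2 \<le> s * x" using s0 xx by (intro mult_left_mono) auto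
    then show a: "A \<le> s * x" using A2 by linarith
    have "s * x \<le> s * 1" using s0 x by (intro mult_left_mono) auto
    then show "A \<le> s" using a by simp
  qed
  have \<nu>: "A \<le> \<nu>" "A \<le> s\<^sup>2 * x\<^sup>2" "A \<le> real n" "\<nu> \<le> real n / 2"
  proof -
    have "1 * A \<le> s * (s * x)" using sx A1 by (intro mult_mono) auto
    then show "A \<le> \<nu>" by (simp add: \<nu>_def power2_eq_square mult_ac)
    have "1 * A \<le> s * (s * x\<^sup>2)" using sx A2 A1 by (intro mult_mono) auto
    then show "A \<le> s\<^sup>2 * x\<^sup>2" by (simp add: power2_eq_square mult_ac)
    have "1 * A \<le> s * s" using sx A1 by (intro mult_mono) auto
    then show "A \<le> real n" using s2 by (simp add: power2_eq_square)
    have "s\<^sup>2 * x \<le> s\<^sup>2 * (1 / 2)" using x by (intro mult_left_mono) auto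
    then show "\<nu> \<le> real n / 2" by (simp add: \<nu>_def s2)
  qed
  define w where "w = 4 * (real c)\<^sup>2"
  have w: "1 \<le> w" "w \<le> \<nu>" using \<nu>(1) A(1) c2 c unfolding w_def by linarith+
  obtain l1 :: nat where l1: "12 * \<nu> \<le> w * real l1" "w * real l1 \<le> 2 * 12 * \<nu>" by (rule ex_block_count[OF w, of 12]) auto
  obtain l2 :: nat where l2: "40000 * \<nu> \<le> w * real l2" "w * real l2 \<le> 2 * 40000 * \<nu>" by (rule ex_block_count[OF w, of 40000]) auto
  obtain l3 :: nat where l3: "400000000 * \<nu> \<le> w * real l3" "w * real l3 \<le> 2 * 400000000 * \<nu>"
    by (rule ex_block_count[OF w, of 400000000]) auto
  have \<nu>0: "0 \<le> \<nu>" using \<nu>(1) A1 by linarith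
  have lc: "w * real (l1 + l2 + l3) \<le> real c * \<nu>"
    using l1 l2 l3 mult_right_mono[OF c \<nu>0] by (simp add: distrib_left)
  have cpos: "0 < real c" using c by linarith
  have "real c * real (4 * c * (l1 + l2 + l3)) \<le> real c * \<nu>"
    using lc by (simp add: w_def power2_eq_square mult_ac)
  \<comment> \<open>Dividing by \<open>c\<close> shows that the blocks use at most
    \<open>\<nu>\<close> vertices, and \<open>\<nu>\<close> is at most n / 2.\<close>
  then have "real (4 * c * (l1 + l2 + l3)) \<le> real n" using cpos \<nu>(4) \<nu>0 by (simp del: of_nat_mult of_nat_add) 
  then have ln: "4 * c * (l1 + l2 + l3) \<le> n" by (simp only: of_nat_le_iff)
  let ?lv = "\<lambda>B x \<sigma>. 4 * c * B + (2 * x + of_bool \<sigma>)" and ?rv = "\<lambda>B x \<sigma>. 4 * c * B + (2 * c + 2 * x + of_bool \<sigma>)"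
  have gg: "gadget_graph {..<n} ?lv ?rv c l1 l2 l3" by (rule gadget_graph_interval) (use cpos ln in auto)
  interpret G: gadget_graph "{..<n}" ?lv ?rv c l1 l2 l3 by (rule gg)
  have cR: "real (card G.R) = w * real (l1 + l2 + l3)" "real (card G.R1) = w * real l1"
    "real (card G.R2) = w * real l2" "real (card G.R3) = w * real l3"
    unfolding G.card_R w_def by simp_all
  have Rc: "real (card G.R) \<le> real c * \<nu>" using lc cR by simp
  have cP: "real (card G.P) = real n * (real n - 1) / 2 - real (card G.R)"
  proof -
    have "card G.P = card ([{..<n}]\<^bsup>2\<^esup>) - card G.R" unfolding G.P_def using G.R_sub G.finite_R by (intro card_Diff_subset)
    moreover have "card G.R \<le> card ([{..<n}]\<^bsup>2\<^esup>)" using G.R_sub by (intro card_mono) (auto simp: finite_imp_finite_nsets)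
    moreover have "real (card ([{..<n}]\<^bsup>2\<^esup>)) = real n * (real n - 1) / 2"
      by (cases n) (auto simp: card_nsets choose_two real_of_nat_div algebra_simps)
    ultimately show ?thesis by (simp add: of_nat_diff)
  qed
  have P4: "(real n)\<^sup>2 / 4 \<le> real (card G.P)"
  proof -
    have "real c * \<nu> \<le> real c * (real n / 2)" using \<nu>(4) by (intro mult_left_mono) auto
    moreover have "real n * (2 + 2 * real c) \<le> real n * real n" using \<nu>(3) A1 c by (intro mult_left_mono) auto
    ultimately show ?thesis unfolding cP using Rc by (simp add: power2_eq_square algebra_simps)
  qed
  have npos: "0 < real n" using \<nu>(3) A1 by linarith
  have Ppos: "0 < real (card G.P)" using P4 npos by (smt (verit) divide_pos_pos zero_less_power)
  \<comment> \<open>The solution of the balance equation: with density 1/2 on the reserved pairs the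
    overall density is again p.\<close>
  define \<pi> where "\<pi> = p - (1 / 2 - p) * real (card G.R) / real (card G.P)"
  have bal: "(\<pi> - p) * real (card G.P) + (1 / 2 - p) * real (card G.R) = 0"
    using Ppos by (simp add: \<pi>_def)
  have dl: "real n * \<bar>\<pi> - p\<bar> \<le> real c"
  proof -
    have "\<bar>\<pi> - p\<bar> = \<bar>1 / 2 - p\<bar> * real (card G.R) / real (card G.P)" by (simp add: \<pi>_def abs_mult)
    also have "\<dots> \<le> (1 / 2) * (real c * \<nu>) / ((real n)\<^sup>2 / 4)"
    proof (intro frac_le mult_mono)
      show "\<bar>1 / 2 - p\<bar> \<le> 1 / 2" using p by linarith
    qed (use Rc P4 npos \<nu>0 in auto)
    finally have "real n * \<bar>\<pi> - p\<bar> \<le> real n * ((1 / 2) * (real c * \<nu>) / ((real n)\<^sup>2 / 4))" by (intro mult_left_mono) auto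
    also have "\<dots> = 2 * real c * x" using npos by (simp add: \<nu>_def s2 field_simps power2_eq_square[of "real n"])
    also have "\<dots> \<le> 2 * real c * (1 / 2)" using x by (intro mult_left_mono) auto
    finally show ?thesis by simp
  qed
  \<comment> \<open>The shift is at most c / n, far below p (1 - p). So \<open>\<pi>\<close> stays
    in [0, 1] and the variance changes by less than a factor 2.\<close>
  have dq: "\<bar>\<pi> - p\<bar> \<le> x\<^sup>2 / 4"
  proof -
    have "real n * \<bar>\<pi> - p\<bar> \<le> real n * (x\<^sup>2 / 4)" using dl \<nu>(2) A1 s2 by simp
    then show ?thesis using npos by simp
  qed
  have "x\<^sup>2 \<le> p" "x\<^sup>2 \<le> 1 - p" unfolding x2 using p by (simp_all add: mult_left_le mult_left_le_one_le)
  then have \<pi>: "0 \<le> \<pi>" "\<pi> \<le> 1" using dq by linarith+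
  have "\<pi> * (1 - \<pi>) - x\<^sup>2 = (\<pi> - p) * (1 - \<pi> - p)" unfolding x2 by (simp add: algebra_simps)
  moreover have "\<bar>(\<pi> - p) * (1 - \<pi> - p)\<bar> \<le> \<bar>\<pi> - p\<bar> * 1"
    unfolding abs_mult using \<pi> p by (intro mult_left_mono) auto
  ultimately have "\<bar>\<pi> * (1 - \<pi>) - x\<^sup>2\<bar> \<le> \<bar>\<pi> - p\<bar>" by (simp only: mult_1_right)
  then have "\<bar>\<pi> * (1 - \<pi>) - x\<^sup>2\<bar> \<le> x\<^sup>2 / 4" using dq by (rule order_trans)
  moreover have "0 \<le> x\<^sup>2" by simp
  ultimately have var: "x\<^sup>2 / 2 \<le> \<pi> * (1 - \<pi>)" "\<pi> * (1 - \<pi>) \<le> 2 * x\<^sup>2" by linarith+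
  have "gadget_scaled {..<n} ?lv ?rv c l1 l2 l3 p \<pi> s x y A"
  proof (intro gadget_scaled.intro gadget_random.intro gadget_random_axioms.intro gadget_scaled_axioms.intro gg)
    show "400000000 * (s\<^sup>2 * x) \<le> real (card G.R3)" using l3 cR by (simp add: \<nu>_def)
    show "40000 * (s\<^sup>2 * x) \<le> real (card G.R2)" "real (card G.R2) \<le> 80000 * (s\<^sup>2 * x)" using l2 cR by (simp_all add: \<nu>_def)
    show "12 * (s\<^sup>2 * x) \<le> real (card G.R1)" "real (card G.R1) \<le> 24 * (s\<^sup>2 * x)" using l1 cR by (simp_all add: \<nu>_def)
    show "real (card G.R) \<le> real c * (s\<^sup>2 * x)" using Rc by (simp add: \<nu>_def)
  qed (use p \<pi> bal dl x2 x y A(1) A2 var in \<open>auto simp: s_def\<close>)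
  then show ?thesis by blast
qed

text \<open>The union of the edges has no isolated vertex. On two vertices this leaves an edge, on
  three a path or a triangle.\<close>

lemma support_cases:
  fixes H :: "nat set set"
  assumes H: "H \<subseteq> [K]\<^bsup>2\<^esup>" "H \<noteq> {}" "finite K"
  obtains (edge) a b where "a \<noteq> b" "H = {{a, b}}"
    | (path) a b d where "a \<noteq> b" "b \<noteq> d" "a \<noteq> d" "H = {{a, b}, {b, d}}"
    | (triangle) a b d where "a \<noteq> b" "b \<noteq> d" "a \<noteq> d" "H = {{a, b}, {b, d}, {a, d}}"
    | (large) "4 \<le> card (\<Union>H)"
proof -
  have U: "\<Union>H \<subseteq> K" "finite (\<Union>H)" "\<And>e. e \<in> H \<Longrightarrow> card e = 2"
    using H finite_subset[of "\<Union>H" K] by (auto simp: nsets_def)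
  obtain e where e: "e \<in> H" using H(2) by blast
  then have "2 \<le> card (\<Union>H)" using U card_mono[of "\<Union>H" e] by (metis Union_upper)
  then consider "card (\<Union>H) = 2" | "card (\<Union>H) = 3" | "4 \<le> card (\<Union>H)" by linarith
  then show ?thesis
  proof cases
    case 1
    then obtain a b where ab: "\<Union>H = {a, b}" "a \<noteq> b" by (auto simp: card_2_iff)
    have "f = {a, b}" if "f \<in> H" for f
      using that U(3)[OF that] ab card_subset_eq[of "{a, b}" f] by auto
    then have "H = {{a, b}}" using e by blast
    then show ?thesis using edge ab(2) by blast
  next
    case 2
    then obtain a b d where abd: "\<Union>H = {a, b, d}" "a \<noteq> b" "b \<noteq> d" "a \<noteq> d" by (auto simp: card_3_iff)
    have sub: "H \<subseteq> {{a, b}, {b, d}, {a, d}}"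
    proof
      fix f assume f: "f \<in> H"
      obtain u v where "f = {u, v}" "u \<noteq> v" using U(3)[OF f] by (auto simp: card_2_iff)
      moreover have "f \<subseteq> {a, b, d}" using f abd(1) by blast
      ultimately show "f \<in> {{a, b}, {b, d}, {a, d}}" by auto
    qed
    have "a \<in> \<Union>H" "b \<in> \<Union>H" "d \<in> \<Union>H" using abd(1) by auto
    then have two: "{a, b} \<in> H \<or> {a, d} \<in> H" "{a, b} \<in> H \<or> {b, d} \<in> H" "{b, d} \<in> H \<or> {a, d} \<in> H"
      using sub abd by blast+
    have eq: "H = (if {a, b} \<in> H then {{a, b}} else {}) \<union> (if {b, d} \<in> H then {{b, d}} else {})
        \<union> (if {a, d} \<in> H then {{a, d}} else {})"
      using sub by auto
    consider "H = {{a, b}, {b, d}, {a, d}}" | "H = {{a, b}, {b, d}}" | "H = {{b, d}, {d, a}}" | "H = {{b, a}, {a, d}}"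
      using eq two by (auto simp: insert_commute split: if_splits)
    then show ?thesis
    proof cases
      case 1 then show ?thesis using triangle[of a b d] abd by blast
    next
      case 2 then show ?thesis using path[of a b d] abd by blast
    next
      case 3 then show ?thesis using path[of b d a] abd by blast
    next
      case 4 then show ?thesis using path[of b a d] abd by blast
    qed
  qed (use large in blast)
qed

text \<open>A support on h vertices contributes at most a constant times m n^(h - 2), with m the
  maximum in the claim: 2 for an edge, \<open>a + 2\<close> for a path, 7 for a triangle and
  \<open>L\<close> for the others; 9 = 2 + 7 covers all. Placing the other labels costs at most n^(k
  - h).\<close>

lemma u_graph_le_of_statistics:
  fixes G :: "'a graph" and p a :: real
  assumes G: "simple_graph G" "card (verts G) = n" "1 \<le> n" and p: "0 \<le> p" "p \<le> 1" and a: "0 \<le> a" "0 \<le> L"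
    and m: "real (card (edges G)) = of_int (round (p * real (n choose 2)))"
    and P3: "\<bar>(\<Sum>i\<in>verts G. (wdeg (verts G) (centered G p) i)\<^sup>2) - p * (1 - p) * real n * (real n - 1)\<bar> \<le> a * (p * (1 - p) * real n)"
    and K3: "\<bar>tri (verts G) (centered G p) (centered G p) (centered G p)\<bar> \<le> 7 * (p * (1 - p) * real n)"
    and large: "\<And>H. H \<in> large_supports k \<Longrightarrow> \<bar>inj_sum (verts G) (centered G p) (\<Union>H) H\<bar> \<le> L * (p * (1 - p) * real n ^ (card (\<Union>H) - 2))"
  shows "u_graph k G p \<le> 2 ^ (k choose 2) * ((a + L + 9) * max (int_dist n p) (p * (1 - p)) * real n ^ (k - 2))"
proof (rule u_graph_le[OF G(1) p])
  let ?V = "verts G" and ?\<alpha> = "centered G p" and ?K = "{..<k}"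
  let ?q = "p * (1 - p)" and ?D = "int_dist n p"
  let ?m = "max ?D ?q"
  have V: "finite ?V" using G(1) by (simp add: simple_graph_def)
  have \<alpha>0: "?\<alpha> {i} = 0" for i by (simp add: centered_def nsets_def)
  have q0: "0 \<le> ?q" using p by simp
  have m0: "0 \<le> ?m" using q0 by simp
  have n1: "1 \<le> real n" using G(3) by simp
  let ?B = "(a + L + 9) * ?m"
  have K2: "\<bar>\<Sum>i\<in>?V. wdeg ?V ?\<alpha> i\<bar> \<le> 2 * ?m"
  proof -
    have "(\<Sum>i\<in>?V. wdeg ?V ?\<alpha> i) = 2 * (of_int (round (p * real (n choose 2))) - p * real (n choose 2))"
      using sum_wdeg_centered[OF G(1), of p] m G(2) by simp
    then have "(\<Sum>i\<in>?V. wdeg ?V ?\<alpha> i) = - (2 * (p * real (n choose 2) - of_int (round (p * real (n choose 2)))))" by simp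
    then have "\<bar>\<Sum>i\<in>?V. wdeg ?V ?\<alpha> i\<bar> = 2 * ?D" by (simp only: int_dist_def abs_minus_cancel abs_mult abs_numeral)
    then show ?thesis by simp
  qed
  have am: "0 \<le> a * ?m" "0 \<le> L * ?m" using a m0 by simp_all
  have X: "\<bar>inj_sum ?V ?\<alpha> (\<Union>H) H\<bar> \<le> ?B * real n ^ (card (\<Union>H) - 2)"
    if H: "H \<subseteq> [?K]\<^bsup>2\<^esup>" "H \<noteq> {}" for H
    using H finite_lessThan[of k]
  proof (cases rule: support_cases)
    case (edge a' b)
    have "\<bar>inj_sum ?V ?\<alpha> {a', b} {{a', b}}\<bar> \<le> 2 * ?m" using inj_sum_K2[where \<alpha> = ?\<alpha>, OF V \<alpha>0 edge(1)] K2 by simp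
    also have "\<dots> \<le> ?B" using am m0 unfolding distrib_right by linarith
    finally show ?thesis using edge by simp
  next
    case (path a' b d)
    have U: "\<Union>H = {a', b, d}" "card {a', b, d} = 3" using path by auto
    \<comment> \<open>The sum of squares in the P3 identity differs from p (1 - p) n (n - 1) by a
      multiple of the edge sum, which is already bounded.\<close>
    have "inj_sum ?V ?\<alpha> {a', b, d} H = ((\<Sum>i\<in>?V. (wdeg ?V ?\<alpha> i)\<^sup>2) - ?q * real n * (real n - 1)) - (1 - 2 * p) * (\<Sum>i\<in>?V. wdeg ?V ?\<alpha> i)"
      unfolding path(4) using inj_sum_P3[where \<alpha> = ?\<alpha>, OF V \<alpha>0 path(1-3)] sum_centered_sq[OF G(1), of p] G(2) by simp
    moreover have "\<bar>(1 - 2 * p) * (\<Sum>i\<in>?V. wdeg ?V ?\<alpha> i)\<bar> \<le> 1 * (2 * ?m)"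
      unfolding abs_mult using K2 p by (intro mult_mono) auto
    ultimately have "\<bar>inj_sum ?V ?\<alpha> {a', b, d} H\<bar> \<le> a * (?q * real n) + 2 * ?m" using P3 by linarith
    also have "\<dots> \<le> a * (?m * real n) + 2 * (?m * real n)"
      using a m0 mult_left_mono[OF n1 m0] by (intro add_mono mult_left_mono mult_right_mono) auto
    also have "\<dots> = (a * ?m + 2 * ?m) * real n" by (simp add: distrib_right)
    also have "\<dots> \<le> ?B * real n" using am m0 unfolding distrib_right[of _ _ ?m] by (intro mult_right_mono) linarith+
    finally show ?thesis using U by simp
  next
    case (triangle a' b d)
    have U: "\<Union>H = {a', b, d}" "card {a', b, d} = 3" using triangle by auto
    have "\<bar>inj_sum ?V ?\<alpha> {a', b, d} H\<bar> \<le> 7 * (?q * real n)"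
      unfolding triangle(4) using inj_sum_K3[where \<alpha> = ?\<alpha>, OF V \<alpha>0 triangle(1-3)] K3 by (simp add: tri_def)
    also have "\<dots> \<le> 7 * (?m * real n)" by (intro mult_left_mono mult_right_mono) auto
    also have "\<dots> = (7 * ?m) * real n" by simp
    also have "\<dots> \<le> ?B * real n" using am m0 unfolding distrib_right[of _ _ ?m] by (intro mult_right_mono) linarith+
    finally show ?thesis using U by simp
  next
    case large
    then have "\<bar>inj_sum ?V ?\<alpha> (\<Union>H) H\<bar> \<le> L * (?q * real n ^ (card (\<Union>H) - 2))"
      using H(1) by (intro assms(11)) (simp add: large_supports_def)
    also have "\<dots> \<le> L * (?m * real n ^ (card (\<Union>H) - 2))" using a by (intro mult_left_mono mult_right_mono) auto
    also have "\<dots> = (L * ?m) * real n ^ (card (\<Union>H) - 2)" by simp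
    also have "\<dots> \<le> ?B * real n ^ (card (\<Union>H) - 2)" using am m0 unfolding distrib_right[of _ _ ?m] by (intro mult_right_mono) auto
    finally show ?thesis .
  qed
  have Y: "\<bar>inj_sum ?V ?\<alpha> ?K H\<bar> \<le> ?B * real n ^ (k - 2)" if H: "H \<in> Pow ([?K]\<^bsup>2\<^esup>) - {{}}" for H
  proof -
    have sub: "\<Union>H \<subseteq> ?K" using H by (auto simp: nsets_def)
    then have hk: "card (\<Union>H) \<le> k" using card_mono[of ?K "\<Union>H"] by simp
    obtain e where "e \<in> H" using H by blast
    then have "card e = 2" "e \<subseteq> \<Union>H" using H by (auto simp: nsets_def)
    then have h2: "2 \<le> card (\<Union>H)" using card_mono[OF finite_subset[OF sub finite_lessThan], of e] by simp
    have "\<bar>inj_sum ?V ?\<alpha> ?K H\<bar> = ext_count n (card (\<Union>H)) (k - card (\<Union>H)) * \<bar>inj_sum ?V ?\<alpha> (\<Union>H) H\<bar>"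
      using inj_sum_support[OF _ V sub, of ?\<alpha>] G(2) ext_count_nonneg by (simp add: abs_mult)
    also have "\<dots> \<le> real n ^ (k - card (\<Union>H)) * (?B * real n ^ (card (\<Union>H) - 2))"
      using H X[of H] by (intro mult_mono ext_count_le) auto
    also have "\<dots> = ?B * real n ^ (k - card (\<Union>H) + (card (\<Union>H) - 2))" by (simp add: power_add)
    also have "k - card (\<Union>H) + (card (\<Union>H) - 2) = k - 2" using hk h2 by simp
    finally show ?thesis .
  qed
  fix F assume F: "F \<subseteq> [?K]\<^bsup>2\<^esup>"
  have "\<bar>lab_dev ?K F G p\<bar> \<le> (\<Sum>H\<in>Pow ([?K]\<^bsup>2\<^esup>) - {{}}. \<bar>inj_sum ?V ?\<alpha> ?K H\<bar>)"
    by (rule abs_lab_dev_le[OF _ V F p]) simp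
  also have "\<dots> \<le> real (card (Pow ([?K]\<^bsup>2\<^esup>) - {{}})) * (?B * real n ^ (k - 2))"
    by (rule sum_bounded_above) (rule Y)
  also have "\<dots> \<le> 2 ^ (k choose 2) * (?B * real n ^ (k - 2))"
  proof (intro mult_right_mono)
    have fin: "finite ([?K]\<^bsup>2\<^esup>)" by (simp add: finite_imp_finite_nsets)
    have "card (Pow ([?K]\<^bsup>2\<^esup>) - {{}}) \<le> card (Pow ([?K]\<^bsup>2\<^esup>))" using fin by (intro card_mono) auto
    also have "\<dots> = 2 ^ (k choose 2)" using fin by (simp add: card_Pow card_nsets)
    finally have "real (card (Pow ([?K]\<^bsup>2\<^esup>) - {{}})) \<le> real (2 ^ (k choose 2))" by (simp only: of_nat_le_iff)
    then show "real (card (Pow ([?K]\<^bsup>2\<^esup>) - {{}})) \<le> 2 ^ (k choose 2)" by simp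
  qed (use a m0 in simp)
  finally show "\<bar>lab_dev ?K F G p\<bar> \<le> 2 ^ (k choose 2) * (?B * real n ^ (k - 2))" .
qed

lemma u_min_upper_bound:
  "\<exists>C A. 0 < C \<and> 0 < A \<and> (\<forall>n p. 0 < p \<and> p < 1 \<and> A \<le> sqrt (real n) * (p * (1 - p)) \<longrightarrow>
     u_min k n p \<le> C * max (int_dist n p) (p * (1 - p)) * real n ^ (k - 2))"
proof -
  \<comment> \<open>The smallest value that \<open>ex_gadget_scaled\<close> admits. It is a fixed
    number, so \<open>A\<close> is absolute and \<open>C\<close> depends on \<open>k\<close>
    alone.\<close>
  define c :: nat where "c = 800080024"
  define A where "A = 100000 * (real c)\<^sup>2"
  define a L where "a = 5 * real c" and "L = 20 * envelope_const k c"
  define C where "C = 2 ^ (k choose 2) * (a + L + 9)"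
  have aL: "0 \<le> a" "0 \<le> L" using envelope_const_pos[of k c] by (simp_all add: a_def L_def)
  have A0: "0 < A" by (simp add: A_def c_def)
  have "u_min k n p \<le> C * max (int_dist n p) (p * (1 - p)) * real n ^ (k - 2)"
    if p: "0 < p" "p < 1" and n: "A \<le> sqrt (real n) * (p * (1 - p))" for n p
  proof -
    obtain lv rv l1 l2 l3 \<pi> s x y where "gadget_scaled {..<n} lv rv c l1 l2 l3 p \<pi> s x y A"
      using ex_gadget_scaled[OF _ p A_def n] unfolding c_def by auto
    then interpret gadget_scaled "{..<n}" lv rv c l1 l2 l3 p \<pi> s x y A .
    have cn: "card {..<n} = n" by simp
    obtain M where M: "M \<subseteq> [{..<n}]\<^bsup>2\<^esup>" "real (card M) = of_int (round (p * real (n choose 2)))"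
      "\<bar>(\<Sum>i<n. (wdeg {..<n} (centered ({..<n}, M) p) i)\<^sup>2) - p * (1 - p) * real n * (real n - 1)\<bar>
         \<le> 5 * real c * (p * (1 - p) * real n)"
      "\<bar>tri {..<n} (centered ({..<n}, M) p) (centered ({..<n}, M) p) (centered ({..<n}, M) p)\<bar> \<le> 7 * (p * (1 - p) * real n)"
      "\<forall>H\<in>large_supports k. \<bar>inj_sum {..<n} (centered ({..<n}, M) p) (\<Union>H) H\<bar>
         \<le> 20 * envelope_const k c * (p * (1 - p) * real n ^ (card (\<Union>H) - 2))"
      using ex_graph[of k] unfolding cn by blast
    let ?G = "({..<n}, M)"
    have G: "simple_graph ?G" using M(1) by (simp add: simple_graph_def)
    have "n \<noteq> 0" using n A0 by (intro notI) simp
    have "u_min k n p \<le> u_graph k ?G p"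
      unfolding u_min_def by (intro Min_le u_graph_values_finite CollectI exI[of _ ?G] conjI refl G) simp
    also have "\<dots> \<le> 2 ^ (k choose 2) * ((a + L + 9) * max (int_dist n p) (p * (1 - p)) * real n ^ (k - 2))"
      by (rule u_graph_le_of_statistics[OF G]) (use M p aL \<open>n \<noteq> 0\<close> in \<open>auto simp: a_def L_def\<close>)
    finally show ?thesis by (simp add: C_def mult.assoc)
  qed
  moreover have "0 < C" using aL by (simp add: C_def)
  ultimately show ?thesis using A0 by blast
qed

theorem theorem1p1:
  shows "(\<forall>k::nat. k \<ge> 3 \<longrightarrow>
           (\<exists>C::real. C > 0 \<and>
             (\<forall>p :: nat \<Rightarrow> real.
                (\<forall>n. 0 < p n \<and> p n < 1) \<longrightarrow>
                (\<lambda>n. 1 / (p n * (1 - p n))) \<in> o(\<lambda>n. real n powr (1/2)) \<longrightarrow>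
                (\<forall>\<^sub>F n in sequentially.
                   u_min k n (p n)
                     \<le> C * max (int_dist n (p n)) (p n * (1 - p n)) * real n ^ (k - 2)))))
       \<and> (\<forall>k::nat. k \<ge> 4 \<longrightarrow>
           (\<exists>c::real. c > 0 \<and>
             (\<forall>p :: nat \<Rightarrow> real.
                (\<forall>n. 0 < p n \<and> p n < 1) \<longrightarrow>
                (\<forall>\<^sub>F n in sequentially.
                   u_min k n (p n)
                     \<ge> c * max (int_dist n (p n)) (p n * (1 - p n)) * real n ^ (k - 2)))))"
proof (intro conjI allI impI)
  fix k :: nat
  obtain C A where CA: "0 < C" "0 < A" "\<And>n p. 0 < p \<Longrightarrow> p < 1 \<Longrightarrow> A \<le> sqrt (real n) * (p * (1 - p)) \<Longrightarrow>
     u_min k n p \<le> C * max (int_dist n p) (p * (1 - p)) * real n ^ (k - 2)"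
    using u_min_upper_bound[of k] by blast
  show "\<exists>C::real. C > 0 \<and> (\<forall>p :: nat \<Rightarrow> real. (\<forall>n. 0 < p n \<and> p n < 1) \<longrightarrow>
      (\<lambda>n. 1 / (p n * (1 - p n))) \<in> o(\<lambda>n. real n powr (1/2)) \<longrightarrow>
      (\<forall>\<^sub>F n in sequentially. u_min k n (p n) \<le> C * max (int_dist n (p n)) (p n * (1 - p n)) * real n ^ (k - 2)))"
  proof (intro exI[of _ C] conjI allI impI CA(1))
    fix p :: "nat \<Rightarrow> real"
    assume p: "\<forall>n. 0 < p n \<and> p n < 1" and o: "(\<lambda>n. 1 / (p n * (1 - p n))) \<in> o(\<lambda>n. real n powr (1/2))"
    \<comment> \<open>The little-o condition enters through the single constant
      \<open>1 / A\<close>, which yields sqrt n * p (1 - p) >= A for all large n.\<close>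
    have "\<forall>\<^sub>F n in sequentially. norm (1 / (p n * (1 - p n))) \<le> 1 / A * norm (real n powr (1 / 2))"
      using CA(2) by (intro landau_o.smallD[OF o]) simp
    then show "\<forall>\<^sub>F n in sequentially. u_min k n (p n) \<le> C * max (int_dist n (p n)) (p n * (1 - p n)) * real n ^ (k - 2)"
    proof (rule eventually_mono)
      fix n assume n: "norm (1 / (p n * (1 - p n))) \<le> 1 / A * norm (real n powr (1 / 2))"
      have q: "0 < p n * (1 - p n)" using p by simp
      have "1 / (p n * (1 - p n)) \<le> sqrt (real n) / A" using n q by (simp add: powr_half_sqrt)
      then have "A \<le> sqrt (real n) * (p n * (1 - p n))" using q CA(2) by (simp add: field_simps)
      then show "u_min k n (p n) \<le> C * max (int_dist n (p n)) (p n * (1 - p n)) * real n ^ (k - 2)"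
        using p by (intro CA(3)) auto
    qed
  qed
next
  fix k :: nat assume "4 \<le> k"
  then obtain c where c: "0 < c" "\<And>n p. 2 * k \<le> n \<Longrightarrow> 0 < p \<Longrightarrow> p < 1 \<Longrightarrow>
     c * max (int_dist n p) (p * (1 - p)) * real n ^ (k - 2) \<le> u_min k n p"
    using u_min_lower_bound by blast
  show "\<exists>c::real. c > 0 \<and> (\<forall>p :: nat \<Rightarrow> real. (\<forall>n. 0 < p n \<and> p n < 1) \<longrightarrow>
      (\<forall>\<^sub>F n in sequentially. u_min k n (p n) \<ge> c * max (int_dist n (p n)) (p n * (1 - p n)) * real n ^ (k - 2)))"
  proof (intro exI[of _ c] conjI allI impI c(1))
    fix p :: "nat \<Rightarrow> real" assume p: "\<forall>n. 0 < p n \<and> p n < 1"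
    show "\<forall>\<^sub>F n in sequentially. u_min k n (p n) \<ge> c * max (int_dist n (p n)) (p n * (1 - p n)) * real n ^ (k - 2)"
      using eventually_ge_at_top[of "2 * k"] by eventually_elim (use c(2) p in auto)
  qed
qed

end
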